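(* Let $L$ be a finite-dimensional transitive local solvable Lie algebra of vector fields on $\mathbb{R}^n$, and let the integers $k$, $m$, $r_1<\dots<r_m$ and $a_1,\dots,a_m$ be associated with $L$ as in the context. Then there are local coordinates in a neighbourhood $U$ of $0\in\mathbb{R}^n$ and a non-negative dilation (homogeneity structure) $h$, described explicitly as follows: the first $a_1$ coordinates are of degree $r_1$, the next $a_2$ coordinates are of degree $r_2$, etc., up to the final $a_m$ coordinates, which are of degree $r_m$. This dilation is completely determined (up to a diffeomorphism) by $L$, so that its eigenvalues (the degrees $r_i$) and multiplicities (the numbers $a_i$) have an invariant meaning. With respect to $h$ one has $$L\subset\mathfrak{g}^{\le 0}(U,h)\qquad\text{and}\qquad L^j\subset\bigoplus_{i=-k}^{-j}\mathfrak{g}^i(U,h)\quad\text{for } j=0,1,\dots,k .$$ Moreover, there is a finite-dimensional commutative Lie subalgebra $\mathfrak{g}^0_0(U,h)$ of $\mathfrak{g}^0(U,h)$ such that $$L\subset\mathfrak{g}^{<0}(U,h)\oplus\mathfrak{g}^0_0(U,h).$$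
   Context: All Lie algebras are real. A local transitive Lie algebra $L$ of vector fields on $\mathbb{R}^n$ ($n\ge 1$) is a Lie algebra (with the Lie bracket of vector fields) of smooth vector fields defined in a connected neighbourhood $U$ of $0\in\mathbb{R}^n$ which span the whole tangent space $T_0\mathbb{R}^n$ at $0$; equivalently, after shrinking $U$, they span $T_x\mathbb{R}^n$ for all $x\in U$. The neighbourhood $U$ may be shrunk whenever necessary. Nilradical series: $L^0=L$, $L^1=\mathfrak{nr}(L)$ (the nilradical, i.e. the largest nilpotent ideal of $L$), $L^{i+1}=[\mathfrak{nr}(L),L^i]$ for $i\ge 1$. Let $k$ be the non-negative integer with $L^k\neq\{0\}$ and $L^{k+1}=\{0\}$. For $i=0,\dots,k+1$ the vector fields in $L^i$ span, in a neighbourhood $U$ of $0$, a regular involutive distribution; $\mathcal{F}^i$ denotes the corresponding foliation of $U$ and $\dim(\mathcal{F}^i)$ the dimension of its leaves. Thus $\mathcal{F}^0$ has the single leaf $U$, and the leaves of $\mathcal{F}^{k+1}$ are points. Let $r_1<r_2<\dots<r_m$ be all those $i\in\{0,\dots,k\}$ for which $\dim(\mathcal{F}^{i+1})<\dim(\mathcal{F}^i)$ (so $r_m=k$), and put $a_i=\dim(\mathcal{F}^{r_i})-\dim(\mathcal{F}^{r_i+1})>0$, $i=1,\dots,m$; then $a_1+\dots+a_m=n$. Non-negative dilation: given (local) coordinates $(y^1,\dots,y^n)$ and non-negative integers (degrees, or weights) $w_1,\dots,w_n$, the associated non-negative dilation, or homogeneity structure, is $h_t(y^1,\dots,y^n)=(t^{w_1}y^1,\dots,t^{w_n}y^n)$,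 $t\in\mathbb{R}$; degree $0$ is allowed. Its weight vector field is $\nabla^h=\sum_i w_i y^i\partial_{y^i}$. For an integer $i$, $\mathfrak{g}^i(U,h)$ is the space of smooth vector fields $X$ on $U$ that are homogeneous of degree $i$, i.e. $[\nabla^h,X]=iX$. With $w(h)=\max\{w_1,\dots,w_n\}$, put $\mathfrak{g}^{<0}(U,h)=\bigoplus_{i=-w(h)}^{-1}\mathfrak{g}^i(U,h)$ and $\mathfrak{g}^{\le 0}(U,h)=\bigoplus_{i=-w(h)}^{0}\mathfrak{g}^i(U,h)$. *)

theory Defs
  imports "HOL-Analysis.Analysis" "HOL-Library.Function_Algebras"
begin

text \<open>Pointwise scalar multiplication, so that \<open>subspace\<close>, \<open>span\<close> etc. apply to spaces of
  vector fields (addition is the pointwise one of \<open>Function_Algebras\<close>).\<close>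

instantiation "fun" :: (type, real_vector) real_vector
begin

definition scaleR_fun_def: "c *\<^sub>R f = (\<lambda>x. c *\<^sub>R f x)"

instance
  by standard (simp_all add: scaleR_fun_def fun_eq_iff scaleR_add_right scaleR_add_left)

end

definition finite_dimensional :: "'v::real_vector set \<Rightarrow> bool" where
  "finite_dimensional S \<longleftrightarrow> (\<exists>B. finite B \<and> S = span B)"


section \<open>Lie algebras given by a bracket on an ambient real vector space\<close>

definition lie_closed :: "('v::real_vector \<Rightarrow> 'v \<Rightarrow> 'v) \<Rightarrow> 'v set \<Rightarrow> bool" where
  "lie_closed br L \<longleftrightarrow> subspace L \<and> (\<forall>X\<in>L. \<forall>Y\<in>L. br X Y \<in> L)"

definition lie_ideal :: "('v::real_vector \<Rightarrow> 'v \<Rightarrow> 'v) \<Rightarrow> 'v set \<Rightarrow> 'v set \<Rightarrow> bool" where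
  "lie_ideal br I L \<longleftrightarrow> subspace I \<and> I \<subseteq> L \<and> (\<forall>X\<in>L. \<forall>Y\<in>I. br X Y \<in> I)"

definition commutator :: "('v::real_vector \<Rightarrow> 'v \<Rightarrow> 'v) \<Rightarrow> 'v set \<Rightarrow> 'v set \<Rightarrow> 'v set" where
  "commutator br A B = span {br X Y | X Y. X \<in> A \<and> Y \<in> B}"

primrec derived_series :: "('v::real_vector \<Rightarrow> 'v \<Rightarrow> 'v) \<Rightarrow> 'v set \<Rightarrow> nat \<Rightarrow> 'v set" where
  "derived_series br L 0 = L"
| "derived_series br L (Suc i) = commutator br (derived_series br L i) (derived_series br L i)"

primrec lower_central_series :: "('v::real_vector \<Rightarrow> 'v \<Rightarrow> 'v) \<Rightarrow> 'v set \<Rightarrow> nat \<Rightarrow> 'v set" where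
  "lower_central_series br L 0 = L"
| "lower_central_series br L (Suc i) = commutator br L (lower_central_series br L i)"

definition lie_solvable :: "('v::real_vector \<Rightarrow> 'v \<Rightarrow> 'v) \<Rightarrow> 'v set \<Rightarrow> bool" where
  "lie_solvable br L \<longleftrightarrow> (\<exists>i. derived_series br L i = {0})"

definition lie_nilpotent :: "('v::real_vector \<Rightarrow> 'v \<Rightarrow> 'v) \<Rightarrow> 'v set \<Rightarrow> bool" where
  "lie_nilpotent br L \<longleftrightarrow> (\<exists>i. lower_central_series br L i = {0})"

text \<open>The largest element, with respect to inclusion, among the nilpotent ideals.\<close>

definition nilradical :: "('v::real_vector \<Rightarrow> 'v \<Rightarrow> 'v) \<Rightarrow> 'v set \<Rightarrow> 'v set" where
  "nilradical br L = (GREATEST N. lie_ideal br N L \<and> lie_nilpotent br N)"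

fun nilradical_series :: "('v::real_vector \<Rightarrow> 'v \<Rightarrow> 'v) \<Rightarrow> 'v set \<Rightarrow> nat \<Rightarrow> 'v set" where
  "nilradical_series br L 0 = L"
| "nilradical_series br L (Suc 0) = nilradical br L"
| "nilradical_series br L (Suc (Suc i)) =
     commutator br (nilradical br L) (nilradical_series br L (Suc i))"


section \<open>Smooth maps and vector fields\<close>

text \<open>\<open>Ck_on k U f\<close>: \<open>f\<close> is of class \<open>C\<^sup>k\<close> on \<open>U\<close>. Only used for open \<open>U\<close>.\<close>

primrec Ck_on :: "nat \<Rightarrow> (real^'n) set \<Rightarrow> (real^'n \<Rightarrow> 'b::real_normed_vector) \<Rightarrow> bool" where
  "Ck_on 0 U f \<longleftrightarrow> continuous_on U f"
| "Ck_on (Suc k) U f \<longleftrightarrow> (\<forall>x\<in>U. f differentiable (at x)) \<and>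
     (\<forall>i. Ck_on k U (\<lambda>x. frechet_derivative f (at x) (axis i 1)))"

definition smooth_on :: "(real^'n) set \<Rightarrow> (real^'n \<Rightarrow> 'b::real_normed_vector) \<Rightarrow> bool" where
  "smooth_on U f \<longleftrightarrow> (\<forall>k. Ck_on k U f)"

text \<open>A vector field on \<open>U\<close> is represented by the function extended by \<open>0\<close> outside \<open>U\<close>, so that
  equality of vector fields is equality of functions.\<close>

definition vector_fields :: "(real^'n) set \<Rightarrow> (real^'n \<Rightarrow> real^'n) set" where
  "vector_fields U = {X. smooth_on U X \<and> (\<forall>x. x \<notin> U \<longrightarrow> X x = 0)}"

definition vf_bracket ::
    "(real^'n) set \<Rightarrow> (real^'n \<Rightarrow> real^'n) \<Rightarrow> (real^'n \<Rightarrow> real^'n) \<Rightarrow> (real^'n \<Rightarrow> real^'n)" where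
  "vf_bracket U X Y = (\<lambda>x. if x \<in> U
     then frechet_derivative Y (at x) (X x) - frechet_derivative X (at x) (Y x) else 0)"

definition distribution :: "(real^'n \<Rightarrow> real^'n) set \<Rightarrow> real^'n \<Rightarrow> (real^'n) set" where
  "distribution A x = span {X x | X. X \<in> A}"

definition connected_nbhd :: "(real^'n) set \<Rightarrow> bool" where
  "connected_nbhd U \<longleftrightarrow> open U \<and> connected U \<and> 0 \<in> U"

definition local_transitive_lie_algebra ::
    "(real^'n) set \<Rightarrow> (real^'n \<Rightarrow> real^'n) set \<Rightarrow> bool" where
  "local_transitive_lie_algebra U L \<longleftrightarrow> connected_nbhd U \<and>
     L \<subseteq> vector_fields U \<and> lie_closed (vf_bracket U) L \<and> distribution L 0 = UNIV"

text \<open>A Lie algebra transitive at \<open>0\<close> is studied after shrinking its domain \<open>U\<^sub>0\<close> to a connected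
  neighbourhood \<open>U\<close> of \<open>0\<close> on which the spanning property holds at every point. This is not just
  a convenience: without it \<open>L\<^sub>0\<close> could contain fields vanishing near \<open>0\<close>, which would
  contribute to its nilradical series although they are zero as local vector fields.\<close>

definition transitive_shrinking ::
    "(real^'n) set \<Rightarrow> (real^'n \<Rightarrow> real^'n) set \<Rightarrow> (real^'n) set \<Rightarrow> bool" where
  "transitive_shrinking U0 L0 U \<longleftrightarrow> connected_nbhd U \<and> U \<subseteq> U0 \<and> (\<forall>x\<in>U. distribution L0 x = UNIV)"

definition restrict_vf :: "(real^'n) set \<Rightarrow> (real^'n \<Rightarrow> real^'n) \<Rightarrow> (real^'n \<Rightarrow> real^'n)" where
  "restrict_vf U X = (\<lambda>x. if x \<in> U then X x else 0)"

text \<open>The constant rank near \<open>0\<close> of the (regular) distribution spanned by \<open>A\<close>, i.e.\ the dimension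
  of the tangent spaces of the leaves of the corresponding foliation.\<close>

definition foliation_dim :: "(real^'n \<Rightarrow> real^'n) set \<Rightarrow> nat" where
  "foliation_dim A = (THE d. \<exists>V. open V \<and> 0 \<in> V \<and> (\<forall>x\<in>V. dim (distribution A x) = d))"

definition leaf_dim :: "(real^'n) set \<Rightarrow> (real^'n \<Rightarrow> real^'n) set \<Rightarrow> nat \<Rightarrow> nat" where
  "leaf_dim U L i = foliation_dim (nilradical_series (vf_bracket U) L i)"

text \<open>The integers \<open>k\<close>, \<open>m\<close>, \<open>r 1 < \<dots> < r m\<close> and \<open>a 1, \<dots>, a m\<close> associated with \<open>L\<close>; only the values
  of \<open>r\<close> and \<open>a\<close> on \<open>{1..m}\<close> matter.\<close>

definition nilradical_data ::
    "(real^'n) set \<Rightarrow> (real^'n \<Rightarrow> real^'n) set \<Rightarrow> nat \<Rightarrow> nat \<Rightarrow> (nat \<Rightarrow> nat) \<Rightarrow> (nat \<Rightarrow> nat) \<Rightarrow> bool"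
  where
  "nilradical_data U L k m r a \<longleftrightarrow>
     nilradical_series (vf_bracket U) L k \<noteq> {0} \<and>
     nilradical_series (vf_bracket U) L (k + 1) = {0} \<and>
     strict_mono_on {1..m} r \<and>
     r ` {1..m} = {i \<in> {0..k}. leaf_dim U L (i + 1) < leaf_dim U L i} \<and>
     (\<forall>i\<in>{1..m}. a i = leaf_dim U L (r i) - leaf_dim U L (r i + 1))"


section \<open>Coordinates and non-negative dilations\<close>

text \<open>Local coordinates \<open>\<psi>\<close> on \<open>V\<close>, centred at \<open>0\<close>. The same predicate describes local
  diffeomorphisms fixing \<open>0\<close>.\<close>

definition local_coordinates :: "(real^'n) set \<Rightarrow> (real^'n \<Rightarrow> real^'n) \<Rightarrow> bool" where
  "local_coordinates V \<psi> \<longleftrightarrow> connected_nbhd V \<and> \<psi> 0 = 0 \<and> inj_on \<psi> V \<and> open (\<psi> ` V) \<and>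
     smooth_on V \<psi> \<and> smooth_on (\<psi> ` V) (inv_into V \<psi>)"

text \<open>The expression of \<open>X\<close> (restricted to \<open>V\<close>) in the coordinates \<open>\<psi>\<close>, a vector field on \<open>\<psi> ` V\<close>.\<close>

definition pushforward ::
    "(real^'n) set \<Rightarrow> (real^'n \<Rightarrow> real^'n) \<Rightarrow> (real^'n \<Rightarrow> real^'n) \<Rightarrow> (real^'n \<Rightarrow> real^'n)" where
  "pushforward V \<psi> X = (\<lambda>y. if y \<in> \<psi> ` V
     then frechet_derivative \<psi> (at (inv_into V \<psi> y)) (X (inv_into V \<psi> y)) else 0)"

text \<open>Below \<open>w c\<close> is the degree of the coordinate \<open>y $ c\<close>, and \<open>W\<close> is the range of the
  coordinates, on which the dilation has its standard form.\<close>

definition dilation :: "('n \<Rightarrow> nat) \<Rightarrow> real \<Rightarrow> real^'n \<Rightarrow> real^'n" where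
  "dilation w t y = (\<chi> c. t ^ w c * y $ c)"

definition weight_field :: "(real^'n) set \<Rightarrow> ('n \<Rightarrow> nat) \<Rightarrow> (real^'n \<Rightarrow> real^'n)" where
  "weight_field W w = (\<lambda>y. if y \<in> W then (\<chi> c. real (w c) * y $ c) else 0)"

definition homog :: "(real^'n) set \<Rightarrow> ('n \<Rightarrow> nat) \<Rightarrow> int \<Rightarrow> (real^'n \<Rightarrow> real^'n) set" where
  "homog W w i =
     {X \<in> vector_fields W. vf_bracket W (weight_field W w) X = real_of_int i *\<^sub>R X}"

text \<open>The sum of the \<open>homog W w i\<close> for \<open>lo \<le> i \<le> hi\<close>; it is direct, being a sum of eigenspaces.\<close>

definition homog_sum :: "(real^'n) set \<Rightarrow> ('n \<Rightarrow> nat) \<Rightarrow> int \<Rightarrow> int \<Rightarrow> (real^'n \<Rightarrow> real^'n) set" where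
  "homog_sum W w lo hi = {(\<Sum>i\<in>{lo..hi}. X i) | X. \<forall>i\<in>{lo..hi}. X i \<in> homog W w i}"

definition max_weight :: "('n::finite \<Rightarrow> nat) \<Rightarrow> nat" where
  "max_weight w = Max (range w)"

definition homog_neg :: "(real^'n) set \<Rightarrow> ('n \<Rightarrow> nat) \<Rightarrow> (real^'n \<Rightarrow> real^'n) set" where
  "homog_neg W w = homog_sum W w (- int (max_weight w)) (- 1)"

definition homog_nonpos :: "(real^'n) set \<Rightarrow> ('n \<Rightarrow> nat) \<Rightarrow> (real^'n \<Rightarrow> real^'n) set" where
  "homog_nonpos W w = homog_sum W w (- int (max_weight w)) 0"

text \<open>With respect to an enumeration \<open>e\<close> of the coordinates by \<open>1, \<dots>, n\<close>, the first \<open>a 1\<close>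
  coordinates have degree \<open>r 1\<close>, the next \<open>a 2\<close> coordinates have degree \<open>r 2\<close>, and so on.\<close>

definition block_weights ::
    "(nat \<Rightarrow> 'n) \<Rightarrow> nat \<Rightarrow> (nat \<Rightarrow> nat) \<Rightarrow> (nat \<Rightarrow> nat) \<Rightarrow> ('n \<Rightarrow> nat) \<Rightarrow> bool" where
  "block_weights e m r a w \<longleftrightarrow>
     (\<forall>j\<in>{1..m}. \<forall>l. (\<Sum>i=1..<j. a i) < l \<and> l \<le> (\<Sum>i=1..j. a i) \<longrightarrow> w (e l) = r j)"

text \<open>The dilation transported to the original space; meaningful at those \<open>x \<in> V\<close> for which the
  dilated coordinates \<open>dilation w t (\<psi> x)\<close> stay in \<open>\<psi> ` V\<close>.\<close>

definition chart_dilation ::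
    "(real^'n) set \<Rightarrow> (real^'n \<Rightarrow> real^'n) \<Rightarrow> ('n \<Rightarrow> nat) \<Rightarrow> real \<Rightarrow> real^'n \<Rightarrow> real^'n" where
  "chart_dilation V \<psi> w t x = inv_into V \<psi> (dilation w t (\<psi> x))"

definition dilations_conjugate ::
    "(real^'n) set \<Rightarrow> (real^'n \<Rightarrow> real^'n) \<Rightarrow> ('n \<Rightarrow> nat) \<Rightarrow>
     (real^'n) set \<Rightarrow> (real^'n \<Rightarrow> real^'n) \<Rightarrow> ('n \<Rightarrow> nat) \<Rightarrow> bool" where
  "dilations_conjugate V \<psi> w V' \<psi>' w' \<longleftrightarrow>
     (\<exists>D \<Phi>. local_coordinates D \<Phi> \<and> D \<subseteq> V \<and> \<Phi> ` D \<subseteq> V' \<and>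
        (\<forall>t. \<forall>x\<in>D. dilation w t (\<psi> x) \<in> \<psi> ` D \<longrightarrow>
           dilation w' t (\<psi>' (\<Phi> x)) \<in> \<psi>' ` V' \<and>
           \<Phi> (chart_dilation V \<psi> w t x) = chart_dilation V' \<psi>' w' t (\<Phi> x)))"

end

theory Submission
  imports Defs "HOL-Computational_Algebra.Polynomial"
begin

text \<open>Ideals of a transitive algebra have constant rank near \<open>0\<close>: the components of their elements
  transversal to a frame of the ideal at \<open>0\<close> solve a linear first order system. Hence there is a frame
  \<open>E\<close> adapted to the nilradical series, where \<open>E a\<close> lies in \<open>L\<^sup>w\<^sup>a\<close>, the weights \<open>w a\<close> being those of the
  theorem. Declare a function to be of degree at most \<open>d\<close> if differentiating along \<open>E a\<close> lowers the degree
  by \<open>w a\<close>, for all \<open>a\<close> with \<open>w a \<ge> 1\<close>, and functions of negative degree vanish. Elements of \<open>L\<^sup>j\<close> have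
  coefficients of degree at most \<open>w a - j\<close> with respect to \<open>E\<close>. Coordinates of degree \<open>w a\<close> are constructed
  one after the other by integrating closed forms; in such coordinates the functions of degree at most
  \<open>d\<close> are polynomials of weighted degree at most \<open>d\<close> in the coordinates of positive weight, with smooth
  functions of the coordinates of weight \<open>0\<close> as coefficients, so elements of \<open>L\<^sup>j\<close> are sums of homogeneous
  fields of degrees at most \<open>- j\<close>.

  Solvability enters through \<open>[L, L] \<subseteq> L\<^sup>1\<close>. It makes all brackets of elements of \<open>L\<close> of negative degree, so
  that the parts of degree \<open>0\<close> of elements of \<open>L\<close> commute and span \<open>G\<close>. The weights are determined by
  \<open>L\<close> since pushforward is an isomorphism of Lie algebras preserving the ranks of ideals.\<close>

section \<open>Jacobson's lemma on nilpotent commutators\<close>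

text \<open>\<open>[L, L]\<close> has to be placed inside the nilradical over the reals, where Lie's
  theorem provides no common eigenvectors. The nilradical is therefore identified with the elements
  acting trivially on every chief factor of \<open>L\<close>, and Jacobson's lemma, which needs only
  a real annihilating polynomial, takes the place of triangularization. The index
  \<open>max 1 (i + j)\<close> of a bracket of \<open>L^i\<close> with \<open>L^j\<close> then
  carries all the algebra into the analytic part: for \<open>i = j = 0\<close> it expresses
  solvability, otherwise the ideal property or the Jacobi identity. Derivatives along fields of
  weight \<open>0\<close> lower no degree and are left out of the notion of degree, which is why
  arbitrary smooth functions of the weight-0 coordinates survive as coefficients. Derivatives along
  general elements of \<open>L\<close> are controlled by commuting them past the fields of positive
  weight. The frame is kept triangular in the coordinates already built. A correction at one
  position depends only on coordinates up to that position, so it leaves the derivatives along later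
  fields intact, and the corrections can run backwards through the positions.\<close>

definition poly_op :: "('v::real_vector \<Rightarrow> 'v) \<Rightarrow> real poly \<Rightarrow> 'v \<Rightarrow> 'v" where
  "poly_op f p v = (\<Sum>i\<le>degree p. coeff p i *\<^sub>R (f ^^ i) v)"

lemma poly_op_ge: "degree p \<le> n \<Longrightarrow> poly_op f p v = (\<Sum>i\<le>n. coeff p i *\<^sub>R (f ^^ i) v)"
  unfolding poly_op_def
  by (rule sum.mono_neutral_left) (auto simp: coeff_eq_0)

lemma linear_funpow:
  fixes f :: "'v::real_vector \<Rightarrow> 'v"
  shows "linear f \<Longrightarrow> linear (f ^^ n)"
  by (induction n) (auto intro!: linearI simp: linear_add linear_scale)

lemma poly_op_pCons: "poly_op f (pCons c p) v = c *\<^sub>R v + poly_op f p (f v)"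
proof -
  have "poly_op f (pCons c p) v = (\<Sum>i\<le>Suc (degree p). coeff (pCons c p) i *\<^sub>R (f ^^ i) v)"
    by (rule poly_op_ge) (simp add: degree_pCons_le)
  also have "\<dots> = c *\<^sub>R v + (\<Sum>i\<le>degree p. coeff p i *\<^sub>R (f ^^ Suc i) v)"
    by (subst sum.atMost_Suc_shift) (simp del: funpow.simps)
  finally show ?thesis by (simp add: poly_op_def funpow_swap1)
qed

lemma poly_op_0 [simp]: "poly_op f 0 v = 0"
  by (simp add: poly_op_def)

lemma poly_op_add: "poly_op f (p + q) v = poly_op f p v + poly_op f q v"
proof -
  let ?n = "max (degree p) (degree q)"
  have "degree (p + q) \<le> ?n" by (rule degree_add_le_max)
  then show ?thesis
    using poly_op_ge[of p ?n f v] poly_op_ge[of q ?n f v] poly_op_ge[of "p + q" ?n f v]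
    by (simp add: scaleR_add_left sum.distrib)
qed

lemma linear_poly_op: "linear f \<Longrightarrow> linear (poly_op f p)"
  unfolding poly_op_def [abs_def]
  by (intro linear_compose_sum ballI) (simp add: linear_funpow linear_compose_scale_right)

lemma poly_op_smult:
  assumes "linear f" shows "poly_op f (smult c p) v = c *\<^sub>R poly_op f p v"
  using poly_op_ge[of "smult c p" "degree p" f v] degree_smult_le[of c p]
  by (simp add: poly_op_def scaleR_sum_right)

lemma poly_op_comm:
  assumes "linear g" "\<And>v. f (g v) = g (f v)"
  shows "poly_op f p (g v) = g (poly_op f p v)"
proof -
  interpret g: linear g by fact
  show ?thesis
    by (induction p arbitrary: v) (simp_all add: poly_op_pCons g.add g.scaleR g.zero assms(2))
qed

lemma poly_op_mult:
  assumes "linear f" shows "poly_op f (p * q) v = poly_op f p (poly_op f q v)"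
proof (induction p arbitrary: v)
  case (pCons a p)
  have "poly_op f (pCons a p * q) v = a *\<^sub>R poly_op f q v + poly_op f p (poly_op f q (f v))"
    by (simp add: mult_pCons_left poly_op_add poly_op_smult[OF assms] poly_op_pCons pCons)
  then show ?case
    by (simp add: poly_op_pCons poly_op_comm[OF assms])
qed simp

text \<open>The vectors \<open>(f ^^ Suc i) v\<close> all lie in the finite-dimensional
  \<open>span B\<close>, so two of them coincide or they are linearly dependent; the relation is a
  polynomial in \<open>f\<close> that kills \<open>f v\<close>. The two cases are separate because
  dependence of a set does not see repetitions in its enumeration.\<close>

lemma poly_op_vector_exists:
  fixes f :: "'v::real_vector \<Rightarrow> 'v"
  assumes "linear f" "finite B" "range f \<subseteq> span B"
  shows "\<exists>p. p \<noteq> 0 \<and> poly_op f p v = 0"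
proof -
  let ?g = "\<lambda>i. (f ^^ Suc i) v"
  have sp: "?g i \<in> span B" for i
    using assms(3) by auto
  have "\<not> (inj ?g \<and> independent (range ?g))"
  proof
    assume g: "inj ?g \<and> independent (range ?g)"
    have "finite (range ?g)"
      using independent_span_bound[OF assms(2) conjunct2[OF g]] sp by blast
    then have "finite (UNIV :: nat set)"
      using conjunct1[OF g] by (rule finite_imageD)
    then show False by simp
  qed
  then obtain q :: "real poly" where "q \<noteq> 0" "poly_op f q (f v) = 0"
  proof (cases "inj ?g")
    case False
    then obtain i' j' where ij': "?g i' = ?g j'" "i' \<noteq> j'"
      unfolding inj_def by blast
    define i j where "i = min i' j'" and "j = max i' j'"
    have ij: "?g i = ?g j" "i < j"
      using ij' by (auto simp: i_def j_def min_def max_def simp del: funpow.simps)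
    let ?q = "monom 1 i - monom (1::real) j"
    have c: "coeff ?q i = 1" using ij by simp
    have "poly_op f ?q (f v) = (\<Sum>l\<le>j. coeff ?q l *\<^sub>R (f ^^ l) (f v))"
      by (rule poly_op_ge) (intro degree_diff_le order_trans[OF degree_monom_le], use ij in auto)
    also have "\<dots> = (\<Sum>l\<in>{i,j}. coeff ?q l *\<^sub>R (f ^^ l) (f v))"
      by (rule sum.mono_neutral_right) (use ij in auto)
    also have "\<dots> = (f ^^ i) (f v) - (f ^^ j) (f v)" using ij by simp
    also have "\<dots> = 0" using ij by (simp add: funpow_swap1)
    finally have "poly_op f ?q (f v) = 0" .
    moreover have "?q \<noteq> 0" using c by (metis coeff_0 zero_neq_one)
    ultimately show ?thesis using that by blast
  next
    case True
    then have "dependent (range ?g)" using \<open>\<not> _\<close> by blast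
    then obtain t u where t: "finite t" "t \<subseteq> range ?g" "(\<Sum>w\<in>t. u w *\<^sub>R w) = 0" "\<exists>w\<in>t. u w \<noteq> 0"
      unfolding dependent_explicit by blast
    obtain T where T: "t = ?g ` T" using t(2) unfolding subset_image_iff by blast
    have fT: "finite T" using t(1) T True by (simp add: finite_image_iff inj_on_subset)
    let ?q = "\<Sum>i\<in>T. monom (u (?g i)) i"
    have cq: "coeff ?q l = (if l \<in> T then u (?g l) else 0)" for l
      using fT by (simp add: coeff_sum)
    obtain i where i: "i \<in> T" "u (?g i) \<noteq> 0" using t(4) T by auto
    then have "?q \<noteq> 0" using cq[of i] by force
    have degq: "degree ?q \<le> Max T"
    proof (intro degree_le allI impI)
      fix l assume "Max T < l"
      then have "l \<notin> T" using fT Max_ge by (meson leD)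
      then show "coeff ?q l = 0" unfolding cq by simp
    qed
    have "poly_op f ?q (f v) = (\<Sum>l\<le>Max T. coeff ?q l *\<^sub>R (f ^^ l) (f v))"
      by (rule poly_op_ge[OF degq])
    also have "\<dots> = (\<Sum>l\<in>T. coeff ?q l *\<^sub>R (f ^^ l) (f v))"
      by (rule sum.mono_neutral_right) (use fT in \<open>auto simp: cq simp del: funpow.simps\<close>)
    also have "\<dots> = (\<Sum>l\<in>T. u (?g l) *\<^sub>R ?g l)"
    proof (rule sum.cong[OF refl])
      fix l assume "l \<in> T"
      then have "coeff ?q l = u (?g l)" unfolding cq by simp
      moreover have "(f ^^ l) (f v) = ?g l" by (simp add: funpow_swap1)
      ultimately show "coeff ?q l *\<^sub>R (f ^^ l) (f v) = u (?g l) *\<^sub>R ?g l" by (simp only:)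
    qed
    also have "\<dots> = (\<Sum>w\<in>t. u w *\<^sub>R w)"
      unfolding T using sum.reindex[OF inj_on_subset[OF True subset_UNIV], of "\<lambda>w. u w *\<^sub>R w"] by simp
    finally show ?thesis using that[OF \<open>?q \<noteq> 0\<close>] t(3) by simp
  qed
  then show ?thesis
    by (intro exI[of _ "pCons 0 q"]) (simp add: poly_op_pCons)
qed

text \<open>The product of annihilators of the finitely many vectors of \<open>B\<close> kills
  \<open>span B\<close>; one more factor of the indeterminate (\<open>pCons 0\<close>) first moves
  every vector into \<open>span B\<close>.\<close>

lemma poly_op_annihilator:
  fixes f :: "'v::real_vector \<Rightarrow> 'v"
  assumes "linear f" "finite B" "range f \<subseteq> span B"
  shows "\<exists>p. p \<noteq> 0 \<and> (\<forall>v. poly_op f p v = 0)"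
proof -
  have "\<exists>p. p \<noteq> 0 \<and> (\<forall>v\<in>B'. poly_op f p v = 0)" if "finite B'" for B'
    using that
  proof induction
    case empty show ?case by (intro exI[of _ 1]) auto
  next
    case (insert b B')
    then obtain p q where pq: "p \<noteq> 0" "\<forall>v\<in>B'. poly_op f p v = 0" "q \<noteq> 0" "poly_op f q b = 0"
      using poly_op_vector_exists[OF assms, of b] by auto
    have z: "poly_op f r 0 = 0" for r
      using linear_0[OF linear_poly_op[OF assms(1)]] by blast
    have "poly_op f (p * q) b = 0" by (simp add: poly_op_mult[OF assms(1)] pq z)
    moreover have "poly_op f (p * q) v = 0" if "v \<in> B'" for v
      using that pq by (subst mult.commute) (simp add: poly_op_mult[OF assms(1)] z)
    ultimately show ?case using pq by (intro exI[of _ "p * q"]) auto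
  qed
  from this[OF assms(2)] obtain p where p: "p \<noteq> 0" "\<forall>v\<in>B. poly_op f p v = 0" by blast
  have "poly_op f p v = 0" if "v \<in> span B" for v
    using linear_eq_0_on_span[OF linear_poly_op[OF assms(1)], of B p] p that by blast
  then show ?thesis
    using p assms(3) by (intro exI[of _ "pCons 0 p"]) (force simp: poly_op_pCons)
qed

text \<open>\<open>[x, _]\<close> acts as a derivation and \<open>[x, a] = c\<close> commutes with
  \<open>a\<close>, so \<open>[x, p(a)] = c p'(a)\<close>.\<close>

lemma poly_op_commutator:
  assumes lin: "linear a" "linear c" "linear x"
    and ac: "\<And>v. a (c v) = c (a v)" and xa: "\<And>v. x (a v) = a (x v) + c v"
  shows "x (poly_op a p v) = poly_op a p (x v) + c (poly_op a (pderiv p) v)"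
proof -
  interpret a: linear a by fact
  interpret c: linear c by fact
  interpret x: linear x by fact
  note lp = linear_poly_op[OF lin(1)]
  have "\<And>v. x (poly_op a p v) = poly_op a p (x v) + c (poly_op a (pderiv p) v)"
  proof (induction p)
    case (pCons b p)
    show ?case
      by (simp add: poly_op_pCons pderiv_pCons poly_op_add x.add x.scaleR pCons.IH xa
          linear_add[OF lp] poly_op_comm[of c a, OF lin(2) ac] c.add algebra_simps)
  qed (simp add: x.zero c.zero)
  then show ?thesis .
qed

lemma funpow_comm:
  assumes "\<And>v. f (g v) = g (f v)" shows "f ((g ^^ n) v) = (g ^^ n) (f v)"
  by (induction n) (simp_all add: assms)

lemma funpow_commutator:
  fixes x c e :: "'v::real_vector \<Rightarrow> 'v"
  assumes lin: "linear c" "linear e"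
    and xc: "\<And>v. x (c v) = c (x v) + e v" and ec: "\<And>v. e (c v) = c (e v)"
  shows "x ((c ^^ Suc n) v) = (c ^^ Suc n) (x v) + real (Suc n) *\<^sub>R (c ^^ n) (e v)"
proof (induction n)
  case 0 show ?case by (simp add: xc)
next
  case (Suc n)
  interpret c: linear c by fact
  have "x ((c ^^ Suc (Suc n)) v) = c (x ((c ^^ Suc n) v)) + e ((c ^^ Suc n) v)"
    by (simp add: xc)
  also note Suc.IH
  also have "e ((c ^^ Suc n) v) = (c ^^ Suc n) (e v)"
    by (rule funpow_comm[of e c, OF ec])
  finally show ?case
    by (simp add: c.add c.scaleR algebra_simps scaleR_2)
qed

text \<open>Jacobson's lemma: if \<open>c = [x, a]\<close> and \<open>[x, c]\<close> commute with \<open>a\<close> and \<open>c\<close>, then applying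
  \<open>[x, _]\<close> to a relation \<open>p(a) c\<^sup>j = 0\<close> gives \<open>p'(a) c\<^sup>j\<^sup>+\<^sup>2 = 0\<close>.\<close>

lemma jacobson:
  fixes a c x :: "'v::real_vector \<Rightarrow> 'v"
  assumes lin: "linear a" "linear c" "linear x" "linear e"
    and ac: "\<And>v. a (c v) = c (a v)" and xa: "\<And>v. x (a v) = a (x v) + c v"
    and xc: "\<And>v. x (c v) = c (x v) + e v" and ec: "\<And>v. e (c v) = c (e v)"
    and ea: "\<And>v. e (a v) = a (e v)"
    and fin: "finite B" "range a \<subseteq> span B"
  shows "\<exists>m. \<forall>v. (c ^^ m) v = 0"
proof -
  interpret a: linear a by fact
  interpret c: linear c by fact
  interpret x: linear x by fact
  interpret e: linear e by fact
  obtain p where p: "p \<noteq> 0" "\<And>v. poly_op a p v = 0"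
    using poly_op_annihilator[OF lin(1) fin] by blast
  \<comment> \<open>Induction on the degree with \<open>j\<close> arbitrary: each step replaces
    \<open>p\<close>, \<open>j\<close> by \<open>p'\<close>, \<open>j + 2\<close>, and for a nonzero
    constant \<open>p\<close> the relation says that \<open>c ^^ j\<close> vanishes.\<close>
  have "\<exists>m. \<forall>v. (c ^^ m) v = 0" if "p \<noteq> 0" "\<And>v. poly_op a p ((c ^^ j) v) = 0" for p j
    using that
  proof (induction "degree p" arbitrary: p j)
    case 0
    then obtain b where "p = [:b:]" "b \<noteq> 0"
      by (metis degree_eq_zeroE pCons_0_0)
    then show ?case using 0(3) by (auto simp: poly_op_pCons)
  next
    case (Suc d)
    have dp: "degree (pderiv p) = d" "pderiv p \<noteq> 0"
      using Suc(2) by (auto simp: degree_pderiv pderiv_eq_0_iff)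
    have lc: "linear (c ^^ n)" for n using linear_funpow[OF lin(2)] .
    have ppc: "poly_op a q ((c ^^ n) v) = (c ^^ n) (poly_op a q v)" for q n v
      by (rule poly_op_comm[OF lc]) (rule funpow_comm[of a c, OF ac])
    have ppe: "poly_op a q (e v) = e (poly_op a q v)" for q v
      by (rule poly_op_comm[OF lin(4)]) (simp add: ea)
    have p0: "poly_op a p ((c ^^ n) v) = 0" if "n \<ge> j" for n v
    proof -
      have "(c ^^ n) v = (c ^^ j) ((c ^^ (n - j)) v)"
        using that by (metis add_diff_inverse_nat comp_apply funpow_add not_less)
      then show ?thesis using Suc.prems(2) by simp
    qed
    have "poly_op a (pderiv p) ((c ^^ (j + 2)) v) = 0" for v
    proof -
      \<comment> \<open>One power more than \<open>j\<close>, because commuting \<open>x\<close>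
        past \<open>c ^^ Suc j\<close> leaves a term with \<open>c ^^ j\<close>, which
        \<open>p(a)\<close> must still kill. The second extra power is the factor \<open>c\<close>
        in front of \<open>p'(a)\<close>.\<close>
      let ?w = "(c ^^ Suc j) v"
      have "0 = x (poly_op a p ?w)" using p0[of "Suc j" v] x.zero by simp
      also have "\<dots> = poly_op a p (x ?w) + c (poly_op a (pderiv p) ?w)"
        by (rule poly_op_commutator[OF lin(1-3) ac xa])
      also have "x ?w = (c ^^ Suc j) (x v) + real (Suc j) *\<^sub>R (c ^^ j) (e v)"
        by (rule funpow_commutator[OF lin(2,4) xc ec])
      also have "poly_op a p \<dots> = 0"
        using p0[of "Suc j" "x v"] p0[of j "e v"]
        by (simp add: linear_add[OF linear_poly_op[OF lin(1)]]
            linear_scale[OF linear_poly_op[OF lin(1)]] del: funpow.simps)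
      finally have "c (poly_op a (pderiv p) ?w) = 0" by simp
      then show ?thesis
        using ppc[of "pderiv p" 1 ?w] by simp
    qed
    then show ?case using Suc.hyps(1)[OF dp(1)[symmetric] dp(2)] by blast
  qed
  from this[of p 0] p show ?thesis by simp
qed

section \<open>The nilradical series of a finite-dimensional Lie algebra\<close>

text \<open>Keeps \<open>y \<in> span S\<close> available in the induction step, because the bracket
  laws below are only given for elements of the Lie algebra.\<close>

lemma span_induct_step [consumes 1, case_names base step]:
  assumes "x \<in> span S" "P 0"
    and "\<And>c x y. x \<in> S \<Longrightarrow> y \<in> span S \<Longrightarrow> P y \<Longrightarrow> P (c *\<^sub>R x + y)"
  shows "P x"
proof -
  have "x \<in> span S \<and> P x"
    using assms(1)
  proof (induction rule: span_induct_alt)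
    case base then show ?case using assms(2) span_zero by blast
  next
    case (step c x y)
    then show ?case using assms(3)[of x y c] by (simp add: span_add span_scale span_base)
  qed
  then show ?thesis by simp
qed

text \<open>The laws are required on \<open>L\<close> only: the bracket of vector fields is defined
  for arbitrary functions, but its bilinearity and the Jacobi identity are properties of smooth
  ones.\<close>

locale fd_lie_algebra =
  fixes br :: "'v::real_vector \<Rightarrow> 'v \<Rightarrow> 'v" and L :: "'v set"
  assumes subspace_L: "subspace L"
    and br_closed: "x \<in> L \<Longrightarrow> y \<in> L \<Longrightarrow> br x y \<in> L"
    and br_add_left: "x \<in> L \<Longrightarrow> y \<in> L \<Longrightarrow> z \<in> L \<Longrightarrow> br (x + y) z = br x z + br y z"
    and br_add_right: "x \<in> L \<Longrightarrow> y \<in> L \<Longrightarrow> z \<in> L \<Longrightarrow> br x (y + z) = br x y + br x z"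
    and br_scale_left: "x \<in> L \<Longrightarrow> y \<in> L \<Longrightarrow> br (c *\<^sub>R x) y = c *\<^sub>R br x y"
    and br_scale_right: "x \<in> L \<Longrightarrow> y \<in> L \<Longrightarrow> br x (c *\<^sub>R y) = c *\<^sub>R br x y"
    and br_anti: "x \<in> L \<Longrightarrow> y \<in> L \<Longrightarrow> br y x = - br x y"
    and jacobi: "x \<in> L \<Longrightarrow> y \<in> L \<Longrightarrow> z \<in> L \<Longrightarrow> br x (br y z) = br (br x y) z + br y (br x z)"
    and fd: "\<exists>B. finite B \<and> L \<subseteq> span B"
begin

lemma L_add: "x \<in> L \<Longrightarrow> y \<in> L \<Longrightarrow> x + y \<in> L"
  and L_scale: "x \<in> L \<Longrightarrow> c *\<^sub>R x \<in> L"
  and L_0: "0 \<in> L"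
  using subspace_L by (auto simp: subspace_def)

lemma br_0_right: "x \<in> L \<Longrightarrow> br x 0 = 0"
  using br_scale_right[of x x 0] by simp

lemma br_0_left: "x \<in> L \<Longrightarrow> br 0 x = 0"
  using br_scale_left[of x x 0] by simp

lemma finite_basis:
  assumes "A \<subseteq> L" shows "\<exists>F. finite F \<and> F \<subseteq> A \<and> independent F \<and> A \<subseteq> span F"
proof -
  obtain T where T: "finite T" "L \<subseteq> span T" using fd by blast
  obtain F where F: "F \<subseteq> A" "independent F" "A \<subseteq> span F" using maximal_independent_subset by blast
  moreover have "finite F" using independent_span_bound[OF T(1) F(2)] F(1) assms T(2) by blast
  ultimately show ?thesis by blast
qed

lemma dim_mono:
  assumes "A \<subseteq> B" "B \<subseteq> L" shows "dim A \<le> dim B"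
proof -
  obtain F where F: "finite F" "F \<subseteq> B" "independent F" "B \<subseteq> span F" using finite_basis[OF assms(2)] by blast
  then have "dim A \<le> card F" using dim_le_card[of A F] assms by blast
  then show ?thesis using basis_card_eq_dim[OF F(2,4,3)] by simp
qed

lemma dim_eq:
  assumes A: "subspace A" "A \<subseteq> B" "B \<subseteq> L" "dim B \<le> dim A" shows "A = B"
proof (rule ccontr)
  assume "A \<noteq> B"
  then obtain b where b: "b \<in> B" "b \<notin> A" using A by blast
  obtain F where F: "finite F" "F \<subseteq> A" "independent F" "A \<subseteq> span F" using finite_basis[of A] A by blast
  obtain G where G: "finite G" "G \<subseteq> B" "independent G" "B \<subseteq> span G" using finite_basis[of B] A by blast
  have "span F \<subseteq> A" using F(2) A(1) by (rule span_minimal)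
  then have nb: "b \<notin> span F" using b by (metis subsetD)
  then have i: "independent (insert b F)" "b \<notin> F" using F(3) span_base[of b F]
      by (simp_all add: independent_insert) metis
  have "insert b F \<subseteq> B" using F(2) A(2) b(1) by simp
  then have "insert b F \<subseteq> span G" using G(4) by (rule order_trans)
  then have "card (insert b F) \<le> card G" using independent_span_bound[OF G(1) i(1)] by blast
  then have "Suc (dim A) \<le> dim B"
    using F(1) i(2) basis_card_eq_dim[OF F(2,4,3)] basis_card_eq_dim[OF G(2,4,3)] by simp
  then show False using A(4) by simp
qed

abbreviation "ideal I \<equiv> lie_ideal br I L"

lemma idealD:
  assumes "ideal I"
  shows "subspace I" "I \<subseteq> L" "\<And>x y. x \<in> L \<Longrightarrow> y \<in> I \<Longrightarrow> br x y \<in> I" "\<And>x y. x \<in> L \<Longrightarrow> y \<in> I \<Longrightarrow> br y x \<in> I"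
proof -
  show *: "subspace I" "I \<subseteq> L" "\<And>x y. x \<in> L \<Longrightarrow> y \<in> I \<Longrightarrow> br x y \<in> I"
    using assms by (auto simp: lie_ideal_def)
  show "br y x \<in> I" if "x \<in> L" "y \<in> I" for x y
  proof -
    have "br y x = - br x y" using that *(2) by (intro br_anti) auto
    moreover have "- br x y \<in> I" by (rule subspace_neg[OF *(1) *(3)[OF that]])
    ultimately show ?thesis by (simp only:)
  qed
qed

lemma ideal_0: "ideal {0}"
  by (auto simp: lie_ideal_def L_0 br_0_right)

lemma ideal_L: "ideal L"
  by (auto simp: lie_ideal_def subspace_L br_closed)

lemma commutator_subset: "subspace S \<Longrightarrow> (\<And>x y. x \<in> A \<Longrightarrow> y \<in> B \<Longrightarrow> br x y \<in> S) \<Longrightarrow> commutator br A B \<subseteq> S"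
  unfolding commutator_def by (rule span_minimal) auto

lemma commutatorI: "x \<in> A \<Longrightarrow> y \<in> B \<Longrightarrow> br x y \<in> commutator br A B"
  unfolding commutator_def by (rule span_base) auto

lemma commutator_mono: "A \<subseteq> A' \<Longrightarrow> B \<subseteq> B' \<Longrightarrow> commutator br A B \<subseteq> commutator br A' B'"
  unfolding commutator_def by (rule span_mono) auto

lemma ideal_span:
  assumes "T \<subseteq> L" "\<And>x y. x \<in> L \<Longrightarrow> y \<in> T \<Longrightarrow> br x y \<in> span T"
  shows "ideal (span T)"
proof -
  have TL: "span T \<subseteq> L" using assms(1) subspace_L by (rule span_minimal)
  have "br x y \<in> span T" if "x \<in> L" "y \<in> span T" for x y
    using that(2)
  proof (induction rule: span_induct_step)
    case base then show ?case using br_0_right[OF that(1)] span_zero by simp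
  next
    case (step c z w)
    then have "z \<in> L" using assms(1) by blast
    have "w \<in> L" using step(2) TL by (rule subsetD[rotated])
    have "br x (c *\<^sub>R z + w) = c *\<^sub>R br x z + br x w"
      using \<open>z \<in> L\<close> \<open>w \<in> L\<close> that(1) by (simp add: br_add_right br_scale_right L_scale)
    then show ?case using assms(2)[OF that(1) step(1)] step(3) by (simp add: span_add span_scale)
  qed
  then show ?thesis using TL by (simp add: lie_ideal_def)
qed

lemma ideal_commutator:
  assumes "ideal A" "ideal B" shows "ideal (commutator br A B)"
  unfolding commutator_def
proof (rule ideal_span)
  let ?T = "{br X Y |X Y. X \<in> A \<and> Y \<in> B}"
  show "?T \<subseteq> L" using idealD(2)[OF assms(1)] idealD(2)[OF assms(2)] by (auto intro!: br_closed)
  fix x y assume x: "x \<in> L" "y \<in> ?T"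
  then obtain a b where y: "y = br a b" "a \<in> A" "b \<in> B" by blast
  have ab: "a \<in> L" "b \<in> L" using y idealD[OF assms(1)] idealD[OF assms(2)] by auto
  have eq: "br x y = br (br x a) b + br a (br x b)" unfolding y(1) by (rule jacobi[OF x(1) ab])
  have "br (br x a) b \<in> span ?T" "br a (br x b) \<in> span ?T"
    using y idealD(3)[OF assms(1) x(1) y(2)] idealD(3)[OF assms(2) x(1) y(3)] by (auto intro!: span_base)
  then show "br x y \<in> span ?T" unfolding eq by (rule span_add)
qed

lemma commutator_le: "ideal B \<Longrightarrow> A \<subseteq> L \<Longrightarrow> commutator br A B \<subseteq> B"
  by (rule commutator_subset) (auto dest: idealD)

lemma ideal_sum:
  assumes "ideal A" "ideal B" shows "ideal {x + y |x y. x \<in> A \<and> y \<in> B}"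
proof -
  note A = idealD[OF assms(1)] and B = idealD[OF assms(2)]
  have "br x z \<in> {x + y |x y. x \<in> A \<and> y \<in> B}" if xz: "x \<in> L" "z \<in> {x + y |x y. x \<in> A \<and> y \<in> B}" for x z
  proof -
    obtain a b where z: "z = a + b" "a \<in> A" "b \<in> B" using xz by blast
    then have "br x z = br x a + br x b" using A(2) B(2) xz(1) by (auto intro: br_add_right)
    then show ?thesis using A(3)[OF xz(1) z(2)] B(3)[OF xz(1) z(3)] by blast
  qed
  moreover have "{x + y |x y. x \<in> A \<and> y \<in> B} \<subseteq> L" using A(2) B(2) L_add by blast
  ultimately show ?thesis
    unfolding lie_ideal_def using subspace_sums[OF A(1) B(1)] by blast
qed

lemma ideal_derived_series: "ideal (derived_series br L i)"
  by (induction i) (auto simp: ideal_L ideal_commutator)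

section \<open>Chief factors of a Lie algebra and their centralizers\<close>

definition adjacent :: "'v set \<Rightarrow> 'v set \<Rightarrow> bool" where
  "adjacent J I \<longleftrightarrow> ideal J \<and> ideal I \<and> J \<subset> I \<and> (\<forall>K. ideal K \<and> J \<subseteq> K \<and> K \<subseteq> I \<longrightarrow> K = J \<or> K = I)"

lemma adjacent_exists:
  assumes "ideal I" "I \<noteq> {0}" shows "\<exists>J. adjacent J I"
proof -
  let ?P = "\<lambda>J. ideal J \<and> J \<subset> I"
  have "?P {0}" using assms ideal_0 idealD(1)[OF assms(1)] subspace_0 by blast
  moreover have "\<forall>J. ?P J \<longrightarrow> dim J < Suc (dim I)"
    using dim_mono[OF _ idealD(2)[OF assms(1)]] by (auto simp: less_Suc_eq_le)
  ultimately obtain J where J: "?P J" "\<forall>K. ?P K \<longrightarrow> dim K \<le> dim J"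
    using ex_has_greatest_nat[of ?P "{0}" dim "Suc (dim I)"] by blast
  have "K = J \<or> K = I" if "ideal K" "J \<subseteq> K" "K \<subseteq> I" for K
  proof (rule disjCI)
    assume "K \<noteq> I"
    then have "dim K \<le> dim J" using that J by blast
    then show "K = J" using dim_eq[of J K] that J idealD by metis
  qed
  then show ?thesis using J assms unfolding adjacent_def by blast
qed

text \<open>The kernel of the adjoint action on the quotient \<open>I/J\<close>.\<close>

definition centr :: "'v set \<Rightarrow> 'v set \<Rightarrow> 'v set" where
  "centr J I = {x \<in> L. \<forall>v\<in>I. br x v \<in> J}"

lemma ideal_centr:
  assumes "ideal J" "ideal I" shows "ideal (centr J I)"
proof -
  note J = idealD[OF assms(1)] and I = idealD[OF assms(2)]
  have "br x y \<in> centr J I" if "x \<in> L" "y \<in> centr J I" for x y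
  proof -
    have y: "y \<in> L" "\<And>v. v \<in> I \<Longrightarrow> br y v \<in> J" using that by (auto simp: centr_def)
    have "br (br x y) v \<in> J" if v: "v \<in> I" for v
    proof -
      have "br (br x y) v = br x (br y v) - br y (br x v)"
        using jacobi[of x y v] \<open>x \<in> L\<close> y v I(2) by auto
      then show ?thesis using J(3)[OF \<open>x \<in> L\<close> y(2)[OF v]] y(2)[OF I(3)[OF \<open>x \<in> L\<close> v]] J(1)
        by (simp add: subspace_diff)
    qed
    then show ?thesis using that y br_closed by (simp add: centr_def)
  qed
  moreover have "subspace (centr J I)"
    unfolding subspace_def centr_def
    using J(1) I(2) by (auto simp: L_0 L_add L_scale br_add_left br_scale_left br_0_left subspace_0
        subspace_add subspace_scale subsetD)
  ultimately show ?thesis unfolding lie_ideal_def by (auto simp: centr_def)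
qed

text \<open>A linear projection modelling the quotient map from \<open>I\<close> to \<open>I/J\<close>.\<close>

lemma quotient_projection:
  assumes "ideal J" "ideal I" "J \<subseteq> I"
  obtains p where "linear p" "\<And>v. p v \<in> I" "\<And>v. v \<in> I \<Longrightarrow> v - p v \<in> J" "\<And>v. v \<in> J \<Longrightarrow> p v = 0"
proof -
  note J = idealD[OF assms(1)] and I = idealD[OF assms(2)]
  obtain F where F: "finite F" "F \<subseteq> J" "independent F" "J \<subseteq> span F" using finite_basis[OF J(2)] by blast
  obtain G where G: "F \<subseteq> G" "G \<subseteq> I" "independent G" "I \<subseteq> span G"
    using maximal_independent_subset_extend[of F I] F assms(3) by blast
  define p where "p = construct G (\<lambda>b. if b \<in> F then 0 else b)"
  have lin: "linear p" unfolding p_def by (rule linear_construct[OF G(3)])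
  interpret p: linear p by (fact lin)
  have pb: "p b = (if b \<in> F then 0 else b)" if "b \<in> G" for b
    unfolding p_def by (simp add: construct_basis[OF G(3) that])
  have 1: "p v \<in> I" for v
  proof -
    have "p v \<in> span ((\<lambda>b. if b \<in> F then 0 else b) ` G)"
      unfolding p_def by (rule construct_in_span[OF G(3)])
    also have "\<dots> \<subseteq> I" using G(2) subspace_0[OF I(1)] by (intro span_minimal[OF _ I(1)]) auto
    finally show ?thesis .
  qed
  have 2: "v - p v \<in> J" if "v \<in> I" for v
  proof -
    have "v \<in> span G" using that G(4) by blast
    then show ?thesis
    proof (induction rule: span_induct_step)
      case base then show ?case using p.zero subspace_0[OF J(1)] by simp
    next
      case (step c b w)
      have "b - p b \<in> J" using pb[OF step(1)] F(2) subspace_0[OF J(1)] by auto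
      moreover have "c *\<^sub>R b + w - p (c *\<^sub>R b + w) = c *\<^sub>R (b - p b) + (w - p w)"
        by (simp add: p.add p.scaleR algebra_simps)
      ultimately show ?case using step(3) J(1) by (simp only:) (intro subspace_add subspace_scale)
    qed
  qed
  have 3: "p v = 0" if "v \<in> J" for v
  proof -
    have "p b = 0" if "b \<in> F" for b using pb[of b] that G(1) by auto
    then show ?thesis using linear_eq_0_on_span[OF lin, of F v] that F(4) by blast
  qed
  show ?thesis using that[OF lin 1 2 3] .
qed

text \<open>\<open>jacobson\<close> applied to the operators induced on \<open>I/J\<close> by
  \<open>x\<close>, \<open>a\<close>, \<open>c = [x, a]\<close> and \<open>[x, c]\<close>. Lying in
  \<open>centr J I\<close> means acting as zero there, so the hypotheses are the required
  commutation relations.\<close>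

lemma nilpotent_mod:
  assumes JI: "ideal J" "ideal I" "J \<subseteq> I" and xa: "x \<in> L" "a \<in> L"
    and c: "c = br x a" and ac: "br a c \<in> centr J I"
    and ec: "br (br x c) c \<in> centr J I" and ea: "br (br x c) a \<in> centr J I"
  shows "\<exists>m. \<forall>v\<in>I. ((\<lambda>v. br c v) ^^ m) v \<in> J"
proof -
  note J = idealD[OF JI(1)] and I = idealD[OF JI(2)]
  obtain p where p: "linear p" "\<And>v. p v \<in> I" "\<And>v. v \<in> I \<Longrightarrow> v - p v \<in> J" "\<And>v. v \<in> J \<Longrightarrow> p v = 0"
    using quotient_projection[OF JI] by blast
  interpret p: linear p by (fact p(1))
  \<comment> \<open>\<open>q y\<close> represents the action of \<open>y\<close> on
    \<open>I/J\<close> as an operator on the ambient space; its range lies in \<open>I\<close>,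
    hence in a finite-dimensional space, as \<open>jacobson\<close> requires.\<close>
  define q where "q y v = p (br y (p v))" for y v
  have pp: "p (br y (p v)) = p (br y v)" if "y \<in> L" "v \<in> I" for y v
  proof -
    have v: "v = p v + (v - p v)" by simp
    have m: "p v \<in> L" "v - p v \<in> L" using that p(2,3) I(2) J(2) by blast+
    have "br y v = br y (p v) + br y (v - p v)" using br_add_right[OF that(1) m] v by simp
    then have "p (br y v) = p (br y (p v)) + p (br y (v - p v))" by (simp add: p.add)
    also have "p (br y (v - p v)) = 0" using p(4) J(3)[OF that(1) p(3)[OF that(2)]] by blast
    finally show ?thesis by simp
  qed
  have linq: "linear (q y)" if "y \<in> L" for y
    using that p(2) I(2) unfolding q_def
    by (intro linearI) (auto simp: p.add p.scaleR br_add_right br_scale_right subsetD)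
  have qq: "q y (q z v) = p (br y (br z (p v)))" if "y \<in> L" "z \<in> L" for y z v
    unfolding q_def using pp[OF that(1), of "p (br z (p v))"] pp[OF that(1), of "br z (p v)"]
        I(3)[OF that(2) p(2)] p(2)
    by simp
  have qbr: "q y (q z v) = q z (q y v) + q (br y z) v" if "y \<in> L" "z \<in> L" for y z v
  proof -
    have "br y (br z (p v)) = br (br y z) (p v) + br z (br y (p v))"
      using jacobi that p(2) I(2) by blast
    then show ?thesis using that by (simp add: qq p.add) (simp add: q_def)
  qed
  have q0: "q y v = 0" if "y \<in> centr J I" for y v
    using that p(2,4) by (simp add: q_def centr_def)
  have cL: "c \<in> L" "br x c \<in> L" using c xa br_closed by auto
  obtain B where B: "finite B" "L \<subseteq> span B" using fd by blast
  have "\<exists>m. \<forall>v. ((q c) ^^ m) v = 0"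
  proof (rule jacobson[of "q a" "q c" "q x" "q (br x c)" B])
    show "q a (q c v) = q c (q a v)" for v using qbr[OF xa(2) cL(1)] q0[OF ac] by simp
    show "q x (q a v) = q a (q x v) + q c v" for v using qbr[OF xa] c by simp
    show "q x (q c v) = q c (q x v) + q (br x c) v" for v using qbr[OF xa(1) cL(1)] .
    show "q (br x c) (q c v) = q c (q (br x c) v)" for v using qbr[OF cL(2,1)] q0[OF ec] by simp
    show "q (br x c) (q a v) = q a (q (br x c) v)" for v using qbr[OF cL(2) xa(2)] q0[OF ea] by simp
    show "range (q a) \<subseteq> span B" using p(2) I(2) B(2) by (auto simp: q_def)
  qed (auto simp: linq xa cL B)
  then obtain m where m: "\<And>v. ((q c) ^^ m) v = 0" by blast
  have fI: "((\<lambda>v. br c v) ^^ n) v \<in> I" if "v \<in> I" for n v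
    by (induction n) (auto simp: that I(3) cL)
  have "p (((\<lambda>v. br c v) ^^ n) v) = ((q c) ^^ n) (p v)" if "v \<in> I" for n v
  proof (induction n)
    case (Suc n)
    have "((q c) ^^ Suc n) (p v) = q c (p (((\<lambda>v. br c v) ^^ n) v))" using Suc by simp
    also have "\<dots> = p (br c (((\<lambda>v. br c v) ^^ n) v))"
      unfolding q_def using pp[OF cL(1), of "p (((\<lambda>v. br c v) ^^ n) v)"] pp[OF cL(1) fI[OF that]] p(2)
          by simp
    finally show ?case by simp
  qed simp
  then have "p (((\<lambda>v. br c v) ^^ m) v) = 0" if "v \<in> I" for v using m that by simp
  then have "((\<lambda>v. br c v) ^^ m) v \<in> J" if "v \<in> I" for v using p(3)[OF fI[OF that, of m]] that by simp
  then show ?thesis by blast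
qed

text \<open>The common kernel of commuting nilpotent operators on \<open>I/J\<close> is non-zero, so it is everything
  because there is no ideal strictly between \<open>J\<close> and \<open>I\<close>.\<close>

lemma commuting_nilpotents_trivial:
  assumes adj: "adjacent J I" and T: "T \<subseteq> L" and Q: "ideal (span T)"
    and comm: "\<And>s t. s \<in> T \<Longrightarrow> t \<in> T \<Longrightarrow> br s t \<in> centr J I"
    and nil: "\<And>t. t \<in> T \<Longrightarrow> \<exists>m. \<forall>v\<in>I. ((\<lambda>v. br t v) ^^ m) v \<in> J"
  shows "span T \<subseteq> centr J I"
proof -
  have JI: "ideal J" "ideal I" "J \<subseteq> I" "J \<noteq> I" using adj by (auto simp: adjacent_def)
  note J = idealD[OF JI(1)] and I = idealD[OF JI(2)]
  obtain F where F: "finite F" "F \<subseteq> T" "T \<subseteq> span F" using finite_basis[OF T] by blast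
  \<comment> \<open>A common kernel vector for finitely many elements: given \<open>v\<close> for
    \<open>F'\<close>, apply \<open>t\<close> as long as the result stays outside \<open>J\<close>.
    The last such iterate is killed by \<open>t\<close> modulo \<open>J\<close> and, since the
    operators commute modulo \<open>J\<close>, still by \<open>F'\<close>.\<close>
  have "\<exists>v\<in>I. v \<notin> J \<and> (\<forall>t\<in>F'. br t v \<in> J)" if "finite F'" "F' \<subseteq> T" for F'
    using that
  proof induction
    case empty then show ?case using JI by blast
  next
    case (insert t F')
    then obtain v where v: "v \<in> I" "v \<notin> J" "\<forall>s\<in>F'. br s v \<in> J" by blast
    have t: "t \<in> T" "t \<in> L" using insert T by auto
    let ?w = "\<lambda>n. ((\<lambda>v. br t v) ^^ n) v"
    obtain m where m: "?w m \<in> J" using nil[OF t(1)] v(1) by blast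
    have "\<exists>n. ?w n \<notin> J \<and> ?w (Suc n) \<in> J"
    proof (rule ccontr)
      assume neg: "\<not> ?thesis"
      have "?w n \<notin> J" for n
      proof (induction n)
        case 0 then show ?case using v by simp
      next
        case (Suc n) then show ?case using neg by blast
      qed
      then show False using m by blast
    qed
    then obtain n where n: "?w n \<notin> J" "?w (Suc n) \<in> J" by blast
    have wI: "?w n \<in> I" for n by (induction n) (auto simp: v I(3) t)
    have "br s (?w n) \<in> J" if "s \<in> F'" for n s
    proof (induction n)
      case 0 then show ?case using v that by simp
    next
      case (Suc n)
      have s: "s \<in> T" "s \<in> L" using that insert T by auto
      have "br s (?w (Suc n)) = br (br s t) (?w n) + br t (br s (?w n))"
        using jacobi[OF s(2) t(2)] wI I(2) by auto
      moreover have "br (br s t) (?w n) \<in> J" using comm[OF s(1) t(1)] wI by (simp add: centr_def)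
      ultimately show ?case using Suc J(3)[OF t(2)] subspace_add[OF J(1)] by simp
    qed
    then show ?case using n wI by (intro bexI[of _ "?w n"]) auto
  qed
  from this[OF F(1,2)] obtain v where v: "v \<in> I" "v \<notin> J" "\<forall>t\<in>F. br t v \<in> J" by blast
  \<comment> \<open>The common kernel of \<open>span T\<close> modulo \<open>J\<close>. It is an
    ideal because \<open>span T\<close> is one, and it contains \<open>v \<notin> J\<close>, so
    adjacency forces \<open>W = I\<close>.\<close>
  define W where "W = {v \<in> I. \<forall>b\<in>span T. br b v \<in> J}"
  note TQ = idealD[OF Q]
  have "br b v \<in> J" if "b \<in> span T" for b
  proof -
    have "b \<in> span F" using that F(3) span_minimal[OF F(3) subspace_span] by blast
    then show ?thesis
    proof (induction rule: span_induct_step)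
      case base then show ?case using v I(2) br_0_left subspace_0[OF J(1)] by auto
    next
      case (step c b w)
      have "F \<subseteq> L" using F(2) T by (rule order_trans)
      then have "b \<in> L" "w \<in> L" "v \<in> L" using step(1,2) v(1) I(2) span_minimal[OF _ subspace_L, of F]
          by auto
      then have "br (c *\<^sub>R b + w) v = c *\<^sub>R br b v + br w v"
          by (simp add: br_add_left br_scale_left L_scale)
      then show ?case using step v J(1) by (simp add: subspace_add subspace_scale)
    qed
  qed
  then have vW: "v \<in> W" using v by (simp add: W_def)
  have "ideal W"
  proof -
    have "subspace W"
      unfolding subspace_def W_def using J(1) I(1,2) TQ(2)
      by (auto simp: br_add_right br_scale_right br_0_right subspace_0 subspace_add subspace_scale subsetD)
    moreover have "br y w \<in> W" if "y \<in> L" "w \<in> W" for y w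
    proof -
      have w: "w \<in> I" "\<And>b. b \<in> span T \<Longrightarrow> br b w \<in> J" using that by (auto simp: W_def)
      have "br b (br y w) \<in> J" if "b \<in> span T" for b
      proof -
        have "br b (br y w) = br (br b y) w + br y (br b w)" using jacobi that \<open>y \<in> L\<close> w TQ(2) I(2) by blast
        then show ?thesis using w(2)[OF TQ(4)[OF \<open>y \<in> L\<close> that]] J(3)[OF \<open>y \<in> L\<close> w(2)[OF that]] J(1)
          by (simp add: subspace_add)
      qed
      then show ?thesis using I(3)[OF that(1) w(1)] by (simp add: W_def)
    qed
    ultimately show ?thesis using I(2) by (auto simp: lie_ideal_def W_def)
  qed
  moreover have "J \<subseteq> W" "W \<subseteq> I" using JI J(3) TQ(2) by (auto simp: W_def)
  ultimately have "W = I" using adj v vW unfolding adjacent_def by blast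
  then show ?thesis using TQ(2) by (auto simp: W_def centr_def)
qed

text \<open>Let \<open>A\<close> be the last derived ideal that acts nontrivially on
  \<open>I/J\<close>; it acts by commuting operators. \<open>nilpotent_mod\<close> and
  \<open>commuting_nilpotents_trivial\<close> first show that \<open>[L, A]\<close> acts trivially.
  After that the generators \<open>[x, a]\<close> of \<open>A = [H, H]\<close> commute on
  \<open>I/J\<close> with \<open>x\<close> and \<open>a\<close>, and a second round shows that
  \<open>A\<close> acts trivially as well, a contradiction.\<close>

lemma solvable_centr:
  assumes adj: "adjacent J I" and solv: "lie_solvable br L"
  shows "commutator br L L \<subseteq> centr J I"
proof (rule ccontr)
  let ?D = "derived_series br L" and ?C = "centr J I"
  assume "\<not> commutator br L L \<subseteq> ?C"
  then have D1: "\<not> ?D 1 \<subseteq> ?C" by simp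
  have JI: "ideal J" "ideal I" "J \<subseteq> I" using adj by (auto simp: adjacent_def)
  note C = ideal_centr[OF JI(1,2)] note CD = idealD[OF C]
  obtain i where "?D i = {0}" using solv by (auto simp: lie_solvable_def)
  then have Di: "?D i \<subseteq> ?C" using subspace_0[OF CD(1)] by simp
  have dec: "?D (Suc j) \<subseteq> ?D j" for j
    using commutator_le[OF ideal_derived_series idealD(2)[OF ideal_derived_series]] by simp
  define s where "s = (LEAST s. ?D (Suc s) \<subseteq> ?C)"
  have "i \<noteq> 0" using D1 Di dec[of 0] by (metis One_nat_def order_trans)
  then have ex: "?D (Suc (i - 1)) \<subseteq> ?C" using Di by simp
  have s: "?D (Suc s) \<subseteq> ?C" unfolding s_def by (rule LeastI[of "\<lambda>s. ?D (Suc s) \<subseteq> ?C", OF ex])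
  \<comment> \<open>Positivity of \<open>s\<close> makes \<open>A\<close> itself a commutator
    \<open>[H, H]\<close>, which the second round needs.\<close>
  then have "s \<noteq> 0" using D1 by (metis One_nat_def)
  then obtain h where h: "s = Suc h" using not0_implies_Suc by blast
  have nA: "\<not> ?D s \<subseteq> ?C" using not_less_Least[of h "\<lambda>s. ?D (Suc s) \<subseteq> ?C"] h by (simp add: s_def)
  define A where "A = ?D s"
  define H where "H = ?D h"
  have iA: "ideal A" and iH: "ideal H" by (simp_all add: A_def H_def ideal_derived_series del:
      derived_series.simps)
  have AH: "A = commutator br H H" by (simp add: A_def H_def h)
  note A = idealD[OF iA] and H = idealD[OF iH]
  have AA: "br a b \<in> ?C" if "a \<in> A" "b \<in> A" for a b
    using s commutatorI[OF that] by (auto simp: A_def)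
  have 1: "commutator br L A \<subseteq> ?C"
    unfolding commutator_def
  proof (rule commuting_nilpotents_trivial[OF adj])
    let ?T = "{br X Y |X Y. X \<in> L \<and> Y \<in> A}"
    have TA: "?T \<subseteq> A" using A(3) by blast
    then show "?T \<subseteq> L" using A(2) by blast
    show "ideal (span ?T)" using ideal_commutator[OF ideal_L iA] by (simp add: commutator_def)
    show "br s t \<in> ?C" if "s \<in> ?T" "t \<in> ?T" for s t using that TA AA by blast
    fix t assume "t \<in> ?T"
    then obtain x a where xa: "t = br x a" "x \<in> L" "a \<in> A" by blast
    have tA: "t \<in> A" "br x t \<in> A" using xa A by auto
    show "\<exists>m. \<forall>v\<in>I. ((\<lambda>v. br t v) ^^ m) v \<in> J"
      by (rule nilpotent_mod[OF JI xa(2) _ xa(1)]) (use xa A(2) AA tA in auto)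
  qed
  have "A \<subseteq> ?C"
    unfolding AH commutator_def
  proof (rule commuting_nilpotents_trivial[OF adj])
    let ?T = "{br X Y |X Y. X \<in> H \<and> Y \<in> H}"
    have TA: "?T \<subseteq> A" using commutatorI[of _ H _ H] by (auto simp: AH)
    then show "?T \<subseteq> L" using A(2) by blast
    show "ideal (span ?T)" using iA by (simp add: AH commutator_def)
    show "br s t \<in> ?C" if "s \<in> ?T" "t \<in> ?T" for s t using that TA AA by blast
    fix t assume t: "t \<in> ?T"
    then obtain x a where xa: "t = br x a" "x \<in> H" "a \<in> H" by blast
    have tA: "t \<in> A" using TA t by blast
    have xaL: "x \<in> L" "a \<in> L" "t \<in> L" using xa H(2) tA A(2) by auto
    have C1: "br x t \<in> ?C" "br a t \<in> ?C" using 1 commutatorI[OF _ tA] xaL by blast+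
    show "\<exists>m. \<forall>v\<in>I. ((\<lambda>v. br t v) ^^ m) v \<in> J"
      by (rule nilpotent_mod[OF JI xaL(1,2) xa(1)]) (use C1 CD(4) xaL in auto)
  qed
  then show False using nA by (simp add: A_def)
qed

section \<open>The nilradical as the common centralizer of all chief factors\<close>

definition nilr :: "'v set" where
  "nilr = {x \<in> L. \<forall>J I. adjacent J I \<longrightarrow> x \<in> centr J I}"

lemma ideal_nilr: "ideal nilr"
proof -
  have c: "ideal (centr J I)" if "adjacent J I" for J I
    using that ideal_centr by (simp add: adjacent_def)
  have "subspace nilr"
    unfolding subspace_def nilr_def
    using idealD(1)[OF c] by (auto simp: L_0 L_add L_scale subspace_0 subspace_add subspace_scale)
  moreover have "br x y \<in> nilr" if "x \<in> L" "y \<in> nilr" for x y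
    using that idealD(3)[OF c] by (auto simp: nilr_def br_closed)
  ultimately show ?thesis by (auto simp: lie_ideal_def nilr_def)
qed

text \<open>Bracketing with \<open>nilr\<close> moves an ideal \<open>I\<close> into an adjacent
  smaller ideal, so by induction on the dimension finitely many brackets annihilate any ideal, in
  particular \<open>nilr\<close> itself.\<close>

lemma nilpotent_nilr: "lie_nilpotent br nilr"
proof -
  define K where "K i I = ((commutator br nilr) ^^ i) I" for i I
  have "\<exists>i. K i I = {0}" if "ideal I" for I
    using that
  proof (induction "dim I" arbitrary: I rule: less_induct)
    case less
    show ?case
    proof (cases "I = {0}")
      case True then show ?thesis by (intro exI[of _ 0]) (simp add: K_def)
    next
      case False
      then obtain J where J: "adjacent J I" using adjacent_exists[OF less(2)] by blast
      then have iJ: "ideal J" "J \<subset> I" by (auto simp: adjacent_def)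
      have dJ: "dim J < dim I"
        using dim_eq[of J I] iJ idealD[OF iJ(1)] idealD[OF less(2)] by (metis not_le psubsetE)
      then obtain i where i: "K i J = {0}" using less(1)[OF dJ iJ(1)] by blast
      have "commutator br nilr I \<subseteq> J"
        using J by (intro commutator_subset idealD(1)[OF iJ(1)]) (auto simp: nilr_def centr_def)
      then have "K i (commutator br nilr I) \<subseteq> K i J"
        unfolding K_def by (induction i) (auto simp: commutator_mono)
      moreover have "K i (commutator br nilr I) = K (Suc i) I" by (simp add: K_def funpow_swap1)
      moreover have "0 \<in> K (Suc i) I" by (simp add: K_def commutator_def span_zero)
      ultimately show ?thesis using i by (intro exI[of _ "Suc i"]) auto
    qed
  qed
  from this[OF ideal_nilr] obtain i where "K i nilr = {0}" ..
  moreover have "lower_central_series br nilr i = K i nilr"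
    by (induction i) (auto simp: K_def)
  ultimately show ?thesis by (auto simp: lie_nilpotent_def)
qed

text \<open>\<open>[M, I] + J\<close> is an ideal between \<open>J\<close> and \<open>I\<close>. If
  it is \<open>J\<close>, then \<open>M\<close> acts trivially on \<open>I/J\<close>. If it is
  \<open>I\<close>, substituting this equation into itself gives \<open>I \<subseteq> K + J\<close>
  for every term \<open>K\<close> of the lower central series of \<open>M\<close>, hence
  \<open>I \<subseteq> J\<close>, which is excluded.\<close>

lemma nilpotent_ideal_le:
  assumes M: "ideal M" "lie_nilpotent br M" shows "M \<subseteq> nilr"
proof -
  note MD = idealD[OF M(1)]
  have "M \<subseteq> centr J I" if adj: "adjacent J I" for J I
  proof -
    have JI: "ideal J" "ideal I" "J \<subseteq> I" "J \<noteq> I" using adj by (auto simp: adjacent_def)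
    note J = idealD[OF JI(1)] and I = idealD[OF JI(2)]
    define S where "S A = {x + y |x y. x \<in> A \<and> y \<in> J}" for A
    have iS: "ideal (S A)" if "ideal A" for A unfolding S_def by (rule ideal_sum[OF that JI(1)])
    have JS: "J \<subseteq> S A" if "ideal A" for A
      using subspace_0[OF idealD(1)[OF that]] by (force simp: S_def)
    let ?I = "commutator br M I"
    have iI: "ideal ?I" by (rule ideal_commutator[OF M(1) JI(2)])
    have II: "?I \<subseteq> I" by (rule commutator_le[OF JI(2) MD(2)])
    have "S ?I \<subseteq> I" using II JI(3) I(1) by (auto simp: S_def intro: subspace_add)
    then consider "S ?I = J" | "S ?I = I" using adj iS[OF iI] JS[OF iI] by (auto simp: adjacent_def)
    then show ?thesis
    proof cases
      case 1
      have "?I \<subseteq> S ?I" using subspace_0[OF J(1)] by (force simp: S_def)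
      then show ?thesis using 1 MD(2) by (auto simp: centr_def intro: commutatorI)
    next
      case 2
      let ?K = "lower_central_series br M"
      have iK: "ideal (?K i)" for i by (induction i) (auto simp: M ideal_commutator)
      have IK: "I \<subseteq> S (?K i)" for i
      proof (induction i)
        case 0
        have "?I \<subseteq> M" using MD(4) I(2) by (intro commutator_subset MD(1)) auto
        then have "S ?I \<subseteq> S M" by (auto simp: S_def)
        then show ?case using 2 by simp
      next
        case (Suc i)
        have "?I \<subseteq> S (?K (Suc i))"
        proof (rule commutator_subset)
          show "subspace (S (?K (Suc i)))" using iS[OF iK[of "Suc i"]] idealD(1) by blast
          fix x y assume xy: "x \<in> M" "y \<in> I"
          then obtain u v where uv: "y = u + v" "u \<in> ?K i" "v \<in> J" using Suc by (auto simp: S_def)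
          have "br x y = br x u + br x v"
            using uv xy MD(2) idealD(2)[OF iK] J(2) by (auto intro!: br_add_right)
          moreover have "br x u \<in> ?K (Suc i)" using xy uv by (auto intro: commutatorI)
          ultimately show "br x y \<in> S (?K (Suc i))" using J(3)[OF _ uv(3)] xy MD(2) by (auto simp: S_def)
        qed
        moreover have "S ?I \<subseteq> S (?K (Suc i))" if "?I \<subseteq> S (?K (Suc i))"
        proof
          fix z assume "z \<in> S ?I"
          then obtain x y where z: "z = x + y" "x \<in> ?I" "y \<in> J" unfolding S_def by blast
          have "x \<in> S (?K (Suc i))" using z(2) that by blast
          then obtain u v where uv: "x = u + v" "u \<in> ?K (Suc i)" "v \<in> J" unfolding S_def by blast
          have "z = u + (v + y)" using z uv by simp
          then show "z \<in> S (?K (Suc i))" using uv z subspace_add[OF J(1)] unfolding S_def by blast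
        qed
        ultimately show ?case using 2 by blast
      qed
      obtain i where "?K i = {0}" using M(2) by (auto simp: lie_nilpotent_def)
      then have "I \<subseteq> J" using IK[of i] by (auto simp: S_def)
      then show ?thesis using JI by blast
    qed
  qed
  then show ?thesis using MD(2) by (auto simp: nilr_def)
qed

text \<open>A largest nilpotent ideal exists, so \<open>GREATEST\<close> has its intended value; the
  description by chief factors can be used from here on.\<close>

lemma nilradical_eq: "nilradical br L = nilr"
  unfolding nilradical_def
  by (rule Greatest_equality) (auto simp: ideal_nilr nilpotent_nilr nilpotent_ideal_le)

lemma derived_subset_nilradical:
  assumes "lie_solvable br L" shows "commutator br L L \<subseteq> nilradical br L"
  using solvable_centr[OF _ assms] commutator_le[OF ideal_L order_refl]
  unfolding nilradical_eq nilr_def by blast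

section \<open>The nilradical series\<close>

lemma ideal_nilradical_series: "ideal (nilradical_series br L i)"
proof (induction i)
  case 0 show ?case by (simp add: ideal_L)
next
  case (Suc i)
  then show ?case by (cases i) (simp_all add: nilradical_eq ideal_nilr ideal_commutator)
qed

lemma nilradical_series_Suc: "i \<ge> 1 \<Longrightarrow> nilradical_series br L (Suc i) = commutator br (nilradical br L)
    (nilradical_series br L i)"
  by (cases i) auto

lemma nilradical_series_Suc_le: "nilradical_series br L (Suc i) \<subseteq> nilradical_series br L i"
proof (cases i)
  case 0 then show ?thesis by (simp add: nilradical_eq nilr_def)
next
  case (Suc j)
  then show ?thesis
    using commutator_le[OF ideal_nilradical_series[of i], of "nilradical br L"]
    by (simp add: nilradical_eq) (metis idealD(2) ideal_nilr)
qed

lemma nilradical_series_mono: "i \<le> j \<Longrightarrow> nilradical_series br L j \<subseteq> nilradical_series br L i"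
  by (rule lift_Suc_antimono_le[of "nilradical_series br L"]) (auto simp: nilradical_series_Suc_le)

text \<open>As for a lower central series: elements of term \<open>i + 1\<close> are combinations of
  brackets \<open>[u, v]\<close> with \<open>u\<close> in term \<open>1\<close> and \<open>v\<close>
  in term \<open>i\<close>, and \<open>[[u, v], y] = [u, [v, y]] - [v, [u, y]]\<close>. Indices
  start at \<open>1\<close> because bracketing with \<open>L\<close> need not raise the
  index.\<close>

lemma br_nilradical_series:
  assumes "1 \<le> i" "1 \<le> j" "x \<in> nilradical_series br L i" "y \<in> nilradical_series br L j"
  shows "br x y \<in> nilradical_series br L (i + j)"
  using assms
proof (induction i arbitrary: x y j)
  case (Suc i)
  let ?N = "nilradical_series br L"
  note N = idealD[OF ideal_nilradical_series]
  show ?case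
  proof (cases "i = 0")
    case True
    then show ?thesis using Suc.prems nilradical_series_Suc[OF Suc.prems(2)] by (auto intro: commutatorI)
  next
    case False
    have y: "y \<in> L" using Suc.prems N(2) by blast
    have "x \<in> span {br X Y |X Y. X \<in> ?N 1 \<and> Y \<in> ?N i}"
      using Suc.prems(3) nilradical_series_Suc[of i] False by (simp add: commutator_def)
    then show ?thesis
    proof (induction rule: span_induct_step)
      case base then show ?case using br_0_left[OF y] subspace_0[OF N(1)] by simp
    next
      case (step c z w)
      obtain u v where z: "z = br u v" "u \<in> ?N 1" "v \<in> ?N i" using step(1) by blast
      have uv: "u \<in> L" "v \<in> L" using z N(2) by blast+
      have "{br X Y |X Y. X \<in> ?N 1 \<and> Y \<in> ?N i} \<subseteq> L"
        using N(2)[of 1] N(2)[of i] by (auto intro!: br_closed)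
      then have w: "w \<in> L" using step(2) span_minimal[OF _ subspace_L] by (meson subsetD)
      have vy: "br v y \<in> ?N (i + j)" using Suc.IH[OF _ Suc.prems(2) z(3) Suc.prems(4)] False by simp
      have uy: "br u y \<in> ?N (Suc j)" using nilradical_series_Suc[OF Suc.prems(2)] z(2) Suc.prems(4)
          by (auto intro: commutatorI)
      have "br z y = br u (br v y) - br v (br u y)" using jacobi[OF uv y] z by simp
      moreover have "br u (br v y) \<in> ?N (Suc (i + j))"
        using nilradical_series_Suc[of "i + j"] z(2) vy Suc.prems(2) by (auto intro: commutatorI)
      moreover have "br v (br u y) \<in> ?N (i + Suc j)"
        using Suc.IH[OF _ _ z(3) uy] False by simp
      ultimately have "br z y \<in> ?N (Suc i + j)" using subspace_diff[OF N(1)] by simp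
      moreover have "br (c *\<^sub>R z + w) y = c *\<^sub>R br z y + br w y"
        using br_closed[OF uv] z y w by (simp add: br_add_left br_scale_left L_scale)
      ultimately show ?case using step(3) by (simp add: subspace_add subspace_scale N(1))
    qed
  qed
qed simp

lemma nilradical_series_zero:
  assumes "nilradical_series br L i = {0}" "i \<le> j" shows "nilradical_series br L j = {0}"
  using nilradical_series_mono[OF assms(2)] assms(1)
    subspace_0[OF idealD(1)[OF ideal_nilradical_series[of j]]]
  by auto

end

text \<open>Serves restriction of vector fields to a smaller domain, which can have a kernel, and,
  through \<open>lie_iso\<close>, pushforward to coordinates.\<close>

locale lie_hom = A: fd_lie_algebra br L + B: fd_lie_algebra br' L'
  for br :: "'v::real_vector \<Rightarrow> 'v \<Rightarrow> 'v" and L and br' :: "'w::real_vector \<Rightarrow> 'w \<Rightarrow> 'w" and L' +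
  fixes f :: "'v \<Rightarrow> 'w"
  assumes lin: "linear f" and f_br: "x \<in> L \<Longrightarrow> y \<in> L \<Longrightarrow> f (br x y) = br' (f x) (f y)"
    and f_onto: "f ` L = L'"
begin

lemma f_commutator:
  assumes "A \<subseteq> L" "B \<subseteq> L" shows "commutator br' (f ` A) (f ` B) = f ` commutator br A B"
proof -
  have "{br' X Y |X Y. X \<in> f ` A \<and> Y \<in> f ` B} = f ` {br X Y |X Y. X \<in> A \<and> Y \<in> B}"
    (is "?l = ?r")
  proof
    show "?l \<subseteq> ?r"
    proof
      fix z assume "z \<in> ?l"
      then obtain x y where xy: "x \<in> A" "y \<in> B" "z = br' (f x) (f y)" by blast
      then have "z = f (br x y)" using f_br[of x y] assms by (metis subsetD)
      then show "z \<in> ?r" using xy by blast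
    qed
    show "?r \<subseteq> ?l"
    proof
      fix z assume "z \<in> ?r"
      then obtain x y where xy: "x \<in> A" "y \<in> B" "z = f (br x y)" by blast
      then have "z = br' (f x) (f y)" using f_br[of x y] assms by (metis subsetD)
      then show "z \<in> ?l" using xy by blast
    qed
  qed
  then show ?thesis by (simp add: commutator_def linear_span_image[OF lin])
qed

lemma f_derived_series: "derived_series br' L' i = f ` derived_series br L i"
  by (induction i) (simp_all add: f_onto f_commutator A.idealD(2)[OF A.ideal_derived_series])

lemma solvable_image: "lie_solvable br L \<Longrightarrow> lie_solvable br' L'"
  unfolding lie_solvable_def using f_derived_series linear_0[OF lin] by (metis image_empty image_insert)

lemma ideal_image:
  assumes "A.ideal N" shows "B.ideal (f ` N)"
proof -
  note N = A.idealD[OF assms]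
  have "br' x y \<in> f ` N" if xy: "x \<in> L'" "y \<in> f ` N" for x y
  proof -
    obtain u v where uv: "u \<in> L" "x = f u" "v \<in> N" "y = f v" using xy f_onto by blast
    then have "br' x y = f (br u v)" using f_br[of u v] N(2) by auto
    then show ?thesis using N(3)[OF uv(1,3)] by blast
  qed
  then show ?thesis
    using N(2) f_onto linear_subspace_image[OF lin N(1)] by (auto simp: lie_ideal_def)
qed

lemma ideal_preimage:
  assumes "B.ideal N" shows "A.ideal {x \<in> L. f x \<in> N}"
proof -
  note N = B.idealD[OF assms]
  have "subspace {x \<in> L. f x \<in> N}"
    using A.subspace_L N(1)
    by (auto simp: subspace_def linear_add[OF lin] linear_scale[OF lin] linear_0[OF lin])
  then show ?thesis
    using N(3) f_onto by (auto simp: lie_ideal_def A.br_closed f_br)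
qed

lemma f_lower_central_series:
  assumes "A \<subseteq> L" "\<And>i. lower_central_series br A i \<subseteq> L"
  shows "lower_central_series br' (f ` A) i = f ` lower_central_series br A i"
  by (induction i) (simp_all add: assms f_commutator)

end

locale lie_iso = lie_hom +
  assumes f_inj: "inj_on f L"
begin

lemma lower_central_series_le: "A.ideal N \<Longrightarrow> lower_central_series br N i \<subseteq> L"
proof -
  assume N: "A.ideal N"
  have "A.ideal (lower_central_series br N i)" by (induction i) (simp_all add: N A.ideal_commutator)
  then show ?thesis by (rule A.idealD(2))
qed

lemma nilpotent_image: "A.ideal N \<Longrightarrow> lie_nilpotent br' (f ` N) \<longleftrightarrow> lie_nilpotent br N"
proof -
  assume N: "A.ideal N"
  have "f ` lower_central_series br N i = {0} \<longleftrightarrow> lower_central_series br N i = {0}" for i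
  proof -
    have "f ` lower_central_series br N i = f ` {0} \<longleftrightarrow> lower_central_series br N i = {0}"
      using inj_on_image_eq_iff[OF f_inj, of "lower_central_series br N i" "{0}"]
        lower_central_series_le[OF N] A.L_0 by auto
    then show ?thesis using linear_0[OF lin] by simp
  qed
  then show ?thesis
    using f_lower_central_series[OF A.idealD(2)[OF N] lower_central_series_le[OF N]]
    by (simp add: lie_nilpotent_def)
qed

text \<open>Injectivity makes the preimage of a nilpotent ideal nilpotent, so each nilradical is
  carried into the other.\<close>

lemma f_nilradical: "nilradical br' L' = f ` nilradical br L"
  unfolding A.nilradical_eq B.nilradical_eq
proof
  let ?N = "{x \<in> L. f x \<in> B.nilr}"
  have N: "A.ideal ?N" by (rule ideal_preimage[OF B.ideal_nilr])
  have fN: "f ` ?N = B.nilr" using f_onto B.idealD(2)[OF B.ideal_nilr] by auto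
  then have "lie_nilpotent br ?N" using nilpotent_image[OF N] B.nilpotent_nilr by simp
  then show "B.nilr \<subseteq> f ` A.nilr" using A.nilpotent_ideal_le[OF N] fN by blast
  show "f ` A.nilr \<subseteq> B.nilr"
    by (rule B.nilpotent_ideal_le[OF ideal_image[OF A.ideal_nilr]])
      (simp add: nilpotent_image A.ideal_nilr A.nilpotent_nilr)
qed

lemma f_nilradical_series: "nilradical_series br' L' i = f ` nilradical_series br L i"
proof (induction i)
  case 0 show ?case by (simp add: f_onto)
next
  case (Suc i)
  note N = A.idealD(2)[OF A.ideal_nilradical_series]
  show ?case
  proof (cases i)
    case 0 then show ?thesis by (simp add: f_nilradical)
  next
    case (Suc j)
    then show ?thesis using Suc.IH N[of 1] N[of i] by (simp add: f_nilradical f_commutator)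
  qed
qed

end

section \<open>Calculus of smooth functions\<close>

abbreviation fd :: "(real^'n \<Rightarrow> 'b::real_normed_vector) \<Rightarrow> real^'n \<Rightarrow> real^'n \<Rightarrow> 'b" where
  "fd f x \<equiv> frechet_derivative f (at x)"

definition pd :: "'n \<Rightarrow> (real^'n \<Rightarrow> 'b::real_normed_vector) \<Rightarrow> real^'n \<Rightarrow> 'b" where
  "pd i f = (\<lambda>x. fd f x (axis i 1))"

lemma Ck_on_Suc: "Ck_on (Suc k) U f \<longleftrightarrow> (\<forall>x\<in>U. f differentiable (at x)) \<and> (\<forall>i. Ck_on k U (pd i f))"
  by (simp add: pd_def)

declare Ck_on.simps(2) [simp del]

lemma fd_eqI: "(f has_derivative f') (at x) \<Longrightarrow> fd f x = f'"
  by (rule frechet_derivative_at[symmetric])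

lemma has_derivative_fd: "f differentiable (at x) \<Longrightarrow> (f has_derivative fd f x) (at x)"
  by (simp add: frechet_derivative_works)

lemma fd_cong:
  assumes "open U" "x \<in> U" "\<And>y. y \<in> U \<Longrightarrow> f y = g y"
  shows "fd f x = fd g x"
proof -
  have "(f has_derivative D) (at x) \<longleftrightarrow> (g has_derivative D) (at x)" for D
    using has_derivative_transform_within_open[OF _ assms(1,2)] assms(3) by metis
  then show ?thesis by (simp add: frechet_derivative_def)
qed

lemma differentiable_cong:
  assumes "open U" "x \<in> U" "\<And>y. y \<in> U \<Longrightarrow> f y = g y"
  shows "f differentiable (at x) \<longleftrightarrow> g differentiable (at x)"
  unfolding differentiable_def
  using has_derivative_transform_within_open[OF _ assms(1,2)] assms(3) by metis

lemma pd_cong: "open U \<Longrightarrow> x \<in> U \<Longrightarrow> (\<And>y. y \<in> U \<Longrightarrow> f y = g y) \<Longrightarrow> pd i f x = pd i g x"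
  unfolding pd_def by (subst fd_cong) auto

lemma Ck_on_cong:
  assumes "open U" "\<And>x. x \<in> U \<Longrightarrow> f x = g x"
  shows "Ck_on k U f \<longleftrightarrow> Ck_on k U g"
  using assms(2)
proof (induction k arbitrary: f g)
  case 0 then show ?case by (simp cong: continuous_on_cong)
next
  case (Suc k)
  have "Ck_on k U (pd i f) \<longleftrightarrow> Ck_on k U (pd i g)" for i
    using Suc.prems pd_cong[OF assms(1)] by (intro Suc.IH) blast
  then show ?case
    using differentiable_cong[OF assms(1) _ Suc.prems] by (simp add: Ck_on_Suc)
qed

lemma Ck_on_subset: "Ck_on k U f \<Longrightarrow> V \<subseteq> U \<Longrightarrow> Ck_on k V f"
  by (induction k arbitrary: f) (auto simp: Ck_on_Suc intro: continuous_on_subset)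

lemma Ck_on_imp_continuous_on: "Ck_on k U f \<Longrightarrow> continuous_on U f"
  by (cases k) (auto simp: Ck_on_Suc intro!: continuous_at_imp_continuous_on
      differentiable_imp_continuous_within)

lemma Ck_on_SucD: "Ck_on (Suc k) U f \<Longrightarrow> Ck_on k U f"
proof (induction k arbitrary: f)
  case 0 then show ?case using Ck_on_imp_continuous_on by simp
next
  case (Suc k)
  from Suc.prems have d: "\<forall>x\<in>U. f differentiable (at x)" and p: "\<And>i. Ck_on (Suc k) U (pd i f)"
    unfolding Ck_on_Suc[of "Suc k"] by auto
  show ?case unfolding Ck_on_Suc[of k] using d Suc.IH[OF p] by simp
qed

lemma fd_expand:
  fixes f :: "real^'n \<Rightarrow> 'b::real_normed_vector"
  assumes "f differentiable (at x)" shows "fd f x v = (\<Sum>i\<in>UNIV. v $ i *\<^sub>R pd i f x)"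
proof -
  have "v = (\<Sum>i\<in>UNIV. v $ i *\<^sub>R axis i 1)"
    using basis_expansion[of v] by (simp add: scalar_mult_eq_scaleR)
  then have "fd f x v = fd f x (\<Sum>i\<in>UNIV. v $ i *\<^sub>R axis i 1)" by simp
  also have "\<dots> = (\<Sum>i\<in>UNIV. v $ i *\<^sub>R pd i f x)"
    unfolding pd_def using linear_frechet_derivative[OF assms] by (simp add: linear_sum linear_scale)
  finally show ?thesis .
qed

lemma Ck_on_const: "Ck_on k U (\<lambda>x. c)"
  by (induction k arbitrary: c) (simp_all add: Ck_on_Suc pd_def)

lemma Ck_on_bounded_linear:
  assumes "bounded_linear h" "open U" "Ck_on k U f" shows "Ck_on k U (\<lambda>x. h (f x))"
  using assms(3)
proof (induction k arbitrary: f)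
  case 0 then show ?case using assms(1) by (auto intro: bounded_linear.continuous_on)
next
  case (Suc k)
  then have d: "\<And>x. x \<in> U \<Longrightarrow> f differentiable (at x)" by (simp add: Ck_on_Suc)
  have hd: "((\<lambda>x. h (f x)) has_derivative (\<lambda>v. h (fd f x v))) (at x)" if "x \<in> U" for x
    using has_derivative_fd[OF d[OF that]] assms(1) by (rule bounded_linear.has_derivative[rotated])
  have "Ck_on k U (pd i (\<lambda>x. h (f x)))" for i
  proof -
    have "Ck_on k U (\<lambda>x. h (pd i f x))" using Suc by (simp add: Ck_on_Suc)
    then show ?thesis
      by (rule Ck_on_cong[OF assms(2), THEN iffD1, rotated]) (simp add: pd_def fd_eqI[OF hd])
  qed
  then show ?case using hd by (auto simp: Ck_on_Suc differentiable_def)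
qed

lemma Ck_on_add:
  assumes "open U" "Ck_on k U f" "Ck_on k U g" shows "Ck_on k U (\<lambda>x. f x + g x)"
  using assms(2,3)
proof (induction k arbitrary: f g)
  case 0 then show ?case by (auto intro: continuous_on_add)
next
  case (Suc k)
  then have d: "\<And>x. x \<in> U \<Longrightarrow> f differentiable (at x)" "\<And>x. x \<in> U \<Longrightarrow> g differentiable (at x)"
    by (simp_all add: Ck_on_Suc)
  have hd: "((\<lambda>x. f x + g x) has_derivative (\<lambda>v. fd f x v + fd g x v)) (at x)" if "x \<in> U" for x
    using has_derivative_add[OF has_derivative_fd[OF d(1)[OF that]] has_derivative_fd[OF d(2)[OF that]]] .
  have "Ck_on k U (pd i (\<lambda>x. f x + g x))" for i
  proof -
    have "Ck_on k U (\<lambda>x. pd i f x + pd i g x)" using Suc by (simp add: Ck_on_Suc)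
    then show ?thesis
      by (rule Ck_on_cong[OF assms(1), THEN iffD1, rotated]) (simp add: pd_def fd_eqI[OF hd])
  qed
  then show ?case using hd by (auto simp: Ck_on_Suc differentiable_def)
qed

lemma Ck_on_sum:
  assumes "open U" "\<And>i. i \<in> I \<Longrightarrow> Ck_on k U (f i)" shows "Ck_on k U (\<lambda>x. \<Sum>i\<in>I. f i x)"
  using assms(2) by (induction I rule: infinite_finite_induct)
    (simp_all add: Ck_on_const Ck_on_add assms(1))

lemma Ck_on_bilinear:
  assumes bl: "bounded_bilinear h" and U: "open U" and "Ck_on k U f" "Ck_on k U g"
  shows "Ck_on k U (\<lambda>x. h (f x) (g x))"
  using assms(3,4)
proof (induction k arbitrary: f g)
  case 0 then show ?case using bl by (auto intro: bounded_bilinear.continuous_on)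
next
  case (Suc k)
  then have d: "\<And>x. x \<in> U \<Longrightarrow> f differentiable (at x)" "\<And>x. x \<in> U \<Longrightarrow> g differentiable (at x)"
    by (simp_all add: Ck_on_Suc)
  have hd: "((\<lambda>x. h (f x) (g x)) has_derivative (\<lambda>v. h (f x) (fd g x v) + h (fd f x v) (g x))) (at x)"
      if "x \<in> U" for x
    using bounded_bilinear.FDERIV[OF bl has_derivative_fd[OF d(1)[OF that]]
      has_derivative_fd[OF d(2)[OF that]]] .
  have "Ck_on k U (pd i (\<lambda>x. h (f x) (g x)))" for i
  proof -
    have "Ck_on k U (\<lambda>x. h (f x) (pd i g x) + h (pd i f x) (g x))"
      using Suc.prems[THEN Ck_on_SucD] Suc.prems by (intro Ck_on_add U Suc.IH) (auto simp: Ck_on_Suc)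
    then show ?thesis
      by (rule Ck_on_cong[OF U, THEN iffD1, rotated]) (simp add: pd_def fd_eqI[OF hd])
  qed
  then show ?case using hd by (auto simp: Ck_on_Suc differentiable_def)
qed

lemmas Ck_on_scaleR = Ck_on_bilinear[OF bounded_bilinear_scaleR]
lemmas Ck_on_mult = Ck_on_bilinear[OF bounded_bilinear_mult]

lemma Ck_on_prod:
  fixes f :: "'i \<Rightarrow> real^'n \<Rightarrow> real"
  assumes "open U" "\<And>i. i \<in> I \<Longrightarrow> Ck_on k U (f i)" shows "Ck_on k U (\<lambda>x. \<Prod>i\<in>I. f i x)"
  using assms(2) by (induction I rule: infinite_finite_induct)
    (simp_all add: Ck_on_const Ck_on_mult assms(1))

lemma pd_component:
  "f differentiable (at x) \<Longrightarrow> pd i (\<lambda>x. f x $ j) x = pd i f x $ j"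
  unfolding pd_def
  by (subst fd_eqI[OF bounded_linear.has_derivative[OF bounded_linear_vec_nth has_derivative_fd]]) auto

lemma Ck_on_component: "open U \<Longrightarrow> Ck_on k U f \<Longrightarrow> Ck_on k U (\<lambda>x. f x $ j)"
  by (rule Ck_on_bounded_linear[OF bounded_linear_vec_nth])

lemma vec_expand: "(f :: real^'m) = (\<Sum>i\<in>UNIV. (f $ i) *\<^sub>R axis i 1)"
  using basis_expansion[of f] by (simp add: scalar_mult_eq_scaleR)

lemma Ck_on_vec:
  fixes f :: "real^'n \<Rightarrow> real^'m"
  assumes "open U" "\<And>j. Ck_on k U (\<lambda>x. f x $ j)" shows "Ck_on k U f"
proof -
  have "Ck_on k U (\<lambda>x. \<Sum>i\<in>UNIV. (f x $ i) *\<^sub>R axis i 1)"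
    by (intro Ck_on_sum Ck_on_scaleR Ck_on_const assms)
  then show ?thesis
    by (rule Ck_on_cong[OF assms(1), THEN iffD1, rotated]) (rule vec_expand[symmetric])
qed

lemma chain_pd:
  fixes f :: "real^'m \<Rightarrow> 'b::real_normed_vector" and g :: "real^'n \<Rightarrow> real^'m"
  assumes "g differentiable (at x)" "f differentiable (at (g x))"
  shows "pd i (\<lambda>x. f (g x)) x = (\<Sum>j\<in>UNIV. (pd i g x $ j) *\<^sub>R pd j f (g x))"
    and "(\<lambda>x. f (g x)) differentiable (at x)" and "fd (\<lambda>x. f (g x)) x v = fd f (g x) (fd g x v)"
proof -
  have hd: "((\<lambda>x. f (g x)) has_derivative (\<lambda>v. fd f (g x) (fd g x v))) (at x)"
    using has_derivative_compose[OF has_derivative_fd[OF assms(1)] has_derivative_fd[OF assms(2)]] .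
  show "pd i (\<lambda>x. f (g x)) x = (\<Sum>j\<in>UNIV. (pd i g x $ j) *\<^sub>R pd j f (g x))"
    by (simp add: pd_def[of i] fd_eqI[OF hd] fd_expand[OF assms(2)])
  show "(\<lambda>x. f (g x)) differentiable (at x)" using hd by (auto simp: differentiable_def)
  show "fd (\<lambda>x. f (g x)) x v = fd f (g x) (fd g x v)" by (simp add: fd_eqI[OF hd])
qed

lemma Ck_on_compose:
  fixes f :: "real^'m \<Rightarrow> 'b::real_normed_vector" and g :: "real^'n \<Rightarrow> real^'m"
  assumes "open U" "open V" "g ` U \<subseteq> V" "Ck_on k V f" "Ck_on k U g"
  shows "Ck_on k U (\<lambda>x. f (g x))"
  using assms(4,5)
proof (induction k arbitrary: f)
  case 0 then show ?case using assms(3) by (auto intro: continuous_on_compose2)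
next
  case (Suc k)
  then have d: "\<And>x. x \<in> U \<Longrightarrow> g differentiable (at x)" "\<And>x. x \<in> U \<Longrightarrow> f differentiable (at (g x))"
    using assms(3) by (auto simp: Ck_on_Suc)
  have g: "Ck_on k U g" using Suc.prems(2) by (rule Ck_on_SucD)
  have "Ck_on k U (pd i (\<lambda>x. f (g x)))" for i
  proof -
    have "Ck_on k U (\<lambda>x. \<Sum>j\<in>UNIV. (pd i g x $ j) *\<^sub>R pd j f (g x))"
      using Suc.prems g by (intro Ck_on_sum Ck_on_scaleR Ck_on_component Suc.IH assms(1))
        (auto simp: Ck_on_Suc)
    then show ?thesis
      by (rule Ck_on_cong[OF assms(1), THEN iffD1, rotated]) (simp add: chain_pd(1) d)
  qed
  then show ?case using chain_pd(2)[of g _ f] d by (auto simp: Ck_on_Suc)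
qed

lemma Ck_on_inverse:
  fixes f :: "real^'n \<Rightarrow> real"
  assumes "open U" "Ck_on k U f" "\<And>x. x \<in> U \<Longrightarrow> f x \<noteq> 0" shows "Ck_on k U (\<lambda>x. inverse (f x))"
  using assms(2)
proof (induction k)
  case 0 then show ?case using assms(3) by (auto intro: continuous_on_inverse)
next
  case (Suc k)
  then have d: "\<And>x. x \<in> U \<Longrightarrow> f differentiable (at x)" by (auto simp: Ck_on_Suc)
  have i: "Ck_on k U (\<lambda>x. inverse (f x))" using Suc Ck_on_SucD by blast
  have hd: "((\<lambda>x. inverse (f x)) has_derivative (\<lambda>v. - (inverse (f x) * fd f x v * inverse (f x))))
      (at x)" if "x \<in> U" for x
    using has_derivative_inverse'[OF assms(3)[OF that] ]
      has_derivative_compose[OF has_derivative_fd[OF d[OF that]], of inverse]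
    by blast
  have "Ck_on k U (pd i (\<lambda>x. inverse (f x)))" for i
  proof -
    have "Ck_on k U (\<lambda>x. - (inverse (f x) * pd i f x * inverse (f x)))"
      using Suc.prems by (intro Ck_on_bounded_linear[OF bounded_linear_minus[OF bounded_linear_ident]]
        Ck_on_mult i assms(1)) (auto simp: Ck_on_Suc)
    then show ?thesis
      by (rule Ck_on_cong[OF assms(1), THEN iffD1, rotated]) (simp add: pd_def fd_eqI[OF hd])
  qed
  then show ?case using hd by (auto simp: Ck_on_Suc differentiable_def)
qed

lemma Ck_on_det:
  fixes A :: "real^'n \<Rightarrow> real^'m^'m"
  assumes "open U" "\<And>i j. Ck_on k U (\<lambda>x. A x $ i $ j)" shows "Ck_on k U (\<lambda>x. det (A x))"
  unfolding det_def by (intro Ck_on_sum Ck_on_mult Ck_on_const Ck_on_prod assms)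

lemma Ck_on_ident: "Ck_on k U (\<lambda>x. x)"
  by (cases k) (simp_all add: Ck_on_Suc pd_def Ck_on_const continuous_on_id)

lemma smooth_onD:
  assumes "smooth_on U f"
  shows "x \<in> U \<Longrightarrow> f differentiable (at x)" "smooth_on U (pd i f)" "continuous_on U f"
proof -
  have *: "Ck_on (Suc k) U f" for k using assms by (simp add: smooth_on_def)
  then show "x \<in> U \<Longrightarrow> f differentiable (at x)" "smooth_on U (pd i f)"
      by (simp_all add: Ck_on_Suc smooth_on_def)
  show "continuous_on U f" using Ck_on_imp_continuous_on * by blast
qed

lemma smooth_on_cong: "open U \<Longrightarrow> (\<And>x. x \<in> U \<Longrightarrow> f x = g x) \<Longrightarrow> smooth_on U f \<longleftrightarrow> smooth_on U g"
  unfolding smooth_on_def using Ck_on_cong by blast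

lemma smooth_on_subset: "smooth_on U f \<Longrightarrow> V \<subseteq> U \<Longrightarrow> smooth_on V f"
  unfolding smooth_on_def using Ck_on_subset by blast

lemma smooth_on_const: "smooth_on U (\<lambda>x. c)"
  and smooth_on_ident: "smooth_on U (\<lambda>x. x)"
  and smooth_on_add: "open U \<Longrightarrow> smooth_on U f \<Longrightarrow> smooth_on U g \<Longrightarrow> smooth_on U (\<lambda>x. f x + g x)"
  and smooth_on_sum: "open U \<Longrightarrow> (\<And>i. i \<in> I \<Longrightarrow> smooth_on U (F i)) \<Longrightarrow> smooth_on U (\<lambda>x. \<Sum>i\<in>I. F i x)"
  and smooth_on_bounded_linear: "bounded_linear h \<Longrightarrow> open U \<Longrightarrow> smooth_on U f \<Longrightarrow> smooth_on U (\<lambda>x. h (f x))"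
  by (simp_all add: smooth_on_def Ck_on_const Ck_on_ident Ck_on_add Ck_on_sum Ck_on_bounded_linear)

lemma smooth_on_scaleR: "open U \<Longrightarrow> smooth_on U f \<Longrightarrow> smooth_on U g \<Longrightarrow> smooth_on U (\<lambda>x. f x *\<^sub>R g x)"
  by (simp add: smooth_on_def Ck_on_scaleR)

lemma smooth_on_mult:
  fixes f :: "real^'n \<Rightarrow> real"
  shows "open U \<Longrightarrow> smooth_on U f \<Longrightarrow> smooth_on U g \<Longrightarrow> smooth_on U (\<lambda>x. f x * g x)"
  by (simp add: smooth_on_def Ck_on_mult)

lemma smooth_on_power:
  fixes f :: "real^'n \<Rightarrow> real"
  shows "open U \<Longrightarrow> smooth_on U f \<Longrightarrow> smooth_on U (\<lambda>x. f x ^ m)"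
  by (induction m) (simp_all add: smooth_on_const smooth_on_mult)

lemma smooth_on_prod:
  fixes F :: "'i \<Rightarrow> real^'n \<Rightarrow> real"
  shows "open U \<Longrightarrow> (\<And>i. i \<in> I \<Longrightarrow> smooth_on U (F i)) \<Longrightarrow> smooth_on U (\<lambda>x. \<Prod>i\<in>I. F i x)"
  by (simp add: smooth_on_def Ck_on_prod)

lemma smooth_on_minus: "open U \<Longrightarrow> smooth_on U f \<Longrightarrow> smooth_on U (\<lambda>x. - f x)"
  by (rule smooth_on_bounded_linear[OF bounded_linear_minus[OF bounded_linear_ident]])

lemma smooth_on_diff: "open U \<Longrightarrow> smooth_on U f \<Longrightarrow> smooth_on U g \<Longrightarrow> smooth_on U (\<lambda>x. f x - g x)"
  using smooth_on_add[OF _ _ smooth_on_minus, of U f g] by simp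

lemma smooth_on_divide:
  fixes f :: "real^'n \<Rightarrow> real"
  shows "open U \<Longrightarrow> smooth_on U f \<Longrightarrow> smooth_on U g \<Longrightarrow> (\<And>x. x \<in> U \<Longrightarrow> g x \<noteq> 0) \<Longrightarrow> smooth_on U (\<lambda>x. f x / g x)"
  unfolding divide_inverse smooth_on_def by (intro allI Ck_on_mult Ck_on_inverse) auto

lemma smooth_on_component: "open U \<Longrightarrow> smooth_on U f \<Longrightarrow> smooth_on U (\<lambda>x. f x $ j)"
  by (simp add: smooth_on_def Ck_on_component)

lemma smooth_on_vec: "open U \<Longrightarrow> (\<And>j. smooth_on U (\<lambda>x. f x $ j)) \<Longrightarrow> smooth_on U (f :: real^'n \<Rightarrow> real^'m)"
  unfolding smooth_on_def by (intro allI Ck_on_vec) auto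

lemma smooth_on_compose:
  fixes f :: "real^'m \<Rightarrow> 'b::real_normed_vector" and g :: "real^'n \<Rightarrow> real^'m"
  assumes "open U" "open V" "g ` U \<subseteq> V" "smooth_on V f" "smooth_on U g"
  shows "smooth_on U (\<lambda>x. f (g x))"
  using assms by (auto simp: smooth_on_def intro: Ck_on_compose)

lemma smooth_on_det:
  fixes A :: "real^'n \<Rightarrow> real^'m^'m"
  assumes "open U" "\<And>i j. smooth_on U (\<lambda>x. A x $ i $ j)" shows "smooth_on U (\<lambda>x. det (A x))"
  using assms by (auto simp: smooth_on_def intro: Ck_on_det)

lemma smooth_on_coord: "smooth_on U (\<lambda>x::real^'n. x $ j)"
  using smooth_on_component[OF open_UNIV smooth_on_ident, of j] smooth_on_subset by blast

lemma smooth_on_fd: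
  assumes "open U" "smooth_on U f" "smooth_on U X"
  shows "smooth_on U (\<lambda>x. fd f x (X x))"
proof -
  have "smooth_on U (\<lambda>x. \<Sum>i\<in>UNIV. X x $ i *\<^sub>R pd i f x)"
    using assms smooth_onD(2) by (intro smooth_on_sum smooth_on_scaleR smooth_on_component) auto
  then show ?thesis
    by (rule smooth_on_cong[OF assms(1), THEN iffD1, rotated])
        (simp add: fd_expand smooth_onD(1)[OF assms(2)])
qed

text \<open>Two applications of the mean value theorem express the second difference over a small
  square by either mixed derivative at some nearby point; continuity of both at \<open>x\<close>
  rules out a gap between them.\<close>

lemma pd_commute_real:
  fixes f :: "real^'n \<Rightarrow> real"
  assumes U: "open U" and f: "smooth_on U f" and x: "x \<in> U"
  shows "pd i (pd j f) x = pd j (pd i f) x"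
proof -
  define e where "e i = (axis i 1 :: real^'n)" for i
  have hd: "((\<lambda>s. g (y + s *\<^sub>R e l)) has_real_derivative pd l g (y + s *\<^sub>R e l)) (at s)"
    if "smooth_on U g" "y + s *\<^sub>R e l \<in> U" for g :: "real^'n \<Rightarrow> real" and y s l
  proof -
    have 1: "((\<lambda>s. y + s *\<^sub>R e l) has_derivative (\<lambda>h. h *\<^sub>R e l)) (at s)"
      by (auto intro!: derivative_eq_intros)
    have gd: "g differentiable (at (y + s *\<^sub>R e l))" by (rule smooth_onD(1)[OF that])
    have "((\<lambda>s. g (y + s *\<^sub>R e l)) has_derivative (\<lambda>h. fd g (y + s *\<^sub>R e l) (h *\<^sub>R e l))) (at s)"
      using has_derivative_compose[OF 1 has_derivative_fd[OF gd]] .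
    also have "(\<lambda>h. fd g (y + s *\<^sub>R e l) (h *\<^sub>R e l)) = (\<lambda>h. pd l g (y + s *\<^sub>R e l) * h)"
      using linear_scale[OF linear_frechet_derivative[OF gd]] by (auto simp: pd_def e_def)
    finally show ?thesis by (simp add: has_field_derivative_def)
  qed
  obtain r where r: "r > 0" "ball x r \<subseteq> U" using U x openE by blast
  \<comment> \<open>Steps of at most \<open>\<delta>/3\<close> in two coordinate directions move a
    point by at most \<open>2\<delta>/3\<close>, so they stay in the ball.\<close>
  have inU: "x + s *\<^sub>R e a + t *\<^sub>R e b \<in> ball x \<delta>" if "0 \<le> s" "s \<le> \<delta>/3" "0 \<le> t" "t \<le> \<delta>/3" "\<delta> > 0"
      for s t \<delta> a b
  proof -
    have "norm (s *\<^sub>R e a + t *\<^sub>R e b) \<le> s + t"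
      using norm_triangle_ineq[of "s *\<^sub>R e a" "t *\<^sub>R e b"] that by (simp add: e_def)
    moreover have "dist x (x + s *\<^sub>R e a + t *\<^sub>R e b) = norm (s *\<^sub>R e a + t *\<^sub>R e b)"
      by (metis add.assoc add_diff_cancel_left' dist_commute dist_norm)
    ultimately show ?thesis using that by simp
  qed
  have key: "\<exists>\<xi>\<in>ball x \<delta>. f (x + h *\<^sub>R e a + h *\<^sub>R e b) - f (x + h *\<^sub>R e a) - f (x + h *\<^sub>R e b) + f x
      = h * h * pd b (pd a f) \<xi>"
    if "0 < \<delta>" "\<delta> \<le> r" "h = \<delta>/3" for \<delta> h a b
  proof -
    have h: "h > 0" using that by simp
    have bU: "ball x \<delta> \<subseteq> U" using r that(2) by (meson order_trans subset_ball)
    let ?\<phi> = "\<lambda>s. f (x + h *\<^sub>R e b + s *\<^sub>R e a) - f (x + s *\<^sub>R e a)"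
    have "\<exists>s. 0 < s \<and> s < h \<and> ?\<phi> h - ?\<phi> 0 = (h - 0) * (pd a f (x + h *\<^sub>R e b + s *\<^sub>R e a) - pd a f
        (x + s *\<^sub>R e a))"
    proof (rule MVT2[OF h])
      fix s assume s: "0 \<le> s" "s \<le> h"
      have "x + h *\<^sub>R e b + s *\<^sub>R e a \<in> U" "x + s *\<^sub>R e a \<in> U"
        using inU[of h \<delta> s b a] inU[of s \<delta> 0 a a] s that bU by auto
      then show "DERIV ?\<phi> s :> pd a f (x + h *\<^sub>R e b + s *\<^sub>R e a) - pd a f (x + s *\<^sub>R e a)"
        by (intro DERIV_diff hd f)
    qed
    then obtain s where s: "0 < s" "s < h" "?\<phi> h - ?\<phi> 0 = h * (pd a f (x + h *\<^sub>R e b + s *\<^sub>R e a) - pd a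
        f (x + s *\<^sub>R e a))" by auto
    let ?\<psi> = "\<lambda>t. pd a f (x + s *\<^sub>R e a + t *\<^sub>R e b)"
    have "\<exists>t. 0 < t \<and> t < h \<and> ?\<psi> h - ?\<psi> 0 = (h - 0) * pd b (pd a f) (x + s *\<^sub>R e a + t *\<^sub>R e b)"
    proof (rule MVT2[OF h])
      fix t assume t: "0 \<le> t" "t \<le> h"
      have "x + s *\<^sub>R e a + t *\<^sub>R e b \<in> U" using inU[of s \<delta> t a b] s t that bU by auto
      then show "DERIV ?\<psi> t :> pd b (pd a f) (x + s *\<^sub>R e a + t *\<^sub>R e b)"
        by (intro hd smooth_onD(2) f)
    qed
    then obtain t where t: "0 < t" "t < h" "?\<psi> h - ?\<psi> 0 = h * pd b (pd a f) (x + s *\<^sub>R e a + t *\<^sub>R e b)"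
        by auto
    have "f (x + h *\<^sub>R e a + h *\<^sub>R e b) - f (x + h *\<^sub>R e a) - f (x + h *\<^sub>R e b) + f x = ?\<phi> h - ?\<phi> 0"
      by (simp add: algebra_simps)
    also have "\<dots> = h * (?\<psi> h - ?\<psi> 0)" using s(3) by (simp add: algebra_simps)
    also have "\<dots> = h * h * pd b (pd a f) (x + s *\<^sub>R e a + t *\<^sub>R e b)" using t(3) by simp
    finally show ?thesis
      using inU[of s \<delta> t a b] s t that by (intro bexI[of _ "x + s *\<^sub>R e a + t *\<^sub>R e b"]) auto
  qed
  have c: "continuous (at x) (pd a (pd b f))" for a b
    using smooth_onD(3)[OF smooth_onD(2)[OF smooth_onD(2)[OF f]]] U x
      by (simp add: continuous_on_eq_continuous_at)
  show ?thesis
  proof (rule ccontr)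
    assume ne: "\<not> ?thesis"
    define \<epsilon> where "\<epsilon> = \<bar>pd i (pd j f) x - pd j (pd i f) x\<bar> / 2"
    have \<epsilon>: "\<epsilon> > 0" using ne by (simp add: \<epsilon>_def)
    obtain d1 where d1: "d1 > 0" "\<And>y. dist y x < d1 \<Longrightarrow> dist (pd i (pd j f) y) (pd i (pd j f) x) < \<epsilon>"
      using c[of i j] \<epsilon> by (auto simp: continuous_at_eps_delta dist_commute)
    obtain d2 where d2: "d2 > 0" "\<And>y. dist y x < d2 \<Longrightarrow> dist (pd j (pd i f) y) (pd j (pd i f) x) < \<epsilon>"
      using c[of j i] \<epsilon> by (auto simp: continuous_at_eps_delta dist_commute)
    define \<delta> where "\<delta> = Min {r, d1, d2}"
    have \<delta>: "0 < \<delta>" "\<delta> \<le> r" "\<delta> \<le> d1" "\<delta> \<le> d2" using r(1) d1(1) d2(1) by (auto simp: \<delta>_def)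
    obtain \<xi> \<eta> where xe: "\<xi> \<in> ball x \<delta>" "\<eta> \<in> ball x \<delta>"
        "(\<delta>/3) * (\<delta>/3) * pd i (pd j f) \<xi> = (\<delta>/3) * (\<delta>/3) * pd j (pd i f) \<eta>"
      using key[OF \<delta>(1,2) refl, of j i] key[OF \<delta>(1,2) refl, of i j] by (auto simp: algebra_simps)
    then have eq: "pd i (pd j f) \<xi> = pd j (pd i f) \<eta>" using \<delta>(1) by simp
    have "dist \<xi> x < d1" "dist \<eta> x < d2" using xe \<delta> by (auto simp: dist_commute)
    then have "\<bar>pd i (pd j f) \<xi> - pd i (pd j f) x\<bar> < \<epsilon>" "\<bar>pd j (pd i f) \<eta> - pd j (pd i f) x\<bar> < \<epsilon>"
      using d1(2) d2(2) by (auto simp: dist_real_def)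
    moreover have "\<bar>pd i (pd j f) x - pd j (pd i f) x\<bar>
        \<le> \<bar>pd j (pd i f) \<eta> - pd j (pd i f) x\<bar> + \<bar>pd i (pd j f) \<xi> - pd i (pd j f) x\<bar>"
      using abs_triangle_ineq4[of "pd j (pd i f) \<eta> - pd j (pd i f) x"
        "pd i (pd j f) \<xi> - pd i (pd j f) x"] eq
      by simp
    ultimately show False unfolding \<epsilon>_def by simp
  qed
qed

lemma pd_commute:
  fixes f :: "real^'n \<Rightarrow> real^'m"
  assumes U: "open U" and f: "smooth_on U f" and x: "x \<in> U"
  shows "pd i (pd j f) x = pd j (pd i f) x"
proof -
  have c: "pd a (pd b f) x $ l = pd a (pd b (\<lambda>x. f x $ l)) x" for a b l
  proof -
    have "pd a (pd b f) x $ l = pd a (\<lambda>x. pd b f x $ l) x"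
      by (rule pd_component[symmetric]) (rule smooth_onD(1)[OF smooth_onD(2)[OF f] x])
    also have "\<dots> = pd a (pd b (\<lambda>x. f x $ l)) x"
      by (rule pd_cong[OF U x]) (simp add: pd_component smooth_onD(1)[OF f])
    finally show ?thesis .
  qed
  show ?thesis
    unfolding vec_eq_iff c using pd_commute_real[OF U smooth_on_component[OF U f] x] by blast
qed

lemma pd_mult:
  fixes f g :: "real^'n \<Rightarrow> real"
  assumes "f differentiable (at x)" "g differentiable (at x)"
  shows "pd i (\<lambda>x. f x * g x) x = f x * pd i g x + pd i f x * g x"
  unfolding pd_def
  by (simp add: fd_eqI[OF bounded_bilinear.FDERIV[OF bounded_bilinear_mult
      has_derivative_fd[OF assms(1)] has_derivative_fd[OF assms(2)]]])

lemma fd_mult: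
  fixes f g :: "real^'n \<Rightarrow> real"
  assumes "f differentiable (at x)" "g differentiable (at x)"
  shows "fd (\<lambda>x. f x * g x) x v = f x * fd g x v + fd f x v * g x"
  by (simp add: fd_eqI[OF bounded_bilinear.FDERIV[OF bounded_bilinear_mult
      has_derivative_fd[OF assms(1)] has_derivative_fd[OF assms(2)]]])

lemma fd_scaleR:
  assumes "f differentiable (at x)" "g differentiable (at x)"
  shows "fd (\<lambda>x. f x *\<^sub>R g x) x v = f x *\<^sub>R fd g x v + fd f x v *\<^sub>R g x"
  by (simp add: fd_eqI[OF bounded_bilinear.FDERIV[OF bounded_bilinear_scaleR
      has_derivative_fd[OF assms(1)] has_derivative_fd[OF assms(2)]]])

lemma fd_add:
  assumes "f differentiable (at x)" "g differentiable (at x)"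
  shows "fd (\<lambda>x. f x + g x) x v = fd f x v + fd g x v"
  by (simp add: fd_eqI[OF has_derivative_add[OF has_derivative_fd[OF assms(1)]
      has_derivative_fd[OF assms(2)]]])

lemma fd_diff:
  assumes "f differentiable (at x)" "g differentiable (at x)"
  shows "fd (\<lambda>x. f x - g x) x v = fd f x v - fd g x v"
  by (simp add: fd_eqI[OF has_derivative_diff[OF has_derivative_fd[OF assms(1)]
      has_derivative_fd[OF assms(2)]]])

lemma fd_sum:
  assumes "\<And>i. i \<in> I \<Longrightarrow> F i differentiable (at x)"
  shows "fd (\<lambda>x. \<Sum>i\<in>I. F i x) x v = (\<Sum>i\<in>I. fd (F i) x v)"
  by (simp add: fd_eqI[OF has_derivative_sum[OF has_derivative_fd[OF assms]]])

lemma fd_component: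
  "f differentiable (at x) \<Longrightarrow> fd (\<lambda>x. f x $ j) x v = fd f x v $ j"
  by (subst fd_eqI[OF bounded_linear.has_derivative[OF bounded_linear_vec_nth has_derivative_fd]]) auto

lemma fd_coord: "fd (\<lambda>x::real^'n. x $ j) x v = v $ j"
  by (simp add: fd_eqI[OF bounded_linear_imp_has_derivative[OF bounded_linear_vec_nth]])

lemma pd_coord: "pd i (\<lambda>x::real^'n. x $ j) x = (if i = j then 1 else 0)"
  by (simp add: pd_def fd_coord axis_def)

text \<open>The inverse function theorem yields a differentiable inverse \<open>g\<close>. By
  Cramer's rule its partial derivatives are rational expressions in those of \<open>f\<close> at
  \<open>g y\<close>; if \<open>g\<close> is of class \<open>C^k\<close>, so are its partial
  derivatives, and \<open>g\<close> is of class \<open>C^(k+1)\<close>.\<close>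

lemma smooth_inverse_function:
  fixes f :: "real^'n \<Rightarrow> real^'n"
  assumes U: "open U" and f: "smooth_on U f" and x0: "x0 \<in> U" and inj: "inj (fd f x0)"
  obtains V where "open V" "x0 \<in> V" "V \<subseteq> U" "inj_on f V" "open (f ` V)" "smooth_on (f ` V) (inv_into V f)"
proof -
  have bl: "bounded_linear (fd f x)" if "x \<in> U" for x
    using has_derivative_fd[OF smooth_onD(1)[OF f that]] by (rule has_derivative_bounded_linear)
  define f' where "f' x = Blinfun (fd f x)" for x
  have f': "blinfun_apply (f' x) = fd f x" if "x \<in> U" for x
    unfolding f'_def by (rule bounded_linear_Blinfun_apply[OF bl[OF that]])
  have cont: "continuous_on U f'"
  proof (rule continuous_on_blinfun_componentwise)
    fix b :: "real^'n" assume "b \<in> Basis"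
    then obtain i where b: "b = axis i 1" by (auto simp: Basis_vec_def)
    have "continuous_on U (pd i f)" using smooth_onD(2,3)[OF f] smooth_onD(3) by blast
    then show "continuous_on U (\<lambda>x. blinfun_apply (f' x) b)"
      by (rule continuous_on_eq) (simp add: f' pd_def b)
  qed
  have lin: "linear (fd f x)" if "x \<in> U" for x using bl[OF that] by (rule bounded_linear.linear)
  obtain g0 where g0: "linear g0" "g0 \<circ> fd f x0 = id"
    using linear_injective_left_inverse[OF lin[OF x0] inj] by blast
  have "Blinfun g0 o\<^sub>L f' x0 = id_blinfun"
    using g0(2) by (intro blinfun_eqI)
      (simp add: bounded_linear_Blinfun_apply linear_conv_bounded_linear[THEN iffD1, OF g0(1)] f'[OF x0]
          fun_eq_iff)
  then obtain U' V g g' where g: "open U'" "U' \<subseteq> U" "x0 \<in> U'" "open V" "f x0 \<in> V" "homeomorphism U' V f g"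
    "\<And>y. y \<in> V \<Longrightarrow> (g has_derivative (g' y)) (at y)"
    "\<And>y. y \<in> V \<Longrightarrow> g' y = inv (blinfun_apply (f'(g y)))"
    "\<And>y. y \<in> V \<Longrightarrow> bij (blinfun_apply (f'(g y)))"
    using inverse_function_theorem[OF U _ cont x0, of f] f' has_derivative_fd[OF smooth_onD(1)[OF f]]
      by metis
  have hom: "f ` U' = V" "\<And>y. y \<in> V \<Longrightarrow> g y \<in> U'" "\<And>y. y \<in> V \<Longrightarrow> f (g y) = y" "\<And>x. x \<in> U' \<Longrightarrow> g (f x) = x"
    using g(6) by (auto simp: homeomorphism_def)
  have injU: "inj_on f U'" using hom(4) by (rule inj_on_inverseI)
  have ginv: "inv_into U' f y = g y" if "y \<in> V" for y
    using inv_into_f_eq[OF injU hom(2)[OF that] hom(3)[OF that]] .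
  define M where "M y = (\<chi> a b. pd b f (g y) $ a)" for y
  have MM: "M y = matrix (fd f (g y))" for y by (simp add: M_def matrix_def pd_def)
  have gU: "g y \<in> U" if "y \<in> V" for y using hom(2)[OF that] g(2) by blast
  have det: "det (M y) \<noteq> 0" if "y \<in> V" for y
    unfolding MM using g(9)[OF that] f'[OF gU[OF that]] det_nz_iff_inj[OF lin[OF gU[OF that]]]
        by (simp add: bij_is_inj)
  have pdg: "pd i g y $ k = det (\<chi> a b. if b = k then axis i 1 $ a else M y $ a $ b) / det (M y)"
      if y: "y \<in> V" for i k y
  proof -
    let ?F = "fd f (g y)"
    have "pd i g y = inv ?F (axis i 1)"
      unfolding pd_def using fd_eqI[OF g(7)[OF y]] g(8)[OF y] f'[OF gU[OF y]] by simp
    then have "?F (pd i g y) = axis i 1"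
      using g(9)[OF y] f'[OF gU[OF y]] by (simp add: bij_is_surj surj_f_inv_f)
    then have "M y *v pd i g y = axis i 1"
      unfolding MM using fun_cong[OF matrix_vector_mul(2)[OF lin[OF gU[OF y]]], of "pd i g y"] by simp
    then show ?thesis using cramer[OF det[OF y]] by (simp add: vec_lambda_beta)
  qed
  have "Ck_on k V g" for k
  proof (induction k)
    case 0
    show ?case using g(6) by (simp add: homeomorphism_def)
  next
    case (Suc k)
    have pf: "Ck_on k V (\<lambda>y. pd b f (g y) $ a)" for a b
    proof (rule Ck_on_component[OF g(4)])
      have "Ck_on k U (pd b f)" using smooth_onD(2)[OF f] by (simp add: smooth_on_def)
      then show "Ck_on k V (\<lambda>y. pd b f (g y))"
        using Ck_on_compose[OF g(4) U _ _ Suc] gU by blast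
    qed
    then have Mk: "Ck_on k V (\<lambda>y. M y $ a $ b)" for a b by (simp add: M_def)
    have "Ck_on k V (\<lambda>y. pd i g y $ l)" for i l
    proof -
      have "Ck_on k V (\<lambda>y. det (\<chi> a b. if b = l then axis i 1 $ a else M y $ a $ b) * inverse (det (M y)))"
      proof (intro Ck_on_mult Ck_on_inverse Ck_on_det g(4))
        fix a b
        show "Ck_on k V (\<lambda>x. (\<chi> a b. if b = l then axis i 1 $ a else M x $ a $ b) $ a $ b)"
          by (cases "b = l") (simp_all add: Mk Ck_on_const)
      qed (auto simp: Mk det)
      then show ?thesis
        by (rule Ck_on_cong[OF g(4), THEN iffD1, rotated]) (simp add: pdg divide_inverse)
    qed
    then have "Ck_on k V (pd i g)" for i by (rule Ck_on_vec[OF g(4)])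
    then show ?case using g(7) by (auto simp: Ck_on_Suc differentiable_def)
  qed
  then have "smooth_on V g" by (simp add: smooth_on_def)
  then have "smooth_on (f ` U') (inv_into U' f)"
    unfolding hom(1) by (rule smooth_on_cong[OF g(4), THEN iffD1, rotated]) (simp add: ginv)
  then show ?thesis using that[OF g(1,3,2) injU] hom(1) g(4) by simp
qed

section \<open>Coordinate cubes and integration along contractions of some of the
  coordinates\<close>

definition cube :: "real \<Rightarrow> (real^'n) set" where
  "cube r = {x. \<forall>i. \<bar>x $ i\<bar> < r}"

lemma open_cube: "open (cube r :: (real^'n) set)"
proof -
  have "cube r = (\<Inter>i\<in>UNIV. {x::real^'n. \<bar>x $ i\<bar> < r})" by (auto simp: cube_def)
  moreover have "open {x::real^'n. \<bar>x $ i\<bar> < r}" for i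
    by (intro open_Collect_less continuous_intros)
  ultimately show ?thesis by auto
qed

lemma convex_cube: "convex (cube r :: (real^'n) set)"
proof -
  have "cube r = (\<Inter>i\<in>UNIV. {x::real^'n. x $ i < r} \<inter> {x. x $ i > - r})"
      by (auto simp: cube_def abs_less_iff minus_less_iff)
  moreover have "convex {x::real^'n. x $ i < r}" "convex {x::real^'n. x $ i > - r}" for i
    using convex_halfspace_lt[of "axis i 1 :: real^'n" r] convex_halfspace_gt[of "- r"
      "axis i 1 :: real^'n"]
    by (simp_all add: inner_axis' inner_real_def)
  ultimately show ?thesis by (auto intro!: convex_INT convex_Int)
qed

lemma connected_nbhd_cube: "r > 0 \<Longrightarrow> connected_nbhd (cube r)"
  by (auto simp: connected_nbhd_def open_cube convex_connected convex_cube) (simp add: cube_def)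

lemma cube_subset_open:
  fixes U :: "(real^'n) set"
  assumes "open U" "0 \<in> U" obtains r where "r > 0" "cube r \<subseteq> U"
proof -
  obtain e where e: "e > 0" "ball 0 e \<subseteq> U" using assms openE by blast
  define r where "r = e / real CARD('n)"
  have "x \<in> ball 0 e" if "x \<in> cube r" for x :: "real^'n"
  proof -
    have "norm x \<le> (\<Sum>i\<in>UNIV. \<bar>x $ i\<bar>)" by (rule norm_le_l1_cart)
    also have "\<dots> < (\<Sum>i\<in>(UNIV::'n set). r)" using that by (intro sum_strict_mono) (auto simp: cube_def)
    also have "\<dots> = e" by (simp add: r_def)
    finally show ?thesis by simp
  qed
  then have "cube r \<subseteq> U" using e(2) by blast
  moreover have "r > 0" using e(1) by (simp add: r_def)
  ultimately show ?thesis using that by blast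
qed

text \<open>The coordinates outside \<open>S\<close> act as parameters; \<open>shrink S 0\<close> is
  the projection to the slice on which the coordinates in \<open>S\<close> vanish.\<close>

definition shrink :: "'n set \<Rightarrow> real \<Rightarrow> real^'n \<Rightarrow> real^'n" where
  "shrink S t x = (\<chi> i. if i \<in> S then t * x $ i else x $ i)"

lemma shrink_nth: "shrink S t x $ i = (if i \<in> S then t * x $ i else x $ i)"
  by (simp add: shrink_def)

lemma shrink_1: "shrink S 1 x = x"
  by (simp add: shrink_def vec_eq_iff)

lemma shrink_cube: "x \<in> cube r \<Longrightarrow> 0 \<le> t \<Longrightarrow> t \<le> 1 \<Longrightarrow> shrink S t x \<in> cube r"
  using mult_left_le_one_le[of "\<bar>x $ i\<bar>" t for i]
  by (auto simp: cube_def shrink_nth abs_mult) (meson abs_ge_zero le_less_trans mult_left_le_one_le)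

lemma continuous_on_shrink: "continuous_on A (\<lambda>p. shrink S (snd p) (fst p) :: real^'n)"
proof -
  have "continuous_on A (\<lambda>p. if i \<in> S then snd p * fst p $ i else (fst p :: real^'n) $ i)" for i
    by (cases "i \<in> S") (auto intro!: continuous_intros)
  then show ?thesis unfolding shrink_def by (rule continuous_on_vec_lambda)
qed

lemma bounded_linear_shrink: "bounded_linear (shrink S t :: real^'n \<Rightarrow> real^'n)"
  unfolding linear_conv_bounded_linear[symmetric]
  by (rule linearI) (auto simp: shrink_def vec_eq_iff algebra_simps)

lemma smooth_on_shrink: "smooth_on U (shrink S t)"
  using smooth_on_bounded_linear[OF bounded_linear_shrink open_UNIV smooth_on_ident] smooth_on_subset
    by blast

lemma pd_shrink:
  fixes h :: "real^'n \<Rightarrow> real"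
  assumes "h differentiable (at (shrink S t x))"
  shows "pd i (\<lambda>x. h (shrink S t x)) x = (if i \<in> S then t else 1) * pd i h (shrink S t x)"
    and "(\<lambda>x. h (shrink S t x)) differentiable (at x)"
proof -
  have hd: "(shrink S t has_derivative shrink S t) (at x)"
    by (rule bounded_linear_imp_has_derivative[OF bounded_linear_shrink])
  have d: "shrink S t differentiable (at x)" using hd by (auto simp: differentiable_def)
  show "(\<lambda>x. h (shrink S t x)) differentiable (at x)" by (rule chain_pd(2)[OF d assms])
  have "pd i (shrink S t) x = (if i \<in> S then t else 1) *\<^sub>R axis i 1"
    by (auto simp: pd_def fd_eqI[OF hd] shrink_def vec_eq_iff axis_def)
  then have "fd h (shrink S t x) (pd i (shrink S t) x) = (if i \<in> S then t else 1) * pd i h (shrink S t x)"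
    using linear_scale[OF linear_frechet_derivative[OF assms]] by (simp add: pd_def)
  then show "pd i (\<lambda>x. h (shrink S t x)) x = (if i \<in> S then t else 1) * pd i h (shrink S t x)"
    unfolding pd_def[of i "\<lambda>x. h (shrink S t x)"] chain_pd(3)[OF d assms] by (simp add: pd_def)
qed

text \<open>The power \<open>t ^ m\<close> makes this family closed under differentiation: a partial
  derivative in a direction of \<open>S\<close> brings out one more factor \<open>t\<close>.\<close>

definition shrink_int :: "'n set \<Rightarrow> nat \<Rightarrow> (real^'n \<Rightarrow> real) \<Rightarrow> real^'n \<Rightarrow> real" where
  "shrink_int S m h x = integral {0..1} (\<lambda>t. t ^ m * h (shrink S t x))"

lemma continuous_shrink_integrand:
  assumes "continuous_on (cube r) h"
  shows "continuous_on (cube r \<times> {0..1}) (\<lambda>p. snd p ^ m * h (shrink S (snd p) (fst p)))"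
  by (intro continuous_intros continuous_on_compose2[OF assms continuous_on_shrink])
      (auto intro: shrink_cube)

lemma integrable_shrink_integrand:
  assumes "continuous_on (cube r) h" "x \<in> cube r"
  shows "(\<lambda>t. t ^ m * h (shrink S t x)) integrable_on {0..1}"
proof (rule integrable_continuous_interval)
  have "continuous_on {0..1} (\<lambda>t. (\<lambda>p. snd p ^ m * h (shrink S (snd p) (fst p))) (x, t))"
    by (rule continuous_on_compose2[OF continuous_shrink_integrand[OF assms(1)]])
      (auto intro!: continuous_intros simp: assms(2))
  then show "continuous_on {0..1} (\<lambda>t. t ^ m * h (shrink S t x))" by simp
qed

lemma shrink_int_has_derivative:
  fixes h :: "real^'n \<Rightarrow> real"
  assumes h: "smooth_on (cube r) h" and x: "x \<in> cube r"
  shows "(shrink_int S m h has_derivative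
    (\<lambda>v. \<Sum>i\<in>UNIV. v $ i * shrink_int S (m + of_bool (i \<in> S)) (pd i h) x)) (at x)"
proof -
  define L :: "'n \<Rightarrow> (real^'n) \<Rightarrow>\<^sub>L real" where "L i = Blinfun (\<lambda>v. v $ i)" for i
  have L: "blinfun_apply (L i) v = v $ i" for i v
    by (simp add: L_def bounded_linear_Blinfun_apply bounded_linear_vec_nth)
  define c where "c i x t = t ^ (m + of_bool (i \<in> S)) * pd i h (shrink S t x)" for i x t
  define fx where "fx x t = (\<Sum>i\<in>UNIV. c i x t *\<^sub>R L i)" for x t
  have dh: "h differentiable (at (shrink S t x))" if "x \<in> cube r" "t \<in> {0..1}" for x :: "real^'n" and t
    using smooth_onD(1)[OF h shrink_cube[OF that(1)]] that(2) by simp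
  have cp: "continuous_on (cube r) (pd i h)" for i using smooth_onD(2)[OF h] smooth_onD(3) by blast
  have "((\<lambda>x. integral (cbox 0 1) (\<lambda>t. t ^ m * h (shrink S t x))) has_derivative
      blinfun_apply (integral (cbox 0 1) (fx x))) (at x within cube r)"
  proof (rule leibniz_rule[OF _ _ _ x convex_cube])
    fix x :: "real^'n" and t assume xt: "x \<in> cube r" "t \<in> cbox (0::real) 1"
    have d: "h differentiable (at (shrink S t x))" using dh xt by simp
    have d2: "(\<lambda>x. h (shrink S t x)) differentiable (at x)" by (rule pd_shrink(2)[OF d])
    have "((\<lambda>x. t ^ m * h (shrink S t x)) has_derivative (\<lambda>v. t ^ m * fd (\<lambda>x. h (shrink S t x)) x v))
        (at x)"
      by (rule has_derivative_mult_right[OF has_derivative_fd[OF d2]])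
    also have "(\<lambda>v. t ^ m * fd (\<lambda>x. h (shrink S t x)) x v) = blinfun_apply (fx x t)"
    proof
      fix v
      have "blinfun_apply (fx x t) v = (\<Sum>i\<in>UNIV. t ^ (m + of_bool (i \<in> S)) * pd i h (shrink S t x) * v $ i)"
        by (simp add: fx_def c_def blinfun.sum_left blinfun.scaleR_left L)
      also have "\<dots> = (\<Sum>i\<in>UNIV. t ^ m * (v $ i * ((if i \<in> S then t else 1) * pd i h (shrink S t x))))"
        by (intro sum.cong) auto
      finally show "t ^ m * fd (\<lambda>x. h (shrink S t x)) x v = blinfun_apply (fx x t) v"
        by (simp add: fd_expand[OF d2] pd_shrink(1)[OF d] sum_distrib_left)
    qed
    finally show "((\<lambda>x. t ^ m * h (shrink S t x)) has_derivative blinfun_apply (fx x t))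
        (at x within cube r)"
      by (rule has_derivative_at_withinI)
  next
    fix x assume "x \<in> (cube r :: (real^'n) set)"
    then show "(\<lambda>t. t ^ m * h (shrink S t x)) integrable_on cbox 0 1"
      using integrable_shrink_integrand[OF smooth_onD(3)[OF h]] by simp
  next
    have "continuous_on (cube r \<times> {0..1}) (\<lambda>p. \<Sum>i\<in>UNIV. (snd p ^ (m + of_bool (i \<in> S)) * pd i h
        (shrink S (snd p) (fst p))) *\<^sub>R L i)"
      by (intro continuous_on_sum continuous_on_scaleR continuous_shrink_integrand cp continuous_on_const)
    then show "continuous_on (cube r \<times> cbox 0 1) (\<lambda>(x, t). fx x t)"
      by (simp add: fx_def c_def case_prod_unfold)
  qed
  moreover have "integral (cbox 0 1) (fx x) = (\<Sum>i\<in>UNIV. integral {0..1} (c i x) *\<^sub>R L i)"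
  proof -
    have i: "c i x integrable_on {0..1}" for i
      unfolding c_def by (rule integrable_shrink_integrand[OF cp x])
    have "((\<lambda>t. \<Sum>i\<in>UNIV. c i x t *\<^sub>R L i) has_integral (\<Sum>i\<in>UNIV. integral {0..1} (c i x) *\<^sub>R L i)) {0..1}"
      by (intro has_integral_sum has_integral_scaleR_left integrable_integral i) simp
    then show ?thesis unfolding fx_def by (simp add: integral_unique)
  qed
  ultimately have "((\<lambda>x. shrink_int S m h x) has_derivative
     (\<lambda>v. \<Sum>i\<in>UNIV. v $ i * shrink_int S (m + of_bool (i \<in> S)) (pd i h) x)) (at x within cube r)"
  proof -
    have "blinfun_apply (\<Sum>i\<in>UNIV. integral {0..1} (c i x) *\<^sub>R L i)
        = (\<lambda>v. \<Sum>i\<in>UNIV. v $ i * shrink_int S (m + of_bool (i \<in> S)) (pd i h) x)"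
      by (rule ext) (simp add: blinfun.sum_left blinfun.scaleR_left L shrink_int_def c_def[abs_def]
          mult.commute[of "integral _ _"])
    moreover assume "((\<lambda>x. integral (cbox 0 1) (\<lambda>t. t ^ m * h (shrink S t x))) has_derivative
      blinfun_apply (integral (cbox 0 1) (fx x))) (at x within cube r)"
      "integral (cbox 0 1) (fx x) = (\<Sum>i\<in>UNIV. integral {0..1} (c i x) *\<^sub>R L i)"
    ultimately show ?thesis by (simp add: shrink_int_def)
  qed
  then show ?thesis using at_within_open[OF x open_cube] by simp
qed

lemma pd_shrink_int:
  assumes "smooth_on (cube r) h" "x \<in> cube r"
  shows "pd i (shrink_int S m h) x = shrink_int S (m + of_bool (i \<in> S)) (pd i h) x"
proof -
  have "pd i (shrink_int S m h) x = (\<Sum>j\<in>UNIV. (if j = i then shrink_int S (m + of_bool (j \<in> S)) (pd j h)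
      x else 0))"
    unfolding pd_def fd_eqI[OF shrink_int_has_derivative[OF assms]]
        by (intro sum.cong) (auto simp: axis_def)
  then show ?thesis by simp
qed

lemma smooth_on_shrink_int:
  fixes h :: "real^'n \<Rightarrow> real"
  assumes "smooth_on (cube r) h" shows "smooth_on (cube r) (shrink_int S m h)"
proof -
  have "Ck_on k (cube r) (shrink_int S m h)" for k
    using assms
  proof (induction k arbitrary: m h)
    case 0
    then show ?case
      using has_derivative_continuous[OF shrink_int_has_derivative[OF 0]]
      by (simp add: continuous_on_eq_continuous_at[OF open_cube])
  next
    case (Suc k)
    have "Ck_on k (cube r) (pd i (shrink_int S m h))" for i
      using Suc.IH[OF smooth_onD(2)[OF Suc.prems]]
      by (rule Ck_on_cong[OF open_cube, THEN iffD1, rotated]) (simp add: pd_shrink_int[OF Suc.prems])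
    then show ?case
      using shrink_int_has_derivative[OF Suc.prems, of _ S m] unfolding Ck_on_Suc differentiable_def
        by blast
  qed
  then show ?thesis by (simp add: smooth_on_def)
qed

lemma shrink_path_derivative:
  fixes h :: "real^'n \<Rightarrow> real"
  assumes h: "smooth_on (cube r) h" and x: "x \<in> cube r" and t: "0 \<le> t" "t \<le> 1"
  shows "((\<lambda>t. h (shrink S t x)) has_real_derivative (\<Sum>j\<in>S. x $ j * pd j h (shrink S t x))) (at t within A)"
proof -
  have "((\<lambda>t. shrink S t x) has_derivative (\<lambda>s. \<chi> i. if i \<in> S then s * x $ i else 0)) (at t)"
  proof -
    define w where "w = (\<chi> i. if i \<in> S then x $ i else (0::real))"
    have e: "(\<lambda>t. shrink S t x) = (\<lambda>t. shrink S 0 x + t *\<^sub>R w)"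
      by (simp add: shrink_def vec_eq_iff w_def fun_eq_iff)
    have "((\<lambda>t. shrink S 0 x + t *\<^sub>R w) has_derivative (\<lambda>s. 0 + s *\<^sub>R w)) (at t)"
      by (intro has_derivative_add has_derivative_const has_derivative_scaleR_left has_derivative_ident)
    moreover have "(\<lambda>s. 0 + s *\<^sub>R w) = (\<lambda>s. \<chi> i. if i \<in> S then s * x $ i else (0::real))"
      by (auto simp: vec_eq_iff w_def fun_eq_iff)
    ultimately show ?thesis unfolding e by simp
  qed
  then have "((\<lambda>t. h (shrink S t x)) has_derivative
      (\<lambda>s. fd h (shrink S t x) (\<chi> i. if i \<in> S then s * x $ i else 0))) (at t)"
    using has_derivative_fd[OF smooth_onD(1)[OF h shrink_cube[OF x t]]] by (rule has_derivative_compose)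
  also have "(\<lambda>s. fd h (shrink S t x) (\<chi> i. if i \<in> S then s * x $ i else 0))
      = (\<lambda>s. (\<Sum>j\<in>S. x $ j * pd j h (shrink S t x)) * s)"
  proof
    fix s
    have "fd h (shrink S t x) (\<chi> i. if i \<in> S then s * x $ i else 0)
        = (\<Sum>j\<in>UNIV. if j \<in> S then s * x $ j * pd j h (shrink S t x) else 0)"
      by (subst fd_expand[OF smooth_onD(1)[OF h shrink_cube[OF x t]]]) (auto intro!: sum.cong)
    also have "\<dots> = (\<Sum>j\<in>S. s * x $ j * pd j h (shrink S t x))" by (simp add: sum.If_cases)
    finally show "fd h (shrink S t x) (\<chi> i. if i \<in> S then s * x $ i else 0)
        = (\<Sum>j\<in>S. x $ j * pd j h (shrink S t x)) * s"
      by (simp add: sum_distrib_left sum_distrib_right mult_ac)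
  qed
  finally show ?thesis
    by (simp add: has_field_derivative_def has_derivative_at_withinI)
qed

lemma const_along_shrink:
  fixes h :: "real^'n \<Rightarrow> real"
  assumes h: "smooth_on (cube r) h" and x: "x \<in> cube r"
    and z: "\<And>j y. j \<in> S \<Longrightarrow> y \<in> cube r \<Longrightarrow> pd j h y = 0" and t: "0 \<le> t" "t \<le> 1"
  shows "h (shrink S t x) = h x"
proof -
  have "((\<lambda>t. h (shrink S t x)) has_real_derivative 0) (at s within {0..1})" if "s \<in> {0..1}" for s
    using shrink_path_derivative[OF h x, of s S "{0..1}"] that by (simp add: z shrink_cube x)
  then have "\<exists>c. \<forall>s\<in>{0..1}. h (shrink S s x) = c"
    by (intro has_field_derivative_zero_constant) auto
  then have "h (shrink S t x) = h (shrink S 1 x)" using t by auto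
  then show ?thesis by (simp add: shrink_1)
qed

text \<open>The primitive of the closed form \<open>\<Sum>j\<in>S. \<theta> j dx\<^sub>j\<close> given by the
  Poincare lemma in the variables \<open>S\<close>, the remaining variables being parameters.\<close>

definition primitive :: "'n set \<Rightarrow> ('n \<Rightarrow> real^'n \<Rightarrow> real) \<Rightarrow> real^'n \<Rightarrow> real" where
  "primitive S \<theta> x = (\<Sum>j\<in>S. x $ j * shrink_int S 0 (\<theta> j) x)"

lemma smooth_on_primitive:
  assumes "\<And>j. j \<in> S \<Longrightarrow> smooth_on (cube r) (\<theta> j)" shows "smooth_on (cube r) (primitive S \<theta>)"
  unfolding primitive_def
  by (intro smooth_on_sum smooth_on_mult smooth_on_coord smooth_on_shrink_int open_cube assms)

lemma pd_primitive_aux: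
  fixes \<theta> :: "'n::finite \<Rightarrow> real^'n \<Rightarrow> real"
  assumes \<theta>: "\<And>j. j \<in> S \<Longrightarrow> smooth_on (cube r) (\<theta> j)" and x: "x \<in> cube r"
  shows "pd l (primitive S \<theta>) x = (if l \<in> S then shrink_int S 0 (\<theta> l) x else 0)
    + (\<Sum>j\<in>S. x $ j * shrink_int S (of_bool (l \<in> S)) (pd l (\<theta> j)) x)"
proof -
  have d: "shrink_int S 0 (\<theta> j) differentiable (at x)" if "j \<in> S" for j
    using smooth_onD(1)[OF smooth_on_shrink_int[OF \<theta>[OF that]] x] .
  have dx: "(\<lambda>x::real^'n. x $ j) differentiable (at x)" for j
      using smooth_onD(1)[OF smooth_on_coord[of UNIV]] by simp
  have "pd l (primitive S \<theta>) x = (\<Sum>j\<in>S. pd l (\<lambda>x. x $ j * shrink_int S 0 (\<theta> j) x) x)"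
    unfolding primitive_def pd_def
    by (rule fd_sum) (rule smooth_onD(1)[OF smooth_on_mult[OF open_cube smooth_on_coord
        smooth_on_shrink_int[OF \<theta>]] x])
  also have "\<dots> = (\<Sum>j\<in>S. (if j = l then shrink_int S 0 (\<theta> j) x else 0) + x $ j * shrink_int S
      (of_bool (l \<in> S)) (pd l (\<theta> j)) x)"
    by (intro sum.cong refl) (simp add: pd_mult[OF dx d] pd_coord pd_shrink_int[OF \<theta> x])
  also have "\<dots> = (if l \<in> S then shrink_int S 0 (\<theta> l) x else 0)
      + (\<Sum>j\<in>S. x $ j * shrink_int S (of_bool (l \<in> S)) (pd l (\<theta> j)) x)"
    by (simp add: sum.distrib)
  finally show ?thesis .
qed

text \<open>Closedness turns the integrand of the derivative into
  \<open>d/dt (t * \<theta> l (shrink S t x))\<close>, whose integral from \<open>0\<close> to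
  \<open>1\<close> is \<open>\<theta> l x\<close>.\<close>

lemma pd_primitive:
  fixes \<theta> :: "'n::finite \<Rightarrow> real^'n \<Rightarrow> real"
  assumes \<theta>: "\<And>j. j \<in> S \<Longrightarrow> smooth_on (cube r) (\<theta> j)" and x: "x \<in> cube r" and l: "l \<in> S"
    and closed: "\<And>i j y. i \<in> S \<Longrightarrow> j \<in> S \<Longrightarrow> y \<in> cube r \<Longrightarrow> pd i (\<theta> j) y = pd j (\<theta> i) y"
  shows "pd l (primitive S \<theta>) x = \<theta> l x"
proof -
  have i: "(\<lambda>t. t ^ m * pd l (\<theta> j) (shrink S t x)) integrable_on {0..1}" if "j \<in> S" for m j
    using integrable_shrink_integrand[OF smooth_onD(3)[OF smooth_onD(2)[OF \<theta>[OF that]]] x] .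
  have i0: "(\<lambda>t. t ^ 0 * \<theta> l (shrink S t x)) integrable_on {0..1}"
    by (rule integrable_shrink_integrand[OF smooth_onD(3)[OF \<theta>[OF l]] x])
  have "((\<lambda>t. \<theta> l (shrink S t x) + (\<Sum>j\<in>S. x $ j * (t ^ 1 * pd l (\<theta> j) (shrink S t x)))) has_integral
      (shrink_int S 0 (\<theta> l) x + (\<Sum>j\<in>S. x $ j * shrink_int S 1 (pd l (\<theta> j)) x))) {0..1}"
    unfolding shrink_int_def
    using integrable_integral[OF i0] integrable_integral[OF i, of _ 1] finite[of S]
    by (intro has_integral_add has_integral_sum has_integral_mult_right) simp_all
  then have 1: "((\<lambda>t. \<theta> l (shrink S t x) + (\<Sum>j\<in>S. x $ j * (t ^ 1 * pd l (\<theta> j) (shrink S t x)))) has_integral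
      pd l (primitive S \<theta>) x) {0..1}"
    using l by (simp add: pd_primitive_aux[OF \<theta> x])
  have "((\<lambda>t. \<theta> l (shrink S t x) + (\<Sum>j\<in>S. x $ j * (t ^ 1 * pd l (\<theta> j) (shrink S t x)))) has_integral
      (1 * \<theta> l (shrink S 1 x) - 0 * \<theta> l (shrink S 0 x))) {0..1}"
  proof (rule fundamental_theorem_of_calculus)
    fix t :: real assume t: "t \<in> {0..1}"
    have "((\<lambda>t. t * \<theta> l (shrink S t x)) has_real_derivative
        (t * (\<Sum>j\<in>S. x $ j * pd j (\<theta> l) (shrink S t x)) + 1 * \<theta> l (shrink S t x))) (at t within {0..1})"
      using t by (intro DERIV_mult' shrink_path_derivative[OF \<theta>[OF l] x] DERIV_ident) auto
    moreover have "(\<Sum>j\<in>S. x $ j * pd j (\<theta> l) (shrink S t x)) = (\<Sum>j\<in>S. x $ j * pd l (\<theta> j) (shrink S t x))"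
      using t l by (intro sum.cong refl) (simp add: closed shrink_cube x)
    ultimately show "((\<lambda>t. t * \<theta> l (shrink S t x)) has_vector_derivative
        (\<theta> l (shrink S t x) + (\<Sum>j\<in>S. x $ j * (t ^ 1 * pd l (\<theta> j) (shrink S t x))))) (at t within {0..1})"
      by (simp add: has_real_derivative_iff_has_vector_derivative sum_distrib_left mult_ac add.commute)
  qed simp
  with 1 show ?thesis by (simp add: shrink_1 has_integral_unique)
qed

section \<open>Vector fields and local coordinates\<close>

text \<open>The second derivative as a bilinear form. Its symmetry is the second-order fact behind
  the bracket identities below.\<close>

definition hess :: "(real^'n \<Rightarrow> 'b::real_normed_vector) \<Rightarrow> real^'n \<Rightarrow> real^'n \<Rightarrow> real^'n \<Rightarrow> 'b" where
  "hess f x v w = (\<Sum>j\<in>UNIV. \<Sum>i\<in>UNIV. (v $ i * w $ j) *\<^sub>R pd i (pd j f) x)"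

lemma hess_commute:
  fixes f :: "real^'n \<Rightarrow> 'b::real_normed_vector"
  assumes "\<And>i j. pd i (pd j f) x = pd j (pd i f) x" shows "hess f x v w = hess f x w v"
proof -
  have "hess f x v w = (\<Sum>i\<in>UNIV. \<Sum>j\<in>UNIV. (v $ i * w $ j) *\<^sub>R pd i (pd j f) x)"
    unfolding hess_def by (rule sum.swap)
  also have "\<dots> = hess f x w v"
    unfolding hess_def by (intro sum.cong refl) (metis assms mult.commute)
  finally show ?thesis .
qed

lemma fd_fd:
  fixes f :: "real^'n \<Rightarrow> 'b::real_normed_vector"
  assumes U: "open U" and f: "smooth_on U f" and Y: "smooth_on U Y" and x: "x \<in> U"
  shows "fd (\<lambda>x. fd f x (Y x)) x v = hess f x v (Y x) + fd f x (fd Y x v)"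
proof -
  have df: "pd j f differentiable (at x)" for j by (rule smooth_onD(1)[OF smooth_onD(2)[OF f] x])
  have dY: "Y differentiable (at x)" by (rule smooth_onD(1)[OF Y x])
  have dYj: "(\<lambda>x. Y x $ j) differentiable (at x)" for j
    by (rule smooth_onD(1)[OF smooth_on_component[OF U Y] x])
  have "fd (\<lambda>x. fd f x (Y x)) x v = fd (\<lambda>x. \<Sum>j\<in>UNIV. Y x $ j *\<^sub>R pd j f x) x v"
    by (subst fd_cong[OF U x]) (auto simp: fd_expand smooth_onD(1)[OF f])
  also have "\<dots> = (\<Sum>j\<in>UNIV. fd (\<lambda>x. Y x $ j *\<^sub>R pd j f x) x v)"
    by (rule fd_sum) (rule smooth_onD(1)[OF smooth_on_scaleR[OF U smooth_on_component[OF U Y]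
        smooth_onD(2)[OF f]] x])
  also have "\<dots> = (\<Sum>j\<in>UNIV. Y x $ j *\<^sub>R fd (pd j f) x v + fd Y x v $ j *\<^sub>R pd j f x)"
    by (simp add: fd_scaleR[OF dYj df] fd_component[OF dY])
  also have "\<dots> = hess f x v (Y x) + fd f x (fd Y x v)"
    unfolding sum.distrib hess_def fd_expand[OF smooth_onD(1)[OF f x], of "fd Y x v"]
    by (simp add: fd_expand[OF df] scaleR_sum_right mult.commute)
  finally show ?thesis .
qed

section \<open>The Lie bracket of vector fields\<close>

lemma vector_fieldsD: "X \<in> vector_fields U \<Longrightarrow> smooth_on U X" "X \<in> vector_fields U \<Longrightarrow> x \<notin> U \<Longrightarrow> X x = 0"
  by (auto simp: vector_fields_def)

lemma vector_fieldsI: "smooth_on U X \<Longrightarrow> (\<And>x. x \<notin> U \<Longrightarrow> X x = 0) \<Longrightarrow> X \<in> vector_fields U"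
  by (auto simp: vector_fields_def)

lemma subspace_vector_fields: "open U \<Longrightarrow> subspace (vector_fields U)"
  by (auto simp: subspace_def vector_fields_def plus_fun_def scaleR_fun_def zero_fun_def
      intro: smooth_on_const smooth_on_add smooth_on_scaleR)

lemma vf_bracket_in: "x \<in> U \<Longrightarrow> vf_bracket U X Y x = fd Y x (X x) - fd X x (Y x)"
  by (simp add: vf_bracket_def)

lemma vf_bracket_vector_fields:
  assumes "open U" "X \<in> vector_fields U" "Y \<in> vector_fields U" shows "vf_bracket U X Y \<in> vector_fields U"
proof (rule vector_fieldsI)
  have "smooth_on U (\<lambda>x. fd Y x (X x) - fd X x (Y x))"
    by (intro smooth_on_diff smooth_on_fd assms vector_fieldsD)
  then show "smooth_on U (vf_bracket U X Y)"
    by (rule smooth_on_cong[OF assms(1), THEN iffD1, rotated]) (simp add: vf_bracket_in)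
qed (simp add: vf_bracket_def)

text \<open>The second-order terms of the two iterated derivatives are the Hessian at the same pair
  of vectors in either order, and they cancel. Symmetry is a hypothesis so that one argument serves
  scalar and vector-valued functions.\<close>

lemma bracket_derivation_aux:
  fixes f :: "real^'n \<Rightarrow> 'b::real_normed_vector"
  assumes U: "open U" and f: "smooth_on U f" and X: "X \<in> vector_fields U" and Y: "Y \<in> vector_fields U"
      and x: "x \<in> U"
    and comm: "\<And>i j. pd i (pd j f) x = pd j (pd i f) x"
  shows "fd f x (vf_bracket U X Y x) = fd (\<lambda>x. fd f x (Y x)) x (X x) - fd (\<lambda>x. fd f x (X x)) x (Y x)"
  using hess_commute[OF comm, of "X x" "Y x"]
  by (simp add: fd_fd[OF U f vector_fieldsD(1)[OF Y] x] fd_fd[OF U f vector_fieldsD(1)[OF X] x]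
      vf_bracket_in[OF x]
      linear_diff[OF linear_frechet_derivative[OF smooth_onD(1)[OF f x]]])

lemma bracket_derivation:
  fixes f :: "real^'n \<Rightarrow> real"
  assumes U: "open U" and f: "smooth_on U f" and X: "X \<in> vector_fields U" and Y: "Y \<in> vector_fields U"
      and x: "x \<in> U"
  shows "fd f x (vf_bracket U X Y x) = fd (\<lambda>x. fd f x (Y x)) x (X x) - fd (\<lambda>x. fd f x (X x)) x (Y x)"
  by (rule bracket_derivation_aux[OF U f X Y x]) (rule pd_commute_real[OF U f x])

lemma bracket_derivation_vec:
  fixes f :: "real^'n \<Rightarrow> real^'m"
  assumes U: "open U" and f: "smooth_on U f" and X: "X \<in> vector_fields U" and Y: "Y \<in> vector_fields U"
      and x: "x \<in> U"
  shows "fd f x (vf_bracket U X Y x) = fd (\<lambda>x. fd f x (Y x)) x (X x) - fd (\<lambda>x. fd f x (X x)) x (Y x)"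
  by (rule bracket_derivation_aux[OF U f X Y x]) (rule pd_commute[OF U f x])

lemma vf_bracket_add_left:
  assumes "X \<in> vector_fields U" "Y \<in> vector_fields U" "Z \<in> vector_fields U"
  shows "vf_bracket U (X + Y) Z = vf_bracket U X Z + vf_bracket U Y Z"
proof
  fix x show "vf_bracket U (X + Y) Z x = (vf_bracket U X Z + vf_bracket U Y Z) x"
  proof (cases "x \<in> U")
    case True
    note d = smooth_onD(1)[OF vector_fieldsD(1) True]
    have "fd (X + Y) x v = fd X x v + fd Y x v" for v
      using fd_add[OF d[OF assms(1)] d[OF assms(2)]] by (simp add: plus_fun_def)
    then show ?thesis
      using linear_add[OF linear_frechet_derivative[OF d[OF assms(3)]]]
      by (simp add: vf_bracket_in[OF True])
  qed (simp add: vf_bracket_def)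
qed

lemma vf_bracket_anti: "vf_bracket U Y X = - vf_bracket U X Y"
  by (auto simp: vf_bracket_def fun_eq_iff)

lemma vf_bracket_scale_left:
  assumes "X \<in> vector_fields U" "Y \<in> vector_fields U"
  shows "vf_bracket U (c *\<^sub>R X) Y = c *\<^sub>R vf_bracket U X Y"
proof
  fix x show "vf_bracket U (c *\<^sub>R X) Y x = (c *\<^sub>R vf_bracket U X Y) x"
  proof (cases "x \<in> U")
    case True
    note d = smooth_onD(1)[OF vector_fieldsD(1) True]
    have "fd (c *\<^sub>R X) x v = c *\<^sub>R fd X x v" for v
      using fd_scaleR[OF differentiable_const[of c] d[OF assms(1)]] by (simp add: scaleR_fun_def)
    then show ?thesis
      using linear_scale[OF linear_frechet_derivative[OF d[OF assms(2)]]]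
      by (simp add: vf_bracket_in[OF True] scaleR_fun_def scaleR_diff_right)
  qed (simp add: vf_bracket_def scaleR_fun_def)
qed

lemma vf_bracket_add_right:
  assumes "X \<in> vector_fields U" "Y \<in> vector_fields U" "Z \<in> vector_fields U"
  shows "vf_bracket U X (Y + Z) = vf_bracket U X Y + vf_bracket U X Z"
proof -
  have "vf_bracket U X (Y + Z) = - vf_bracket U (Y + Z) X" by (rule vf_bracket_anti)
  also have "\<dots> = - vf_bracket U Y X + - vf_bracket U Z X"
      by (simp add: vf_bracket_add_left[OF assms(2,3,1)])
  finally show ?thesis by (simp only: vf_bracket_anti[symmetric])
qed

lemma vf_bracket_scale_right:
  assumes "X \<in> vector_fields U" "Y \<in> vector_fields U"
  shows "vf_bracket U X (c *\<^sub>R Y) = c *\<^sub>R vf_bracket U X Y"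
proof -
  have "vf_bracket U X (c *\<^sub>R Y) = - vf_bracket U (c *\<^sub>R Y) X" by (rule vf_bracket_anti)
  also have "\<dots> = c *\<^sub>R (- vf_bracket U Y X)" by (simp add: vf_bracket_scale_left[OF assms(2,1)])
  finally show ?thesis by (simp only: vf_bracket_anti[symmetric])
qed

text \<open>After each derivative of a bracket is expanded by \<open>fd_fd\<close>, the first-order
  terms cancel by linearity and the Hessian terms by symmetry.\<close>

lemma vf_jacobi:
  assumes U: "open U" and X: "X \<in> vector_fields U" and Y: "Y \<in> vector_fields U" and Z: "Z \<in> vector_fields U"
  shows "vf_bracket U X (vf_bracket U Y Z) = vf_bracket U (vf_bracket U X Y) Z + vf_bracket U Y
      (vf_bracket U X Z)"
proof
  fix x show "vf_bracket U X (vf_bracket U Y Z) x = (vf_bracket U (vf_bracket U X Y) Z + vf_bracket U Y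
      (vf_bracket U X Z)) x"
  proof (cases "x \<in> U")
    case True
    have b: "fd (vf_bracket U A B) x v = hess B x v (A x) + fd B x (fd A x v) - hess A x v (B x) - fd A
        x (fd B x v)"
      if A: "A \<in> vector_fields U" and B: "B \<in> vector_fields U" for A B v
    proof -
      note sA = vector_fieldsD(1)[OF A] and sB = vector_fieldsD(1)[OF B]
      have "fd (vf_bracket U A B) x v = fd (\<lambda>x. fd B x (A x) - fd A x (B x)) x v"
        by (subst fd_cong[OF U True]) (auto simp: vf_bracket_in)
      also have "\<dots> = fd (\<lambda>x. fd B x (A x)) x v - fd (\<lambda>x. fd A x (B x)) x v"
        by (rule fd_diff) (rule smooth_onD(1)[OF smooth_on_fd[OF U] True], rule sA sB, rule sA sB)+
      finally show ?thesis by (simp add: fd_fd[OF U sB sA True] fd_fd[OF U sA sB True])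
    qed
    have l: "linear (fd A x)" if "A \<in> vector_fields U" for A
      by (rule linear_frechet_derivative[OF smooth_onD(1)[OF vector_fieldsD(1)[OF that] True]])
    have h: "hess A x v w = hess A x w v" if "A \<in> vector_fields U" for A v w
      by (rule hess_commute) (rule pd_commute[OF U vector_fieldsD(1)[OF that] True])
    show ?thesis
      using h[OF X, of "Y x" "Z x"] h[OF Y, of "X x" "Z x"] h[OF Z, of "X x" "Y x"]
      by (simp add: vf_bracket_in[OF True] b X Y Z linear_diff[OF l] algebra_simps)
  qed (simp add: vf_bracket_def)
qed

lemma fd_lie_algebra_vf:
  assumes "open U" "L \<subseteq> vector_fields U" "lie_closed (vf_bracket U) L" "\<exists>B. finite B \<and> L \<subseteq> span B"
  shows "fd_lie_algebra (vf_bracket U) L"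
proof -
  have s: "X \<in> vector_fields U" if "X \<in> L" for X using assms(2) that by blast
  show ?thesis
  proof
    show "subspace L" "\<And>x y. x \<in> L \<Longrightarrow> y \<in> L \<Longrightarrow> vf_bracket U x y \<in> L" "\<exists>B. finite B \<and> L \<subseteq> span B"
      using assms(3,4) by (auto simp: lie_closed_def)
  qed (rule vf_bracket_add_left vf_bracket_add_right vf_bracket_scale_left vf_bracket_scale_right
      vf_bracket_anti
      vf_jacobi[OF assms(1)]; rule s; assumption)+
qed

section \<open>Local coordinates and pushforward of vector fields\<close>

lemma local_coordinatesD:
  assumes "local_coordinates V \<psi>"
  shows "open V" "connected V" "0 \<in> V" "\<psi> 0 = 0" "inj_on \<psi> V" "open (\<psi> ` V)" "smooth_on V \<psi>"
    "smooth_on (\<psi> ` V) (inv_into V \<psi>)" "0 \<in> \<psi> ` V" "connected (\<psi> ` V)"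
    "\<And>x. x \<in> V \<Longrightarrow> inv_into V \<psi> (\<psi> x) = x" "\<And>y. y \<in> \<psi> ` V \<Longrightarrow> inv_into V \<psi> y \<in> V"
    "\<And>y. y \<in> \<psi> ` V \<Longrightarrow> \<psi> (inv_into V \<psi> y) = y"
proof -
  show *: "open V" "connected V" "0 \<in> V" "\<psi> 0 = 0" "inj_on \<psi> V" "open (\<psi> ` V)" "smooth_on V \<psi>"
    "smooth_on (\<psi> ` V) (inv_into V \<psi>)"
    using assms by (auto simp: local_coordinates_def connected_nbhd_def)
  show "0 \<in> \<psi> ` V" using *(3,4) by force
  show "connected (\<psi> ` V)" by (rule connected_continuous_image[OF smooth_onD(3)[OF *(7)] *(2)])
  show "\<And>x. x \<in> V \<Longrightarrow> inv_into V \<psi> (\<psi> x) = x" using *(5) by simp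
  show "\<And>y. y \<in> \<psi> ` V \<Longrightarrow> inv_into V \<psi> y \<in> V" by (rule inv_into_into)
  show "\<And>y. y \<in> \<psi> ` V \<Longrightarrow> \<psi> (inv_into V \<psi> y) = y" by (rule f_inv_into_f)
qed

lemma local_coordinates_inverse:
  assumes "local_coordinates V \<psi>" shows "local_coordinates (\<psi> ` V) (inv_into V \<psi>)"
proof -
  note D = local_coordinatesD[OF assms]
  have im: "inv_into V \<psi> ` \<psi> ` V = V" using D(11) by force
  have inj: "inj_on (inv_into V \<psi>) (\<psi> ` V)" by (rule inj_on_inv_into) simp
  have "smooth_on V (inv_into (\<psi> ` V) (inv_into V \<psi>))"
    by (rule smooth_on_cong[OF D(1), THEN iffD2, OF _ D(7)])
      (metis D(11) im imageI inj inv_into_f_f)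
  then show ?thesis
    using D inj by (auto simp: local_coordinates_def connected_nbhd_def im) (metis D(11))
qed

lemma fd_coordinates_inverse:
  assumes "local_coordinates V \<psi>" "x \<in> V"
  shows "fd (inv_into V \<psi>) (\<psi> x) (fd \<psi> x v) = v" "fd \<psi> x (fd (inv_into V \<psi>) (\<psi> x) v) = v"
proof -
  note D = local_coordinatesD[OF assms(1)]
  have d1: "\<psi> differentiable (at x)" by (rule smooth_onD(1)[OF D(7) assms(2)])
  have d2: "inv_into V \<psi> differentiable (at (\<psi> x))" by (rule smooth_onD(1)[OF D(8)]) (use assms(2) in blast)
  have "fd (\<lambda>x. inv_into V \<psi> (\<psi> x)) x = fd (\<lambda>x. x) x" by (rule fd_cong[OF D(1) assms(2)]) (rule D(11))
  then show "fd (inv_into V \<psi>) (\<psi> x) (fd \<psi> x v) = v" using chain_pd(3)[OF d1 d2, of v] by simp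
  have "fd (\<lambda>y. \<psi> (inv_into V \<psi> y)) (\<psi> x) = fd (\<lambda>x. x) (\<psi> x)"
    by (rule fd_cong[OF D(6)]) (use assms(2) D(13) in auto)
  moreover have "\<psi> differentiable (at (inv_into V \<psi> (\<psi> x)))" using d1 D(11)[OF assms(2)] by simp
  ultimately show "fd \<psi> x (fd (inv_into V \<psi>) (\<psi> x) v) = v"
    using chain_pd(3)[OF d2, of \<psi> v] D(11)[OF assms(2)] by simp
qed

lemma pushforward_at: "local_coordinates V \<psi> \<Longrightarrow> x \<in> V \<Longrightarrow> pushforward V \<psi> X (\<psi> x) = fd \<psi> x (X x)"
  by (simp add: pushforward_def local_coordinatesD(11))

lemma linear_pushforward:
  assumes "local_coordinates V \<psi>" shows "linear (pushforward V \<psi>)"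
proof -
  have l: "linear (fd \<psi> (inv_into V \<psi> y))" if "y \<in> \<psi> ` V" for y
    using linear_frechet_derivative[OF smooth_onD(1)[OF local_coordinatesD(7)[OF assms]]]
      local_coordinatesD(12)[OF assms that] by blast
  show ?thesis
    by (rule linearI) (auto simp: pushforward_def fun_eq_iff scaleR_fun_def linear_add[OF l]
        linear_scale[OF l])
qed

lemma pushforward_vector_fields:
  assumes "local_coordinates V \<psi>" "smooth_on V X" shows "pushforward V \<psi> X \<in> vector_fields (\<psi> ` V)"
proof (rule vector_fieldsI)
  note D = local_coordinatesD[OF assms(1)]
  have "smooth_on (\<psi> ` V) (\<lambda>y. (\<lambda>x. fd \<psi> x (X x)) (inv_into V \<psi> y))"
    by (rule smooth_on_compose[OF D(6,1) _ smooth_on_fd[OF D(1,7) assms(2)] D(8)]) (use D(12) in auto)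
  then show "smooth_on (\<psi> ` V) (pushforward V \<psi> X)"
    by (rule smooth_on_cong[OF D(6), THEN iffD1, rotated]) (simp add: pushforward_def)
qed (simp add: pushforward_def)

lemma pushforward_function:
  fixes f :: "real^'n \<Rightarrow> 'b::real_normed_vector"
  assumes "local_coordinates V \<psi>" "x \<in> V" "f differentiable (at (\<psi> x))"
  shows "fd f (\<psi> x) (pushforward V \<psi> X (\<psi> x)) = fd (\<lambda>x. f (\<psi> x)) x (X x)"
  using chain_pd(3)[OF smooth_onD(1)[OF local_coordinatesD(7)[OF assms(1)] assms(2)] assms(3)]
  by (simp add: pushforward_at[OF assms(1,2)])

text \<open>The derivation property of the bracket is applied to the chart \<open>\<psi>\<close>
  itself: \<open>fd \<psi> x (Y x)\<close> is the pushed-forward field at \<open>\<psi> x\<close>,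
  so iterated derivatives of \<open>\<psi>\<close> along the two fields are derivatives of their
  pushforwards.\<close>

lemma pushforward_bracket:
  assumes lc: "local_coordinates V \<psi>" and VU: "V \<subseteq> U" and U: "open U" and X: "X \<in> vector_fields U" and
      Y: "Y \<in> vector_fields U"
  shows "pushforward V \<psi> (vf_bracket U X Y) = vf_bracket (\<psi> ` V) (pushforward V \<psi> X) (pushforward V \<psi> Y)"
proof
  fix y
  note D = local_coordinatesD[OF lc]
  show "pushforward V \<psi> (vf_bracket U X Y) y = vf_bracket (\<psi> ` V) (pushforward V \<psi> X) (pushforward V \<psi> Y) y"
  proof (cases "y \<in> \<psi> ` V")
    case True
    then obtain x where x: "x \<in> V" "y = \<psi> x" by blast
    have s: "smooth_on V A" if "A \<in> vector_fields U" for A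
        using vector_fieldsD(1)[OF that] VU smooth_on_subset by blast
    let ?r = "restrict_vf V"
    have rs: "?r A \<in> vector_fields V" if "A \<in> vector_fields U" for A
      by (rule vector_fieldsI) (use smooth_on_cong[OF D(1), of A "?r A"] s[OF that] in \<open>auto simp:
          restrict_vf_def\<close>)
    have p: "fd (pushforward V \<psi> B) y (pushforward V \<psi> A y) = fd (\<lambda>x. fd \<psi> x (?r B x)) x (?r A x)"
      if "A \<in> vector_fields U" "B \<in> vector_fields U" for A B
    proof -
      have "fd (pushforward V \<psi> B) y (pushforward V \<psi> A y) = fd (\<lambda>x. pushforward V \<psi> B (\<psi> x)) x (A x)"
        unfolding x(2) using smooth_onD(1)[OF vector_fieldsD(1)[OF pushforward_vector_fields[OF lc
            s[OF that(2)]]]] True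
        by (intro pushforward_function lc x) (simp add: x)
      also have "fd (\<lambda>x. pushforward V \<psi> B (\<psi> x)) x = fd (\<lambda>x. fd \<psi> x (?r B x)) x"
        by (rule fd_cong[OF D(1) x(1)]) (simp add: pushforward_at[OF lc] restrict_vf_def)
      finally show ?thesis using x(1) by (simp add: restrict_vf_def)
    qed
    have "vf_bracket (\<psi> ` V) (pushforward V \<psi> X) (pushforward V \<psi> Y) y
        = fd \<psi> x (vf_bracket V (?r X) (?r Y) x)"
      using bracket_derivation_vec[OF D(1,7) rs[OF X] rs[OF Y] x(1)] p[OF X Y] p[OF Y X] True
      by (simp add: vf_bracket_in)
    also have "vf_bracket V (?r X) (?r Y) x = vf_bracket U X Y x"
    proof -
      have "fd (?r A) x = fd A x" for A by (rule fd_cong[OF D(1) x(1)]) (simp add: restrict_vf_def)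
      then show ?thesis using x(1) VU by (auto simp: vf_bracket_def restrict_vf_def)
    qed
    finally show ?thesis using x pushforward_at[OF lc x(1)] by simp
  qed (simp add: pushforward_def vf_bracket_def)
qed

lemma linear_restrict_vf: "linear (restrict_vf U)"
  by (rule linearI) (auto simp: restrict_vf_def fun_eq_iff scaleR_fun_def)

lemma restrict_vf_vector_fields:
  assumes "open U" "U \<subseteq> W" "X \<in> vector_fields W" shows "restrict_vf U X \<in> vector_fields U"
  by (rule vector_fieldsI)
    (use smooth_on_cong[OF assms(1), of X "restrict_vf U X"]
        smooth_on_subset[OF vector_fieldsD(1)[OF assms(3)] assms(2)]
      in \<open>auto simp: restrict_vf_def\<close>)

lemma restrict_vf_bracket:
  assumes "open U" "U \<subseteq> W"
  shows "restrict_vf U (vf_bracket W X Y) = vf_bracket U (restrict_vf U X) (restrict_vf U Y)"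
proof
  fix x
  have "fd (restrict_vf U A) x = fd A x" if "x \<in> U" for A
    by (rule fd_cong[OF assms(1) that]) (simp add: restrict_vf_def)
  then show "restrict_vf U (vf_bracket W X Y) x = vf_bracket U (restrict_vf U X) (restrict_vf U Y) x"
    using assms(2) by (auto simp: restrict_vf_def vf_bracket_def)
qed

lemma local_coordinates_compose:
  fixes V W :: "(real^'n) set"
  assumes V: "local_coordinates V \<psi>" and W: "local_coordinates W \<phi>" and WV: "W \<subseteq> \<psi> ` V"
    and V': "V' = inv_into V \<psi> ` W"
  shows "local_coordinates V' (\<lambda>x. \<phi> (\<psi> x))" "V' \<subseteq> V" "\<psi> ` V' = W" "(\<lambda>x. \<phi> (\<psi> x)) ` V' = \<phi> ` W"
    "pushforward V' (\<lambda>x. \<phi> (\<psi> x)) X = pushforward W \<phi> (pushforward V \<psi> X)"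
proof -
  note D = local_coordinatesD[OF V] and E = local_coordinatesD[OF W]
  show V'V: "V' \<subseteq> V" using V' WV D(12) by auto
  have "(\<lambda>y. \<psi> (inv_into V \<psi> y)) ` W = (\<lambda>y. y) ` W"
    by (rule image_cong) (use D(13) WV in auto)
  then show im: "\<psi> ` V' = W" by (simp add: V' image_image)
  then show im2: "(\<lambda>x. \<phi> (\<psi> x)) ` V' = \<phi> ` W" by (metis image_image)
  have V'eq: "V' = V \<inter> \<psi> -` W" using V'V im D(5) by (auto simp: inj_on_def)
  have oV': "open V'" unfolding V'eq using continuous_open_preimage[OF smooth_onD(3)[OF D(7)] D(1) E(1)] .
  have cV': "connected V'"
    unfolding V' using connected_continuous_image[OF continuous_on_subset[OF smooth_onD(3)[OF D(8)] WV]
        E(2)] .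
  have inj: "inj_on (\<lambda>x. \<phi> (\<psi> x)) V'"
    using comp_inj_on[of \<psi> V' \<phi>] inj_on_subset[OF D(5) V'V] E(5) im by (simp add: o_def)
  have inv: "inv_into V' (\<lambda>x. \<phi> (\<psi> x)) y = inv_into V \<psi> (inv_into W \<phi> y)" if "y \<in> \<phi> ` W" for y
  proof (rule inv_into_f_eq[OF inj])
    have w: "inv_into W \<phi> y \<in> W" using E(12)[OF that] .
    then show "inv_into V \<psi> (inv_into W \<phi> y) \<in> V'" unfolding V' by blast
    show "\<phi> (\<psi> (inv_into V \<psi> (inv_into W \<phi> y))) = y" using D(13) w WV E(13)[OF that] by auto
  qed
  have "smooth_on (\<phi> ` W) (\<lambda>y. inv_into V \<psi> (inv_into W \<phi> y))"
    by (rule smooth_on_compose[OF E(6) D(6) _ D(8) E(8)]) (use E(12) WV in auto)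
  then have "smooth_on (\<phi> ` W) (inv_into V' (\<lambda>x. \<phi> (\<psi> x)))"
    by (rule smooth_on_cong[OF E(6), THEN iffD1, rotated]) (simp add: inv)
  moreover have "smooth_on V' (\<lambda>x. \<phi> (\<psi> x))"
    by (rule smooth_on_compose[OF oV' E(1) _ E(7) smooth_on_subset[OF D(7) V'V]]) (simp add: im)
  moreover have "0 \<in> V'" using V'eq D(3,4) E(3) by auto
  ultimately show lc: "local_coordinates V' (\<lambda>x. \<phi> (\<psi> x))"
    unfolding local_coordinates_def connected_nbhd_def im2 using oV' cV' inj D(4) E(4,6) by simp
  show "pushforward V' (\<lambda>x. \<phi> (\<psi> x)) X = pushforward W \<phi> (pushforward V \<psi> X)"
  proof
    fix y show "pushforward V' (\<lambda>x. \<phi> (\<psi> x)) X y = pushforward W \<phi> (pushforward V \<psi> X) y"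
    proof (cases "y \<in> \<phi> ` W")
      case True
      then obtain x where x: "x \<in> V'" "y = \<phi> (\<psi> x)" using im2 by (metis imageE)
      have xV: "x \<in> V" "\<psi> x \<in> W" using x(1) V'V im by auto
      have "pushforward V' (\<lambda>x. \<phi> (\<psi> x)) X y = fd (\<lambda>x. \<phi> (\<psi> x)) x (X x)"
        unfolding x(2) by (rule pushforward_at[OF lc x(1)])
      also have "\<dots> = fd \<phi> (\<psi> x) (fd \<psi> x (X x))"
        by (rule chain_pd(3)) (rule smooth_onD(1)[OF D(7) xV(1)], rule smooth_onD(1)[OF E(7) xV(2)])
      also have "\<dots> = pushforward W \<phi> (pushforward V \<psi> X) y"
        unfolding x(2) pushforward_at[OF W xV(2)] pushforward_at[OF V xV(1)] ..
      finally show ?thesis .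
    next
      case False
      then have "y \<notin> (\<lambda>x. \<phi> (\<psi> x)) ` V'" unfolding im2 .
      with False show ?thesis unfolding pushforward_def by (simp only: if_False)
    qed
  qed
qed

lemma local_coordinates_restrict:
  assumes lc: "local_coordinates V \<psi>" and W: "connected_nbhd W" "W \<subseteq> \<psi> ` V"
    and V': "V' = inv_into V \<psi> ` W"
  shows "local_coordinates V' \<psi>" "V' \<subseteq> V" "\<psi> ` V' = W"
    "pushforward V' \<psi> X = restrict_vf W (pushforward V \<psi> X)"
proof -
  have *: "inv_into W (\<lambda>x. x) y = y" if "y \<in> W" for y
    using inv_into_f_eq[of "\<lambda>x. x" W y y] that by simp
  have id: "local_coordinates W (\<lambda>x. x)"
    using W(1) smooth_on_cong[of W "inv_into W (\<lambda>x. x)" "\<lambda>x. x"] *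
    by (auto simp: local_coordinates_def smooth_on_ident connected_nbhd_def)
  have "pushforward W (\<lambda>x. x) Y = restrict_vf W Y" for Y
    by (auto simp: pushforward_def restrict_vf_def * fun_eq_iff)
  then show "local_coordinates V' \<psi>" "V' \<subseteq> V" "\<psi> ` V' = W"
      "pushforward V' \<psi> X = restrict_vf W (pushforward V \<psi> X)"
    using local_coordinates_compose[OF lc id W(2) V'] by simp_all
qed

section \<open>Ranks of ideals of a transitive Lie algebra\<close>

definition frame_matrix :: "('n \<Rightarrow> real^'n \<Rightarrow> real^'n) \<Rightarrow> real^'n \<Rightarrow> real^'n^'n" where
  "frame_matrix E x = (\<chi> a b. E b x $ a)"

text \<open>Cramer's formula for the coefficient of \<open>v\<close> on \<open>E j x\<close> in the
  frame; being explicit, it depends smoothly on \<open>x\<close> wherever the frame determinant does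
  not vanish.\<close>

definition coef :: "('n::finite \<Rightarrow> real^'n \<Rightarrow> real^'n) \<Rightarrow> real^'n \<Rightarrow> 'n \<Rightarrow> real^'n \<Rightarrow> real" where
  "coef E x j v = det (\<chi> a b. if b = j then v $ a else frame_matrix E x $ a $ b) / det (frame_matrix E x)"

lemma frame_matrix_mult: "frame_matrix E x *v c = (\<Sum>j\<in>UNIV. c $ j *\<^sub>R E j x)"
  by (simp add: frame_matrix_def matrix_vector_mult_def vec_eq_iff mult.commute)

lemma coef_eq:
  assumes "det (frame_matrix E x) \<noteq> 0"
  shows "v = (\<Sum>j\<in>UNIV. c j *\<^sub>R E j x) \<longleftrightarrow> (\<forall>j. c j = coef E x j v)"
proof -
  have "v = (\<Sum>j\<in>UNIV. c j *\<^sub>R E j x) \<longleftrightarrow> frame_matrix E x *v (\<chi> j. c j) = v"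
    by (auto simp: frame_matrix_mult)
  also have "\<dots> \<longleftrightarrow> (\<forall>j. c j = coef E x j v)"
    unfolding cramer[OF assms] by (simp add: vec_eq_iff coef_def)
  finally show ?thesis .
qed

lemma coef_expand: "det (frame_matrix E x) \<noteq> 0 \<Longrightarrow> (\<Sum>j\<in>UNIV. coef E x j v *\<^sub>R E j x) = v"
  by (rule coef_eq[THEN iffD2, symmetric]) auto

lemma coef_unique: "det (frame_matrix E x) \<noteq> 0 \<Longrightarrow> coef E x j (\<Sum>j\<in>UNIV. c j *\<^sub>R E j x) = c j"
  by (rule coef_eq[THEN iffD1, OF _ refl, THEN spec, symmetric])

lemma linear_coef:
  assumes "det (frame_matrix E x) \<noteq> 0" shows "linear (coef E x j)"
proof (rule linearI)
  fix u v c
  have "u + v = (\<Sum>j\<in>UNIV. (coef E x j u + coef E x j v) *\<^sub>R E j x)"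
    by (simp add: scaleR_add_left sum.distrib coef_expand[OF assms])
  then show "coef E x j (u + v) = coef E x j u + coef E x j v"
    using coef_eq[OF assms, of "u + v" "\<lambda>j. coef E x j u + coef E x j v"] by simp
  have "c *\<^sub>R v = (\<Sum>j\<in>UNIV. (c * coef E x j v) *\<^sub>R E j x)"
    by (simp add: scaleR_scaleR[symmetric] scaleR_sum_right[symmetric] coef_expand[OF assms] del:
        scaleR_scaleR)
  then show "coef E x j (c *\<^sub>R v) = c *\<^sub>R coef E x j v"
    using coef_eq[OF assms, of "c *\<^sub>R v" "\<lambda>j. c * coef E x j v"] by simp
qed

lemma coef_frame: "det (frame_matrix E x) \<noteq> 0 \<Longrightarrow> coef E x j (E l x) = (if j = l then 1 else 0)"
  using coef_unique[of E x j "\<lambda>j. if j = l then 1 else 0"]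
    by (simp add: if_distrib[of "\<lambda>c. c *\<^sub>R _"] cong: if_cong)

lemma smooth_on_frame_det: "open U \<Longrightarrow> (\<And>j. smooth_on U (E j)) \<Longrightarrow> smooth_on U (\<lambda>x. det (frame_matrix E x))"
  unfolding frame_matrix_def by (rule smooth_on_det) (auto intro: smooth_on_component)

lemma smooth_on_coef:
  assumes "open U" "\<And>j. smooth_on U (E j)" "\<And>x. x \<in> U \<Longrightarrow> det (frame_matrix E x) \<noteq> 0" "smooth_on U Z"
  shows "smooth_on U (\<lambda>x. coef E x j (Z x))"
  unfolding coef_def
proof (intro smooth_on_divide smooth_on_frame_det smooth_on_det assms)
  fix a b
  show "smooth_on U (\<lambda>x. (\<chi> a b. if b = j then Z x $ a else frame_matrix E x $ a $ b) $ a $ b)"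
    using assms by (cases "b = j") (auto simp: frame_matrix_def intro: smooth_on_component)
qed

lemma frame_det_nonzero:
  assumes "inj_on (\<lambda>j. E j x) UNIV" "independent (range (\<lambda>j. E j x))"
  shows "det (frame_matrix E x) \<noteq> 0"
proof -
  have "c = 0" if c: "frame_matrix E x *v c = 0" for c
  proof -
    let ?u = "\<lambda>v. c $ inv (\<lambda>j. E j x) v"
    have "(\<Sum>v\<in>range (\<lambda>j. E j x). ?u v *\<^sub>R v) = (\<Sum>j\<in>UNIV. c $ j *\<^sub>R E j x)"
      using assms(1) by (subst sum.reindex) (auto simp: inv_f_f[OF assms(1)])
    also have "\<dots> = 0" using c by (simp add: frame_matrix_mult)
    finally have "\<forall>v\<in>range (\<lambda>j. E j x). ?u v = 0"
      using assms(2) independent_explicit[of "range (\<lambda>j. E j x)"] by auto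
    then show "c = 0" using inv_f_f[OF assms(1)] by (simp add: vec_eq_iff)
  qed
  then have "inj ((*v) (frame_matrix E x))"
    using linear_injective_0[OF matrix_vector_mul_linear] by blast
  then show ?thesis using det_nz_iff_inj_gen
      by (metis det_nz_iff_inj matrix_of_matrix_vector_mul matrix_vector_mul_linear)
qed

text \<open>The Leibniz rule for \<open>[X, Z]\<close> with \<open>Z\<close> expanded in the frame.
  It trades derivatives of coefficients for coefficients of brackets, the mechanism behind both the
  constancy of ranks and the filtration by degree.\<close>

lemma coef_bracket:
  assumes V: "open V" "x \<in> V" and VU: "V \<subseteq> U"
    and E: "\<And>j. E j \<in> vector_fields U" and d: "\<And>x. x \<in> V \<Longrightarrow> det (frame_matrix E x) \<noteq> 0"
    and X: "X \<in> vector_fields U" and Z: "Z \<in> vector_fields U"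
  shows "coef E x j (vf_bracket U X Z x) = fd (\<lambda>x. coef E x j (Z x)) x (X x)
    + (\<Sum>l\<in>UNIV. coef E x l (Z x) * coef E x j (vf_bracket U X (E l) x))"
proof -
  have xU: "x \<in> U" using V VU by blast
  have s: "smooth_on V A" if "A \<in> vector_fields U" for A
    using smooth_on_subset[OF vector_fieldsD(1)[OF that] VU] .
  have sz: "smooth_on V (\<lambda>x. coef E x l (Z x))" for l by (rule smooth_on_coef[OF V(1) s[OF E] d s[OF Z]])
  note dz = smooth_onD(1)[OF sz V(2)] and dE = smooth_onD(1)[OF s[OF E] V(2)]
  note dX = smooth_onD(1)[OF s[OF X] V(2)]
  have 1: "fd Z x v = (\<Sum>l\<in>UNIV. coef E x l (Z x) *\<^sub>R fd (E l) x v + fd (\<lambda>x. coef E x l (Z x)) x v *\<^sub>R E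
      l x)" for v
  proof -
    have "fd Z x v = fd (\<lambda>x. \<Sum>l\<in>UNIV. coef E x l (Z x) *\<^sub>R E l x) x v"
      by (subst fd_cong[OF V]) (auto simp: coef_expand d)
    also have "\<dots> = (\<Sum>l\<in>UNIV. fd (\<lambda>x. coef E x l (Z x) *\<^sub>R E l x) x v)"
      by (rule fd_sum) (rule smooth_onD(1)[OF smooth_on_scaleR[OF V(1) sz s[OF E]] V(2)])
    finally show ?thesis by (simp add: fd_scaleR[OF dz dE])
  qed
  have "fd X x (Z x) = fd X x (\<Sum>l\<in>UNIV. coef E x l (Z x) *\<^sub>R E l x)" by (simp add: coef_expand d V)
  also have "\<dots> = (\<Sum>l\<in>UNIV. coef E x l (Z x) *\<^sub>R fd X x (E l x))"
    using linear_frechet_derivative[OF dX] by (simp add: linear_sum linear_scale)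
  finally have "vf_bracket U X Z x = (\<Sum>l\<in>UNIV. fd (\<lambda>x. coef E x l (Z x)) x (X x) *\<^sub>R E l x)
      + (\<Sum>l\<in>UNIV. coef E x l (Z x) *\<^sub>R vf_bracket U X (E l) x)"
    by (simp add: vf_bracket_in[OF xU] 1 sum.distrib scaleR_diff_right sum_subtractf)
  then show ?thesis
    using linear_coef[OF d[OF V(2)], of j]
    by (simp add: linear_add linear_sum linear_scale coef_unique[OF d[OF V(2)]])
qed

text \<open>A Gronwall-type estimate: by the mean value inequality the maximum over a small ball of
  the sum of the \<open>\<bar>r k x\<bar>\<close> is at most half of itself.\<close>

lemma linear_system_zero:
  fixes r :: "'k \<Rightarrow> real^'n \<Rightarrow> real"
  assumes K: "finite K" and V: "open V" "x0 \<in> V" and r: "\<And>k. k \<in> K \<Longrightarrow> smooth_on V (r k)"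
    and r0: "\<And>k. k \<in> K \<Longrightarrow> r k x0 = 0"
    and A: "\<And>k i l. k \<in> K \<Longrightarrow> l \<in> K \<Longrightarrow> continuous_on V (A k i l)"
    and sys: "\<And>k i x. k \<in> K \<Longrightarrow> x \<in> V \<Longrightarrow> pd i (r k) x = (\<Sum>l\<in>K. A k i l x * r l x)"
  obtains \<delta> where "\<delta> > 0" "ball x0 \<delta> \<subseteq> V" "\<And>k x. k \<in> K \<Longrightarrow> x \<in> ball x0 \<delta> \<Longrightarrow> r k x = 0"
proof -
  obtain \<rho> where \<rho>: "\<rho> > 0" "cball x0 \<rho> \<subseteq> V" using V open_contains_cball by blast
  have "\<exists>C. \<forall>x\<in>cball x0 \<rho>. \<bar>A k i l x\<bar> \<le> C" if "k \<in> K" "l \<in> K" for k i l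
  proof -
    have "compact (A k i l ` cball x0 \<rho>)"
      by (rule compact_continuous_image[OF continuous_on_subset[OF A[OF that] \<rho>(2)] compact_cball])
    then show ?thesis using compact_imp_bounded bounded_iff by (metis imageI real_norm_def)
  qed
  then have "\<forall>k i l. \<exists>C. k \<in> K \<and> l \<in> K \<longrightarrow> (\<forall>x\<in>cball x0 \<rho>. \<bar>A k i l x\<bar> \<le> C)" by blast
  then obtain C0 where C0: "\<And>k i l x. k \<in> K \<Longrightarrow> l \<in> K \<Longrightarrow> x \<in> cball x0 \<rho> \<Longrightarrow> \<bar>A k i l x\<bar> \<le> C0 k i l" by metis
  define C where "C = (\<Sum>k\<in>K. \<Sum>i\<in>UNIV. \<Sum>l\<in>K. \<bar>C0 k i l\<bar>) + 1"
  have CK: "\<bar>A k i l x\<bar> \<le> C" if "k \<in> K" "l \<in> K" "x \<in> cball x0 \<rho>" for k i l x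
  proof -
    have "\<bar>C0 k i l\<bar> \<le> (\<Sum>l\<in>K. \<bar>C0 k i l\<bar>)" using that K by (intro member_le_sum) auto
    also have "\<dots> \<le> (\<Sum>i\<in>UNIV. \<Sum>l\<in>K. \<bar>C0 k i l\<bar>)"
        by (intro member_le_sum[of i UNIV "\<lambda>i. \<Sum>l\<in>K. \<bar>C0 k i l\<bar>"] sum_nonneg) auto
    also have "\<dots> \<le> (\<Sum>k\<in>K. \<Sum>i\<in>UNIV. \<Sum>l\<in>K. \<bar>C0 k i l\<bar>)" using that K
        by (intro member_le_sum[of k K "\<lambda>k. \<Sum>i\<in>UNIV. \<Sum>l\<in>K. \<bar>C0 k i l\<bar>"] sum_nonneg) auto
    finally have "\<bar>C0 k i l\<bar> \<le> C" by (simp add: C_def)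
    then show ?thesis using C0[OF that, of i] by linarith
  qed
  have C: "C > 0" unfolding C_def by (smt (verit) abs_ge_zero sum_nonneg)
  \<comment> \<open>\<open>N * \<delta>\<close> is the factor in the final estimate: one bound
    \<open>C\<close> for each unknown and each of the \<open>CARD('n)\<close> partial derivatives.
    The radius is chosen to make this factor at most \<open>1/2\<close>.\<close>
  define N where "N = real (card K) * real CARD('n) * C"
  have N: "N \<ge> 0" using C by (simp add: N_def)
  define \<delta> where "\<delta> = min \<rho> (1 / (2 * (N + 1)))"
  have \<delta>: "\<delta> > 0" "\<delta> \<le> \<rho>" "N * \<delta> \<le> 1/2"
  proof -
    show "\<delta> > 0" "\<delta> \<le> \<rho>" using \<rho> N by (auto simp: \<delta>_def)
    have "N * \<delta> \<le> N * (1 / (2 * (N + 1)))" using N by (intro mult_left_mono) (auto simp: \<delta>_def)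
    also have "\<dots> \<le> 1/2" using N by (simp add: field_simps)
    finally show "N * \<delta> \<le> 1/2" .
  qed
  have BV: "cball x0 \<delta> \<subseteq> V" "cball x0 \<delta> \<subseteq> cball x0 \<rho>" using \<delta>(2) \<rho>(2) by auto
  define \<psi> where "\<psi> x = (\<Sum>k\<in>K. \<bar>r k x\<bar>)" for x
  have "continuous_on (cball x0 \<delta>) \<psi>"
    unfolding \<psi>_def by (intro continuous_intros continuous_on_subset[OF smooth_onD(3)[OF r] BV(1)])
  then obtain z where z: "z \<in> cball x0 \<delta>" "\<And>x. x \<in> cball x0 \<delta> \<Longrightarrow> \<psi> x \<le> \<psi> z"
    using continuous_attains_sup[OF compact_cball, of x0 \<delta> \<psi>] \<delta>(1)
      by (metis cball_eq_empty less_le_not_le less_imp_le)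
  have \<psi>0: "\<psi> x \<ge> 0" for x by (simp add: \<psi>_def sum_nonneg)
  have rb: "\<bar>r k x\<bar> \<le> real CARD('n) * C * \<psi> z * \<delta>" if k: "k \<in> K" and x: "x \<in> cball x0 \<delta>" for k x
  proof -
    have "norm (r k x - r k x0) \<le> (real CARD('n) * C * \<psi> z) * norm (x - x0)"
    proof (rule differentiable_bound[OF convex_cball, of x0 \<delta> "r k" "fd (r k)"])
      fix y assume y: "y \<in> cball x0 \<delta>"
      then have yV: "y \<in> V" "y \<in> cball x0 \<rho>" using BV by auto
      have d: "r k differentiable (at y)" by (rule smooth_onD(1)[OF r[OF k] yV(1)])
      show "(r k has_derivative fd (r k) y) (at y within cball x0 \<delta>)"
        by (rule has_derivative_at_withinI[OF has_derivative_fd[OF d]])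
      have p: "\<bar>pd i (r k) y\<bar> \<le> C * \<psi> z" for i
      proof -
        have "\<bar>pd i (r k) y\<bar> \<le> (\<Sum>l\<in>K. \<bar>A k i l y * r l y\<bar>)" unfolding sys[OF k yV(1)] by (rule sum_abs)
        also have "\<dots> \<le> (\<Sum>l\<in>K. C * \<bar>r l y\<bar>)"
          using CK[OF k _ yV(2)] by (intro sum_mono) (simp add: abs_mult mult_right_mono)
        also have "\<dots> = C * \<psi> y" by (simp add: \<psi>_def sum_distrib_left)
        also have "\<dots> \<le> C * \<psi> z" using z(2)[OF y] C by simp
        finally show ?thesis .
      qed
      show "onorm (fd (r k) y) \<le> real CARD('n) * C * \<psi> z"
      proof (rule onorm_le)
        fix v :: "real^'n"
        have "norm (fd (r k) y v) \<le> (\<Sum>i\<in>UNIV. \<bar>v $ i * pd i (r k) y\<bar>)"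
          unfolding fd_expand[OF d] by (simp add: sum_abs)
        also have "\<dots> \<le> (\<Sum>i\<in>(UNIV::'n set). norm v * (C * \<psi> z))"
          unfolding abs_mult using p component_le_norm_cart[of v] by (intro sum_mono mult_mono) auto
        finally show "norm (fd (r k) y v) \<le> real CARD('n) * C * \<psi> z * norm v" by (simp add: mult_ac)
      qed
    qed (use x \<delta> in auto)
    also have "\<dots> \<le> (real CARD('n) * C * \<psi> z) * \<delta>"
      using x C \<psi>0 by (intro mult_left_mono) (auto simp: dist_norm norm_minus_commute)
    finally show ?thesis using r0[OF k] by simp
  qed
  have "\<psi> z \<le> (\<Sum>k\<in>K. real CARD('n) * C * \<psi> z * \<delta>)" unfolding \<psi>_def[of z] using rb[OF _ z(1)]
      by (intro sum_mono) (simp add: \<psi>_def)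
  also have "\<dots> = (N * \<delta>) * \<psi> z" by (simp add: N_def)
  also have "\<dots> \<le> 1/2 * \<psi> z" using \<delta>(3) \<psi>0 by (intro mult_right_mono) auto
  finally have "\<psi> z = 0" using \<psi>0[of z] by simp
  then have "r k x = 0" if "k \<in> K" "x \<in> ball x0 \<delta>" for k x
    using rb[OF that(1), of x] that(2) by simp
  then show ?thesis using that[OF \<delta>(1)] BV(1) by force
qed

lemma distribution_subspace:
  assumes "subspace I" shows "distribution I x = (\<lambda>X. X x) ` I"
proof -
  have "subspace ((\<lambda>X. X x) ` I)"
  proof (rule linear_subspace_image[OF _ assms])
    show "linear (\<lambda>X::real^'a \<Rightarrow> real^'a. X x)" by (rule linearI) (simp_all add: scaleR_fun_def)
  qed
  moreover have "{X x |X. X \<in> I} = (\<lambda>X. X x) ` I" by blast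
  ultimately show ?thesis unfolding distribution_def by (metis span_eq_iff)
qed

lemma frame_exists:
  fixes x0 :: "real^'n"
  assumes D: "independent D"
  obtains \<beta> :: "'n \<Rightarrow> real^'n" where "inj \<beta>" "independent (range \<beta>)" "D \<subseteq> range \<beta>"
proof -
  obtain B where B: "D \<subseteq> B" "independent B" "UNIV \<subseteq> span B"
    by (rule maximal_independent_subset_extend[OF subset_UNIV D])
  have "finite B" using B(2) by (rule independent_imp_finite)
  moreover have "card B = CARD('n)"
  proof -
    have "span B = UNIV" using B(3) by auto
    then show ?thesis using dim_eq_card[of B UNIV] B(2) by (simp add: dim_UNIV)
  qed
  ultimately obtain \<beta> where "bij_betw \<beta> (UNIV :: 'n set) B"
    using finite_same_card_bij by (metis finite)
  then show ?thesis using that[of \<beta>] B by (auto simp: bij_betw_def)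
qed

locale transitive_algebra = fd_lie_algebra "vf_bracket U" L for U :: "(real^'n) set" and L +
  assumes open_U: "open U" and L_vf: "L \<subseteq> vector_fields U"
    and transitive: "x \<in> U \<Longrightarrow> distribution L x = UNIV"
begin

text \<open>Elements of \<open>I\<close> that realize a basis of its values at \<open>x0\<close> are
  completed to a frame by constant fields; \<open>J\<close> marks the members taken from
  \<open>I\<close>.\<close>

lemma frame_near:
  assumes I: "ideal I" and x0: "x0 \<in> U"
  obtains E V J where "open V" "x0 \<in> V" "V \<subseteq> U" "\<And>j. E j \<in> vector_fields U" "\<And>j. j \<in> J \<Longrightarrow> E j \<in> I"
    "\<And>x. x \<in> V \<Longrightarrow> det (frame_matrix E x) \<noteq> 0" "distribution I x0 \<subseteq> span ((\<lambda>j. E j x0) ` J)"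
proof -
  note Id = idealD[OF I]
  obtain D where D: "D \<subseteq> distribution I x0" "independent D" "distribution I x0 \<subseteq> span D"
    using maximal_independent_subset by blast
  obtain \<beta> :: "'n \<Rightarrow> real^'n" where \<beta>: "inj \<beta>" "independent (range \<beta>)" "D \<subseteq> range \<beta>"
      using frame_exists[OF D(2)] by blast
  define J where "J = {j. \<beta> j \<in> D}"
  have "\<forall>j\<in>J. \<exists>Y\<in>I. Y x0 = \<beta> j"
    using D(1) unfolding J_def distribution_subspace[OF Id(1)] by force
  then obtain Y where Y: "\<And>j. j \<in> J \<Longrightarrow> Y j \<in> I" "\<And>j. j \<in> J \<Longrightarrow> Y j x0 = \<beta> j" by metis
  define E where "E j = (if j \<in> J then Y j else restrict_vf U (\<lambda>_. \<beta> j))" for j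
  have Evf: "E j \<in> vector_fields U" for j
  proof (cases "j \<in> J")
    case True then show ?thesis using Y(1) Id(2) L_vf by (auto simp: E_def)
  next
    case False
    have "(\<lambda>_. \<beta> j) \<in> vector_fields UNIV" by (rule vector_fieldsI) (auto simp: smooth_on_const)
    then show ?thesis using False restrict_vf_vector_fields[OF open_U] by (auto simp: E_def)
  qed
  have Ex0: "E j x0 = \<beta> j" for j using Y(2) x0 by (auto simp: E_def restrict_vf_def)
  have det0: "det (frame_matrix E x0) \<noteq> 0" by (rule frame_det_nonzero) (use \<beta> Ex0 in auto)
  define V where "V = {x \<in> U. det (frame_matrix E x) \<noteq> 0}"
  have "continuous_on U (\<lambda>x. det (frame_matrix E x))"
    by (rule smooth_onD(3)[OF smooth_on_frame_det[OF open_U vector_fieldsD(1)[OF Evf]]])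
  then have "open V" unfolding V_def
      using open_U continuous_open_preimage[of U "\<lambda>x. det (frame_matrix E x)" "- {0}"]
    by (simp add: vimage_def Int_def open_Compl)
  moreover have "span D \<subseteq> span ((\<lambda>j. E j x0) ` J)"
    using \<beta>(3) Ex0 by (intro span_mono) (auto simp: J_def)
  ultimately show ?thesis
    by (intro that[of V E J] Evf order_trans[OF D(3)]) (use x0 det0 Y(1) in \<open>simp_all add: V_def E_def\<close>)
qed

text \<open>For \<open>I = L\<close> transitivity leaves no place for constant fields: an index
  outside \<open>J\<close> would put a frame vector at \<open>x0\<close> into the span of the
  others.\<close>

lemma L_frame_near:
  assumes x0: "x0 \<in> U"
  obtains E V where "open V" "x0 \<in> V" "V \<subseteq> U" "\<And>j. E j \<in> L" "\<And>x. x \<in> V \<Longrightarrow> det (frame_matrix E x) \<noteq> 0"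
proof -
  obtain E V J where E: "open V" "x0 \<in> V" "V \<subseteq> U" "\<And>j. E j \<in> vector_fields U" "\<And>j. j \<in> J \<Longrightarrow> E j \<in> L"
    "\<And>x. x \<in> V \<Longrightarrow> det (frame_matrix E x) \<noteq> 0" "distribution L x0 \<subseteq> span ((\<lambda>j. E j x0) ` J)"
    by (rule frame_near[OF ideal_L x0]) (rule that)
  have "j \<in> J" for j
  proof (rule ccontr)
    assume j: "j \<notin> J"
    have "E j x0 \<in> span ((\<lambda>j. E j x0) ` J)" using E(7) transitive[OF x0] by auto
    moreover have "coef E x0 j w = 0" if "w \<in> (\<lambda>j. E j x0) ` J" for w
      using that j coef_frame[OF E(6)[OF E(2)], of j] by auto
    ultimately have "coef E x0 j (E j x0) = 0"
      using linear_eq_0_on_span[OF linear_coef[OF E(6)[OF E(2)]]] by blast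
    then show False using coef_frame[OF E(6)[OF E(2)], of j j] by simp
  qed
  then show ?thesis using that[OF E(1-3) E(5) E(6)] by blast
qed

text \<open>Near \<open>x\<^sub>0\<close> the components transversal to a frame spanning the ideal at \<open>x\<^sub>0\<close> satisfy a linear
  system because \<open>[L, I] \<subseteq> I\<close>.\<close>

lemma ideal_components_zero:
  assumes I: "ideal I" and V: "open V" "x0 \<in> V" "V \<subseteq> U" and E: "\<And>j. E j \<in> vector_fields U"
      "\<And>j. j \<in> J \<Longrightarrow> E j \<in> I"
    and d: "\<And>x. x \<in> V \<Longrightarrow> det (frame_matrix E x) \<noteq> 0"
    and sp: "distribution I x0 \<subseteq> span ((\<lambda>j. E j x0) ` J)"
  obtains \<delta> where "\<delta> > 0" "ball x0 \<delta> \<subseteq> V" "\<And>Z j x. Z \<in> I \<Longrightarrow> j \<notin> J \<Longrightarrow> x \<in> ball x0 \<delta> \<Longrightarrow> coef E x j (Z x) = 0"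
proof -
  note Id = idealD[OF I]
  obtain F W where F: "open W" "x0 \<in> W" "W \<subseteq> U" "\<And>j. F j \<in> L" "\<And>x. x \<in> W \<Longrightarrow> det (frame_matrix F x) \<noteq> 0"
    by (rule L_frame_near[OF subsetD[OF V(3,2)]]) (rule that)
  obtain B where B: "finite B" "B \<subseteq> I" "I \<subseteq> span B" using finite_basis[OF Id(2)] by blast
  define T where "T = V \<inter> W"
  have T: "open T" "x0 \<in> T" "T \<subseteq> U" "T \<subseteq> V" "T \<subseteq> W" using V F by (auto simp: T_def)
  have s: "smooth_on T A" if "A \<in> vector_fields U" for A
    using smooth_on_subset[OF vector_fieldsD(1)[OF that] T(3)] .
  have Ivf: "Z \<in> vector_fields U" if "Z \<in> I" for Z using that Id(2) L_vf by blast
  have Fvf: "F j \<in> vector_fields U" for j using F(4) L_vf by blast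
  have dE: "det (frame_matrix E x) \<noteq> 0" if "x \<in> T" for x using that d T by blast
  have dF: "det (frame_matrix F x) \<noteq> 0" if "x \<in> T" for x using that F T by blast
  \<comment> \<open>The unknowns of the linear system: the components outside \<open>J\<close> of a
    finite set spanning \<open>I\<close>.\<close>
  define K where "K = B \<times> (- J)"
  define r where "r k x = coef E x (snd k) (fst k x)" for k x
  \<comment> \<open>Combinations of the unknowns with continuous coefficients. The linear system
    amounts to \<open>Mod\<close> containing all partial derivatives of the unknowns.\<close>
  define Mod where "Mod f \<longleftrightarrow> (\<exists>A. (\<forall>k\<in>K. continuous_on T (A k)) \<and> (\<forall>x\<in>T. f x = (\<Sum>k\<in>K. A k x * r k x)))"
      for f :: "real^'n \<Rightarrow> real"
  have fK: "finite K" using B(1) by (simp add: K_def)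
  have Mod_mult: "Mod (\<lambda>x. c x * f x)" if cf: "continuous_on T c" "Mod f" for c f
  proof -
    obtain A where A: "\<forall>k\<in>K. continuous_on T (A k)" "\<forall>x\<in>T. f x = (\<Sum>k\<in>K. A k x * r k x)" using cf(2)
        by (auto simp: Mod_def)
    show ?thesis unfolding Mod_def
      by (rule exI[of _ "\<lambda>k x. c x * A k x"]) (use A cf(1) in \<open>auto intro!: continuous_intros simp:
          sum_distrib_left mult.assoc\<close>)
  qed
  have Mod_add: "Mod (\<lambda>x. f x + g x)" if fg: "Mod f" "Mod g" for f g
  proof -
    obtain A where A: "\<forall>k\<in>K. continuous_on T (A k)" "\<forall>x\<in>T. f x = (\<Sum>k\<in>K. A k x * r k x)" using fg(1)
        by (auto simp: Mod_def)
    obtain A' where A': "\<forall>k\<in>K. continuous_on T (A' k)" "\<forall>x\<in>T. g x = (\<Sum>k\<in>K. A' k x * r k x)" using fg(2)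
        by (auto simp: Mod_def)
    show ?thesis unfolding Mod_def
      by (rule exI[of _ "\<lambda>k x. A k x + A' k x"]) (use A A' in \<open>auto intro!: continuous_intros simp:
          sum.distrib algebra_simps\<close>)
  qed
  have Mod_0: "Mod (\<lambda>x. 0)" unfolding Mod_def by (rule exI[of _ "\<lambda>k x. 0"]) auto
  have Mod_sum: "Mod (\<lambda>x. \<Sum>i\<in>A. f i x)" if "\<And>i. i \<in> A \<Longrightarrow> Mod (f i)" for A :: "'n set" and f
    using finite[of A] that by (induction A rule: finite_induct) (auto intro: Mod_0 Mod_add)
  have Mod_r: "Mod (r k)" if "k \<in> K" for k
    unfolding Mod_def by (rule exI[of _ "\<lambda>l x. if l = k then 1 else 0"])
      (use that fK in \<open>auto simp: if_distrib[of "\<lambda>c. c * _"] cong: if_cong\<close>)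
  have Mod_cong: "Mod f \<longleftrightarrow> Mod g" if "\<And>x. x \<in> T \<Longrightarrow> f x = g x" for f g using that by (simp add: Mod_def)
  have Mod_I: "Mod (\<lambda>x. coef E x j (Z x))" if "Z \<in> I" "j \<notin> J" for Z j
  proof -
    have "Z \<in> span B" using that B by blast
    then show ?thesis
    proof (induction rule: span_induct_alt)
      case base
      have "Mod (\<lambda>x. coef E x j ((0 :: real^'n \<Rightarrow> real^'n) x)) \<longleftrightarrow> Mod (\<lambda>x. 0)"
        by (rule Mod_cong) (use linear_0[OF linear_coef[OF dE]] in simp)
      then show ?case using Mod_0 by simp
    next
      case (step c b w)
      have "Mod (\<lambda>x. c * r (b, j) x + coef E x j (w x))"
        using step that by (intro Mod_add Mod_mult Mod_r) (auto simp: K_def)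
      moreover have "Mod (\<lambda>x. coef E x j ((c *\<^sub>R b + w) x)) \<longleftrightarrow> Mod (\<lambda>x. c * r (b, j) x + coef E x j (w x))"
        by (rule Mod_cong) (simp add: r_def scaleR_fun_def linear_add[OF linear_coef[OF dE]]
            linear_scale[OF linear_coef[OF dE]])
      ultimately show ?case by simp
    qed
  qed
  have cont: "continuous_on T (\<lambda>x. coef E x j (Z x))" if "Z \<in> vector_fields U" for Z j
    by (rule smooth_onD(3)[OF smooth_on_coef[OF T(1) s[OF E(1)] dE s[OF that]]])
  have rsm: "smooth_on T (r k)" if "k \<in> K" for k
    unfolding r_def using that B(2) by (intro smooth_on_coef[OF T(1) s[OF E(1)] dE s[OF Ivf]])
        (auto simp: K_def)
  have ModX: "Mod (\<lambda>x. fd (r k) x (X x))" if X: "X \<in> L" and k: "k \<in> K" for X k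
  proof -
    obtain Z j where Zj: "k = (Z, j)" "Z \<in> I" "j \<notin> J" using k B(2) by (auto simp: K_def)
    have Xvf: "X \<in> vector_fields U" using X L_vf by blast
    have e: "fd (r k) x (X x) = coef E x j (vf_bracket U X Z x)
        + (\<Sum>l\<in>UNIV. (- 1) * (coef E x l (Z x) * coef E x j (vf_bracket U X (E l) x)))" if "x \<in> T" for x
      using coef_bracket[OF T(1) that T(3) E(1) dE Xvf Ivf[OF Zj(2)], of j]
      by (simp add: r_def[abs_def] Zj(1) sum_negf)
    \<comment> \<open>For \<open>l \<in> J\<close> the bracket \<open>[X, E l]\<close> lies in
      \<open>I\<close>, so the second factor is a combination of the unknowns; for
      \<open>l \<notin> J\<close> the first factor is one.\<close>
    have m: "Mod (\<lambda>x. coef E x l (Z x) * coef E x j (vf_bracket U X (E l) x))" for l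
    proof (cases "l \<in> J")
      case True
      then show "Mod (\<lambda>x. coef E x l (Z x) * coef E x j (vf_bracket U X (E l) x))"
        using Id(3)[OF X E(2)] by (intro Mod_mult Mod_I cont Ivf Zj) auto
    next
      case False
      have "Mod (\<lambda>x. coef E x j (vf_bracket U X (E l) x) * coef E x l (Z x))"
        by (intro Mod_mult Mod_I cont vf_bracket_vector_fields open_U Xvf E Zj False)
      then show "Mod (\<lambda>x. coef E x l (Z x) * coef E x j (vf_bracket U X (E l) x))"
          by (simp add: mult.commute)
    qed
    have "Mod (\<lambda>x. coef E x j (vf_bracket U X Z x)
        + (\<Sum>l\<in>UNIV. (- 1) * (coef E x l (Z x) * coef E x j (vf_bracket U X (E l) x))))"
      by (intro Mod_add Mod_sum Mod_mult[OF continuous_on_const] m Mod_I Id(3) X Zj)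
    then show ?thesis using Mod_cong[of "\<lambda>x. fd (r k) x (X x)", OF e] by blast
  qed
  \<comment> \<open>Transitivity enters here: partial derivatives are combinations of derivatives
    along a frame \<open>F\<close> of elements of \<open>L\<close>.\<close>
  have ModP: "Mod (pd i (r k))" if k: "k \<in> K" for i k
  proof -
    have e: "pd i (r k) x = (\<Sum>m\<in>UNIV. coef F x m (axis i 1) * fd (r k) x (F m x))" if x: "x \<in> T" for x
    proof -
      have "pd i (r k) x = fd (r k) x (\<Sum>m\<in>UNIV. coef F x m (axis i 1) *\<^sub>R F m x)"
        by (simp add: pd_def coef_expand[OF dF[OF x]])
      then show ?thesis
        using linear_frechet_derivative[OF smooth_onD(1)[OF rsm[OF k] x]]
          by (simp add: linear_sum linear_scale)
    qed
    have "continuous_on T (\<lambda>x. coef F x m (axis i 1))" for m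
      by (rule smooth_onD(3)[OF smooth_on_coef[OF T(1) s[OF Fvf] dF smooth_on_const]])
    then have "Mod (\<lambda>x. \<Sum>m\<in>UNIV. coef F x m (axis i 1) * fd (r k) x (F m x))"
      by (intro Mod_sum Mod_mult ModX F k)
    then show ?thesis using Mod_cong[of "pd i (r k)", OF e] by blast
  qed
  define P where "P k i A \<longleftrightarrow> (\<forall>l\<in>K. continuous_on T (A l)) \<and>
      (\<forall>x\<in>T. pd i (r k) x = (\<Sum>l\<in>K. A l x * r l x))" for k i A
  define A where "A k i = (SOME A. P k i A)" for k i
  have A: "P k i (A k i)" if "k \<in> K" for k i
  proof -
    have "Ex (P k i)" using ModP[OF that, of i] unfolding Mod_def P_def .
    then show ?thesis unfolding A_def by (rule someI_ex)
  qed
  have r0: "r k x0 = 0" if k: "k \<in> K" for k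
  proof -
    obtain Z j where Zj: "k = (Z, j)" "Z \<in> I" "j \<notin> J" using k B(2) by (auto simp: K_def)
    have "Z x0 \<in> span ((\<lambda>j. E j x0) ` J)" using sp Zj(2) unfolding distribution_def
        by (auto intro: span_base)
    then have "coef E x0 j (Z x0) = 0"
      using linear_eq_0_on_span[OF linear_coef[OF dE[OF T(2)]], of "(\<lambda>j. E j x0) ` J" j] Zj(3)
        coef_frame[OF dE[OF T(2)], of j]
      by fastforce
    then show ?thesis by (simp add: r_def Zj)
  qed
  obtain \<delta> where \<delta>: "\<delta> > 0" "ball x0 \<delta> \<subseteq> T" "\<And>k x. k \<in> K \<Longrightarrow> x \<in> ball x0 \<delta> \<Longrightarrow> r k x = 0"
    by (rule linear_system_zero[where K=K and r=r and A=A, OF fK T(1,2) rsm r0])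
        (use A[unfolded P_def] in blast)+
  have "coef E x j (Z x) = 0" if zj: "Z \<in> I" "j \<notin> J" "x \<in> ball x0 \<delta>" for Z j x
  proof -
    have "x \<in> T" using zj(3) \<delta>(2) by blast
    then obtain A where "coef E x j (Z x) = (\<Sum>k\<in>K. A k x * r k x)" using Mod_I[OF zj(1,2)]
        unfolding Mod_def by blast
    then show ?thesis using \<delta>(3) zj(3) by simp
  qed
  then show ?thesis using that[OF \<delta>(1)] \<delta>(2) T(4) by blast
qed

text \<open>Near \<open>x0\<close> the frame members in \<open>J\<close> lie in \<open>I\<close>
  and, the transversal components being zero, span its values, so the rank is \<open>card J\<close>
  throughout.\<close>

lemma ideal_rank_constant:
  assumes I: "ideal I" and x0: "x0 \<in> U"
  obtains \<delta> where "\<delta> > 0" "ball x0 \<delta> \<subseteq> U" "\<And>x. x \<in> ball x0 \<delta> \<Longrightarrow> dim (distribution I x)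
      = dim (distribution I x0)"
proof -
  obtain E V J where E: "open V" "x0 \<in> V" "V \<subseteq> U" "\<And>j. E j \<in> vector_fields U" "\<And>j. j \<in> J \<Longrightarrow> E j \<in> I"
    "\<And>x. x \<in> V \<Longrightarrow> det (frame_matrix E x) \<noteq> 0" "distribution I x0 \<subseteq> span ((\<lambda>j. E j x0) ` J)"
    by (rule frame_near[OF I x0]) (rule that)
  obtain \<delta> where \<delta>: "\<delta> > 0" "ball x0 \<delta> \<subseteq> V" "\<And>Z j x. Z \<in> I \<Longrightarrow> j \<notin> J \<Longrightarrow> x \<in> ball x0 \<delta> \<Longrightarrow> coef E x j (Z x) = 0"
    by (rule ideal_components_zero[OF I E(1-4) E(5) E(6) E(7)]) (assumption | rule that)+
  have "dim (distribution I x) = card J" if x: "x \<in> ball x0 \<delta>" for x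
  proof (rule dim_unique[of "(\<lambda>j. E j x) ` J"])
    have xV: "x \<in> V" using x \<delta> by blast
    note d = E(6)[OF xV]
    show "(\<lambda>j. E j x) ` J \<subseteq> distribution I x"
      using E(5) by (auto simp: distribution_def intro!: span_base)
    have "Z x \<in> span ((\<lambda>j. E j x) ` J)" if "Z \<in> I" for Z
    proof -
      have "Z x = (\<Sum>j\<in>UNIV. coef E x j (Z x) *\<^sub>R E j x)" by (simp add: coef_expand[OF d])
      also have "\<dots> = (\<Sum>j\<in>J. coef E x j (Z x) *\<^sub>R E j x)"
        by (rule sum.mono_neutral_right) (use \<delta>(3)[OF that _ x] in auto)
      also have "\<dots> \<in> span ((\<lambda>j. E j x) ` J)" by (intro span_sum span_scale span_base) auto
      finally show ?thesis .
    qed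
    then show "distribution I x \<subseteq> span ((\<lambda>j. E j x) ` J)"
      unfolding distribution_def by (intro span_minimal) auto
    have inj: "inj (\<lambda>j. E j x)"
      by (rule injI) (metis coef_frame[OF d] zero_neq_one)
    then show "card ((\<lambda>j. E j x) ` J) = card J" by (intro card_image) (auto simp: inj_on_def)
    show "independent ((\<lambda>j. E j x) ` J)"
    proof (rule independent_if_scalars_zero)
      fix f v assume f: "(\<Sum>v\<in>(\<lambda>j. E j x) ` J. f v *\<^sub>R v) = 0" "v \<in> (\<lambda>j. E j x) ` J"
      then obtain j where j: "j \<in> J" "v = E j x" by blast
      have "(\<Sum>v\<in>(\<lambda>j. E j x) ` J. f v *\<^sub>R v) = (\<Sum>j\<in>J. f (E j x) *\<^sub>R E j x)"
        using inj by (subst sum.reindex) (auto simp: inj_on_def)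
      also have "\<dots> = (\<Sum>j\<in>UNIV. (if j \<in> J then f (E j x) else 0) *\<^sub>R E j x)"
        by (rule sum.mono_neutral_cong_left) auto
      finally have "coef E x j 0 = f (E j x)"
          using coef_unique[OF d, of j "\<lambda>j. if j \<in> J then f (E j x) else 0"] f(1) j by simp
      then show "f v = 0" using linear_0[OF linear_coef[OF d]] j by simp
    qed simp
  qed
  then show ?thesis using that[OF \<delta>(1)] \<delta> E(3) by (metis centre_in_ball subset_trans)
qed

lemma foliation_dim_ideal:
  assumes "ideal I" "0 \<in> U" shows "foliation_dim I = dim (distribution I 0)"
proof -
  obtain \<delta> where \<delta>: "\<delta> > 0" "\<And>x. x \<in> ball 0 \<delta> \<Longrightarrow> dim (distribution I x) = dim (distribution I 0)"
    by (rule ideal_rank_constant[OF assms]) (rule that)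
  show ?thesis
    unfolding foliation_dim_def
  proof (rule the_equality)
    show "\<exists>V. open V \<and> 0 \<in> V \<and> (\<forall>x\<in>V. dim (distribution I x) = dim (distribution I 0))"
      using \<delta> by (metis centre_in_ball open_ball)
  qed auto
qed

text \<open>The rank is locally constant on the connected \<open>U\<close>, so an ideal of fields
  vanishing on an open piece has rank \<open>0\<close> everywhere. This makes the passage to a
  smaller chart domain injective.\<close>

lemma ideal_vanishing:
  assumes K: "ideal K" and U: "connected U" and V: "open V" "x0 \<in> V" "V \<subseteq> U"
    and z: "\<And>X x. X \<in> K \<Longrightarrow> x \<in> V \<Longrightarrow> X x = 0" and X: "X \<in> K"
  shows "X = 0"
proof -
  have "\<forall>x\<in>U. \<forall>y\<in>U. dim (distribution K x) = dim (distribution K y)"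
  proof (intro ballI connected_local_const[OF U])
    fix a assume a: "a \<in> U"
    obtain \<delta> where \<delta>: "\<delta> > 0" "\<And>x. x \<in> ball a \<delta> \<Longrightarrow> dim (distribution K x) = dim (distribution K a)"
      by (rule ideal_rank_constant[OF K a]) (rule that)
    then show "\<forall>\<^sub>F b in at a within U. dim (distribution K a) = dim (distribution K b)"
      unfolding eventually_at using \<delta> by (metis dist_commute mem_ball)
  qed auto
  moreover have "dim (distribution K x0) = 0"
  proof -
    have "distribution K x0 \<subseteq> {0}" unfolding distribution_def by (rule span_minimal) (use z V in auto)
    then show ?thesis by simp
  qed
  ultimately have d0: "dim (distribution K x) = 0" if "x \<in> U" for x
    using that subsetD[OF V(3,2)] by metis
  have "X x = 0" if "x \<in> U" for x
  proof -
    have "X x \<in> distribution K x" using X by (auto simp: distribution_def intro!: span_base)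
    then show ?thesis using d0[OF that] dim_eq_0 by blast
  qed
  moreover have "X x = 0" if "x \<notin> U" for x using X idealD(2)[OF K] L_vf vector_fieldsD(2) that by blast
  ultimately show ?thesis by (auto simp: fun_eq_iff)
qed

end

section \<open>Filtration of functions by degree\<close>

text \<open>\<open>Fil r E w d\<close> consists of the functions on \<open>cube r\<close> of degree at most \<open>d\<close>, where differentiation
  along the frame field \<open>E a\<close> lowers the degree by \<open>w a\<close>.\<close>

inductive Fil :: "real \<Rightarrow> ('n::finite \<Rightarrow> real^'n \<Rightarrow> real^'n) \<Rightarrow> ('n \<Rightarrow> nat) \<Rightarrow> int \<Rightarrow> (real^'n \<Rightarrow> real) \<Rightarrow> bool"
  for r E w where
  neg: "d < 0 \<Longrightarrow> (\<And>x. x \<in> cube r \<Longrightarrow> g x = 0) \<Longrightarrow> Fil r E w d g"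
| step: "0 \<le> d \<Longrightarrow> smooth_on (cube r) g \<Longrightarrow>
    (\<And>a. 1 \<le> w a \<Longrightarrow> Fil r E w (d - int (w a)) (\<lambda>x. fd g x (E a x))) \<Longrightarrow> Fil r E w d g"

lemma smooth_on_zero: "open U \<Longrightarrow> (\<And>x. x \<in> U \<Longrightarrow> f x = 0) \<Longrightarrow> smooth_on U f"
  using smooth_on_cong[of U f "\<lambda>x. 0"] smooth_on_const by metis

lemma fd_zero: "open U \<Longrightarrow> x \<in> U \<Longrightarrow> (\<And>x. x \<in> U \<Longrightarrow> f x = 0) \<Longrightarrow> fd f x v = 0"
  using fd_cong[of U x f "\<lambda>x. 0"] by simp

lemma Fil_smooth: "Fil r E w d g \<Longrightarrow> smooth_on (cube r) g"
  by (induction rule: Fil.induct) (auto intro: smooth_on_zero open_cube)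

lemma Fil_cong:
  assumes "Fil r E w d g" "\<And>x. x \<in> cube r \<Longrightarrow> g x = h x" shows "Fil r E w d h"
  using assms
proof (induction arbitrary: h rule: Fil.induct)
  case (neg d g)
  then show ?case by (intro Fil.neg) auto
next
  case (step d g)
  show ?case
  proof (rule Fil.step[OF step(1)])
    show "smooth_on (cube r) h" using smooth_on_cong[of "cube r" g h, OF open_cube step.prems] step(2)
        by blast
    fix a assume a: "1 \<le> w a"
    show "Fil r E w (d - int (w a)) (\<lambda>x. fd h x (E a x))"
      by (rule step.IH[OF a]) (subst fd_cong[OF open_cube _ step.prems], auto)
  qed
qed

text \<open>The data left once the algebra is done: \<open>A j\<close> stands for \<open>L^j\<close>
  on a cube, \<open>pos\<close> orders the frame by nondecreasing weight, and by
  \<open>A_span\<close> elements of \<open>A j\<close> involve only frame fields of weight at least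
  \<open>j\<close>.\<close>

locale graded_frame =
  fixes r :: real and A :: "nat \<Rightarrow> (real^'n \<Rightarrow> real^'n) set" and E :: "'n::finite \<Rightarrow> real^'n \<Rightarrow> real^'n"
    and w :: "'n \<Rightarrow> nat" and pos :: "'n \<Rightarrow> nat"
  assumes r_pos: "r > 0" and inj_pos: "inj pos" and w_mono: "pos a \<le> pos b \<Longrightarrow> w a \<le> w b"
    and A_vf: "A j \<subseteq> vector_fields (cube r)" and E_A: "E a \<in> A (w a)"
    and det_E: "x \<in> cube r \<Longrightarrow> det (frame_matrix E x) \<noteq> 0"
    and A_span: "Y \<in> A j \<Longrightarrow> x \<in> cube r \<Longrightarrow> w a < j \<Longrightarrow> coef E x a (Y x) = 0"
    and A_bracket: "X \<in> A i \<Longrightarrow> Y \<in> A j \<Longrightarrow> vf_bracket (cube r) X Y \<in> A (max 1 (i + j))"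
begin

abbreviation "B \<equiv> cube r :: (real^'n) set"
abbreviation "F \<equiv> Fil r E w"

lemma A_smooth: "Y \<in> A j \<Longrightarrow> smooth_on B Y"
  using A_vf vector_fieldsD(1) by blast

lemma E_vf: "E i \<in> vector_fields B" using E_A A_vf by blast
lemma E_smooth: "smooth_on B (E i)" using E_vf vector_fieldsD(1) by blast

lemma smooth_deriv: "smooth_on B g \<Longrightarrow> Y \<in> A j \<Longrightarrow> smooth_on B (\<lambda>x. fd g x (Y x))"
  by (rule smooth_on_fd[OF open_cube _ A_smooth])

lemma smooth_coef: "Y \<in> A j \<Longrightarrow> smooth_on B (\<lambda>x. coef E x i (Y x))"
  by (rule smooth_on_coef[OF open_cube E_smooth det_E A_smooth])

lemma deriv_expand:
  assumes "smooth_on B g" "x \<in> B"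
  shows "fd g x v = (\<Sum>c\<in>UNIV. coef E x c v * fd g x (E c x))"
proof -
  have "fd g x v = fd g x (\<Sum>c\<in>UNIV. coef E x c v *\<^sub>R E c x)" by (simp add: coef_expand det_E assms)
  then show ?thesis
    using linear_frechet_derivative[OF smooth_onD(1)[OF assms]] by (simp add: linear_sum linear_scale)
qed

lemma F_zero: "(\<And>x. x \<in> B \<Longrightarrow> g x = 0) \<Longrightarrow> F d g"
proof (induction "nat (d + 1)" arbitrary: d g rule: less_induct)
  case less
  show ?case
  proof (cases "d < 0")
    case True then show ?thesis using less(2) by (rule Fil.neg)
  next
    case False
    show ?thesis
    proof (rule Fil.step)
      show "smooth_on B g" by (rule smooth_on_zero[OF open_cube less(2)])
      fix a assume "1 \<le> w a"
      then show "F (d - int (w a)) (\<lambda>x. fd g x (E a x))"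
        using False fd_zero[OF open_cube _ less(2)] by (intro less(1)) auto
    qed (use False in simp)
  qed
qed

lemma F_neg_zero: "F d g \<Longrightarrow> d < 0 \<Longrightarrow> x \<in> B \<Longrightarrow> g x = 0"
  by (cases rule: Fil.cases) auto

lemma F_deriv:
  assumes "F d g" "1 \<le> w a" shows "F (d - int (w a)) (\<lambda>x. fd g x (E a x))"
  using assms(1)
proof cases
  case neg
  then show ?thesis by (intro F_zero fd_zero[OF open_cube]) auto
qed (use assms(2) in auto)

lemma F_mono: "F d g \<Longrightarrow> d \<le> d' \<Longrightarrow> F d' g"
proof (induction arbitrary: d' rule: Fil.induct)
  case (step d g)
  show ?case by (rule Fil.step) (use step in auto)
qed (auto intro: F_zero)

lemma F_add: "F d f \<Longrightarrow> F d g \<Longrightarrow> F d (\<lambda>x. f x + g x)"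
proof (induction arbitrary: g rule: Fil.induct)
  case (neg d f)
  show ?case using F_neg_zero[OF neg(3,1)] neg(2) by (intro F_zero) auto
next
  case (step d f)
  note sg = Fil_smooth[OF step.prems]
  show ?case
  proof (rule Fil.step[OF step(1) smooth_on_add[OF open_cube step(2) sg]])
    fix a assume a: "1 \<le> w a"
    show "F (d - int (w a)) (\<lambda>x. fd (\<lambda>x. f x + g x) x (E a x))"
      by (rule Fil_cong[OF step.IH[OF a F_deriv[OF step.prems a]]])
        (simp add: fd_add smooth_onD(1)[OF step(2)] smooth_onD(1)[OF sg])
  qed
qed

lemma F_sum: "(\<And>i. i \<in> I \<Longrightarrow> F d (f i)) \<Longrightarrow> F d (\<lambda>x. \<Sum>i\<in>I. f i x)"
  by (induction I rule: infinite_finite_induct) (auto intro: F_zero F_add)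

lemma F_const: "0 \<le> d \<Longrightarrow> F d (\<lambda>x. c)"
  by (rule Fil.step) (auto intro: F_zero smooth_on_const)

text \<open>Leibniz rule and induction on the total degree. A factor of negative degree is zero, so
  those cases are settled directly and the induction only meets nonnegative degrees.\<close>

lemma F_mult: "F d f \<Longrightarrow> F e g \<Longrightarrow> F (d + e) (\<lambda>x. f x * g x)"
proof (induction "nat (d + e)" arbitrary: d e f g rule: less_induct)
  case less
  show ?case
  proof (cases "d < 0 \<or> e < 0")
    case True
    then show ?thesis using F_neg_zero[OF less(2)] F_neg_zero[OF less(3)] by (intro F_zero) auto
  next
    case False
    note sf = Fil_smooth[OF less(2)] and sg = Fil_smooth[OF less(3)]
    show ?thesis
    proof (rule Fil.step[OF _ smooth_on_mult[OF open_cube sf sg]])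
      fix a assume a: "1 \<le> w a"
      have "F (d + (e - int (w a))) (\<lambda>x. f x * fd g x (E a x))"
      proof (cases "e - int (w a) < 0")
        case True
        show ?thesis using F_neg_zero[OF F_deriv[OF less(3) a] True] by (intro F_zero) simp
      next
        case nn: False
        show ?thesis by (rule less(1)[OF _ less(2) F_deriv[OF less(3) a]]) (use False a nn in simp)
      qed
      moreover have "F ((d - int (w a)) + e) (\<lambda>x. fd f x (E a x) * g x)"
      proof (cases "d - int (w a) < 0")
        case True
        show ?thesis using F_neg_zero[OF F_deriv[OF less(2) a] True] by (intro F_zero) simp
      next
        case nn: False
        show ?thesis by (rule less(1)[OF _ F_deriv[OF less(2) a] less(3)]) (use False a nn in simp)
      qed
      ultimately have "F (d + e - int (w a)) (\<lambda>x. f x * fd g x (E a x) + fd f x (E a x) * g x)"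
        by (intro F_add) (simp_all add: algebra_simps)
      then show "F (d + e - int (w a)) (\<lambda>x. fd (\<lambda>x. f x * g x) x (E a x))"
        by (rule Fil_cong) (simp add: fd_mult smooth_onD(1)[OF sf] smooth_onD(1)[OF sg])
    qed (use False in simp)
  qed
qed

lemma F_minus: "F d f \<Longrightarrow> F d (\<lambda>x. - f x)"
  using F_mult[OF F_const[of 0 "-1"], of d f] by simp

lemma F_diff: "F d f \<Longrightarrow> F d g \<Longrightarrow> F d (\<lambda>x. f x - g x)"
  using F_add[OF _ F_minus, of d f g] by simp

lemma bracket_E_A: "1 \<le> w a \<Longrightarrow> Y \<in> A j \<Longrightarrow> vf_bracket B (E a) Y \<in> A (w a + j)"
  using A_bracket[OF E_A] by (metis max.absorb2 trans_le_add1)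

text \<open>By \<open>coef_bracket\<close> the derivative along \<open>E a\<close> is the
  coefficient of \<open>[E a, Y] \<in> A (w a + j)\<close> minus products indexed by
  \<open>l\<close>. Products with \<open>w l < j\<close> or \<open>w l \<ge> w c\<close> vanish by
  \<open>A_span\<close>; in the others both factors have a smaller difference of weight and index,
  on which the induction runs.\<close>

lemma F_coef: "Y \<in> A j \<Longrightarrow> F (int (w c) - int j) (\<lambda>x. coef E x c (Y x))"
proof (induction "nat (int (w c) - int j + 1)" arbitrary: c j Y rule: less_induct)
  case less
  show ?case
  proof (cases "w c < j")
    case True then show ?thesis using A_span[OF less(2)] by (intro F_zero) auto
  next
    case False
    show ?thesis
    proof (rule Fil.step[OF _ smooth_coef[OF less(2)]])
      fix a assume a: "1 \<le> w a"
      let ?d = "int (w c) - int j - int (w a)"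
      have 1: "F ?d (\<lambda>x. coef E x c (vf_bracket B (E a) Y x))"
        using less(1)[OF _ bracket_E_A[OF a less(2)], of c] False a by (simp add: algebra_simps)
      have 2: "F ?d (\<lambda>x. coef E x l (Y x) * coef E x c (vf_bracket B (E a) (E l) x))" for l
      proof -
        note br = bracket_E_A[OF a E_A, of l]
        consider "w l < j" | "w c \<le> w l" | "j \<le> w l" "w l < w c" by linarith
        then show ?thesis
        proof cases
          case 1 then show ?thesis using A_span[OF less(2)] by (intro F_zero) auto
        next
          case 2 then show ?thesis using A_span[OF br, of _ c] a by (intro F_zero) auto
        next
          case 3
          have "F (int (w l) - int j) (\<lambda>x. coef E x l (Y x))" using 3 by (intro less(1)[OF _ less(2)]) auto
          moreover have "F (int (w c) - int (w a + w l)) (\<lambda>x. coef E x c (vf_bracket B (E a) (E l) x))"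
            using 3 a by (intro less(1)[OF _ br]) auto
          ultimately show ?thesis by (rule F_mult[THEN F_mono]) simp
        qed
      qed
      have "F ?d (\<lambda>x. coef E x c (vf_bracket B (E a) Y x) - (\<Sum>l\<in>UNIV. coef E x l (Y x) * coef E x c
          (vf_bracket B (E a) (E l) x)))"
        by (intro F_diff F_sum 1 2)
      then show "F (int (w c) - int j - int (w a)) (\<lambda>x. fd (\<lambda>x. coef E x c (Y x)) x (E a x))"
        by (rule Fil_cong)
          (use coef_bracket[OF open_cube _ order_refl E_vf det_E E_vf, of _ Y c a] less(2) A_vf in \<open>auto
              simp: subset_iff\<close>)
    qed (use False in simp)
  qed
qed

text \<open>\<open>Y\<close> is a combination of frame fields of weight at least \<open>j\<close>.
  Only derivatives of \<open>g\<close> along these are assumed to be controlled, which is what is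
  known while a coordinate is still being corrected.\<close>

lemma F_A_deriv_pos:
  assumes Y: "Y \<in> A j" "1 \<le> j" and g: "smooth_on B g"
    and F: "\<And>a. j \<le> w a \<Longrightarrow> F (d - int (w a)) (\<lambda>x. fd g x (E a x))"
  shows "F (d - int j) (\<lambda>x. fd g x (Y x))"
proof -
  have "F (d - int j) (\<lambda>x. coef E x c (Y x) * fd g x (E c x))" for c
  proof (cases "w c < j")
    case True then show ?thesis using A_span[OF Y(1)] by (intro F_zero) auto
  next
    case False
    then show ?thesis by (intro F_mult[OF F_coef[OF Y(1)] F, THEN F_mono]) auto
  qed
  then have "F (d - int j) (\<lambda>x. \<Sum>c\<in>UNIV. coef E x c (Y x) * fd g x (E c x))" by (rule F_sum)
  then show ?thesis by (rule Fil_cong) (simp add: deriv_expand[OF g, symmetric])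
qed

text \<open>For \<open>j = 0\<close> an expansion in the frame would involve derivatives along
  fields of weight \<open>0\<close>, which the degree does not control. Instead \<open>Y\<close> is
  moved past \<open>E a\<close>: \<open>E a (Y g) = Y (E a g) + [E a, Y] g\<close>, where the first
  term is covered by induction and the bracket has index \<open>w a\<close>.\<close>

lemma F_A_deriv: "F d g \<Longrightarrow> Y \<in> A j \<Longrightarrow> F (d - int j) (\<lambda>x. fd g x (Y x))"
proof (cases "1 \<le> j")
  case True
  assume g: "F d g" and Y: "Y \<in> A j"
  show ?thesis
    by (rule F_A_deriv_pos[OF Y True Fil_smooth[OF g]]) (use F_deriv[OF g] True in auto)
next
  case False
  assume "F d g" and Y: "Y \<in> A j"
  then have "F d (\<lambda>x. fd g x (Y x))" using False
  proof (induction rule: Fil.induct)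
    case (neg d g)
    then show ?case by (intro F_zero fd_zero[OF open_cube]) auto
  next
    case (step d g)
    then have Y0: "Y \<in> A 0" by (cases j) auto
    have Yvf: "Y \<in> vector_fields B" using Y0 A_vf by blast
    show ?case
    proof (rule Fil.step[OF step(1) smooth_deriv[OF step(2) Y0]])
      fix a assume a: "1 \<le> w a"
      have 1: "F (d - int (w a)) (\<lambda>x. fd (\<lambda>x. fd g x (E a x)) x (Y x))"
          by (rule step.IH[OF a Y]) (use step in auto)
      have "vf_bracket B (E a) Y \<in> A (w a)" using bracket_E_A[OF a Y0] by simp
      then have 2: "F (d - int (w a)) (\<lambda>x. fd g x (vf_bracket B (E a) Y x))"
        by (rule F_A_deriv_pos[OF _ a step(2)]) (use step.hyps(3) a in auto)
      show "F (d - int (w a)) (\<lambda>x. fd (\<lambda>x. fd g x (Y x)) x (E a x))"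
        by (rule Fil_cong[OF F_add[OF 1 2]]) (simp add: bracket_derivation[OF open_cube step(2) E_vf Yvf])
    qed
  qed
  then show ?thesis using False by (cases j) auto
qed

end

text \<open>\<open>poly_fun r Z Q w e\<close>: polynomials in the coordinates in \<open>Q\<close> of weighted degree at most \<open>e\<close>, the
  coefficients being smooth functions of the coordinates in \<open>Z\<close>.\<close>

definition coeff_fun :: "real \<Rightarrow> 'n set \<Rightarrow> (real^'n \<Rightarrow> real) \<Rightarrow> bool" where
  "coeff_fun r Z f \<longleftrightarrow> smooth_on (cube r) f \<and> (\<forall>b x. b \<notin> Z \<longrightarrow> x \<in> cube r \<longrightarrow> pd b f x = 0)"

definition monomial :: "'n::finite set \<Rightarrow> ('n \<Rightarrow> nat) \<Rightarrow> real^'n \<Rightarrow> real" where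
  "monomial Q \<alpha> x = (\<Prod>b\<in>Q. x $ b ^ \<alpha> b)"

inductive poly_fun :: "real \<Rightarrow> 'n::finite set \<Rightarrow> 'n set \<Rightarrow> ('n \<Rightarrow> nat) \<Rightarrow> int \<Rightarrow> (real^'n \<Rightarrow> real) \<Rightarrow> bool"
  for r Z Q w e where
  zero: "(\<And>x. x \<in> cube r \<Longrightarrow> g x = 0) \<Longrightarrow> poly_fun r Z Q w e g"
| add: "coeff_fun r Z f \<Longrightarrow> int (\<Sum>b\<in>Q. w b * \<alpha> b) \<le> e \<Longrightarrow> poly_fun r Z Q w e g \<Longrightarrow>
    (\<And>x. x \<in> cube r \<Longrightarrow> h x = f x * monomial Q \<alpha> x + g x) \<Longrightarrow> poly_fun r Z Q w e h"

lemma poly_fun_cong: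
  "poly_fun r Z Q w e g \<Longrightarrow> (\<And>x. x \<in> cube r \<Longrightarrow> g x = h x) \<Longrightarrow> poly_fun r Z Q w e h"
  by (cases rule: poly_fun.cases) (auto intro: poly_fun.intros)

lemma poly_fun_add:
  "poly_fun r Z Q w e g \<Longrightarrow> poly_fun r Z Q w e h \<Longrightarrow> poly_fun r Z Q w e (\<lambda>x. g x + h x)"
proof (induction rule: poly_fun.induct)
  case (zero g)
  then show ?case by (elim poly_fun_cong) auto
next
  case (add f \<alpha> g k)
  show ?case by (rule poly_fun.add[OF add(1,2) add.IH[OF add.prems]]) (simp add: add(4))
qed

lemma smooth_on_monomial: "smooth_on U (monomial Q \<alpha>)"
proof -
  have "smooth_on UNIV (monomial Q \<alpha>)"
    unfolding monomial_def by (intro smooth_on_prod smooth_on_power smooth_on_coord open_UNIV)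
  then show ?thesis by (rule smooth_on_subset) simp
qed

lemma poly_fun_smooth: "poly_fun r Z Q w e g \<Longrightarrow> smooth_on (cube r) g"
proof (induction rule: poly_fun.induct)
  case (zero g) then show ?case by (intro smooth_on_zero open_cube)
next
  case (add f \<alpha> g h)
  have "smooth_on (cube r) (\<lambda>x. f x * monomial Q \<alpha> x + g x)"
    using add by (intro smooth_on_add smooth_on_mult open_cube smooth_on_monomial)
      (auto simp: coeff_fun_def)
  then show ?case by (rule smooth_on_cong[OF open_cube, THEN iffD2, rotated]) (simp add: add(4))
qed

lemma pd_zero_const:
  fixes g :: "real^'n \<Rightarrow> real"
  assumes "\<And>x t. g (x + t *\<^sub>R axis b 1) = g x" "g differentiable (at x)"
  shows "pd b g x = 0"
proof -
  have l: "((\<lambda>t. x + t *\<^sub>R axis b 1) has_derivative (\<lambda>t. t *\<^sub>R axis b 1)) (at 0)"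
    by (auto intro!: derivative_eq_intros)
  have "((\<lambda>t. g (x + t *\<^sub>R axis b 1)) has_derivative (\<lambda>t. fd g x (t *\<^sub>R axis b 1))) (at 0)"
    using has_derivative_compose[OF l, of g "fd g x"] has_derivative_fd[OF assms(2)] by simp
  moreover have "((\<lambda>t. g (x + t *\<^sub>R axis b 1)) has_derivative (\<lambda>t. 0)) (at 0)"
    by (simp add: assms(1))
  ultimately have "(\<lambda>t. fd g x (t *\<^sub>R axis b 1)) = (\<lambda>t. 0)" by (rule has_derivative_unique)
  then have "fd g x (1 *\<^sub>R axis b 1) = 0" by (rule fun_cong)
  then show ?thesis by (simp add: pd_def)
qed

lemma pd_power_coord:
  "pd a (\<lambda>x::real^'n. x $ a ^ Suc m) x = real (Suc m) * x $ a ^ m"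
proof -
  have "((\<lambda>x::real^'n. x $ a) has_derivative (\<lambda>v. v $ a)) (at x)"
    by (rule bounded_linear_imp_has_derivative[OF bounded_linear_vec_nth])
  then have "((\<lambda>x::real^'n. x $ a ^ Suc m) has_derivative (\<lambda>v. real (Suc m) * v $ a * x $ a ^ m)) (at x)"
    using has_derivative_power[of "\<lambda>x. x $ a" "\<lambda>v. v $ a" x UNIV "Suc m"] by simp
  then show ?thesis by (simp add: pd_def fd_eqI)
qed

lemma monomial_remove: "a \<in> Q \<Longrightarrow> monomial Q \<alpha> x = x $ a ^ \<alpha> a * monomial (Q - {a}) \<alpha> x"
  unfolding monomial_def by (rule prod.remove) auto

lemma monomial_cong: "(\<And>b. b \<in> Q \<Longrightarrow> \<alpha> b = \<beta> b) \<Longrightarrow> monomial Q \<alpha> x = monomial Q \<beta> x"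
  unfolding monomial_def by (rule prod.cong) auto

lemma pd_monomial_other: "b \<notin> Q \<Longrightarrow> pd b (monomial Q \<alpha>) x = 0"
proof (rule pd_zero_const)
  show "monomial Q \<alpha> (x + t *\<^sub>R axis b 1) = monomial Q \<alpha> x" if "b \<notin> Q" for x t
    unfolding monomial_def using that by (intro prod.cong) (auto simp: axis_def)
qed (use smooth_onD(1)[OF smooth_on_monomial[of UNIV]] in auto)

text \<open>Termwise integration in \<open>x $ a\<close>, possible because the coefficients do not
  depend on this variable.\<close>

lemma poly_fun_integral:
  fixes Q :: "'n::finite set"
  assumes "poly_fun r Z Q w e g" "a \<in> Q" "a \<notin> Z"
  shows "\<exists>G. poly_fun r Z Q w (e + int (w a)) G \<and> (\<forall>x\<in>cube r. pd a G x = g x \<and> (x $ a = 0 \<longrightarrow> G x = 0))"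
  using assms(1)
proof (induction rule: poly_fun.induct)
  case (zero g)
  show ?case
    by (rule exI[of _ "\<lambda>x. 0"]) (use zero in \<open>auto intro: poly_fun.zero simp: pd_def\<close>)
next
  case (add f \<alpha> g h)
  then obtain G where G: "poly_fun r Z Q w (e + int (w a)) G" "\<And>x. x \<in> cube r \<Longrightarrow> pd a G x = g x"
      "\<And>x. x \<in> cube r \<Longrightarrow> x $ a = 0 \<Longrightarrow> G x = 0" by blast
  define \<beta> where "\<beta> = \<alpha>(a := Suc (\<alpha> a))"
  define k where "k x = f x * (1 / real (Suc (\<alpha> a)))" for x
  note f = add(1)[unfolded coeff_fun_def]
  have sf: "smooth_on (cube r) f" using f by blast
  have k: "coeff_fun r Z k"
    unfolding coeff_fun_def
  proof (intro conjI allI impI)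
    show "smooth_on (cube r) k" unfolding k_def by (rule smooth_on_mult[OF open_cube sf smooth_on_const])
    fix b and x :: "real^'n" assume "b \<notin> Z" "x \<in> cube r"
    then show "pd b k x = 0"
      using f unfolding k_def
      by (subst pd_mult[OF smooth_onD(1)[OF sf] differentiable_const]) (auto simp: pd_def)
  qed
  have m1: "monomial Q \<beta> x = x $ a ^ Suc (\<alpha> a) * monomial (Q - {a}) \<alpha> x" for x
    using monomial_remove[OF assms(2), of \<beta> x] monomial_cong[of "Q - {a}" \<beta> \<alpha>] by (simp add: \<beta>_def)
  have km: "pd a (\<lambda>x. k x * monomial Q \<beta> x) x = f x * monomial Q \<alpha> x" if x: "x \<in> cube r" for x
  proof -
    have d: "k differentiable (at x)" "monomial Q \<beta> differentiable (at x)"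
        "monomial (Q - {a}) \<alpha> differentiable (at x)"
      "(\<lambda>x. x $ a ^ Suc (\<alpha> a)) differentiable (at x)"
      using k[unfolded coeff_fun_def] x smooth_on_monomial[of UNIV]
        smooth_on_power[OF open_UNIV smooth_on_coord, of a "Suc (\<alpha> a)"]
      by (auto intro: smooth_onD(1))
    have "pd a (monomial Q \<beta>) x = pd a (\<lambda>x. x $ a ^ Suc (\<alpha> a) * monomial (Q - {a}) \<alpha> x) x"
      by (rule pd_cong[OF open_UNIV]) (simp_all only: m1 UNIV_I)
    also have "\<dots> = real (Suc (\<alpha> a)) * x $ a ^ \<alpha> a * monomial (Q - {a}) \<alpha> x"
      by (simp only: pd_mult[OF d(4,3)] pd_monomial_other pd_power_coord) (simp add: pd_monomial_other)
    finally have "pd a (monomial Q \<beta>) x = real (Suc (\<alpha> a)) * monomial Q \<alpha> x"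
      by (simp add: monomial_remove[OF assms(2), of \<alpha>])
    moreover have "pd a k x = 0" using k assms(3) x by (simp add: coeff_fun_def)
    ultimately have "pd a (\<lambda>x. k x * monomial Q \<beta> x) x = k x * (real (Suc (\<alpha> a)) * monomial Q \<alpha> x)"
      by (simp only: pd_mult[OF d(1,2)])
    also have "\<dots> = f x * monomial Q \<alpha> x" by (simp add: k_def)
    finally show ?thesis .
  qed
  have deg: "(\<Sum>b\<in>Q. w b * \<beta> b) = (\<Sum>b\<in>Q. w b * \<alpha> b) + w a"
    using sum.remove[OF _ assms(2), of "\<lambda>b. w b * \<beta> b"] sum.remove[OF _ assms(2), of "\<lambda>b. w b * \<alpha> b"]
      by (simp add: \<beta>_def)
  have p: "poly_fun r Z Q w (e + int (w a)) (\<lambda>x. k x * monomial Q \<beta> x + G x)"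
  proof (rule poly_fun.add[where \<alpha>=\<beta>, OF k _ G(1)])
    show "int (\<Sum>b\<in>Q. w b * \<beta> b) \<le> e + int (w a)" using add(2) unfolding deg of_nat_add by linarith
  qed simp
  have sk: "smooth_on (cube r) (\<lambda>x. k x * monomial Q \<beta> x)"
    using k by (intro smooth_on_mult open_cube smooth_on_monomial) (simp add: coeff_fun_def)
  have "pd a (\<lambda>x. k x * monomial Q \<beta> x + G x) x = h x" if x: "x \<in> cube r" for x
    using km[OF x] G(2)[OF x] add(4)[OF x] fd_add[OF smooth_onD(1)[OF sk x]
      smooth_onD(1)[OF poly_fun_smooth[OF G(1)] x]]
    by (simp add: pd_def)
  then show ?case
    using p G(3) by (intro exI[of _ "\<lambda>x. k x * monomial Q \<beta> x + G x"]) (auto simp: m1)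
qed

text \<open>Setting \<open>x $ a\<close> to \<open>0\<close> kills the monomials containing this
  variable and leaves the other terms unchanged.\<close>

lemma poly_fun_shrink:
  assumes "poly_fun r Z Q w e g" "a \<in> Q" "a \<notin> Z" "r > 0"
  shows "poly_fun r Z Q w e (\<lambda>x. g (shrink {a} 0 x))"
  using assms(1)
proof (induction rule: poly_fun.induct)
  case (zero g)
  then show ?case using shrink_cube[of _ r 0 "{a}"] by (intro poly_fun.zero) simp
next
  case (add f \<alpha> g h)
  have fe: "f (shrink {a} 0 x) = f x" if "x \<in> cube r" for x
    by (rule const_along_shrink[OF _ that]) (use add(1) assms(3) in \<open>auto simp: coeff_fun_def\<close>)
  have m: "monomial Q \<alpha> (shrink {a} 0 x) = (if \<alpha> a = 0 then monomial Q \<alpha> x else 0)" for x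
  proof -
    have "monomial (Q - {a}) \<alpha> (shrink {a} 0 x) = monomial (Q - {a}) \<alpha> x"
      unfolding monomial_def by (intro prod.cong) (auto simp: shrink_nth)
    then show ?thesis by (simp add: monomial_remove[OF assms(2)] shrink_nth)
  qed
  show ?case
  proof (cases "\<alpha> a = 0")
    case True
    show ?thesis
      by (rule poly_fun.add[OF add(1,2) add.IH]) (simp add: add(4) shrink_cube fe m True)
  next
    case False
    show ?thesis
      by (rule poly_fun_cong[OF add.IH]) (simp add: add(4) shrink_cube m False)
  qed
qed

lemma shrink_insert': "shrink {a} 0 (shrink S 0 x) = shrink (insert a S) 0 x"
  by (auto simp: shrink_def vec_eq_iff)

text \<open>One variable at a time: the increment of \<open>g\<close> in \<open>x $ a\<close> is the
  integral \<open>G\<close> of \<open>pd a g\<close> that vanishes for \<open>x $ a = 0\<close>, and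
  by \<open>poly_fun_shrink\<close> the slice of \<open>g\<close> at \<open>x $ a = 0\<close>
  satisfies the hypotheses for the remaining variables.\<close>

lemma poly_fun_increment:
  fixes g :: "real^'n \<Rightarrow> real"
  assumes "finite S" "S \<subseteq> Q" "S \<inter> Z = {}" "r > 0" "smooth_on (cube r) g"
    and "\<And>a. a \<in> S \<Longrightarrow> poly_fun r Z Q w (e - int (w a)) (pd a g)"
  shows "poly_fun r Z Q w e (\<lambda>x. g x - g (shrink S 0 x))"
  using assms
proof (induction S arbitrary: g rule: finite_induct)
  case empty
  show ?case by (rule poly_fun.zero) (simp add: shrink_def)
next
  case (insert a S)
  have aQ: "a \<in> Q" "a \<notin> Z" using insert.prems by auto
  note sg = insert.prems(4)
  let ?s = "shrink {a} 0 :: real^'n \<Rightarrow> real^'n"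
  define g' where "g' x = g (?s x)" for x
  have sg': "smooth_on (cube r) g'"
    unfolding g'_def by (rule smooth_on_compose[OF open_cube open_cube _ sg smooth_on_shrink])
        (auto intro: shrink_cube)
  have dg: "g differentiable (at (?s x))" if "x \<in> cube r" for x
      using smooth_onD(1)[OF sg shrink_cube[OF that]] by simp
  have pg': "pd b g' x = (if b = a then 0 else pd b g (?s x))" if "x \<in> cube r" for b x
    unfolding g'_def using pd_shrink(1)[OF dg[OF that], of b] by simp
  obtain G where G: "poly_fun r Z Q w (e - int (w a) + int (w a)) G"
    "\<And>x. x \<in> cube r \<Longrightarrow> pd a G x = pd a g x" "\<And>x. x \<in> cube r \<Longrightarrow> x $ a = 0 \<Longrightarrow> G x = 0"
    using poly_fun_integral[OF insert.prems(5) aQ] by blast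
  define h where "h x = g x - g' x - G x" for x
  note sG = poly_fun_smooth[OF G(1)]
  have sh: "smooth_on (cube r) h" unfolding h_def by (intro smooth_on_diff open_cube sg sg' sG)
  have ph: "pd a h x = 0" if x: "x \<in> cube r" for x
  proof -
    have "pd a h x = pd a g x - pd a g' x - pd a G x"
      unfolding h_def pd_def
      by (simp add: fd_diff smooth_onD(1)[OF sg x] smooth_onD(1)[OF sg' x] smooth_onD(1)[OF sG x]
          smooth_onD(1)[OF smooth_on_diff[OF open_cube sg sg'] x])
    then show ?thesis using G(2)[OF x] pg'[OF x] by simp
  qed
  have eqG: "g x - g' x = G x" if x: "x \<in> cube r" for x
  proof -
    have "h (?s x) = h x" by (rule const_along_shrink[OF sh x]) (use ph in auto)
    moreover have "?s (?s x) = ?s x" by (simp add: shrink_def vec_eq_iff)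
    moreover have "G (?s x) = 0" using G(3)[of "?s x"] shrink_cube[OF x, of 0] by (simp add: shrink_nth)
    ultimately show ?thesis by (simp add: h_def g'_def)
  qed
  have "poly_fun r Z Q w e (\<lambda>x. g' x - g' (shrink S 0 x))"
  proof (rule insert.IH[OF _ _ insert.prems(3) sg'])
    fix b assume b: "b \<in> S"
    have "poly_fun r Z Q w (e - int (w b)) (\<lambda>x. pd b g (?s x))"
      using insert.prems(5) b by (intro poly_fun_shrink aQ insert.prems(3)) auto
    then show "poly_fun r Z Q w (e - int (w b)) (pd b g')"
      by (rule poly_fun_cong) (use pg' b insert.hyps in auto)
  qed (use insert.prems in auto)
  then have "poly_fun r Z Q w e (\<lambda>x. (g' x - g' (shrink S 0 x)) + G x)"
    using G(1) by (intro poly_fun_add) simp_all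
  then show ?case
    by (rule poly_fun_cong) (simp add: eqG[symmetric], simp add: g'_def shrink_insert' insert.hyps)
qed

section \<open>Construction of weighted coordinates\<close>

text \<open>\<open>C\<close> is the set of coordinates already constructed, an initial segment for
  \<open>pos\<close>. By \<open>E_comp\<close> the frame is unitriangular in these coordinates;
  \<open>E_0\<close> normalizes the remaining frame fields at \<open>0\<close>, so that the next
  function can replace its coordinate.\<close>

locale graded_stage = graded_frame +
  fixes C :: "'a::finite set"
  assumes C_down: "b \<in> C \<Longrightarrow> pos a \<le> pos b \<Longrightarrow> a \<in> C"
    and E_comp: "b \<in> C \<Longrightarrow> pos b \<le> pos a \<Longrightarrow> x \<in> cube r \<Longrightarrow> E a x $ b = (if a = b then 1 else 0)"
    and coord_Fil: "b \<in> C \<Longrightarrow> Fil r E w (int (w b)) (\<lambda>x. x $ b)"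
    and E_0: "a \<notin> C \<Longrightarrow> E a 0 = axis a 1"
begin

definition Z where "Z = {b \<in> C. w b = 0}"
definition Q where "Q = {b \<in> C. 1 \<le> w b}"

definition base :: "(real^'a \<Rightarrow> real) \<Rightarrow> bool" where
  "base g \<longleftrightarrow> smooth_on B g \<and> (\<forall>b x. b \<notin> C \<longrightarrow> x \<in> B \<longrightarrow> pd b g x = 0)"

lemma pos_less: "a \<noteq> b \<Longrightarrow> pos a < pos b \<or> pos b < pos a"
  using inj_pos by (metis injD linorder_neqE_nat)

lemma notin_C_pos: "b \<in> C \<Longrightarrow> a \<notin> C \<Longrightarrow> pos b < pos a"
  using C_down by (meson not_le)

lemma pd_base:
  assumes g: "base g" and a: "a \<in> C" and x: "x \<in> B"
  shows "pd a g x = fd g x (E a x) - (\<Sum>b\<in>{b\<in>C. pos a < pos b}. E a x $ b * pd b g x)"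
proof -
  have d: "g differentiable (at x)" using g x smooth_onD(1) by (auto simp: base_def)
  have "fd g x (E a x) = (\<Sum>b\<in>UNIV. E a x $ b * pd b g x)" by (simp add: fd_expand[OF d])
  also have "\<dots> = (\<Sum>b\<in>insert a {b\<in>C. pos a < pos b}. E a x $ b * pd b g x)"
  proof (rule sum.mono_neutral_right)
    show "\<forall>i\<in>UNIV - insert a {b \<in> C. pos a < pos b}. E a x $ i * pd i g x = 0"
    proof
      fix i assume i: "i \<in> UNIV - insert a {b \<in> C. pos a < pos b}"
      show "E a x $ i * pd i g x = 0"
      proof (cases "i \<in> C")
        case True
        then have "pos i < pos a" using i pos_less[of i a] by auto
        then show ?thesis using E_comp[OF True _ x, of a] i by auto
      qed (use g x in \<open>simp add: base_def\<close>)
    qed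
  qed auto
  finally show ?thesis using E_comp[OF a order_refl x] by simp
qed

lemma F_E_comp: "b \<in> C \<Longrightarrow> 1 \<le> w a \<Longrightarrow> F (int (w b) - int (w a)) (\<lambda>x. E a x $ b)"
  using F_deriv[OF coord_Fil, of b a] by (simp add: fd_coord)

text \<open>Triangularity expresses \<open>pd a g\<close> by the derivative along \<open>E a\<close>
  and the \<open>pd b g\<close> at later positions, so the induction runs down from the last
  position. The threshold \<open>s\<close> permits control that is known only beyond a given
  position.\<close>

lemma F_pd:
  assumes g: "base g" and s: "\<And>a. a \<in> C \<Longrightarrow> s < pos a \<Longrightarrow> 1 \<le> w a"
    and F: "\<And>a. a \<in> C \<Longrightarrow> s < pos a \<Longrightarrow> F (e - int (w a)) (\<lambda>x. fd g x (E a x))"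
    and a: "a \<in> C" "s < pos a"
  shows "F (e - int (w a)) (pd a g)"
  using a
proof (induction "Max (range pos) - pos a" arbitrary: a rule: less_induct)
  case less
  have 1: "F (e - int (w a)) (\<lambda>x. E a x $ b * pd b g x)" if b: "b \<in> C" "pos a < pos b" for b
  proof -
    have "pos b \<le> Max (range pos)" by simp
    then have "Max (range pos) - pos b < Max (range pos) - pos a" using b(2) by linarith
    then have "F (e - int (w b)) (pd b g)" using b less(3) by (intro less(1)) auto
    then have "F ((int (w b) - int (w a)) + (e - int (w b))) (\<lambda>x. E a x $ b * pd b g x)"
      using s less b by (intro F_mult F_E_comp) auto
    then show ?thesis by (rule F_mono) simp
  qed
  have "F (e - int (w a)) (\<lambda>x. fd g x (E a x) - (\<Sum>b\<in>{b\<in>C. pos a < pos b}. E a x $ b * pd b g x))"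
    by (intro F_diff F_sum F less(2,3)) (use 1 in auto)
  then show ?case by (rule Fil_cong) (simp add: pd_base[OF g less(2)])
qed

text \<open>By triangularity a field \<open>E a\<close> of positive weight has no components in the
  coordinates of weight \<open>0\<close>, so it annihilates functions of these coordinates.\<close>

lemma F_coeff_fun:
  assumes "coeff_fun r Z f" shows "F 0 f"
proof (rule Fil.step)
  show sf: "smooth_on B f" using assms by (simp add: coeff_fun_def)
  fix a assume a: "1 \<le> w a"
  show "F (0 - int (w a)) (\<lambda>x. fd f x (E a x))"
  proof (rule F_zero)
    fix x assume x: "x \<in> B"
    have "E a x $ b * pd b f x = 0" for b
    proof (cases "b \<in> Z")
      case True
      then have b: "b \<in> C" "w b = 0" by (auto simp: Z_def)
      then have "pos b \<le> pos a" using a w_mono[of a b] by (cases "pos a \<le> pos b") auto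
      moreover have "a \<noteq> b" using a b(2) by auto
      ultimately show ?thesis using E_comp[OF b(1) _ x] by simp
    qed (use assms x in \<open>simp add: coeff_fun_def\<close>)
    then have "(\<Sum>b\<in>UNIV. E a x $ b * pd b f x) = 0" by (intro sum.neutral ballI)
    then show "fd f x (E a x) = 0" by (simp add: fd_expand[OF smooth_onD(1)[OF sf x]])
  qed
qed simp

lemma F_power: "F d g \<Longrightarrow> F (int m * d) (\<lambda>x. g x ^ m)"
proof (induction m)
  case 0 show ?case using F_const by simp
next
  case (Suc m)
  then have "F (d + int m * d) (\<lambda>x. g x * g x ^ m)" by (intro F_mult) auto
  then show ?case by (simp add: algebra_simps)
qed

lemma F_monomial:
  assumes "finite S" "S \<subseteq> C" shows "F (int (\<Sum>b\<in>S. w b * \<alpha> b)) (\<lambda>x. \<Prod>b\<in>S. x $ b ^ \<alpha> b)"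
  using assms
proof (induction S rule: finite_induct)
  case empty show ?case using F_const[of 0 1] by simp
next
  case (insert b S)
  have "F (int (\<alpha> b) * int (w b) + int (\<Sum>b\<in>S. w b * \<alpha> b)) (\<lambda>x. x $ b ^ \<alpha> b * (\<Prod>b\<in>S. x $ b ^ \<alpha> b))"
    using insert by (intro F_mult F_power coord_Fil) auto
  then show ?case using insert by (simp add: mult.commute)
qed

lemma poly_fun_F: "poly_fun r Z Q w e g \<Longrightarrow> F e g"
proof (induction rule: poly_fun.induct)
  case (zero g) then show ?case by (rule F_zero)
next
  case (add f \<alpha> g h)
  have "F (0 + int (\<Sum>b\<in>Q. w b * \<alpha> b)) (\<lambda>x. f x * monomial Q \<alpha> x)"
    unfolding monomial_def by (intro F_mult F_coeff_fun add(1) F_monomial) (auto simp: Q_def)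
  then have "F e (\<lambda>x. f x * monomial Q \<alpha> x + g x)" using add(2,5) by (intro F_add) (auto elim: F_mono)
  then show ?case by (rule Fil_cong) (simp add: add(4))
qed

lemma base_pd:
  assumes "base g" shows "base (pd a g)"
proof -
  have sg: "smooth_on B g" using assms by (simp add: base_def)
  have "pd b (pd a g) x = 0" if "b \<notin> C" "x \<in> B" for b x
  proof -
    have "pd b (pd a g) x = pd a (pd b g) x" by (rule pd_commute_real[OF open_cube sg that(2)])
    also have "\<dots> = 0" unfolding pd_def[of a]
      by (rule fd_zero[OF open_cube that(2)]) (use assms that(1) in \<open>auto simp: base_def\<close>)
    finally show ?thesis .
  qed
  then show ?thesis using smooth_onD(2)[OF sg] by (simp add: base_def)
qed

lemma base_shrink:
  assumes "base g" shows "base (\<lambda>x. g (shrink S 0 x))" "b \<in> S \<Longrightarrow> x \<in> B \<Longrightarrow> pd b (\<lambda>x. g (shrink S 0 x)) x = 0"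
proof -
  have sg: "smooth_on B g" using assms by (simp add: base_def)
  have p: "pd b (\<lambda>x. g (shrink S 0 x)) x = (if b \<in> S then 0 else 1) * pd b g (shrink S 0 x)" if "x \<in> B"
      for b x
    by (rule pd_shrink(1)) (rule smooth_onD(1)[OF sg shrink_cube[OF that]], auto)
  then show "b \<in> S \<Longrightarrow> x \<in> B \<Longrightarrow> pd b (\<lambda>x. g (shrink S 0 x)) x = 0" by simp
  have "smooth_on B (\<lambda>x. g (shrink S 0 x))"
    by (rule smooth_on_compose[OF open_cube open_cube _ sg smooth_on_shrink]) (auto intro: shrink_cube)
  then show "base (\<lambda>x. g (shrink S 0 x))"
    using p assms by (auto simp: base_def shrink_cube)
qed

text \<open>The partial derivatives in the variables \<open>Q\<close> have smaller degree and are
  polynomial by induction, so \<open>g\<close> differs by a polynomial from its slice where these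
  variables vanish; that slice depends on \<open>Z\<close> only.\<close>

lemma F_imp_poly_fun: "F e g \<Longrightarrow> base g \<Longrightarrow> poly_fun r Z Q w e g"
proof (induction "nat (e + 1)" arbitrary: e g rule: less_induct)
  case less
  show ?case
  proof (cases "e < 0")
    case True
    then show ?thesis using F_neg_zero[OF less(2)] by (intro poly_fun.zero) auto
  next
    case False
    have sg: "smooth_on B g" using less(3) by (simp add: base_def)
    have QC: "Q \<subseteq> C" "\<And>a. a \<in> Q \<Longrightarrow> 1 \<le> w a" "Q \<inter> Z = {}" by (auto simp: Q_def Z_def)
    have "F (e - int (w a)) (pd a g)" if a: "a \<in> Q" for a
    proof -
      have w: "1 \<le> w b" if "pos a \<le> pos b" for b using w_mono[OF that] QC(2)[OF a] by linarith
      show ?thesis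
      proof (cases "pos a")
        \<comment> \<open>\<open>F_pd\<close> needs a threshold strictly below \<open>pos a\<close>,
          so at position \<open>0\<close> the last triangular step is carried out directly.\<close>
        case 0
        have aC: "a \<in> C" using a QC by auto
        have w: "1 \<le> w b" for b using w[of b] 0 by simp
        show ?thesis
        proof -
          have 1: "F (e - int (w b)) (pd b g)" if "b \<in> C" "0 < pos b" for b
            by (rule F_pd[OF less(3) _ F_deriv[OF less(2)] that]) (use w in auto)
          have "F (e - int (w a)) (\<lambda>x. E a x $ b * pd b g x)" if b: "b \<in> C" "pos a < pos b" for b
          proof -
            have "F ((int (w b) - int (w a)) + (e - int (w b))) (\<lambda>x. E a x $ b * pd b g x)"
              using w b by (intro F_mult F_E_comp 1) auto
            then show ?thesis by (rule F_mono) simp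
          qed
          then have "F (e - int (w a)) (\<lambda>x. fd g x (E a x) - (\<Sum>b\<in>{b\<in>C. pos a < pos b}. E a x $ b * pd b
              g x))"
            by (intro F_diff F_sum F_deriv[OF less(2) w]) auto
          then show ?thesis by (rule Fil_cong) (simp add: pd_base[OF less(3) aC])
        qed
      next
        case (Suc s)
        show ?thesis
          by (rule F_pd[OF less(3) _ F_deriv[OF less(2)], of s]) (use w Suc a QC in auto)
      qed
    qed
    then have "poly_fun r Z Q w (e - int (w a)) (pd a g)" if "a \<in> Q" for a
      using QC(2)[OF that] False that by (intro less(1) base_pd less(3)) auto
    then have 1: "poly_fun r Z Q w e (\<lambda>x. g x - g (shrink Q 0 x))"
      by (intro poly_fun_increment QC r_pos sg) auto
    have "coeff_fun r Z (\<lambda>x. g (shrink Q 0 x))"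
      unfolding coeff_fun_def
    proof (intro conjI allI impI)
      note bs = base_shrink(1)[OF less(3), of Q]
      show "smooth_on B (\<lambda>x. g (shrink Q 0 x))" using bs by (simp add: base_def)
      fix b x assume b: "b \<notin> Z" "x \<in> B"
      show "pd b (\<lambda>x. g (shrink Q 0 x)) x = 0"
      proof (cases "b \<in> C")
        case True
        then have "b \<in> Q" using b(1) by (simp add: Z_def Q_def)
        then show ?thesis using b(2) by (rule base_shrink(2)[OF less(3)])
      qed (use bs b(2) in \<open>simp add: base_def\<close>)
    qed
    then have "poly_fun r Z Q w e (\<lambda>x. g (shrink Q 0 x))"
      using False by (rule_tac \<alpha>="\<lambda>_. 0" and g="\<lambda>_. 0" in poly_fun.add)
        (auto simp: monomial_def intro: poly_fun.zero)
    from poly_fun_add[OF 1 this] show ?thesis by (rule poly_fun_cong) simp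
  qed
qed

text \<open>The form dual to \<open>E p\<close> is closed in the variables \<open>- C\<close>, since brackets of the corresponding frame
  fields have degree greater than \<open>w p\<close>. Its primitive is then corrected by functions of the earlier
  coordinates, one position at a time, until its derivatives along all \<open>E a\<close> have the right degree.\<close>

context
  fixes p assumes p: "p \<notin> C" and p_next: "pos a < pos p \<Longrightarrow> a \<in> C"
begin

definition S where "S = - C"

lemma S_pos: "a \<in> S \<longleftrightarrow> pos p \<le> pos a"
proof
  assume "a \<in> S" then show "pos p \<le> pos a" using p_next by (force simp: S_def)
next
  assume "pos p \<le> pos a" then show "a \<in> S" using p C_down by (auto simp: S_def)
qed

definition cvf :: "'a \<Rightarrow> real^'a \<Rightarrow> real^'a" where "cvf i = restrict_vf B (\<lambda>_. axis i 1)"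

lemma cvf_vf: "cvf i \<in> vector_fields B"
proof -
  have "(\<lambda>_. axis i 1) \<in> vector_fields UNIV" by (rule vector_fieldsI) (auto simp: smooth_on_const)
  then show ?thesis unfolding cvf_def by (rule restrict_vf_vector_fields[OF open_cube subset_UNIV])
qed

lemma cvf_at: "x \<in> B \<Longrightarrow> cvf i x = axis i 1"
  by (simp add: cvf_def restrict_vf_def)

lemma fd_cvf: "x \<in> B \<Longrightarrow> fd (cvf i) x v = 0"
  using fd_cong[OF open_cube, of x r "cvf i" "\<lambda>_. axis i 1"] by (simp add: cvf_at)

text \<open>The components of the one-form that is \<open>1\<close> on \<open>E p\<close> and
  \<open>0\<close> on the other frame fields.\<close>

definition \<theta> :: "'a \<Rightarrow> real^'a \<Rightarrow> real" where "\<theta> j x = coef E x p (cvf j x)"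

lemma smooth_\<theta>: "smooth_on B (\<theta> j)"
  unfolding \<theta>_def[abs_def]
      by (rule smooth_on_coef[OF open_cube E_smooth det_E vector_fieldsD(1)[OF cvf_vf]])

text \<open>Components are compared in increasing order of position: once the coefficients at
  earlier positions vanish, triangularity reduces component \<open>l\<close> of the coordinate field
  \<open>j\<close> to its coefficient on \<open>E l\<close>, and this component is \<open>0\<close>
  because \<open>j \<noteq> l\<close>.\<close>

lemma coef_cvf_zero:
  assumes j: "j \<in> S" and l: "l \<notin> S" and x: "x \<in> B" shows "coef E x l (cvf j x) = 0"
  using l
proof (induction "pos l" arbitrary: l rule: less_induct)
  case less
  then have lC: "l \<in> C" by (simp add: S_def)
  have "(\<Sum>a\<in>UNIV. coef E x a (cvf j x) * E a x $ l) = (\<Sum>a\<in>UNIV. if a = l then coef E x l (cvf j x) else 0)"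
  proof (rule sum.cong[OF refl])
    fix a
    consider "a = l" | "pos a < pos l" | "pos l < pos a" using pos_less by blast
    then show "coef E x a (cvf j x) * E a x $ l = (if a = l then coef E x l (cvf j x) else 0)"
    proof cases
      case 1 then show ?thesis using E_comp[OF lC _ x, of a] by simp
    next
      case 2
      then have "a \<notin> S" using lC C_down by (auto simp: S_def)
      then show ?thesis using less(1)[OF 2] 2 by auto
    next
      case 3 then show ?thesis using E_comp[OF lC _ x, of a] by auto
    qed
  qed
  moreover have "(\<Sum>a\<in>UNIV. coef E x a (cvf j x) * E a x $ l)
      = (\<Sum>a\<in>UNIV. coef E x a (cvf j x) *\<^sub>R E a x) $ l"
    by simp
  moreover have "(\<Sum>a\<in>UNIV. coef E x a (cvf j x) *\<^sub>R E a x) = axis j 1"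
      by (simp add: coef_expand det_E x cvf_at)
  moreover have "j \<noteq> l" using j less by auto
  ultimately show ?case by (simp add: axis_def)
qed

text \<open>Both weights are at least \<open>w p\<close>, so the index
  \<open>max 1 (w l + w m)\<close> of the bracket exceeds \<open>w p\<close>. For
  \<open>w p = 0\<close> this rests on the \<open>1\<close>, that is, on solvability.\<close>

lemma coef_bracket_S:
  assumes "l \<in> S" "m \<in> S" "x \<in> B" shows "coef E x p (vf_bracket B (E l) (E m) x) = 0"
proof (rule A_span[OF A_bracket[OF E_A E_A] assms(3)])
  have "w p \<le> w l" "w p \<le> w m" using assms S_pos w_mono by auto
  then show "w p < max 1 (w l + w m)" by linarith
qed

text \<open>The coefficient on \<open>E p\<close> of the vanishing bracket of two coordinate fields
  is expanded twice by \<open>coef_bracket\<close>. Brackets of frame fields drop out by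
  \<open>coef_bracket_S\<close>, and what remains is the symmetry.\<close>

lemma \<theta>_closed:
  assumes i: "i \<in> S" and j: "j \<in> S" and x: "x \<in> B" shows "pd i (\<theta> j) x = pd j (\<theta> i) x"
proof -
  have cb: "coef E x c (vf_bracket B X Y x) = fd (\<lambda>x. coef E x c (Y x)) x (X x)
      + (\<Sum>l\<in>UNIV. coef E x l (Y x) * coef E x c (vf_bracket B X (E l) x))"
    if "X \<in> vector_fields B" "Y \<in> vector_fields B" for X Y c
    by (rule coef_bracket[OF open_cube x order_refl E_vf _ that]) (rule det_E)
  have z: "vf_bracket B (cvf i) (cvf j) x = 0" by (simp add: vf_bracket_in[OF x] fd_cvf[OF x])
  have lin: "linear (coef E x p)" by (rule linear_coef[OF det_E[OF x]])
  have 1: "0 = pd i (\<theta> j) x + (\<Sum>l\<in>UNIV. coef E x l (cvf j x) * coef E x p (vf_bracket B (cvf i) (E l) x))"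
    using cb[OF cvf_vf cvf_vf, of p i j] linear_0[OF lin] z
      by (simp add: pd_def \<theta>_def[abs_def] cvf_at[OF x])
  have 2: "coef E x l (cvf j x) * coef E x p (vf_bracket B (cvf i) (E l) x)
      = - (coef E x l (cvf j x) * fd (\<theta> i) x (E l x))" for l
  proof (cases "l \<in> S")
    case False then show ?thesis using coef_cvf_zero[OF j _ x] by simp
  next
    case True
    have "vf_bracket B (cvf i) (E l) x = - vf_bracket B (E l) (cvf i) x"
      using fun_cong[OF vf_bracket_anti[of B "cvf i" "E l"], of x] by simp
    then have "coef E x p (vf_bracket B (cvf i) (E l) x) = - coef E x p (vf_bracket B (E l) (cvf i) x)"
      by (simp add: linear_neg[OF lin])
    also have "coef E x p (vf_bracket B (E l) (cvf i) x) = fd (\<theta> i) x (E l x)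
        + (\<Sum>m\<in>UNIV. coef E x m (cvf i x) * coef E x p (vf_bracket B (E l) (E m) x))"
      using cb[OF E_vf cvf_vf, of p l i] by (simp add: \<theta>_def[abs_def])
    also have "(\<Sum>m\<in>UNIV. coef E x m (cvf i x) * coef E x p (vf_bracket B (E l) (E m) x)) = 0"
    proof (rule sum.neutral, rule ballI)
      fix m show "coef E x m (cvf i x) * coef E x p (vf_bracket B (E l) (E m) x) = 0"
        using coef_cvf_zero[OF i _ x, of m] coef_bracket_S[OF True _ x, of m] by (cases "m \<in> S") auto
    qed
    finally show ?thesis by simp
  qed
  have "(\<Sum>l\<in>UNIV. coef E x l (cvf j x) * fd (\<theta> i) x (E l x)) = pd j (\<theta> i) x"
    using deriv_expand[OF smooth_\<theta> x, of i "axis j 1"] by (simp add: pd_def cvf_at[OF x])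
  with 1 show ?thesis by (simp add: 2 sum_negf)
qed

lemma primitive_0: "primitive T h 0 = 0"
  by (simp add: primitive_def)

text \<open>For \<open>a \<in> S\<close> the field \<open>E a\<close> has no components in
  \<open>C\<close>, so its action on the primitive involves only the variables in which the form is
  closed and returns the coefficient of \<open>E a\<close> on \<open>E p\<close>.\<close>

lemma initial_coordinate:
  defines "f \<equiv> primitive S \<theta>"
  shows "smooth_on B f" "f 0 = 0" "a \<in> S \<Longrightarrow> x \<in> B \<Longrightarrow> fd f x (E a x) = (if a = p then 1 else 0)"
proof -
  show sf: "smooth_on B f" unfolding f_def by (rule smooth_on_primitive[OF smooth_\<theta>])
  show "f 0 = 0" unfolding f_def by (rule primitive_0)
  show "fd f x (E a x) = (if a = p then 1 else 0)" if a: "a \<in> S" and x: "x \<in> B"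
  proof -
    have "fd f x (E a x) = (\<Sum>j\<in>UNIV. E a x $ j * pd j f x)"
        by (simp add: fd_expand[OF smooth_onD(1)[OF sf x]])
    also have "\<dots> = (\<Sum>j\<in>UNIV. E a x $ j * coef E x p (axis j 1))"
    proof (rule sum.cong[OF refl])
      fix j
      show "E a x $ j * pd j f x = E a x $ j * coef E x p (axis j 1)"
      proof (cases "j \<in> S")
        case True
        then have "pd j f x = \<theta> j x"
          unfolding f_def by (intro pd_primitive[OF smooth_\<theta> x True]) (auto intro: \<theta>_closed)
        then show ?thesis by (simp add: \<theta>_def cvf_at[OF x])
      next
        case False
        then have "j \<in> C" "pos j \<le> pos a" "a \<noteq> j" using a notin_C_pos[of j a] by (auto simp: S_def)
        then show ?thesis using E_comp[OF _ _ x] by simp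
      qed
    qed
    also have "\<dots> = coef E x p (\<Sum>j\<in>UNIV. E a x $ j *\<^sub>R axis j 1)"
      using linear_coef[OF det_E[OF x], of p] by (simp add: linear_sum linear_scale)
    also have "\<dots> = coef E x p (E a x)" by (simp add: vec_expand[symmetric])
    finally show ?thesis using coef_frame[OF det_E[OF x], of p a] by auto
  qed
qed

text \<open>One correction, at the position \<open>s\<close> of \<open>q\<close>. Commuting
  \<open>E a\<close> with \<open>E q\<close> shows that \<open>g\<close>, the derivative of
  \<open>f\<close> along \<open>E q\<close>, has derivatives of the right degree along later fields.
  Hence \<open>g\<close> has degree at most \<open>e\<close> up to its slice \<open>g2\<close>,
  which depends only on coordinates up to \<open>q\<close>. Subtracting the primitive of
  \<open>g2\<close> in the variable \<open>q\<close> removes it without changing derivatives along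
  later fields.\<close>

lemma correct_coordinate:
  assumes f: "smooth_on B f" "f 0 = 0" and fS: "\<And>a x. a \<in> S \<Longrightarrow> x \<in> B \<Longrightarrow> fd f x (E a x)
      = (if a = p then 1 else 0)"
    and fF: "\<And>a. 1 \<le> w a \<Longrightarrow> s < pos a \<Longrightarrow> F (int (w p) - int (w a)) (\<lambda>x. fd f x (E a x))"
    and q: "q \<in> C" "pos q = s" "1 \<le> w q"
  obtains f' where "smooth_on B f'" "f' 0 = 0"
    "\<And>a x. a \<in> S \<Longrightarrow> x \<in> B \<Longrightarrow> fd f' x (E a x) = (if a = p then 1 else 0)"
    "\<And>a. 1 \<le> w a \<Longrightarrow> s \<le> pos a \<Longrightarrow> F (int (w p) - int (w a)) (\<lambda>x. fd f' x (E a x))"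
proof -
  define e where "e = int (w p) - int (w q)"
  define g where "g x = fd f x (E q x)" for x
  have sg: "smooth_on B g" unfolding g_def by (rule smooth_deriv[OF f(1) E_A])
  have gF: "F (e - int (w a)) (\<lambda>x. fd g x (E a x))" if a: "1 \<le> w a" "s < pos a" for a
  proof -
    have "F (int (w p) - int (w a) - int (w q)) (\<lambda>x. fd (\<lambda>x. fd f x (E a x)) x (E q x))"
      by (rule F_deriv[OF fF[OF a] q(3)])
    moreover have "F (int (w p) - int (w a + w q)) (\<lambda>x. fd f x (vf_bracket B (E a) (E q) x))"
    proof (rule F_A_deriv_pos[OF bracket_E_A[OF a(1) E_A] _ f(1) fF])
      fix b assume b: "w a + w q \<le> w b"
      then show "1 \<le> w b" using a by simp
      have "w q < w b" using b a(1) by linarith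
      then show "s < pos b" using q(2) w_mono[of b q] by linarith
    qed (use a in simp)
    ultimately have "F (e - int (w a)) (\<lambda>x. fd (\<lambda>x. fd f x (E a x)) x (E q x)
        + fd f x (vf_bracket B (E a) (E q) x))"
      by (intro F_add) (simp_all add: e_def algebra_simps)
    then show ?thesis
      by (rule Fil_cong) (simp add: bracket_derivation[OF open_cube f(1) E_vf E_vf] g_def[abs_def])
  qed
  have pq: "pos q < pos p" using q(1) p C_down by (meson not_le)
  \<comment> \<open>For \<open>a \<in> S\<close> the degree \<open>w p - w q - w a\<close> is
    negative, since \<open>w a \<ge> w p\<close> and \<open>w q \<ge> 1\<close>. Consequently
    \<open>g\<close> depends on the constructed coordinates only.\<close>
  have gS: "fd g x (E a x) = 0" if a: "a \<in> S" "x \<in> B" for a x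
  proof (rule F_neg_zero[OF gF _ a(2)])
    have "pos p \<le> pos a" using a S_pos by simp
    then have "w p \<le> w a" "w q \<le> w p" "s < pos a" using pq w_mono q(2) by auto
    then show "1 \<le> w a" "s < pos a" "e - int (w a) < 0" using q(3) by (auto simp: e_def)
  qed
  have gb: "base g"
    unfolding base_def
  proof (intro conjI allI impI sg)
    fix b x assume b: "b \<notin> C" "x \<in> B"
    have "pd b g x = (\<Sum>a\<in>UNIV. coef E x a (cvf b x) * fd g x (E a x))"
      using deriv_expand[OF sg b(2), of "axis b 1"] by (simp add: pd_def cvf_at[OF b(2)])
    also have "\<dots> = 0"
    proof (rule sum.neutral, rule ballI)
      fix a show "coef E x a (cvf b x) * fd g x (E a x) = 0"
        using coef_cvf_zero[of b a x] gS[of a x] b by (cases "a \<in> S") (auto simp: S_def)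
    qed
    finally show "pd b g x = 0" .
  qed
  define S' where "S' = {a \<in> C. s < pos a}"
  have wS': "1 \<le> w a" if "s < pos a" for a using w_mono[of q a] that q by linarith
  have S'Q: "S' \<subseteq> Q" "S' \<inter> Z = {}" using wS' by (fastforce simp: S'_def Q_def Z_def)+
  have "poly_fun r Z Q w (e - int (w a)) (pd a g)" if "a \<in> S'" for a
    by (rule F_imp_poly_fun[OF F_pd[OF gb _ gF] base_pd[OF gb]]) (use that wS' in \<open>auto simp: S'_def\<close>)
  then have P: "F e (\<lambda>x. g x - g (shrink S' 0 x))"
    by (intro poly_fun_F poly_fun_increment S'Q r_pos sg) auto
  define g2 where "g2 x = g (shrink S' 0 x)" for x
  have b2: "base g2" unfolding g2_def by (rule base_shrink(1)[OF gb])
  then have s2: "smooth_on B g2" by (simp add: base_def)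
  have p2: "pd b g2 x = 0" if "pos q < pos b" "x \<in> B" for b x
    using b2 base_shrink(2)[OF gb, of b S' x] that q(2) unfolding base_def g2_def[abs_def] S'_def
      by (cases "b \<in> C") auto
  define h where "h = primitive {q} (\<lambda>_. g2)"
  have sh: "smooth_on B h" unfolding h_def by (rule smooth_on_primitive[OF s2])
  have hq: "pd q h x = g2 x" if "x \<in> B" for x
    unfolding h_def by (rule pd_primitive[OF s2 that]) auto
  have hb: "pd b h x = 0" if b: "pos q < pos b" and x: "x \<in> B" for b x
  proof -
    have "shrink_int {q} 0 (pd b g2) x = integral {0..1} (\<lambda>t::real. 0)"
      unfolding shrink_int_def by (rule Henstock_Kurzweil_Integration.integral_cong)
          (use p2[OF b] shrink_cube[OF x] in auto)
    moreover have "b \<noteq> q" using b by auto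
    ultimately show ?thesis unfolding h_def by (subst pd_primitive_aux[OF s2 x]) auto
  qed
  have hE: "fd h x (E a x) = (if a = q then g2 x else 0)" if a: "pos q \<le> pos a" and x: "x \<in> B" for a x
  proof -
    have "fd h x (E a x) = (\<Sum>b\<in>UNIV. E a x $ b * pd b h x)"
        by (simp add: fd_expand[OF smooth_onD(1)[OF sh x]])
    also have "\<dots> = (\<Sum>b\<in>UNIV. if b = q then (if a = q then g2 x else 0) else 0)"
    proof (rule sum.cong[OF refl])
      fix b
      consider "b = q" | "pos b < pos q" | "pos q < pos b" using pos_less by blast
      then show "E a x $ b * pd b h x = (if b = q then (if a = q then g2 x else 0) else 0)"
      proof cases
        case 1 then show ?thesis using E_comp[OF q(1) a x] hq[OF x] by auto
      next
        case 2
        then have "b \<in> C" "pos b \<le> pos a" "a \<noteq> b" "b \<noteq> q" using C_down[OF q(1), of b] a by auto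
        then show ?thesis using E_comp[OF _ _ x] by simp
      next
        case 3 then show ?thesis using hb[OF 3 x] by auto
      qed
    qed
    finally show ?thesis by simp
  qed
  define f' where "f' x = f x - h x" for x
  have fd': "fd f' x v = fd f x v - fd h x v" if "x \<in> B" for x v
    unfolding f'_def by (rule fd_diff[OF smooth_onD(1)[OF f(1) that] smooth_onD(1)[OF sh that]])
  show ?thesis
  proof (rule that[of f'])
    show "smooth_on B f'" unfolding f'_def by (intro smooth_on_diff open_cube f sh)
    show "f' 0 = 0" by (simp add: f'_def f h_def primitive_0)
    show "fd f' x (E a x) = (if a = p then 1 else 0)" if "a \<in> S" "x \<in> B" for a x
    proof -
      have "pos q \<le> pos a" "a \<noteq> q" using that q(1) pq S_pos by (auto simp: S_def)
      then show ?thesis using fd'[OF that(2)] fS[OF that] hE[OF _ that(2)] by simp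
    qed
    show "F (int (w p) - int (w a)) (\<lambda>x. fd f' x (E a x))" if a: "1 \<le> w a" "s \<le> pos a" for a
    proof (cases "a = q")
      case True
      show ?thesis
        by (rule Fil_cong[OF P[unfolded e_def, folded True]]) (simp add: fd' hE True g_def g2_def)
    next
      case False
      then have "s < pos a" using a(2) q(2) pos_less[OF False] by linarith
      from Fil_cong[OF fF[OF a(1) this]] show ?thesis
        using False a(2) q(2) by (simp add: fd' hE)
    qed
  qed
qed

text \<open>Downward induction on the position, from that of \<open>p\<close> to \<open>0\<close>.
  It starts with the primitive, whose derivatives along \<open>E a\<close> with
  \<open>a \<in> S\<close> are constant; positions of weight \<open>0\<close> carry no condition,
  and at position \<open>0\<close> the property says that the degree is at most
  \<open>w p\<close>.\<close>

lemma next_coordinate: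
  obtains f where "smooth_on B f" "f 0 = 0"
    "\<And>a x. a \<in> S \<Longrightarrow> x \<in> B \<Longrightarrow> fd f x (E a x) = (if a = p then 1 else 0)" "F (int (w p)) f"
proof -
  define P where "P s f \<longleftrightarrow> smooth_on B f \<and> f 0 = 0 \<and>
    (\<forall>a x. a \<in> S \<longrightarrow> x \<in> B \<longrightarrow> fd f x (E a x) = (if a = p then 1 else 0)) \<and>
    (\<forall>a. 1 \<le> w a \<longrightarrow> s \<le> pos a \<longrightarrow> F (int (w p) - int (w a)) (\<lambda>x. fd f x (E a x)))" for s f
  have init: "P (pos p) (primitive S \<theta>)"
    unfolding P_def
  proof (intro conjI allI impI initial_coordinate)
    fix a assume a: "1 \<le> w a" "pos p \<le> pos a"
    then have aS: "a \<in> S" using S_pos by simp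
    show "F (int (w p) - int (w a)) (\<lambda>x. fd (primitive S \<theta>) x (E a x))"
    proof (cases "a = p")
      case True
      show ?thesis by (rule Fil_cong[OF F_const[of _ 1]]) (use True initial_coordinate(3)[OF aS] in auto)
    next
      case False
      show ?thesis by (rule F_zero) (use False initial_coordinate(3)[OF aS] in auto)
    qed
  qed
  have "\<exists>f. P s f" if "s \<le> pos p" for s
    using that
  proof (induction s rule: inc_induct)
    case base then show ?case using init by blast
  next
    case (step s)
    then obtain f where f: "P (Suc s) f" by blast
    show ?case
    proof (cases "\<exists>q. pos q = s \<and> 1 \<le> w q")
      case False
      have "Suc s \<le> pos a" if "1 \<le> w a" "s \<le> pos a" for a
        using False that by (metis Suc_leI le_neq_implies_less)
      then have "P s f" using f unfolding P_def by blast
      then show ?thesis by blast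
    next
      case True
      then obtain q where q: "pos q = s" "1 \<le> w q" by blast
      have qC: "q \<in> C" using p_next q step by simp
      obtain f' where "smooth_on B f'" "f' 0 = 0"
        "\<And>a x. a \<in> S \<Longrightarrow> x \<in> B \<Longrightarrow> fd f' x (E a x) = (if a = p then 1 else 0)"
        "\<And>a. 1 \<le> w a \<Longrightarrow> s \<le> pos a \<Longrightarrow> F (int (w p) - int (w a)) (\<lambda>x. fd f' x (E a x))"
        by (rule correct_coordinate[of f s q]) (use f q qC in \<open>auto simp: P_def Suc_le_eq\<close>)
      then show ?thesis unfolding P_def by blast
    qed
  qed
  from this[of 0] obtain f where f: "P 0 f" by auto
  have "F (int (w p)) f" by (rule Fil.step) (use f in \<open>auto simp: P_def\<close>)
  then show ?thesis using that f unfolding P_def by blast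
qed

end

end

section \<open>Passing to new coordinates on a cube\<close>

lemma cube_chart:
  fixes f :: "real^'n \<Rightarrow> real^'n"
  assumes U: "open U" "0 \<in> U" and f: "smooth_on U f" "f 0 = 0" and inj: "inj (fd f 0)"
  obtains V r where "r > 0" "V \<subseteq> U" "local_coordinates V f" "f ` V = cube r"
proof -
  obtain V0 where V0: "open V0" "0 \<in> V0" "V0 \<subseteq> U" "inj_on f V0" "open (f ` V0)"
      "smooth_on (f ` V0) (inv_into V0 f)"
    by (rule smooth_inverse_function[OF U(1) f(1) U(2) inj])
  have "0 \<in> f ` V0" using V0(2) f(2) by force
  then obtain r where r: "r > 0" "cube r \<subseteq> f ` V0" by (rule cube_subset_open[OF V0(5)])
  have nb: "connected (cube r :: (real^'n) set)" "0 \<in> (cube r :: (real^'n) set)"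
    using connected_nbhd_cube[where 'a='n, OF r(1)] by (simp_all add: connected_nbhd_def)
  define V where "V = inv_into V0 f ` cube r"
  have VV0: "V \<subseteq> V0" using r(2) inv_into_into[of _ f V0] by (auto simp: V_def)
  have "(\<lambda>y. f (inv_into V0 f y)) ` cube r = (\<lambda>y. y) ` cube r"
    by (rule image_cong) (use r(2) in \<open>auto intro: f_inv_into_f\<close>)
  then have im: "f ` V = cube r" by (simp add: V_def image_image)
  have Veq: "V = V0 \<inter> f -` cube r"
  proof
    show "V \<subseteq> V0 \<inter> f -` cube r" using VV0 im by auto
    show "V0 \<inter> f -` cube r \<subseteq> V"
    proof
      fix x assume x: "x \<in> V0 \<inter> f -` cube r"
      then have "f x \<in> f ` V" using im by simp
      then show "x \<in> V" using x VV0 inj_onD[OF V0(4)] by blast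
    qed
  qed
  have "open V" unfolding Veq
    using continuous_open_preimage[OF smooth_onD(3)[OF smooth_on_subset[OF f(1) V0(3)]] V0(1) open_cube] .
  moreover have "connected V" unfolding V_def
    by (rule connected_continuous_image[OF continuous_on_subset[OF smooth_onD(3)[OF V0(6)] r(2)]])
        (use nb in simp)
  moreover have "0 \<in> V" using Veq V0(2) f(2) nb by auto
  moreover have injV: "inj_on f V" using inj_on_subset[OF V0(4) VV0] .
  moreover have "smooth_on (cube r) (inv_into V f)"
  proof (rule smooth_on_cong[OF open_cube, THEN iffD1, OF _ smooth_on_subset[OF V0(6) r(2)]])
    fix y :: "real^'n" assume y: "y \<in> cube r"
    show "inv_into V0 f y = inv_into V f y"
    proof (rule inv_into_f_eq[OF injV, symmetric])
      show "inv_into V0 f y \<in> V" using y by (simp add: V_def)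
      show "f (inv_into V0 f y) = y" using y r(2) by (auto intro: f_inv_into_f)
    qed
  qed
  ultimately have "local_coordinates V f"
    using smooth_on_subset[OF f(1)] VV0 V0(3) f(2) open_cube
    by (auto simp: local_coordinates_def connected_nbhd_def im)
  then show ?thesis using that[OF r(1) _ _ im] VV0 V0(3) by blast
qed

context graded_frame begin

context
  fixes V \<phi> r'
  assumes lc: "local_coordinates V \<phi>" and VB: "V \<subseteq> B" and im: "\<phi> ` V = cube r'" and r': "r' > 0"
begin

abbreviation "push \<equiv> pushforward V \<phi>"

lemma det_push: "x \<in> V \<Longrightarrow> det (frame_matrix (\<lambda>a. push (E a)) (\<phi> x)) \<noteq> 0"
proof -
  assume x: "x \<in> V"
  have d: "\<phi> differentiable (at x)" by (rule smooth_onD(1)[OF local_coordinatesD(7)[OF lc] x])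
  note lin = linear_frechet_derivative[OF d]
  have "inj (fd \<phi> x)" using fd_coordinates_inverse(1)[OF lc x] by (rule inj_on_inverseI)
  then have "det (matrix (fd \<phi> x)) \<noteq> 0" by (simp add: det_nz_iff_inj[OF lin])
  moreover have "frame_matrix (\<lambda>a. push (E a)) (\<phi> x) = matrix (fd \<phi> x) ** frame_matrix E x"
  proof -
    have "fd \<phi> x v $ a = (\<Sum>c\<in>UNIV. matrix (fd \<phi> x) $ a $ c * v $ c)" for v a
      using fun_cong[OF matrix_vector_mul(2)[OF lin], of v]
        by (auto simp: matrix_vector_mult_def vec_eq_iff)
    then show ?thesis
      by (simp add: frame_matrix_def matrix_matrix_mult_def pushforward_at[OF lc x])
  qed
  ultimately show ?thesis using det_E VB x by (auto simp: det_mul)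
qed

lemma coef_push:
  assumes x: "x \<in> V"
  shows "coef (\<lambda>a. push (E a)) (\<phi> x) a (push Y (\<phi> x)) = coef E x a (Y x)"
proof -
  have xB: "x \<in> B" using x VB by blast
  have lin: "linear (fd \<phi> x)"
    by (rule linear_frechet_derivative[OF smooth_onD(1)[OF local_coordinatesD(7)[OF lc] x]])
  have "push Y (\<phi> x) = fd \<phi> x (\<Sum>a\<in>UNIV. coef E x a (Y x) *\<^sub>R E a x)"
    by (simp add: pushforward_at[OF lc x] coef_expand det_E xB)
  also have "\<dots> = (\<Sum>a\<in>UNIV. coef E x a (Y x) *\<^sub>R push (E a) (\<phi> x))"
    using lin by (simp add: linear_sum linear_scale pushforward_at[OF lc x])
  finally show ?thesis by (simp add: coef_unique[OF det_push[OF x]])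
qed

lemma graded_frame_push: "graded_frame r' (\<lambda>j. push ` A j) (\<lambda>a. push (E a)) w pos"
proof
  show "0 < r'" by (rule r')
  show "inj pos" by (rule inj_pos)
  show "w a \<le> w b" if "pos a \<le> pos b" for a b using w_mono[OF that] .
  show "push ` A j \<subseteq> vector_fields (cube r')" for j
    using pushforward_vector_fields[OF lc smooth_on_subset[OF A_smooth VB]] by (auto simp: im)
  show "push (E a) \<in> push ` A (w a)" for a using E_A by blast
  show "det (frame_matrix (\<lambda>a. push (E a)) x) \<noteq> 0" if "x \<in> cube r'" for x
    using det_push that unfolding im[symmetric] by blast
  show "coef (\<lambda>a. push (E a)) x a (Y x) = 0" if Y: "Y \<in> push ` A j" "x \<in> cube r'" "w a < j" for Y j x a
  proof -
    obtain X z where X: "X \<in> A j" "Y = push X" "z \<in> V" "x = \<phi> z" using Y(1,2) im by blast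
    have "z \<in> B" using X(3) VB by blast
    then show ?thesis using A_span[OF X(1) _ Y(3)] by (simp add: X coef_push)
  qed
  show "vf_bracket (cube r') X Y \<in> push ` A (max 1 (i + j))" if XY: "X \<in> push ` A i" "Y \<in> push ` A j"
      for X Y i j
  proof -
    obtain X' Y' where X': "X' \<in> A i" "Y' \<in> A j" "X = push X'" "Y = push Y'" using XY by blast
    have "vf_bracket (cube r') X Y = push (vf_bracket B X' Y')"
    proof -
      have "X' \<in> vector_fields B" "Y' \<in> vector_fields B" using X' A_vf by blast+
      then show ?thesis using pushforward_bracket[OF lc VB open_cube, of X' Y'] X' im by simp
    qed
    then show ?thesis using A_bracket[OF X'(1,2)] by blast
  qed
qed

lemma Fil_push:
  "F d g \<Longrightarrow> Fil r' (\<lambda>a. push (E a)) w d (\<lambda>y. g (inv_into V \<phi> y))"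
proof (induction rule: Fil.induct)
  case (neg d g)
  then show ?case using local_coordinatesD(12)[OF lc] VB im by (intro Fil.neg) auto
next
  case (step d g)
  note D = local_coordinatesD[OF lc]
  have sm: "smooth_on (cube r') (\<lambda>y. g (inv_into V \<phi> y))"
    using D(8,12) VB im by (intro smooth_on_compose[OF open_cube open_cube _ step(2)]) auto
  show ?case
  proof (rule Fil.step[OF step(1) sm])
    fix a assume a: "1 \<le> w a"
    interpret P: graded_frame r' "\<lambda>j. push ` A j" "\<lambda>a. push (E a)" w pos by (rule graded_frame_push)
    show "Fil r' (\<lambda>a. push (E a)) w (d - int (w a)) (\<lambda>y. fd (\<lambda>y. g (inv_into V \<phi> y)) y (push (E a) y))"
    proof (rule Fil_cong[OF step.IH[OF a]])
      fix y assume "y \<in> (cube r' :: (real^'n) set)"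
      then obtain x where x: "x \<in> V" "y = \<phi> x" using im by blast
      have "fd (\<lambda>y. g (inv_into V \<phi> y)) (\<phi> x) (push (E a) (\<phi> x)) = fd (\<lambda>x. g (inv_into V \<phi> (\<phi> x))) x
          (E a x)"
        by (rule pushforward_function[OF lc x(1)]) (rule smooth_onD(1)[OF sm], use x im in blast)
      also have "fd (\<lambda>x. g (inv_into V \<phi> (\<phi> x))) x = fd g x"
        by (rule fd_cong[OF D(1) x(1)]) (simp add: D(11))
      finally show "fd g (inv_into V \<phi> y) (E a (inv_into V \<phi> y)) = fd (\<lambda>y. g (inv_into V \<phi> y)) y
          (push (E a) y)"
        using x D(11)[OF x(1)] by simp
    qed
  qed
qed

end

end

text \<open>The chart replaces coordinate \<open>p\<close> by the new function \<open>f\<close> and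
  keeps the others. Its differential at \<open>0\<close> is invertible: \<open>E p\<close> equals
  \<open>axis p 1\<close> there, so \<open>pd p f 0\<close> is the derivative of \<open>f\<close>
  along \<open>E p\<close>, which is \<open>1\<close>.\<close>

lemma (in graded_stage) advance:
  assumes p: "p \<notin> C" and p_next: "\<And>a. pos a < pos p \<Longrightarrow> a \<in> C"
  obtains V \<phi> r' where "r' > 0" "V \<subseteq> B" "local_coordinates V \<phi>" "\<phi> ` V = cube r'"
    "graded_stage r' (\<lambda>j. pushforward V \<phi> ` A j) (\<lambda>a. pushforward V \<phi> (E a)) w pos (insert p C)"
proof -
  obtain f where f: "smooth_on B f" "f 0 = 0"
      "\<And>a x. a \<in> S \<Longrightarrow> x \<in> B \<Longrightarrow> fd f x (E a x) = (if a = p then 1 else 0)"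
    "F (int (w p)) f"
    using next_coordinate[OF p p_next] by blast
  define \<phi> :: "real^'a \<Rightarrow> real^'a" where "\<phi> x = (\<chi> i. if i = p then f x else x $ i)" for x
  have s\<phi>: "smooth_on B \<phi>"
  proof (rule smooth_on_vec[OF open_cube])
    fix j show "smooth_on B (\<lambda>x. \<phi> x $ j)"
      by (cases "j = p") (simp_all add: \<phi>_def f smooth_on_coord)
  qed
  have fd\<phi>: "fd \<phi> x v $ i = (if i = p then fd f x v else v $ i)" if "x \<in> B" for x v i
    using fd_component[OF smooth_onD(1)[OF s\<phi> that], of i v]
    by (cases "i = p") (simp_all add: \<phi>_def fd_coord)
  have B0: "0 \<in> B" using r_pos by (simp add: cube_def)
  have pS: "p \<in> S" using p by (simp add: S_def[OF p p_next])
  have lin: "linear (fd \<phi> 0)" by (rule linear_frechet_derivative[OF smooth_onD(1)[OF s\<phi> B0]])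
  have pf: "pd p f 0 = 1" using f(3)[OF pS B0] E_0[OF p] by (simp add: pd_def)
  have inj\<phi>: "inj (fd \<phi> 0)"
    unfolding linear_injective_0[OF lin]
  proof (intro allI impI)
    fix v assume v: "fd \<phi> 0 v = 0"
    have z: "v $ i = 0" if "i \<noteq> p" for i using fd\<phi>[OF B0, of v i] v that by simp
    have "fd f 0 v = (\<Sum>i\<in>UNIV. if i = p then v $ p else 0)"
      unfolding fd_expand[OF smooth_onD(1)[OF f(1) B0]] by (intro sum.cong refl) (auto simp: z pf)
    then have "v $ p = 0" using fd\<phi>[OF B0, of v p] v by simp
    then show "v = 0" using z by (metis vec_eq_iff zero_index)
  qed
  have \<phi>0: "\<phi> 0 = 0" by (simp add: \<phi>_def f vec_eq_iff)
  obtain V r' where V: "r' > 0" "V \<subseteq> B" "local_coordinates V \<phi>" "\<phi> ` V = cube r'"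
    by (rule cube_chart[OF open_cube B0 s\<phi> \<phi>0 inj\<phi>])
  interpret P: graded_frame r' "\<lambda>j. pushforward V \<phi> ` A j" "\<lambda>a. pushforward V \<phi> (E a)" w pos
    by (rule graded_frame_push[OF V(3,2,4,1)])
  note Dc = local_coordinatesD[OF V(3)]
  have at: "pushforward V \<phi> X (\<phi> x) $ i = (if i = p then fd f x (X x) else X x $ i)" if "x \<in> V" for X x i
    using fd\<phi>[of x "X x" i] that V(2) by (auto simp: pushforward_at[OF V(3) that])
  have pC: "pos b < pos p" if "b \<in> C" for b using that p C_down by (meson not_le)
  have "graded_stage r' (\<lambda>j. pushforward V \<phi> ` A j) (\<lambda>a. pushforward V \<phi> (E a)) w pos (insert p C)"
  proof
    show "a \<in> insert p C" if "b \<in> insert p C" "pos a \<le> pos b" for a b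
      using that C_down p_next pos_less[of a p] by (cases "a = p") auto
    show "pushforward V \<phi> (E a) y $ b = (if a = b then 1 else 0)"
      if b: "b \<in> insert p C" "pos b \<le> pos a" and y: "y \<in> cube r'" for a b y
    proof -
      obtain x where x: "x \<in> V" "y = \<phi> x" using y V(4) by blast
      have xB: "x \<in> B" using x V(2) by blast
      show ?thesis
      proof (cases "b = p")
        case True
        then have "a \<in> S" using b(2) S_pos[OF p p_next] by simp
        then show ?thesis using at[OF x(1)] f(3)[OF _ xB] True x(2) by auto
      next
        case False
        then show ?thesis using at[OF x(1)] E_comp[OF _ b(2) xB] b(1) x(2) by auto
      qed
    qed
    show "Fil r' (\<lambda>a. pushforward V \<phi> (E a)) w (int (w b)) (\<lambda>y. y $ b)" if b: "b \<in> insert p C" for b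
    proof -
      have "F (int (w b)) (\<lambda>x. \<phi> x $ b)"
      proof (cases "b = p")
        case True then show ?thesis using f(4) by (simp add: \<phi>_def)
      next
        case False then show ?thesis using coord_Fil[of b] b by (simp add: \<phi>_def)
      qed
      from Fil_push[OF V(3,2,4,1) this] show ?thesis
        by (rule Fil_cong) (use Dc(13) V(4) in simp)
    qed
    show "pushforward V \<phi> (E a) 0 = axis a 1" if a: "a \<notin> insert p C" for a
    proof -
      have aS: "a \<in> S" "a \<noteq> p" using a by (auto simp: S_def[OF p p_next])
      have "pushforward V \<phi> (E a) (\<phi> 0) = axis a 1"
        unfolding vec_eq_iff at[OF Dc(3)] using f(3)[OF aS(1) B0] E_0[of a] a aS(2) by (auto simp: axis_def)
      then show ?thesis using Dc(4) by simp
    qed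
  qed
  then show ?thesis using that[OF V] by blast
qed

text \<open>The induction starts from the empty set of constructed coordinates, where only
  \<open>E_0\<close> has content, and applies \<open>advance\<close> position by position, composing
  the charts.\<close>

lemma (in graded_frame) weighted_coordinates:
  assumes E0: "\<And>a. E a 0 = axis a 1"
  obtains V \<phi> r' where "r' > 0" "V \<subseteq> B" "local_coordinates V \<phi>" "\<phi> ` V = cube r'"
    "graded_stage r' (\<lambda>j. pushforward V \<phi> ` A j) (\<lambda>a. pushforward V \<phi> (E a)) w pos UNIV"
proof -
  have "\<exists>V \<phi> r'. r' > 0 \<and> V \<subseteq> B \<and> local_coordinates V \<phi> \<and> \<phi> ` V = cube r' \<and>
      graded_stage r' (\<lambda>j. pushforward V \<phi> ` A j) (\<lambda>a. pushforward V \<phi> (E a)) w pos {b. pos b < c}" for c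
  proof (induction c)
    case 0
    have lc: "local_coordinates B (\<lambda>x. x)"
    proof -
      have "inv_into B (\<lambda>x. x) y = y" if "y \<in> B" for y using inv_into_f_eq[of "\<lambda>x. x" B y y] that by simp
      then have "smooth_on B (inv_into B (\<lambda>x. x))"
        using smooth_on_cong[OF open_cube, of r "inv_into B (\<lambda>x. x)" "\<lambda>x. x"] smooth_on_ident by blast
      then show ?thesis using connected_nbhd_cube[OF r_pos]
          by (simp add: local_coordinates_def smooth_on_ident open_cube)
    qed
    have id: "pushforward B (\<lambda>x. x) X = X" if "X \<in> A j" for X j
    proof
      fix y show "pushforward B (\<lambda>x. x) X y = X y"
      proof (cases "y \<in> B")
        case True then show ?thesis using pushforward_at[OF lc True, of X] by simp
      next
        case False
        moreover have "X \<in> vector_fields B" using that A_vf by blast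
        ultimately show ?thesis using vector_fieldsD(2) by (auto simp: pushforward_def)
      qed
    qed
    have "pushforward B (\<lambda>x. x) ` A j = (\<lambda>X. X) ` A j" for j by (rule image_cong) (simp_all add: id)
    then have "(\<lambda>j. pushforward B (\<lambda>x. x) ` A j) = A" by simp
    moreover have "(\<lambda>a. pushforward B (\<lambda>x. x) (E a)) = E" using id[OF E_A] by auto
    moreover have "graded_stage r A E w pos {b. pos b < 0}" by unfold_locales (auto simp: E0)
    ultimately show ?case using lc r_pos by (intro exI[of _ B] exI[of _ "\<lambda>x. x"] exI[of _ r]) simp
  next
    case (Suc c)
    then obtain V \<phi> r' where V: "r' > 0" "V \<subseteq> B" "local_coordinates V \<phi>" "\<phi> ` V = cube r'"
      "graded_stage r' (\<lambda>j. pushforward V \<phi> ` A j) (\<lambda>a. pushforward V \<phi> (E a)) w pos {b. pos b < c}"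
          by blast
    show ?case
    proof (cases "\<exists>p. pos p = c")
      case False
      then have "{b. pos b < Suc c} = {b. pos b < c}" by (auto simp: less_Suc_eq)
      then show ?thesis using Suc.IH by simp
    next
      case True
      then obtain p where p: "pos p = c" by blast
      have ins: "insert p {b. pos b < c} = {b. pos b < Suc c}" using p inj_pos
          by (auto simp: less_Suc_eq inj_def)
      interpret P: graded_stage r' "\<lambda>j. pushforward V \<phi> ` A j" "\<lambda>a. pushforward V \<phi> (E a)" w pos
          "{b. pos b < c}" by (rule V(5))
      obtain W \<psi> r'' where W: "r'' > 0" "W \<subseteq> cube r'" "local_coordinates W \<psi>" "\<psi> ` W = cube r''"
        "graded_stage r'' (\<lambda>j. pushforward W \<psi> ` pushforward V \<phi> ` A j)
            (\<lambda>a. pushforward W \<psi> (pushforward V \<phi> (E a))) w pos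
          (insert p {b. pos b < c})"
        by (rule P.advance[of p]) (use p that in auto)
      have WV: "W \<subseteq> \<phi> ` V" using W(2) V(4) by simp
      note comp = local_coordinates_compose[OF V(3) W(3) WV refl]
      show ?thesis
      proof (intro exI conjI)
        show "r'' > 0" by (rule W(1))
        show "inv_into V \<phi> ` W \<subseteq> B" using comp(2) V(2) by blast
        show "local_coordinates (inv_into V \<phi> ` W) (\<lambda>x. \<psi> (\<phi> x))" by (rule comp(1))
        show "(\<lambda>x. \<psi> (\<phi> x)) ` inv_into V \<phi> ` W = cube r''" using comp(4) W(4) by simp
        show "graded_stage r'' (\<lambda>j. pushforward (inv_into V \<phi> ` W) (\<lambda>x. \<psi> (\<phi> x)) ` A j)
          (\<lambda>a. pushforward (inv_into V \<phi> ` W) (\<lambda>x. \<psi> (\<phi> x)) (E a)) w pos {b. pos b < Suc c}"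
          using W(5) unfolding ins image_image comp(5) .
      qed
    qed
  qed
  moreover have "{b. pos b < Suc (Max (range pos))} = UNIV" by (auto simp: less_Suc_eq_le)
  ultimately have
    "\<exists>V \<phi> r'. r' > 0 \<and> V \<subseteq> B \<and> local_coordinates V \<phi> \<and> \<phi> ` V = cube r' \<and>
      graded_stage r' (\<lambda>j. pushforward V \<phi> ` A j) (\<lambda>a. pushforward V \<phi> (E a)) w pos UNIV"
    by metis
  then show ?thesis using that by blast
qed

section \<open>Homogeneous vector fields\<close>

lemma weight_field_at: "x \<in> W \<Longrightarrow> weight_field W w x = (\<chi> c. real (w c) * x $ c)"
  by (simp add: weight_field_def)

lemma linear_weight: "linear (\<lambda>x::real^'n. \<chi> c. real (w c) * x $ c)"
  by (rule linearI) (auto simp: vec_eq_iff algebra_simps)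

lemma smooth_on_linear:
  fixes h :: "real^'n \<Rightarrow> real^'m"
  assumes "linear h" shows "smooth_on U h"
proof -
  have "smooth_on UNIV h"
    by (rule smooth_on_bounded_linear[OF linear_conv_bounded_linear[THEN iffD1, OF assms] open_UNIV
        smooth_on_ident])
  then show ?thesis by (rule smooth_on_subset) simp
qed

lemma fd_linear: "linear h \<Longrightarrow> fd (h :: real^'n \<Rightarrow> real^'m) x v = h v"
  using fd_eqI[OF bounded_linear_imp_has_derivative[OF linear_conv_bounded_linear[THEN iffD1]], of h x]
    by metis

lemma weight_field_vf: "open W \<Longrightarrow> weight_field W w \<in> vector_fields W"
proof (rule vector_fieldsI)
  assume "open W"
  then show "smooth_on W (weight_field W w)"
    using smooth_on_cong[of W "weight_field W w" "\<lambda>x. \<chi> c. real (w c) * x $ c"]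
      smooth_on_linear[OF linear_weight]
    by (simp add: weight_field_at)
qed (simp add: weight_field_def)

lemma subspace_homog: "open W \<Longrightarrow> subspace (homog W w i)"
proof -
  assume W: "open W"
  note sv = subspace_vector_fields[OF W] and wf = weight_field_vf[OF W, of w]
  have 0: "vf_bracket W (weight_field W w) 0 = 0"
    using vf_bracket_scale_right[OF wf wf, of 0] by simp
  show ?thesis
    unfolding subspace_def homog_def
    using subspace_0[OF sv] subspace_add[OF sv] subspace_scale[OF sv]
    by (auto simp: vf_bracket_add_right[OF wf] vf_bracket_scale_right[OF wf] 0 scaleR_add_right)
qed

text \<open>Reduces statements about sums of homogeneous fields to span induction over single
  homogeneous fields.\<close>

lemma homog_sum_span: "open W \<Longrightarrow> homog_sum W w lo hi = span (\<Union>i\<in>{lo..hi}. homog W w i)"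
proof
  assume W: "open W"
  note S = subspace_homog[OF W, of w]
  show "homog_sum W w lo hi \<subseteq> span (\<Union>i\<in>{lo..hi}. homog W w i)"
    unfolding homog_sum_def by (auto intro!: span_sum intro: span_base)
  show "span (\<Union>i\<in>{lo..hi}. homog W w i) \<subseteq> homog_sum W w lo hi"
  proof (rule span_minimal)
    show "subspace (homog_sum W w lo hi)"
    proof (rule subspaceI)
      show "0 \<in> homog_sum W w lo hi"
        unfolding homog_sum_def by (rule CollectI, rule exI[of _ "\<lambda>_. 0"]) (use subspace_0[OF S] in simp)
      fix X Y c assume "X \<in> homog_sum W w lo hi" "Y \<in> homog_sum W w lo hi"
      then obtain f g where f: "X = (\<Sum>i\<in>{lo..hi}. f i)" "\<forall>i\<in>{lo..hi}. f i \<in> homog W w i"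
        and g: "Y = (\<Sum>i\<in>{lo..hi}. g i)" "\<forall>i\<in>{lo..hi}. g i \<in> homog W w i" by (auto simp: homog_sum_def)
      show "X + Y \<in> homog_sum W w lo hi"
        unfolding homog_sum_def
        by (rule CollectI, rule exI[of _ "\<lambda>i. f i + g i"])
            (use f g subspace_add[OF S] in \<open>simp add: sum.distrib\<close>)
      show "c *\<^sub>R X \<in> homog_sum W w lo hi"
        unfolding homog_sum_def
        by (rule CollectI, rule exI[of _ "\<lambda>i. c *\<^sub>R f i"])
            (use f subspace_scale[OF S] in \<open>simp add: scaleR_sum_right\<close>)
    qed
    show "(\<Union>i\<in>{lo..hi}. homog W w i) \<subseteq> homog_sum W w lo hi"
    proof
      fix X assume "X \<in> (\<Union>i\<in>{lo..hi}. homog W w i)"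
      then obtain i where i: "i \<in> {lo..hi}" "X \<in> homog W w i" by blast
      then show "X \<in> homog_sum W w lo hi"
        unfolding homog_sum_def
        by (intro CollectI exI[of _ "\<lambda>j. if j = i then X else 0"]) (auto simp: subspace_0[OF S])
    qed
  qed
qed

lemma homog_sum_mono: "open W \<Longrightarrow> lo' \<le> lo \<Longrightarrow> hi \<le> hi' \<Longrightarrow> homog_sum W w lo hi \<subseteq> homog_sum W w lo' hi'"
  unfolding homog_sum_span by (intro span_mono UN_mono) auto

lemma subspace_homog_sum: "open W \<Longrightarrow> subspace (homog_sum W w lo hi)"
  by (simp add: homog_sum_span)

lemma homog_in_sum: "open W \<Longrightarrow> lo \<le> i \<Longrightarrow> i \<le> hi \<Longrightarrow> X \<in> homog W w i \<Longrightarrow> X \<in> homog_sum W w lo hi"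
  unfolding homog_sum_span by (rule span_base) auto

lemma homog_vf: "homog W w i \<subseteq> vector_fields W"
  by (auto simp: homog_def)

lemma homog_sum_vf: "open W \<Longrightarrow> homog_sum W w lo hi \<subseteq> vector_fields W"
  unfolding homog_sum_span by (rule span_minimal) (auto simp: subspace_vector_fields homog_def)

lemma homog_bracket:
  assumes W: "open W" and X: "X \<in> homog W w i" and Y: "Y \<in> homog W w j"
  shows "vf_bracket W X Y \<in> homog W w (i + j)"
proof -
  have vf: "X \<in> vector_fields W" "Y \<in> vector_fields W" using X Y by (auto simp: homog_def)
  note wf = weight_field_vf[OF W, of w]
  have "vf_bracket W (weight_field W w) (vf_bracket W X Y)
      = vf_bracket W (real_of_int i *\<^sub>R X) Y + vf_bracket W X (real_of_int j *\<^sub>R Y)"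
    using vf_jacobi[OF W wf vf] X Y by (simp add: homog_def)
  also have "\<dots> = real_of_int (i + j) *\<^sub>R vf_bracket W X Y"
    by (simp add: vf_bracket_scale_left[OF vf] vf_bracket_scale_right[OF vf] scaleR_add_left)
  finally show ?thesis using vf_bracket_vector_fields[OF W vf] by (simp add: homog_def)
qed

lemma homog_sum_bracket:
  assumes W: "open W" and X: "X \<in> homog_sum W w a b" and Y: "Y \<in> homog_sum W w c d"
  shows "vf_bracket W X Y \<in> homog_sum W w (a + c) (b + d)"
proof -
  note sub = subspace_homog_sum[OF W, of w "a + c" "b + d"]
  have vf: "homog_sum W w lo hi \<subseteq> vector_fields W" for lo hi by (rule homog_sum_vf[OF W])
  have 0: "vf_bracket W X 0 = 0" "vf_bracket W 0 X = 0" if "X \<in> vector_fields W" for X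
    using vf_bracket_scale_right[OF that that, of 0] vf_bracket_scale_left[OF that that, of 0] by simp_all
  have 1: "vf_bracket W X Y \<in> homog_sum W w (a + c) (b + d)" if X: "X \<in> homog W w i" "a \<le> i" "i \<le> b" for X i
    using Y[unfolded homog_sum_span[OF W]]
  proof (induction rule: span_induct_step)
    case base
    show ?case using 0(1) X(1) homog_vf subspace_0[OF sub] by (metis subsetD)
  next
    case (step e Z Y)
    then obtain j where j: "Z \<in> homog W w j" "c \<le> j" "j \<le> d" by auto
    have Yv: "Y \<in> vector_fields W" using step(2) vf[of c d] unfolding homog_sum_span[OF W] by blast
    have Zv: "Z \<in> vector_fields W" and Xv: "X \<in> vector_fields W" using j X homog_vf by blast+
    have eZ: "e *\<^sub>R Z \<in> vector_fields W" using subspace_scale[OF subspace_vector_fields[OF W] Zv] .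
    have "vf_bracket W X Z \<in> homog_sum W w (a + c) (b + d)"
      using homog_bracket[OF W X(1) j(1)] X j by (intro homog_in_sum[OF W, of _ "i + j"]) auto
    then show ?case
      using step(3) sub
      by (simp add: vf_bracket_add_right[OF Xv eZ Yv] vf_bracket_scale_right[OF Xv Zv] subspace_add
          subspace_scale
          del: plus_fun_apply)
  qed
  have Yv: "Y \<in> vector_fields W" using Y vf by blast
  show ?thesis
    using X[unfolded homog_sum_span[OF W]]
  proof (induction rule: span_induct_step)
    case base
    show ?case using 0(2)[OF Yv] subspace_0[OF sub] by (simp del: zero_fun_apply)
  next
    case (step e Z X)
    then obtain i where i: "Z \<in> homog W w i" "a \<le> i" "i \<le> b" by auto
    have Xv: "X \<in> vector_fields W" using step(2) vf[of a b] unfolding homog_sum_span[OF W] by blast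
    have Zv: "Z \<in> vector_fields W" using i homog_vf by blast
    have eZ: "e *\<^sub>R Z \<in> vector_fields W" using subspace_scale[OF subspace_vector_fields[OF W] Zv] .
    show ?case
      using 1[OF i] step(3) sub
      by (simp add: vf_bracket_add_left[OF eZ Xv Yv] vf_bracket_scale_left[OF Zv Yv] subspace_add
          subspace_scale
          del: plus_fun_apply)
  qed
qed

text \<open>Homogeneous fields are eigenvectors of the bracket with the weight field: applying this
  operator to the relation and subtracting \<open>a\<close> times the relation eliminates
  \<open>X a\<close>.\<close>

lemma homog_independent:
  assumes W: "open W" and "finite S" "\<And>i. i \<in> S \<Longrightarrow> X i \<in> homog W w i" "(\<Sum>i\<in>S. X i) = 0"
  shows "\<forall>i\<in>S. X i = 0"
  using assms(2-4)
proof (induction S arbitrary: X rule: finite_induct)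
  case (insert a S)
  define T where "T Y = vf_bracket W (weight_field W w) Y" for Y
  note wf = weight_field_vf[OF W, of w]
  have vf: "X i \<in> vector_fields W" if "i \<in> insert a S" for i using insert.prems(1)[OF that] homog_vf
      by blast
  have Ts: "T (\<Sum>i\<in>S'. X i) = (\<Sum>i\<in>S'. real_of_int i *\<^sub>R X i)" if "S' \<subseteq> insert a S" for S'
    using finite_subset[OF that] insert.hyps(1) that
  proof (induction S' rule: infinite_finite_induct)
    case (insert b S')
    have "sum X S' \<in> vector_fields W" using insert.prems vf subspace_vector_fields[OF W]
        by (intro subspace_sum) auto
    then have "T (X b + sum X S') = T (X b) + T (sum X S')" unfolding T_def
      using insert.prems vf by (intro vf_bracket_add_right wf) auto
    moreover have "T (X b) = real_of_int b *\<^sub>R X b"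
        using insert.prems \<open>\<And>i. i \<in> insert a S \<Longrightarrow> X i \<in> homog W w i\<close> by (auto simp: T_def homog_def)
    ultimately show ?case using insert by (simp del: plus_fun_apply)
  qed (use vf_bracket_scale_right[OF wf wf, of 0] in \<open>auto simp: T_def\<close>)
  have "(\<Sum>i\<in>insert a S. real_of_int i *\<^sub>R X i) = 0"
    using Ts[OF order_refl] insert.prems(2) vf_bracket_scale_right[OF wf wf, of 0]
      by (simp add: T_def del: zero_fun_apply)
  moreover have "(\<Sum>i\<in>insert a S. real_of_int a *\<^sub>R X i) = 0"
    using insert.prems(2) by (simp only: scaleR_sum_right[symmetric] scaleR_zero_right)
  ultimately have "(\<Sum>i\<in>insert a S. real_of_int (i - a) *\<^sub>R X i) = 0"
    by (simp only: of_int_diff scaleR_diff_left sum_subtractf diff_0_right)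
  then have "(\<Sum>i\<in>S. real_of_int (i - a) *\<^sub>R X i) = 0" using insert.hyps by simp
  then have "\<forall>i\<in>S. real_of_int (i - a) *\<^sub>R X i = 0"
    using insert.prems(1) subspace_scale[OF subspace_homog[OF W]] by (intro insert.IH) auto
  then have S0: "\<forall>i\<in>S. X i = 0" using insert.hyps(2) by auto
  then have "X a = 0" using insert.prems(2) insert.hyps by (simp del: zero_fun_apply plus_fun_apply)
  then show ?case using S0 by (simp del: zero_fun_apply)
qed simp

lemma homog_0_neg_zero:
  assumes W: "open W" and X: "X \<in> homog W w 0" "X \<in> homog_sum W w lo (- 1)" shows "X = 0"
proof -
  obtain f where f: "X = (\<Sum>i\<in>{lo..-1}. f i)" "\<forall>i\<in>{lo..-1}. f i \<in> homog W w i" using X(2)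
      by (auto simp: homog_sum_def)
  define g where "g i = (if i = 0 then - X else f i)" for i
  have "(\<Sum>i\<in>insert 0 {lo..-1}. g i) = - X + (\<Sum>i\<in>{lo..-1}. g i)" by (subst sum.insert) (auto simp: g_def)
  also have "(\<Sum>i\<in>{lo..-1}. g i) = X" unfolding f(1) by (rule sum.cong) (auto simp: g_def)
  finally have "(\<Sum>i\<in>insert 0 {lo..-1}. g i) = 0" by (simp only: left_minus)
  moreover have "g i \<in> homog W w i" if "i \<in> insert 0 {lo..-1}" for i
    using that f(2) X(1) subspace_neg[OF subspace_homog[OF W]] by (auto simp: g_def)
  ultimately have "g 0 = 0" using homog_independent[OF W, of "insert 0 {lo..-1}" g w] by blast
  then show ?thesis by (simp add: g_def)
qed

section \<open>Homogeneous fields with weighted polynomial components\<close>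

lemma euler_monomial:
  "fd (\<lambda>x. \<Prod>b\<in>S. x $ b ^ \<alpha> b) x (\<chi> c. real (w c) * x $ c) = real (\<Sum>b\<in>S. w b * \<alpha> b) *
      (\<Prod>b\<in>S. (x::real^'n) $ b ^ \<alpha> b)"
proof (induction S rule: infinite_finite_induct)
  case (insert a S)
  let ?v = "\<chi> c. real (w c) * x $ c"
  have hd: "((\<lambda>x::real^'n. x $ a) has_derivative (\<lambda>v. v $ a)) (at x)"
    by (rule bounded_linear_imp_has_derivative[OF bounded_linear_vec_nth])
  have "((\<lambda>x::real^'n. x $ a ^ \<alpha> a) has_derivative (\<lambda>v. real (\<alpha> a) * v $ a * x $ a ^ (\<alpha> a - 1))) (at x)"
    using has_derivative_power[OF hd, of "\<alpha> a"] by simp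
  then have "fd (\<lambda>x::real^'n. x $ a ^ \<alpha> a) x ?v = real (\<alpha> a) * (real (w a) * x $ a) * x $ a ^ (\<alpha> a - 1)"
    by (simp add: fd_eqI)
  also have "\<dots> = real (w a * \<alpha> a) * x $ a ^ \<alpha> a"
    by (cases "\<alpha> a") (simp_all add: algebra_simps)
  finally have 1: "fd (\<lambda>x::real^'n. x $ a ^ \<alpha> a) x ?v = real (w a * \<alpha> a) * x $ a ^ \<alpha> a" .
  have d: "(\<lambda>x::real^'n. x $ a ^ \<alpha> a) differentiable (at x)"
      "(\<lambda>x::real^'n. \<Prod>b\<in>S. x $ b ^ \<alpha> b) differentiable (at x)"
    using smooth_onD(1)[OF smooth_on_power[OF open_UNIV smooth_on_coord]]
      smooth_onD(1)[OF smooth_on_monomial[of UNIV S \<alpha>]]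
    by (auto simp: monomial_def[abs_def])
  have "fd (\<lambda>x. x $ a ^ \<alpha> a * (\<Prod>b\<in>S. x $ b ^ \<alpha> b)) x ?v
      = x $ a ^ \<alpha> a * (real (\<Sum>b\<in>S. w b * \<alpha> b) * (\<Prod>b\<in>S. x $ b ^ \<alpha> b)) + real (w a * \<alpha> a) * x $ a ^ \<alpha> a *
          (\<Prod>b\<in>S. x $ b ^ \<alpha> b)"
    unfolding fd_mult[OF d] insert.IH 1 ..
  then show ?case using insert.hyps by (simp add: algebra_simps)
qed simp_all

definition coord_field :: "(real^'n) set \<Rightarrow> 'n \<Rightarrow> (real^'n \<Rightarrow> real) \<Rightarrow> real^'n \<Rightarrow> real^'n" where
  "coord_field W c g = (\<lambda>x. if x \<in> W then g x *\<^sub>R axis c 1 else 0)"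

text \<open>Differentiating \<open>g\<close> along the weight field contributes its degree
  \<open>d\<close>; differentiating the weight field in direction \<open>c\<close> contributes
  \<open>- w c\<close>.\<close>

lemma coord_field_homog:
  assumes W: "open W" and g: "smooth_on W g" and e: "\<And>x. x \<in> W \<Longrightarrow> fd g x (\<chi> c. real (w c) * x $ c)
      = real_of_int d * g x"
  shows "coord_field W c g \<in> homog W w (d - int (w c))"
proof -
  have "smooth_on W (\<lambda>x. g x *\<^sub>R axis c 1 :: real^'a)" by (rule smooth_on_scaleR[OF W g smooth_on_const])
  then have s: "smooth_on W (coord_field W c g)"
    by (rule smooth_on_cong[OF W, THEN iffD1, rotated]) (simp add: coord_field_def)
  have "vf_bracket W (weight_field W w) (coord_field W c g) = real_of_int (d - int (w c)) *\<^sub>R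
      coord_field W c g"
  proof
    fix x show "vf_bracket W (weight_field W w) (coord_field W c g) x
        = (real_of_int (d - int (w c)) *\<^sub>R coord_field W c g) x"
    proof (cases "x \<in> W")
      case True
      let ?v = "\<chi> c. real (w c) * x $ c"
      have "fd (coord_field W c g) x ?v = fd (\<lambda>x. g x *\<^sub>R axis c 1 :: real^'a) x ?v"
        by (subst fd_cong[OF W True, of "coord_field W c g" "\<lambda>x. g x *\<^sub>R axis c 1"])
            (auto simp: coord_field_def)
      also have "\<dots> = (real_of_int d * g x) *\<^sub>R axis c 1"
        using fd_scaleR[OF smooth_onD(1)[OF g True] differentiable_const, of "axis c 1 :: real^'a" ?v]
          e[OF True] by simp
      finally have 1: "fd (coord_field W c g) x (weight_field W w x) = (real_of_int d * g x) *\<^sub>R axis c 1"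
        by (simp add: weight_field_at[OF True])
      have "fd (weight_field W w) x v = fd (\<lambda>x::real^'a. \<chi> c. real (w c) * x $ c) x v" for v
        by (subst fd_cong[OF W True, of "weight_field W w" "\<lambda>x. \<chi> c. real (w c) * x $ c"])
            (auto simp: weight_field_at)
      then have 2: "fd (weight_field W w) x (coord_field W c g x) = (real (w c) * g x) *\<^sub>R axis c 1"
        by (simp add: fd_linear[OF linear_weight] coord_field_def True) (simp add: vec_eq_iff axis_def)
      show ?thesis
        unfolding vf_bracket_in[OF True] 1 2
            by (simp add: scaleR_fun_def coord_field_def True left_diff_distrib scaleR_diff_left)
    qed (simp add: vf_bracket_def coord_field_def scaleR_fun_def)
  qed
  then show ?thesis using s by (auto simp: homog_def vector_fields_def) (simp add: coord_field_def)
qed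

text \<open>The weight field annihilates functions of the weight-0 coordinates, so every term has
  the degree of its monomial, which lies between \<open>0\<close> and \<open>e\<close> and is
  lowered by \<open>w c\<close>.\<close>

lemma poly_fun_field:
  assumes "poly_fun r Z Q w e g" "\<And>b. b \<in> Z \<Longrightarrow> w b = 0"
  shows "coord_field (cube r) c g \<in> homog_sum (cube r) w (- int (w c)) (e - int (w c))"
  using assms(1)
proof (induction rule: poly_fun.induct)
  case (zero g)
  then have "coord_field (cube r) c g = 0" by (auto simp: coord_field_def fun_eq_iff)
  then show ?case using subspace_0[OF subspace_homog_sum[OF open_cube]] by (simp del: zero_fun_apply)
next
  case (add f \<alpha> g h)
  let ?d = "int (\<Sum>b\<in>Q. w b * \<alpha> b)"
  have sf: "smooth_on (cube r) f" using add(1) by (simp add: coeff_fun_def)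
  have "coord_field (cube r) c (\<lambda>x. f x * monomial Q \<alpha> x) \<in> homog (cube r) w (?d - int (w c))"
  proof (rule coord_field_homog[OF open_cube smooth_on_mult[OF open_cube sf smooth_on_monomial]])
    fix x :: "real^'a" assume x: "x \<in> cube r"
    have "(\<chi> c. real (w c) * x $ c) $ b * pd b f x = 0" for b
      using add(1) x assms(2) by (cases "b \<in> Z") (auto simp: coeff_fun_def)
    then have "(\<Sum>b\<in>UNIV. (\<chi> c. real (w c) * x $ c) $ b * pd b f x) = 0" by (intro sum.neutral ballI)
    then have "fd f x (\<chi> c. real (w c) * x $ c) = 0"
      unfolding fd_expand[OF smooth_onD(1)[OF sf x]] by simp
    moreover have "fd (monomial Q \<alpha>) x (\<chi> c. real (w c) * x $ c) = real_of_int ?d * monomial Q \<alpha> x"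
      using euler_monomial[of \<alpha> Q x w] by (simp add: monomial_def[abs_def])
    ultimately show "fd (\<lambda>x. f x * monomial Q \<alpha> x) x (\<chi> c. real (w c) * x $ c) = real_of_int ?d *
        (f x * monomial Q \<alpha> x)"
      by (subst fd_mult[OF smooth_onD(1)[OF sf x] smooth_onD(1)[OF smooth_on_monomial[of UNIV] UNIV_I]])
          simp
  qed
  then have "coord_field (cube r) c (\<lambda>x. f x * monomial Q \<alpha> x) \<in> homog_sum (cube r) w (- int (w c))
      (e - int (w c))"
    by (rule homog_in_sum[OF open_cube, rotated 2]) (use add(2) of_nat_0_le_iff in \<open>simp_all del:
        of_nat_sum\<close>)
  moreover have "coord_field (cube r) c h = coord_field (cube r) c (\<lambda>x. f x * monomial Q \<alpha> x)
      + coord_field (cube r) c g"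
    by (auto simp: coord_field_def fun_eq_iff add(4) scaleR_add_left)
  ultimately show ?case
    using add.IH subspace_add[OF subspace_homog_sum[OF open_cube]] by (simp del: plus_fun_apply)
qed

lemma sum_fun_apply: "(\<Sum>c\<in>S. f c) x = (\<Sum>c\<in>S. f c x)"
  by (induction S rule: infinite_finite_induct) auto

text \<open>Component \<open>c\<close> of \<open>Y\<close> is the derivative along \<open>Y\<close>
  of a coordinate of degree \<open>w c\<close>, so it has degree at most \<open>w c - j\<close> and
  is a weighted polynomial once all coordinates are constructed. The free bound \<open>lo\<close>
  covers both \<open>- max_weight w\<close> and \<open>- k\<close>.\<close>

lemma (in graded_stage) A_homog:
  assumes C: "C = UNIV" and k: "\<And>a. w a \<le> k" and lo: "lo \<le> - int (max_weight w)" and Y: "Y \<in> A j"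
  shows "Y \<in> homog_sum B w lo (- int j)"
proof -
  have eq: "Y = (\<Sum>c\<in>UNIV. coord_field B c (\<lambda>x. Y x $ c))"
  proof
    fix x
    have "(\<Sum>c\<in>UNIV. coord_field B c (\<lambda>x. Y x $ c)) x = (\<Sum>c\<in>UNIV. coord_field B c (\<lambda>x. Y x $ c) x)"
      by (rule sum_fun_apply)
    also have "\<dots> = Y x"
    proof (cases "x \<in> B")
      case True then show ?thesis using vec_expand[of "Y x"] by (simp add: coord_field_def)
    next
      case False
      moreover have "Y \<in> vector_fields B" using Y A_vf by blast
      ultimately show ?thesis using vector_fieldsD(2) by (simp add: coord_field_def)
    qed
    finally show "Y x = (\<Sum>c\<in>UNIV. coord_field B c (\<lambda>x. Y x $ c)) x" ..
  qed
  have "coord_field B c (\<lambda>x. Y x $ c) \<in> homog_sum B w lo (- int j)" for c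
  proof -
    have "F (int (w c) - int j) (\<lambda>x. Y x $ c)"
      using F_A_deriv[OF coord_Fil Y, of c] C by (simp add: fd_coord)
    moreover have "base (\<lambda>x. Y x $ c)"
      unfolding base_def using smooth_on_component[OF open_cube A_smooth[OF Y]] C by simp
    ultimately have "poly_fun r Z Q w (int (w c) - int j) (\<lambda>x. Y x $ c)" by (rule F_imp_poly_fun)
    then have "coord_field B c (\<lambda>x. Y x $ c) \<in> homog_sum B w (- int (w c)) (int (w c) - int j - int (w c))"
      by (rule poly_fun_field) (simp add: Z_def)
    moreover have "w c \<le> max_weight w" by (simp add: max_weight_def)
    ultimately show ?thesis using homog_sum_mono[OF open_cube, of lo "- int (w c)" "- int j"
        "- int j" r w] lo by auto
  qed
  then show ?thesis by (subst eq) (intro subspace_sum subspace_homog_sum open_cube)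
qed

lemma commuting_span:
  assumes "open W" "T \<subseteq> vector_fields W" "\<And>X Y. X \<in> T \<Longrightarrow> Y \<in> T \<Longrightarrow> vf_bracket W X Y = 0"
    and X: "X \<in> span T" and Y: "Y \<in> span T"
  shows "vf_bracket W X Y = 0"
proof -
  have Tv: "span T \<subseteq> vector_fields W" using assms(2) subspace_vector_fields[OF assms(1)]
      by (rule span_minimal)
  have sub: "subspace {X \<in> vector_fields W. vf_bracket W X Y = 0}" if "Y \<in> vector_fields W" for Y
    using subspace_vector_fields[OF assms(1)] vf_bracket_scale_left[OF that that, of 0]
    by (auto simp: subspace_def vf_bracket_add_left[OF _ _ that] vf_bracket_scale_left[OF _ that] simp
        del: zero_fun_apply plus_fun_apply)
  have 1: "vf_bracket W X Y = 0" if "Y \<in> T" "X \<in> span T" for X Y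
  proof -
    have "T \<subseteq> {X \<in> vector_fields W. vf_bracket W X Y = 0}" using assms(2,3) that(1) by blast
    from span_minimal[OF this sub] show ?thesis using that assms(2) by blast
  qed
  have "T \<subseteq> {Y \<in> vector_fields W. vf_bracket W Y X = 0}"
  proof
    fix Z assume Z: "Z \<in> T"
    have "vf_bracket W Z X = - vf_bracket W X Z" by (rule vf_bracket_anti)
    also have "\<dots> = 0" unfolding 1[OF Z X] by (rule minus_zero)
    finally show "Z \<in> {Y \<in> vector_fields W. vf_bracket W Y X = 0}" using Z assms(2) by blast
  qed
  from span_minimal[OF this sub] have "vf_bracket W Y X = 0" using X Y Tv by blast
  moreover have "vf_bracket W X Y = - vf_bracket W Y X" by (rule vf_bracket_anti)
  ultimately show ?thesis by (simp only: minus_zero)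
qed

lemma (in graded_stage) degree_zero_part:
  assumes C: "C = UNIV" and A0: "\<exists>T. finite T \<and> T \<subseteq> A 0 \<and> A 0 \<subseteq> span T"
  obtains G where "G \<subseteq> homog B w 0" "lie_closed (vf_bracket B) G" "finite_dimensional G"
    "\<And>X Y. X \<in> G \<Longrightarrow> Y \<in> G \<Longrightarrow> vf_bracket B X Y = 0"
    "A 0 \<subseteq> {X + Y |X Y. X \<in> homog_neg B w \<and> Y \<in> G}"
proof -
  let ?M = "int (max_weight w)"
  have wM: "w a \<le> max_weight w" for a by (simp add: max_weight_def)
  note AH = A_homog[OF C wM order_refl]
  have oc: "open B" by (rule open_cube)
  have "\<exists>N Y. N \<in> homog_neg B w \<and> Y \<in> homog B w 0 \<and> X = N + Y" if X: "X \<in> A 0" for X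
  proof -
    obtain f where f: "X = (\<Sum>i\<in>{- ?M..0}. f i)" "\<forall>i\<in>{- ?M..0}. f i \<in> homog B w i"
      using AH[OF X] unfolding homog_sum_def by auto
    have s: "{- ?M..0} = insert 0 {- ?M..-1}" by auto
    have "X = (\<Sum>i\<in>{- ?M..-1}. f i) + f 0" unfolding f(1) s by (subst sum.insert) (auto simp: add.commute)
    moreover have "(\<Sum>i\<in>{- ?M..-1}. f i) \<in> homog_neg B w"
      unfolding homog_neg_def homog_sum_def using f(2) by (intro CollectI exI[of _ f]) auto
    ultimately show ?thesis using f(2) by auto
  qed
  then obtain N Y where NY: "\<And>X. X \<in> A 0 \<Longrightarrow> N X \<in> homog_neg B w" "\<And>X. X \<in> A 0 \<Longrightarrow> Y X \<in> homog B w 0"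
    "\<And>X. X \<in> A 0 \<Longrightarrow> X = N X + Y X" by metis
  obtain T where T: "finite T" "T \<subseteq> A 0" "A 0 \<subseteq> span T" using A0 by blast
  \<comment> \<open>The chosen parts of degree \<open>0\<close> are not known to depend linearly on
    the field, so \<open>G\<close> is spanned by those of a finite spanning set, which also makes it
    finite-dimensional.\<close>
  define G where "G = span (Y ` T)"
  have YT: "Y ` T \<subseteq> homog B w 0" using NY(2) T(2) by blast
  have G0: "G \<subseteq> homog B w 0" unfolding G_def by (rule span_minimal[OF YT subspace_homog[OF oc]])
  have comm: "vf_bracket B (Y X) (Y X') = 0" if XX': "X \<in> T" "X' \<in> T" for X X'
  proof -
    have XA: "X \<in> A 0" "X' \<in> A 0" using XX' T(2) by blast+
    note n = NY(1)[OF XA(1), unfolded homog_neg_def] NY(1)[OF XA(2), unfolded homog_neg_def]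
    note y = NY(2)[OF XA(1)] NY(2)[OF XA(2)]
    have y': "Y X \<in> homog_sum B w 0 0" "Y X' \<in> homog_sum B w 0 0" using y
        by (auto intro: homog_in_sum[OF oc])
    have vf: "N X \<in> vector_fields B" "N X' \<in> vector_fields B" "Y X \<in> vector_fields B"
        "Y X' \<in> vector_fields B"
      using n y homog_sum_vf[OF oc] homog_vf by blast+
    have vfY: "N X' + Y X' \<in> vector_fields B" using subspace_add[OF subspace_vector_fields[OF oc] vf(2,4)] .
    have "vf_bracket B X X' = vf_bracket B (N X + Y X) (N X' + Y X')"
        using NY(3)[OF XA(1)] NY(3)[OF XA(2)] by (simp only:)
    also have "\<dots> = (vf_bracket B (N X) (N X') + vf_bracket B (N X) (Y X'))
        + (vf_bracket B (Y X) (N X') + vf_bracket B (Y X) (Y X'))"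
      by (simp only: vf_bracket_add_left[OF vf(1,3) vfY] vf_bracket_add_right[OF vf(1,2,4)]
          vf_bracket_add_right[OF vf(3,2,4)])
    finally have e: "vf_bracket B (Y X) (Y X') = vf_bracket B X X' - vf_bracket B (N X) (N X') -
        vf_bracket B (N X) (Y X') - vf_bracket B (Y X) (N X')"
      by (simp add: algebra_simps)
    have "vf_bracket B X X' \<in> A 1" using A_bracket[OF XA] by simp
    then have "vf_bracket B X X' \<in> homog_sum B w (- ?M) (- 1)" using AH by fastforce
    moreover have "vf_bracket B (N X) (N X') \<in> homog_sum B w (- ?M + - ?M) (- 1 + - 1)"
        by (rule homog_sum_bracket[OF oc n])
    moreover have "vf_bracket B (N X) (Y X') \<in> homog_sum B w (- ?M + 0) (- 1 + 0)"
        by (rule homog_sum_bracket[OF oc n(1) y'(2)])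
    moreover have "vf_bracket B (Y X) (N X') \<in> homog_sum B w (0 + - ?M) (0 + - 1)"
        by (rule homog_sum_bracket[OF oc y'(1) n(2)])
    \<comment> \<open>A common range of negative degrees: a bracket of two negative parts can reach
      degree \<open>- 2 * ?M\<close>.\<close>
    ultimately have "vf_bracket B X X' \<in> homog_sum B w (- 2 * ?M) (- 1)"
        "vf_bracket B (N X) (N X') \<in> homog_sum B w (- 2 * ?M) (- 1)"
      "vf_bracket B (N X) (Y X') \<in> homog_sum B w (- 2 * ?M) (- 1)"
          "vf_bracket B (Y X) (N X') \<in> homog_sum B w (- 2 * ?M) (- 1)"
      by (auto elim!: subsetD[OF homog_sum_mono[OF oc], rotated -1])
    then have "vf_bracket B (Y X) (Y X') \<in> homog_sum B w (- 2 * ?M) (- 1)"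
      unfolding e by (intro subspace_diff[OF subspace_homog_sum[OF oc]])
    moreover have "vf_bracket B (Y X) (Y X') \<in> homog B w 0" using homog_bracket[OF oc y] by simp
    ultimately show ?thesis using homog_0_neg_zero[OF oc] by blast
  qed
  have YTv: "Y ` T \<subseteq> vector_fields B" using YT homog_vf by blast
  have Gc: "vf_bracket B X X' = 0" if "X \<in> G" "X' \<in> G" for X X'
    by (rule commuting_span[OF oc YTv _ that[unfolded G_def]]) (use comm in blast)
  have Gs: "subspace G" by (simp add: G_def)
  show ?thesis
  proof (rule that[OF G0])
    show "lie_closed (vf_bracket B) G" using Gs Gc subspace_0[OF Gs] by (simp add: lie_closed_def)
    show "finite_dimensional G" using T(1) by (auto simp: finite_dimensional_def G_def)
    let ?S = "{X + Y |X Y. X \<in> homog_neg B w \<and> Y \<in> G}"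
    have "subspace ?S" unfolding homog_neg_def by (rule subspace_sums[OF subspace_homog_sum[OF oc] Gs])
    moreover have "T \<subseteq> ?S"
    proof
      fix X assume X: "X \<in> T"
      then have "X \<in> A 0" using T(2) by blast
      then show "X \<in> ?S" using NY(1,3)[of X] X span_base[of "Y X" "Y ` T"] unfolding G_def by blast
    qed
    ultimately show "A 0 \<subseteq> ?S" using T(3) span_minimal by blast
  qed (rule Gc)
qed

section \<open>Solvable transitive Lie algebras\<close>

locale solvable_transitive = transitive_algebra U L for U :: "(real^'n) set" and L +
  assumes connected_U: "connected U" and U0: "0 \<in> U" and solvable: "lie_solvable (vf_bracket U) L"
begin

definition N where "N = nilradical_series (vf_bracket U) L"
definition d where "d i = dim (distribution (N i) 0)"

lemma ideal_N: "ideal (N i)"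
  unfolding N_def by (rule ideal_nilradical_series)

lemma N_dec: "i \<le> j \<Longrightarrow> N j \<subseteq> N i"
  unfolding N_def by (rule nilradical_series_mono)

lemma N_0: "N 0 = L" by (simp add: N_def)

text \<open>Two elements of \<open>L\<close> bracket into the nilradical by solvability; if exactly
  one index is \<open>0\<close>, the ideal property suffices.\<close>

lemma N_bracket:
  assumes "X \<in> N i" "Y \<in> N j" shows "vf_bracket U X Y \<in> N (max 1 (i + j))"
proof -
  have L: "X \<in> L" "Y \<in> L" using assms idealD(2)[OF ideal_N] by blast+
  consider "i = 0" "j = 0" | "i = 0" "1 \<le> j" | "1 \<le> i" "j = 0" | "1 \<le> i" "1 \<le> j" by linarith
  then show ?thesis
  proof cases
    case 1
    have "vf_bracket U X Y \<in> commutator (vf_bracket U) L L" by (rule commutatorI[OF L])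
    then show ?thesis using derived_subset_nilradical[OF solvable] 1 by (auto simp: N_def)
  next
    case 2
    then show ?thesis using idealD(3)[OF ideal_N L(1) assms(2)] by (simp add: max_absorb2)
  next
    case 3
    then show ?thesis using idealD(4)[OF ideal_N L(2) assms(1)] by (simp add: max_absorb2)
  next
    case 4
    then show ?thesis using br_nilradical_series[OF 4] assms by (simp add: N_def max_absorb2)
  qed
qed

lemma leaf_dim_eq: "leaf_dim U L i = d i"
  unfolding leaf_dim_def d_def N_def by (rule foliation_dim_ideal[OF ideal_nilradical_series U0])

lemma d_dec: "i \<le> j \<Longrightarrow> d j \<le> d i"
proof -
  assume "i \<le> j"
  then have "distribution (N j) 0 \<subseteq> distribution (N i) 0"
    unfolding distribution_def using N_dec by (intro span_mono) auto
  then show ?thesis unfolding d_def by (rule dim_subset)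
qed

lemma d_0: "d 0 = CARD('n)"
  using transitive[OF U0] by (simp add: d_def N_0)

lemma d_le: "d i \<le> CARD('n)"
  using d_dec[of 0 i] d_0 by simp

lemma d_zero: "N i = {0} \<Longrightarrow> d i = 0"
proof -
  assume "N i = {0}"
  then have "distribution (N i) 0 = {0}" by (auto simp: distribution_def)
  then show ?thesis by (simp add: d_def)
qed

text \<open>Built downwards from \<open>N (Suc k) = {0}\<close>: a basis of the values of
  \<open>N (Suc i)\<close> at \<open>0\<close> is extended to one of the values of
  \<open>N i\<close>, and the new fields receive the preceding numbers. Thus the last
  \<open>d j\<close> fields lie in \<open>N j\<close>.\<close>

lemma adapted_fields:
  assumes k: "N (Suc k) = {0}"
  obtains X where "\<And>j l. j \<le> k \<Longrightarrow> CARD('n) - d j < l \<Longrightarrow> l \<le> CARD('n) \<Longrightarrow> X l \<in> N j"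
    "inj_on (\<lambda>l. X l 0) {1..CARD('n)}" "independent ((\<lambda>l. X l 0) ` {1..CARD('n)})"
proof -
  let ?n = "CARD('n)"
  define P where "P i X \<longleftrightarrow> (\<forall>j l. i \<le> j \<longrightarrow> j \<le> k \<longrightarrow> ?n - d j < l \<longrightarrow> l \<le> ?n \<longrightarrow> X l \<in> N j) \<and>
     inj_on (\<lambda>l. X l 0) {?n - d i<..?n} \<and> independent ((\<lambda>l. X l 0) ` {?n - d i<..?n})" for i and X ::
         "nat \<Rightarrow> real^'n \<Rightarrow> real^'n"
  have "\<exists>X. P i X" if "i \<le> Suc k" for i
    using that
  proof (induction i rule: inc_induct)
    case base
    \<comment> \<open>Since \<open>d (Suc k) = 0\<close>, no index is constrained and any function
      serves.\<close>
    show ?case by (rule exI[of _ undefined]) (simp add: P_def d_zero[OF k] independent_empty)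
  next
    case (step i)
    then obtain X where X: "P (Suc i) X" by blast
    let ?S = "{?n - d (Suc i)<..?n}"
    let ?D = "(\<lambda>l. X l 0) ` ?S"
    have Di: "distribution (N i) 0 = (\<lambda>Y. Y 0) ` N i"
        by (rule distribution_subspace[OF idealD(1)[OF ideal_N]])
    have Dsub: "?D \<subseteq> distribution (N i) 0"
    proof
      fix v assume "v \<in> ?D"
      then obtain l where l: "l \<in> ?S" "v = X l 0" by blast
      have "Suc i \<le> k"
      proof (rule ccontr)
        assume "\<not> Suc i \<le> k"
        then have "Suc i = Suc k" using step(2) by linarith
        then have "d (Suc i) = 0" using d_zero[OF k] by (simp only:)
        then show False using l(1) by simp
      qed
      then have "X l \<in> N (Suc i)" using X l(1) by (auto simp: P_def)
      then have "X l \<in> N i" using N_dec[of i "Suc i"] by auto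
      then show "v \<in> distribution (N i) 0" unfolding Di l(2) by blast
    qed
    have ind: "independent ?D" using X by (simp add: P_def)
    obtain Bs where Bs: "?D \<subseteq> Bs" "Bs \<subseteq> distribution (N i) 0" "independent Bs"
        "distribution (N i) 0 \<subseteq> span Bs"
      by (rule maximal_independent_subset_extend[OF Dsub ind])
    have fin: "finite Bs" using Bs(3) by (rule independent_imp_finite)
    have cB: "card Bs = d i" unfolding d_def by (rule basis_card_eq_dim[OF Bs(2,4,3)])
    have cD: "card ?D = d (Suc i)" using X d_le[of "Suc i"] by (simp add: P_def card_image)
    let ?R = "{?n - d i<..?n - d (Suc i)}"
    have "card (Bs - ?D) = card ?R"
      using card_Diff_subset[OF _ Bs(1)] cB cD d_dec[of i "Suc i"] d_le[of i] by simp
    then obtain \<beta> where \<beta>: "bij_betw \<beta> ?R (Bs - ?D)"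
      using finite_same_card_bij[of ?R "Bs - ?D"] fin by auto
    have "\<forall>l\<in>?R. \<exists>Y\<in>N i. Y 0 = \<beta> l"
    proof
      fix l assume "l \<in> ?R"
      then have "\<beta> l \<in> Bs" using bij_betw_apply[OF \<beta>] by blast
      then have "\<beta> l \<in> distribution (N i) 0" using Bs(2) by (rule subsetD[rotated])
      then show "\<exists>Y\<in>N i. Y 0 = \<beta> l" unfolding Di by auto
    qed
    then obtain Y where Y: "\<And>l. l \<in> ?R \<Longrightarrow> Y l \<in> N i \<and> Y l 0 = \<beta> l" by metis
    define X' where "X' l = (if l \<in> ?S then X l else Y l)" for l
    have split: "{?n - d i<..?n} = ?R \<union> ?S" "?R \<inter> ?S = {}" using d_dec[of i "Suc i"] by auto
    have XS: "X' l = X l" if "l \<in> ?S" for l using that by (simp add: X'_def)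
    have XR: "X' l 0 = \<beta> l" "X' l \<in> N i" if "l \<in> ?R" for l
      using that Y[OF that] split(2) by (auto simp: X'_def)
    have im: "(\<lambda>l. X' l 0) ` ?R = Bs - ?D" "(\<lambda>l. X' l 0) ` ?S = ?D"
      using \<beta> XR(1) XS by (auto simp: bij_betw_def)
    have 1: "X' l \<in> N j" if j: "i \<le> j" "j \<le> k" "?n - d j < l" "l \<le> ?n" for j l
    proof (cases "j = i")
      case False
      then have "l \<in> ?S" using j d_dec[of "Suc i" j] by auto
      then show ?thesis using X j False XS by (auto simp: P_def)
    next
      case True
      show ?thesis
      proof (cases "l \<in> ?S")
        case l: True
        then have "Suc i \<le> k" using j True d_zero[OF k] by (cases "i = k") auto
        then have "X l \<in> N (Suc i)" using X l by (auto simp: P_def)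
        then show ?thesis using XS[OF l] True N_dec[of i "Suc i"] by auto
      next
        case False
        then have "l \<in> ?R" using j True by auto
        then show ?thesis using XR(2) True by blast
      qed
    qed
    have 2: "inj_on (\<lambda>l. X' l 0) {?n - d i<..?n}"
      unfolding split(1)
    proof (subst inj_on_Un, intro conjI)
      have "inj_on \<beta> ?R" using \<beta> by (rule bij_betw_imp_inj_on)
      then show "inj_on (\<lambda>l. X' l 0) ?R" by (rule inj_on_cong[THEN iffD1, rotated]) (simp add: XR(1))
      have "inj_on (\<lambda>l. X l 0) ?S" using X by (simp add: P_def)
      then show "inj_on (\<lambda>l. X' l 0) ?S" by (rule inj_on_cong[THEN iffD1, rotated]) (simp add: XS)
      show "(\<lambda>l. X' l 0) ` (?R - ?S) \<inter> (\<lambda>l. X' l 0) ` (?S - ?R) = {}"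
      proof -
        have "(\<lambda>l. X' l 0) ` (?R - ?S) \<subseteq> Bs - ?D" unfolding im(1)[symmetric]
            by (rule image_mono[OF Diff_subset])
        moreover have "(\<lambda>l. X' l 0) ` (?S - ?R) \<subseteq> ?D" unfolding im(2)[symmetric]
            by (rule image_mono[OF Diff_subset])
        ultimately show ?thesis by blast
      qed
    qed
    have "(\<lambda>l. X' l 0) ` {?n - d i<..?n} = Bs" unfolding split(1) image_Un im using Bs(1) by blast
    then have "P i X'" unfolding P_def using 1 2 Bs(3) by auto
    then show ?case by blast
  qed
  then obtain X where X: "P 0 X" by blast
  have e: "{?n - d 0<..?n} = {1..?n}" using d_0 by auto
  show ?thesis using that[of X] X unfolding P_def e by auto
qed

text \<open>The sets of the last \<open>d i\<close> indices shrink as \<open>i\<close> grows, so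
  this count is the greatest \<open>j\<close> in \<open>{1..k}\<close> for which \<open>l\<close> is
  among the last \<open>d j\<close> indices, and \<open>0\<close> if there is none; see
  \<open>wt_iff\<close>.\<close>

definition wt :: "nat \<Rightarrow> nat \<Rightarrow> nat" where
  "wt k l = card {i \<in> {1..k}. CARD('n) - d i < l}"

lemma wt_le: "wt k l \<le> k"
proof -
  have "wt k l \<le> card {1..k}" unfolding wt_def by (rule card_mono) auto
  then show ?thesis by simp
qed

lemma wt_mono: "l \<le> l' \<Longrightarrow> wt k l \<le> wt k l'"
  unfolding wt_def by (rule card_mono) auto

lemma wt_iff:
  assumes "1 \<le> j" "j \<le> k" shows "j \<le> wt k l \<longleftrightarrow> CARD('n) - d j < l"
proof
  assume l: "CARD('n) - d j < l"
  have "{1..j} \<subseteq> {i \<in> {1..k}. CARD('n) - d i < l}"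
  proof
    fix i assume "i \<in> {1..j}"
    then show "i \<in> {i \<in> {1..k}. CARD('n) - d i < l}" using l assms d_dec[of i j] by auto
  qed
  then have "card {1..j} \<le> wt k l" unfolding wt_def by (intro card_mono) auto
  then show "j \<le> wt k l" by simp
next
  assume j: "j \<le> wt k l"
  show "CARD('n) - d j < l"
  proof (rule ccontr)
    assume l: "\<not> CARD('n) - d j < l"
    have "{i \<in> {1..k}. CARD('n) - d i < l} \<subseteq> {1..<j}"
    proof
      fix i assume i: "i \<in> {i \<in> {1..k}. CARD('n) - d i < l}"
      then have "\<not> j \<le> i" using l d_dec[of j i] by auto
      then show "i \<in> {1..<j}" using i by auto
    qed
    then have "wt k l \<le> card {1..<j}" unfolding wt_def by (intro card_mono) auto
    then show False using j assms by simp
  qed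
qed

text \<open>Prepares the input of \<open>weighted_coordinates\<close>: adapted fields as frame, a
  cube on which the transversal components of every \<open>N j\<close> vanish, and a linear change
  of variables that makes the frame standard at \<open>0\<close>.\<close>

lemma weighted_chart:
  assumes k: "N (Suc k) = {0}" and e: "bij_betw e {1..CARD('n)} (UNIV :: 'n set)"
  obtains V \<psi> r w E pos where "V \<subseteq> U" "local_coordinates V \<psi>" "\<psi> ` V = cube r"
    "\<And>l. l \<in> {1..CARD('n)} \<Longrightarrow> w (e l) = wt k l"
    "graded_stage r (\<lambda>j. pushforward V \<psi> ` N j) E w pos UNIV"
proof -
  let ?n = "CARD('n)"
  obtain X where X: "\<And>j l. j \<le> k \<Longrightarrow> ?n - d j < l \<Longrightarrow> l \<le> ?n \<Longrightarrow> X l \<in> N j"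
    "inj_on (\<lambda>l. X l 0) {1..?n}" "independent ((\<lambda>l. X l 0) ` {1..?n})"
    by (rule adapted_fields[OF k]) (rule that; assumption)
  define pos where "pos = inv_into {1..?n} e"
  have pos: "pos c \<in> {1..?n}" "e (pos c) = c" for c
    using e inv_into_into[of c e "{1..?n}"] f_inv_into_f[of c e "{1..?n}"]
      by (auto simp: pos_def bij_betw_def)
  have pose: "pos (e l) = l" if "l \<in> {1..?n}" for l
    using e that by (simp add: pos_def bij_betw_def)
  have inj_pos: "inj pos" by (metis injI pos(2))
  have rpos: "range pos = {1..?n}"
  proof
    show "range pos \<subseteq> {1..?n}" using pos(1) by blast
    show "{1..?n} \<subseteq> range pos" using pose by (metis rangeI subsetI)
  qed
  define w where "w c = wt k (pos c)" for c
  define E0 where "E0 c = X (pos c)" for c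
  have w_iff: "j \<le> w c \<longleftrightarrow> ?n - d j < pos c" if "j \<le> k" for j c
  proof (cases "j = 0")
    case True then show ?thesis using pos(1)[of c] d_0 by simp
  next
    case False then show ?thesis using wt_iff[of j k "pos c"] that by (simp add: w_def)
  qed
  have E0N: "E0 c \<in> N j" if "j \<le> w c" for c j
  proof -
    have j: "j \<le> k" using that wt_le[of k "pos c"] by (simp add: w_def)
    then show ?thesis unfolding E0_def using w_iff[OF j] that pos(1)[of c] by (intro X(1)) auto
  qed
  have E0vf: "E0 c \<in> vector_fields U" for c
    using E0N[of 0 c] idealD(2)[OF ideal_N] L_vf by blast
  have injE: "inj (\<lambda>c. E0 c 0)"
    unfolding E0_def using comp_inj_on[OF inj_pos, of "\<lambda>l. X l 0"] X(2) by (simp add: rpos comp_def)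
  have rE: "range (\<lambda>c. E0 c 0) = (\<lambda>l. X l 0) ` {1..?n}"
    unfolding E0_def rpos[symmetric] by (simp add: image_image)
  have det0: "det (frame_matrix E0 0) \<noteq> 0" by (rule frame_det_nonzero[where E = E0 and x = 0, OF injE])
      (unfold rE, rule X(3))
  define V0 where "V0 = {x \<in> U. det (frame_matrix E0 x) \<noteq> 0}"
  have V0: "open V0" "0 \<in> V0" "V0 \<subseteq> U"
  proof -
    have "continuous_on U (\<lambda>x. det (frame_matrix E0 x))"
      by (rule smooth_onD(3)[OF smooth_on_frame_det[OF open_U vector_fieldsD(1)[OF E0vf]]])
    then show "open V0" unfolding V0_def
      using open_U continuous_open_preimage[of U "\<lambda>x. det (frame_matrix E0 x)" "- {0}"]
      by (simp add: vimage_def Int_def open_Compl)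
  qed (use U0 det0 in \<open>auto simp: V0_def\<close>)
  have "\<exists>\<delta>>0. ball 0 \<delta> \<subseteq> V0 \<and> (\<forall>Z c x. Z \<in> N j \<longrightarrow> c \<notin> {c. j \<le> w c} \<longrightarrow> x \<in> ball 0 \<delta> \<longrightarrow> coef E0 x c (Z x) = 0)"
    if j: "j \<le> k" for j
  proof -
    let ?J = "{c. j \<le> w c}"
    have "pos ` ?J = {?n - d j<..?n}"
    proof
      show "pos ` ?J \<subseteq> {?n - d j<..?n}" using w_iff[OF j] pos(1) by auto
      show "{?n - d j<..?n} \<subseteq> pos ` ?J"
      proof
        fix l assume l: "l \<in> {?n - d j<..?n}"
        then have "pos (e l) = l" by (intro pose) auto
        then show "l \<in> pos ` ?J" using l w_iff[OF j, of "e l"] by (intro image_eqI[of _ _ "e l"]) auto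
      qed
    qed
    then have "card ?J = d j"
      using card_image[OF inj_on_subset[OF inj_pos subset_UNIV], of ?J] d_le[of j] by simp
    then have c: "card ((\<lambda>c. E0 c 0) ` ?J) = d j"
      using card_image[OF inj_on_subset[OF injE subset_UNIV], of ?J] by simp
    have sub: "(\<lambda>c. E0 c 0) ` ?J \<subseteq> distribution (N j) 0"
      using E0N by (auto simp: distribution_def intro!: span_base)
    have ind: "independent ((\<lambda>c. E0 c 0) ` ?J)"
      by (rule independent_mono[OF X(3)]) (unfold rE[symmetric], rule image_mono, rule subset_UNIV)
    have sp: "distribution (N j) 0 \<subseteq> span ((\<lambda>c. E0 c 0) ` ?J)"
      by (rule card_ge_dim_independent[OF sub ind]) (simp add: c d_def)
    have dV: "det (frame_matrix E0 x) \<noteq> 0" if "x \<in> V0" for x using that by (simp add: V0_def)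
    have EN: "E0 c \<in> N j" if "c \<in> ?J" for c using that E0N by simp
    obtain \<delta> where "\<delta> > 0" "ball 0 \<delta> \<subseteq> V0" "\<And>Z c x. Z \<in> N j \<Longrightarrow> c \<notin> ?J \<Longrightarrow> x \<in> ball 0 \<delta> \<Longrightarrow> coef E0 x c (Z x) = 0"
      by (rule ideal_components_zero[OF ideal_N V0 E0vf EN dV sp]) (assumption | rule that)+
    then show ?thesis by blast
  qed
  then have "\<forall>j. \<exists>\<delta>. j \<le> k \<longrightarrow> \<delta> > 0 \<and> ball 0 \<delta> \<subseteq> V0 \<and>
      (\<forall>Z c x. Z \<in> N j \<longrightarrow> c \<notin> {c. j \<le> w c} \<longrightarrow> x \<in> ball 0 \<delta> \<longrightarrow> coef E0 x c (Z x) = 0)" by blast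
  from choice[OF this] obtain \<delta> where \<delta>': "\<forall>j. j \<le> k \<longrightarrow> \<delta> j > 0 \<and> ball 0 (\<delta> j) \<subseteq> V0 \<and>
      (\<forall>Z c x. Z \<in> N j \<longrightarrow> c \<notin> {c. j \<le> w c} \<longrightarrow> x \<in> ball 0 (\<delta> j) \<longrightarrow> coef E0 x c (Z x) = 0)" by (rule exE)
  have \<delta>: "\<delta> j > 0" "ball 0 (\<delta> j) \<subseteq> V0" if "j \<le> k" for j using \<delta>' that by blast+
  have \<delta>3: "coef E0 x c (Z x) = 0" if "j \<le> k" "Z \<in> N j" "w c < j" "x \<in> ball 0 (\<delta> j)" for j Z c x
    using \<delta>' that by (simp add: not_le)
  \<comment> \<open>Only the finitely many \<open>j \<le> k\<close> impose conditions, since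
    \<open>N j = {0}\<close> beyond them, so one cube serves all \<open>j\<close>.\<close>
  define \<delta>0 where "\<delta>0 = Min (\<delta> ` {..k})"
  have \<delta>0: "\<delta>0 > 0" "\<And>j. j \<le> k \<Longrightarrow> \<delta>0 \<le> \<delta> j" using \<delta>(1) by (auto simp: \<delta>0_def)
  obtain r0 where r0: "r0 > 0" "cube r0 \<subseteq> ball (0 :: real^'n) \<delta>0"
    by (rule cube_subset_open[of "ball 0 \<delta>0"]) (use \<delta>0(1) in auto)
  let ?B = "cube r0 :: (real^'n) set"
  have Bb: "x \<in> ball 0 (\<delta> j)" if "x \<in> ?B" "j \<le> k" for x j
    using r0(2) \<delta>0(2)[OF that(2)] that(1) by force
  have BV: "?B \<subseteq> V0" using Bb[of _ 0] \<delta>(2)[of 0] by blast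
  then have BU: "?B \<subseteq> U" using V0(3) by blast
  have B0: "0 \<in> ?B" using r0(1) by (simp add: cube_def)
  let ?R = "restrict_vf ?B"
  define E1 where "E1 c = ?R (E0 c)" for c
  have fm: "frame_matrix E1 x = frame_matrix E0 x" if "x \<in> ?B" for x
    using that by (simp add: frame_matrix_def E1_def restrict_vf_def)
  have cf: "coef E1 x c (?R Z x) = coef E0 x c (Z x)" if "x \<in> ?B" for x c Z
    using that by (simp only: coef_def fm restrict_vf_def if_True)
  have detB: "det (frame_matrix E0 x) \<noteq> 0" if "x \<in> ?B" for x using that BV by (auto simp: V0_def)
  interpret G0: graded_frame r0 "\<lambda>j. ?R ` N j" E1 w pos
  proof
    show "r0 > 0" by (rule r0(1))
    show "inj pos" by (rule inj_pos)
    show "w a \<le> w b" if "pos a \<le> pos b" for a b unfolding w_def using that by (rule wt_mono)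
    show "?R ` N j \<subseteq> vector_fields ?B" for j
      using restrict_vf_vector_fields[OF open_cube BU] idealD(2)[OF ideal_N] L_vf by blast
    show "E1 a \<in> ?R ` N (w a)" for a using E0N[of "w a" a] by (simp add: E1_def)
    show "det (frame_matrix E1 x) \<noteq> 0" if "x \<in> ?B" for x using fm[OF that] detB[OF that] by simp
    show "coef E1 x a (Y x) = 0" if Y: "Y \<in> ?R ` N j" "x \<in> ?B" "w a < j" for Y j x a
    proof -
      obtain Z where Z: "Z \<in> N j" "Y = ?R Z" using Y(1) by blast
      show ?thesis
      proof (cases "j \<le> k")
        case True
        show ?thesis unfolding Z(2) cf[OF Y(2)] by (rule \<delta>3[OF True Z(1) Y(3) Bb[OF Y(2) True]])
      next
        case False
        then have "N j = {0}" using nilradical_series_zero[of "Suc k" j] k by (simp add: N_def)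
        then have "Z = 0" using Z(1) by blast
        then show ?thesis unfolding Z(2) cf[OF Y(2)] using linear_0[OF linear_coef[OF detB[OF Y(2)]]]
            by simp
      qed
    qed
    show "vf_bracket ?B Y Z \<in> ?R ` N (max 1 (i + j))" if YZ': "Y \<in> ?R ` N i" "Z \<in> ?R ` N j" for Y Z i j
    proof -
      obtain Y' Z' where YZ: "Y' \<in> N i" "Z' \<in> N j" "Y = ?R Y'" "Z = ?R Z'" using YZ' by blast
      show ?thesis unfolding YZ(3,4)
        using imageI[OF N_bracket[OF YZ(1,2)], of ?R] restrict_vf_bracket[OF open_cube BU] by (simp only:)
    qed
  qed
  \<comment> \<open>Sends the frame at \<open>0\<close> to the standard basis, the normalization
    that the construction of coordinates starts from.\<close>
  define T where "T v = (\<chi> c. coef E0 0 c v)" for v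
  have linT: "linear T"
    by (rule linearI) (simp_all add: T_def vec_eq_iff linear_add[OF linear_coef[OF det0]]
        linear_scale[OF linear_coef[OF det0]])
  have TE: "T (E0 c 0) = axis c 1" for c
    by (auto simp: T_def vec_eq_iff axis_def coef_frame[OF det0])
  have fT: "fd T x v = T v" for x v by (rule fd_linear[OF linT])
  have "inj T"
    unfolding linear_injective_0[OF linT]
  proof (intro allI impI)
    fix v assume "T v = 0"
    then have "coef E0 0 c v = 0" for c by (simp add: T_def vec_eq_iff)
    then show "v = 0" using coef_expand[OF det0, of v] by simp
  qed
  then have injT: "inj (fd T 0)" by (simp add: fT[abs_def] inj_def)
  obtain V1 r1 where V1: "r1 > 0" "V1 \<subseteq> ?B" "local_coordinates V1 T" "T ` V1 = cube r1"
    by (rule cube_chart[OF open_cube B0 smooth_on_linear[OF linT] linear_0[OF linT] injT])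
  interpret G1: graded_frame r1 "\<lambda>j. pushforward V1 T ` ?R ` N j" "\<lambda>c. pushforward V1 T (E1 c)" w pos
    by (rule G0.graded_frame_push[OF V1(3,2,4,1)])
  have E10: "pushforward V1 T (E1 c) 0 = axis c 1" for c
    using pushforward_at[OF V1(3) local_coordinatesD(3)[OF V1(3)], of "E1 c"] B0
    by (simp add: linear_0[OF linT] fT TE E1_def restrict_vf_def)
  obtain W \<psi> r where W: "r > 0" "W \<subseteq> cube r1" "local_coordinates W \<psi>" "\<psi> ` W = cube r"
    "graded_stage r (\<lambda>j. pushforward W \<psi> ` pushforward V1 T ` ?R ` N j)
        (\<lambda>c. pushforward W \<psi> (pushforward V1 T (E1 c))) w pos UNIV"
    by (rule G1.weighted_coordinates[OF E10])
  have WV: "W \<subseteq> T ` V1" using W(2) V1(4) by simp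
  note comp = local_coordinates_compose[OF V1(3) W(3) WV refl]
  have pr: "pushforward V1 T (?R Y) = pushforward V1 T Y" for Y
    using local_coordinatesD(12)[OF V1(3)] V1(2) by (auto simp: pushforward_def restrict_vf_def fun_eq_iff)
  have eq: "(\<lambda>j. pushforward W \<psi> ` pushforward V1 T ` ?R ` N j)
      = (\<lambda>j. pushforward (inv_into V1 T ` W) (\<lambda>x. \<psi> (T x)) ` N j)"
    by (simp add: image_image pr comp(5))
  show ?thesis
  proof (rule that)
    show "inv_into V1 T ` W \<subseteq> U" using comp(2) V1(2) BU by blast
    show "local_coordinates (inv_into V1 T ` W) (\<lambda>x. \<psi> (T x))" by (rule comp(1))
    show "(\<lambda>x. \<psi> (T x)) ` inv_into V1 T ` W = cube r" using comp(4) W(4) by simp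
    show "w (e l) = wt k l" if "l \<in> {1..?n}" for l using pose[OF that] by (simp add: w_def)
    show "graded_stage r (\<lambda>j. pushforward (inv_into V1 T ` W) (\<lambda>x. \<psi> (T x)) ` N j)
      (\<lambda>c. pushforward W \<psi> (pushforward V1 T (E1 c))) w pos UNIV"
      using W(5) unfolding eq .
  qed
qed

end

lemma distribution_pushforward:
  assumes lc: "local_coordinates V \<phi>" and x: "x \<in> V"
  shows "distribution (pushforward V \<phi> ` I) (\<phi> x) = fd \<phi> x ` distribution I x"
    "dim (distribution (pushforward V \<phi> ` I) (\<phi> x)) = dim (distribution I x)"
proof -
  have lin: "linear (fd \<phi> x)"
    by (rule linear_frechet_derivative[OF smooth_onD(1)[OF local_coordinatesD(7)[OF lc] x]])
  have inj: "inj (fd \<phi> x)"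
    by (rule inj_on_inverseI[where g = "fd (inv_into V \<phi>) (\<phi> x)"]) (rule fd_coordinates_inverse(1)[OF lc x])
  have "{Y (\<phi> x) |Y. Y \<in> pushforward V \<phi> ` I} = fd \<phi> x ` {X x |X. X \<in> I}"
    using pushforward_at[OF lc x] by (auto simp: image_def) metis
  then show 1: "distribution (pushforward V \<phi> ` I) (\<phi> x) = fd \<phi> x ` distribution I x"
    by (simp add: distribution_def linear_span_image[OF lin])
  show "dim (distribution (pushforward V \<phi> ` I) (\<phi> x)) = dim (distribution I x)"
    unfolding 1 by (rule dim_image_eq[OF lin inj_on_subset[OF inj subset_UNIV]])
qed

text \<open>Injectivity is the point: the kernel of the pushforward is an ideal whose elements
  vanish on \<open>V\<close>, hence zero by \<open>ideal_vanishing\<close>. The nilradical series is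
  then transported by \<open>lie_iso\<close>.\<close>

lemma (in solvable_transitive) solvable_transitive_pushforward:
  assumes VU: "V \<subseteq> U" and lc: "local_coordinates V \<phi>"
  shows "solvable_transitive (\<phi> ` V) (pushforward V \<phi> ` L)"
    "nilradical_series (vf_bracket (\<phi> ` V)) (pushforward V \<phi> ` L) i = pushforward V \<phi> ` N i"
    "leaf_dim (\<phi> ` V) (pushforward V \<phi> ` L) i = d i"
    "inj_on (pushforward V \<phi>) L"
proof -
  let ?p = "pushforward V \<phi>" and ?W = "\<phi> ` V"
  note D = local_coordinatesD[OF lc]
  have lin: "linear ?p" by (rule linear_pushforward[OF lc])
  have p_br: "?p (vf_bracket U X Y) = vf_bracket ?W (?p X) (?p Y)" if "X \<in> L" "Y \<in> L" for X Y
    by (rule pushforward_bracket[OF lc VU open_U subsetD[OF L_vf that(1)] subsetD[OF L_vf that(2)]])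
  have sm: "smooth_on V X" if "X \<in> L" for X
    using smooth_on_subset[OF vector_fieldsD(1)[OF subsetD[OF L_vf that]] VU] .
  have pL: "?p ` L \<subseteq> vector_fields ?W" using pushforward_vector_fields[OF lc sm] by blast
  have "vf_bracket ?W X Y \<in> ?p ` L" if XY: "X \<in> ?p ` L" "Y \<in> ?p ` L" for X Y
  proof -
    obtain X' Y' where *: "X' \<in> L" "Y' \<in> L" "X = ?p X'" "Y = ?p Y'" using XY by blast
    show ?thesis unfolding *(3,4) p_br[OF *(1,2), symmetric] by (rule imageI[OF br_closed[OF *(1,2)]])
  qed
  then have closed: "lie_closed (vf_bracket ?W) (?p ` L)"
    by (simp add: lie_closed_def linear_subspace_image[OF lin subspace_L])
  obtain T where T: "finite T" "L \<subseteq> span T" using fd by blast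
  have "?p ` L \<subseteq> span (?p ` T)" using image_mono[OF T(2)] by (simp add: linear_span_image[OF lin])
  then have fin: "\<exists>B. finite B \<and> ?p ` L \<subseteq> span B" using T(1) by blast
  interpret Q: fd_lie_algebra "vf_bracket ?W" "?p ` L" by (rule fd_lie_algebra_vf[OF D(6) pL closed fin])
  interpret H: lie_hom "vf_bracket U" L "vf_bracket ?W" "?p ` L" ?p
    by (intro lie_hom.intro fd_lie_algebra_axioms Q.fd_lie_algebra_axioms lie_hom_axioms.intro lin p_br
        refl)
  have "lie_ideal (vf_bracket ?W) {0} (?p ` L)"
    using Q.br_0_right subspace_0[OF Q.subspace_L] by (auto simp: lie_ideal_def subspace_single_0)
  from H.ideal_preimage[OF this] have K: "ideal {X \<in> L. ?p X \<in> {0}}" .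
  have ker: "X = 0" if X: "X \<in> L" "?p X = 0" for X
  proof (rule ideal_vanishing[OF K connected_U D(1,3) VU])
    fix Y x assume Y: "Y \<in> {X \<in> L. ?p X \<in> {0}}" "x \<in> V"
    then have "fd \<phi> x (Y x) = 0" using pushforward_at[OF lc Y(2), of Y] by simp
    then show "Y x = 0"
      using fd_coordinates_inverse(1)[OF lc Y(2), of "Y x"]
        linear_0[OF linear_frechet_derivative[OF smooth_onD(1)[OF D(8) imageI[OF Y(2)]]]] by simp
  qed (use X in auto)
  show inj: "inj_on ?p L"
    unfolding linear_inj_on_iff_eq_0[OF lin subspace_L] using ker by blast
  interpret I: lie_iso "vf_bracket U" L "vf_bracket ?W" "?p ` L" ?p by unfold_locales (rule inj)
  show st: "solvable_transitive ?W (?p ` L)"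
  proof unfold_locales
    show "distribution (?p ` L) y = UNIV" if y: "y \<in> ?W" for y
    proof -
      obtain x where x: "x \<in> V" "y = \<phi> x" using y by blast
      have "fd \<phi> x v \<in> range (fd \<phi> x)" for v by blast
      then have "range (fd \<phi> x) = UNIV" using fd_coordinates_inverse(2)[OF lc x(1)] by (metis UNIV_eq_I)
      then show ?thesis
        unfolding x(2) distribution_pushforward(1)[OF lc x(1)] using transitive[of x] x(1) VU by auto
    qed
    show "lie_solvable (vf_bracket ?W) (?p ` L)" by (rule H.solvable_image[OF solvable])
  qed (rule D pL)+
  show N': "nilradical_series (vf_bracket ?W) (?p ` L) i = ?p ` N i" for i
    unfolding N_def by (rule I.f_nilradical_series)
  interpret P: solvable_transitive ?W "?p ` L" by (rule st)
  show "leaf_dim ?W (?p ` L) i = d i"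
    unfolding P.leaf_dim_eq P.d_def P.N_def N' d_def
    using distribution_pushforward(2)[OF lc D(3), of "N i"] D(4) by simp
qed

section \<open>Uniqueness of the weights and conjugacy of dilations\<close>

lemma strict_mono_on_image_eq:
  fixes r r' :: "nat \<Rightarrow> nat"
  assumes "strict_mono_on {1..m} r" "strict_mono_on {1..m'} r'" "r ` {1..m} = r' ` {1..m'}"
  shows "m' = m" "\<And>j. j \<in> {1..m} \<Longrightarrow> r' j = r j"
proof -
  have s: "sorted_wrt (<) (map f [1..<Suc n])" if "strict_mono_on {1..n} f" for f :: "nat \<Rightarrow> nat" and n
    unfolding sorted_wrt_map
    by (rule sorted_wrt_mono_rel[OF _ sorted_wrt_upt]) (use that in \<open>auto simp: strict_mono_on_def\<close>)
  have e: "map r [1..<Suc m] = map r' [1..<Suc m']"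
    by (rule strict_sorted_equal[OF s[OF assms(2)] s[OF assms(1)]])
      (use assms(3) in \<open>simp only: set_map set_upt atLeastLessThanSuc_atLeastAtMost\<close>)
  from arg_cong[OF e, of length] show m: "m' = m" by (simp only: length_map length_upt diff_Suc_1)
  show "r' j = r j" if "j \<in> {1..m}" for j
    using e that by (simp only: m map_eq_conv set_upt atLeastLessThanSuc_atLeastAtMost)
qed

context solvable_transitive
begin

context
  fixes k m :: nat and r a :: "nat \<Rightarrow> nat"
  assumes data: "nilradical_data U L k m r a"
begin

lemma N_Suc_k: "N (Suc k) = {0}" and N_k: "N k \<noteq> {0}" and r_mono: "strict_mono_on {1..m} r"
  and r_image: "r ` {1..m} = {i \<in> {0..k}. d (Suc i) < d i}"
  and a_eq: "i \<in> {1..m} \<Longrightarrow> a i = d (r i) - d (Suc (r i))"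
  using data by (auto simp: nilradical_data_def leaf_dim_eq N_def)

text \<open>Telescoping: as \<open>t\<close> grows, the codimension changes exactly after the values
  \<open>r s\<close>, and there by \<open>a s\<close>.\<close>

lemma codim_sum: "t \<le> Suc k \<Longrightarrow> CARD('n) - d t = sum a {s \<in> {1..m}. r s < t}"
proof (induction t)
  case 0
  then show ?case by (simp add: d_0)
next
  case (Suc t)
  have inj: "inj_on r {1..m}" by (rule strict_mono_on_imp_inj_on[OF r_mono])
  show ?case
  proof (cases "d (Suc t) < d t")
    case True
    then have "t \<in> r ` {1..m}" unfolding r_image using Suc.prems by simp
    then obtain s where s: "s \<in> {1..m}" "t = r s" by blast
    have "{s \<in> {1..m}. r s < Suc t} = insert s {s \<in> {1..m}. r s < t}"
      using s inj by (auto simp: less_Suc_eq dest: inj_onD)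
    then have "sum a {s \<in> {1..m}. r s < Suc t} = a s + sum a {s \<in> {1..m}. r s < t}" using s(2) by simp
    then show ?thesis using Suc True a_eq[OF s(1)] s(2) d_le[of t] by simp
  next
    case False
    then have "t \<notin> r ` {1..m}" unfolding r_image by simp
    then have "{s \<in> {1..m}. r s < Suc t} = {s \<in> {1..m}. r s < t}" by (auto simp: less_Suc_eq)
    then show ?thesis using Suc False d_dec[of t "Suc t"] by simp
  qed
qed

text \<open>Identifies block \<open>j\<close> with the indices \<open>l\<close> satisfying
  \<open>n - d (r j) < l \<le> n - d (Suc (r j))\<close>, where \<open>n = CARD('n)\<close>, the
  form in which it is compared with \<open>wt\<close>.\<close>

lemma block_sums:
  assumes j: "j \<in> {1..m}"
  shows "(\<Sum>i=1..<j. a i) = CARD('n) - d (r j)" "(\<Sum>i=1..j. a i) = CARD('n) - d (Suc (r j))" "r j \<le> k"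
proof -
  show k: "r j \<le> k" using r_image j by auto
  have m: "r s < r j \<longleftrightarrow> s < j" if "s \<in> {1..m}" for s
    using strict_mono_on_less[OF r_mono that j] .
  have i: "r s = r j \<longleftrightarrow> s = j" if "s \<in> {1..m}" for s
    using strict_mono_on_eq[OF r_mono that j] .
  have "{s \<in> {1..m}. r s < r j} = {s \<in> {1..m}. s < j}" using m by blast
  also have "\<dots> = {1..<j}" using j by auto
  finally show "(\<Sum>i=1..<j. a i) = CARD('n) - d (r j)" using codim_sum[of "r j"] k by simp
  have "{s \<in> {1..m}. r s < Suc (r j)} = {s \<in> {1..m}. s < j \<or> s = j}" using m i unfolding less_Suc_eq
      by blast
  also have "\<dots> = {1..j}" using j by auto
  finally show "(\<Sum>i=1..j. a i) = CARD('n) - d (Suc (r j))" using codim_sum[of "Suc (r j)"] k by simp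
qed

lemma sum_blocks: "(\<Sum>i=1..m. a i) = CARD('n)"
proof -
  have "{s \<in> {1..m}. r s < Suc k} = {1..m}" using r_image by (auto simp: less_Suc_eq_le)
  then show ?thesis using codim_sum[of "Suc k"] d_zero[OF N_Suc_k] by simp
qed

text \<open>For \<open>l\<close> in block \<open>j\<close> the condition counted by
  \<open>wt\<close> holds up to \<open>r j\<close> and fails from \<open>Suc (r j)\<close> on,
  because \<open>d\<close> is decreasing.\<close>

lemma block_weights_wt:
  assumes w: "\<And>l. l \<in> {1..CARD('n)} \<Longrightarrow> w (e l) = wt k l"
  shows "block_weights e m r a w"
  unfolding block_weights_def
proof (intro ballI allI impI)
  fix j l assume j: "j \<in> {1..m}" and l: "(\<Sum>i=1..<j. a i) < l \<and> l \<le> (\<Sum>i=1..j. a i)"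
  note b = block_sums[OF j]
  have "{i \<in> {1..k}. CARD('n) - d i < l} = {1..r j}"
  proof (intro set_eqI iffI)
    fix i assume i: "i \<in> {i \<in> {1..k}. CARD('n) - d i < l}"
    have "\<not> Suc (r j) \<le> i" using d_dec[of "Suc (r j)" i] i l b(2) by auto
    then show "i \<in> {1..r j}" using i by simp
  next
    fix i assume i: "i \<in> {1..r j}"
    then show "i \<in> {i \<in> {1..k}. CARD('n) - d i < l}" using d_dec[of i "r j"] l b(1,3) by auto
  qed
  then have "wt k l = r j" by (simp add: wt_def)
  moreover have "l \<in> {1..CARD('n)}" using l b(2) by auto
  ultimately show "w (e l) = r j" using w by simp
qed

text \<open>By \<open>sum_blocks\<close> the blocks exhaust \<open>{1..CARD('n)}\<close>, so every
  coordinate receives a weight; its block is the first whose partial sum reaches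
  \<open>l\<close>.\<close>

lemma block_weights_unique:
  assumes e: "bij_betw e {1..CARD('n)} (UNIV :: 'n set)"
    and w: "block_weights e m r a w" "block_weights e m r a w'"
  shows "w = w'"
proof
  fix c
  have "c \<in> e ` {1..CARD('n)}" using e by (simp add: bij_betw_def)
  then obtain l where l: "l \<in> {1..CARD('n)}" "c = e l" by blast
  define j where "j = (LEAST j. l \<le> (\<Sum>i=1..j. a i))"
  have lm: "l \<le> (\<Sum>i=1..m. a i)" using sum_blocks l(1) by simp
  have jl: "l \<le> (\<Sum>i=1..j. a i)" unfolding j_def by (rule LeastI[of _ m]) (rule lm)
  have jm: "j \<le> m" unfolding j_def by (rule Least_le) (rule lm)
  have j0: "j \<noteq> 0" using jl l(1) by (cases "j = 0") simp_all
  then have "\<not> l \<le> (\<Sum>i=1..j - 1. a i)" unfolding j_def by (intro not_less_Least) auto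
  moreover have "{1..j - 1} = {1..<j}" using j0 by auto
  ultimately have "(\<Sum>i=1..<j. a i) < l" by simp
  moreover have "j \<in> {1..m}" using jm j0 by simp
  ultimately have "w (e l) = r j" "w' (e l) = r j" using w jl unfolding block_weights_def by blast+
  then show "w c = w' c" by (simp only: l(2))
qed

text \<open>The data see the algebra only through the vanishing of the terms of its nilradical
  series and the leaf dimensions.\<close>

lemma data_unique:
  assumes data': "nilradical_data U' L' k' m' r' a'"
    and N': "\<And>i. nilradical_series (vf_bracket U') L' i = {0} \<longleftrightarrow> N i = {0}"
    and d': "\<And>i. leaf_dim U' L' i = d i"
  shows "k' = k" "m' = m" "\<And>j. j \<in> {1..m} \<Longrightarrow> r' j = r j \<and> a' j = a j"
proof -
  have z: "N i = {0} \<longleftrightarrow> k < i" for i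
    using N_Suc_k N_k nilradical_series_zero[of "Suc k" i] nilradical_series_zero[of i k]
    by (metis N_def Suc_leI not_le)
  have "N k' \<noteq> {0}" "N (Suc k') = {0}" using data' N' by (auto simp: nilradical_data_def)
  then show k: "k' = k" unfolding z by simp
  have r': "strict_mono_on {1..m'} r'" "r ` {1..m} = r' ` {1..m'}"
    using data' r_image by (auto simp: nilradical_data_def d' k)
  show m: "m' = m" by (rule strict_mono_on_image_eq(1)[OF r_mono r'])
  show "r' j = r j \<and> a' j = a j" if j: "j \<in> {1..m}" for j
  proof -
    have "r' j = r j" by (rule strict_mono_on_image_eq(2)[OF r_mono r' j])
    then show ?thesis using data' j a_eq[OF j] by (simp add: nilradical_data_def d' m)
  qed
qed

end

end

text \<open>In both charts the dilation has the same standard form, so following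
  \<open>\<psi>\<^sub>1\<close> by the inverse of \<open>\<psi>\<^sub>2\<close> over a cube
  contained in both images intertwines the two dilations.\<close>

lemma dilations_conjugate_same_weights:
  assumes lc1: "local_coordinates V\<^sub>1 \<psi>\<^sub>1" and lc2: "local_coordinates V\<^sub>2 \<psi>\<^sub>2"
  shows "dilations_conjugate V\<^sub>1 \<psi>\<^sub>1 w V\<^sub>2 \<psi>\<^sub>2 w"
proof -
  note D1 = local_coordinatesD[OF lc1] and D2 = local_coordinatesD[OF lc2]
  obtain \<rho> where \<rho>: "\<rho> > 0" "cube \<rho> \<subseteq> \<psi>\<^sub>1 ` V\<^sub>1 \<inter> \<psi>\<^sub>2 ` V\<^sub>2"
    by (rule cube_subset_open[of "\<psi>\<^sub>1 ` V\<^sub>1 \<inter> \<psi>\<^sub>2 ` V\<^sub>2"]) (use D1(6,9) D2(6,9) in auto)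
  let ?W = "cube \<rho> :: (real^'a) set"
  define D where "D = inv_into V\<^sub>1 \<psi>\<^sub>1 ` ?W"
  define D' where "D' = inv_into V\<^sub>2 \<psi>\<^sub>2 ` ?W"
  have W: "connected_nbhd ?W" "?W \<subseteq> \<psi>\<^sub>1 ` V\<^sub>1" "?W \<subseteq> \<psi>\<^sub>2 ` V\<^sub>2" using connected_nbhd_cube[OF \<rho>(1)] \<rho>(2)
      by auto
  note R1 = local_coordinates_restrict[OF lc1 W(1,2) D_def] and R2
      = local_coordinates_restrict[OF lc2 W(1,3) D'_def]
  note R2' = local_coordinatesD[OF R2(1)]
  let ?\<Phi> = "\<lambda>x. inv_into D' \<psi>\<^sub>2 (\<psi>\<^sub>1 x)"
  have inv2: "inv_into D' \<psi>\<^sub>2 y = inv_into V\<^sub>2 \<psi>\<^sub>2 y" if "y \<in> ?W" for y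
    using D2(11)[OF subsetD[OF R2(2) R2'(12)[of y]]] R2'(13)[of y] that R2(3) by simp
  have inv: "local_coordinates ?W (inv_into D' \<psi>\<^sub>2)"
    using local_coordinates_inverse[OF R2(1)] by (simp add: R2(3))
  have D_eq: "D = inv_into D \<psi>\<^sub>1 ` ?W"
    using local_coordinatesD(11)[OF R1(1)] R1(3) by force
  have lc: "local_coordinates D ?\<Phi>"
    by (rule local_coordinates_compose(1)[OF R1(1) inv _ D_eq]) (simp add: R1(3))
  have im: "?\<Phi> ` D \<subseteq> V\<^sub>2"
    using R2'(12) R2(2,3) R1(3) by blast
  show ?thesis
    unfolding dilations_conjugate_def
  proof (intro exI[of _ D] exI[of _ ?\<Phi>] conjI allI ballI impI)
    fix t x assume x: "x \<in> D" and dx: "dilation w t (\<psi>\<^sub>1 x) \<in> \<psi>\<^sub>1 ` D"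
    have yW: "\<psi>\<^sub>1 x \<in> ?W" "dilation w t (\<psi>\<^sub>1 x) \<in> ?W" using x dx R1(3) by auto
    have y: "\<psi>\<^sub>2 (?\<Phi> x) = \<psi>\<^sub>1 x" by (rule R2'(13)) (use yW in \<open>simp add: R2(3)\<close>)
    show "dilation w t (\<psi>\<^sub>2 (?\<Phi> x)) \<in> \<psi>\<^sub>2 ` V\<^sub>2" unfolding y using yW(2) W(3) by blast
    show "?\<Phi> (chart_dilation V\<^sub>1 \<psi>\<^sub>1 w t x) = chart_dilation V\<^sub>2 \<psi>\<^sub>2 w t (?\<Phi> x)"
      unfolding chart_dilation_def y D1(13)[OF subsetD[OF W(2) yW(2)]] by (rule inv2[OF yW(2)])
  qed (use lc im R1(2) in auto)
qed

text \<open>Restriction is a homomorphism, possibly with a kernel, and solvability passes to its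
  image.\<close>

lemma solvable_transitive_restrict:
  assumes L0: "local_transitive_lie_algebra U\<^sub>0 L\<^sub>0" "finite_dimensional L\<^sub>0"
      "lie_solvable (vf_bracket U\<^sub>0) L\<^sub>0"
    and U: "transitive_shrinking U\<^sub>0 L\<^sub>0 U"
  shows "solvable_transitive U (restrict_vf U ` L\<^sub>0)"
proof -
  let ?R = "restrict_vf U"
  have oU: "open U" "connected U" "0 \<in> U" "U \<subseteq> U\<^sub>0" and tr: "\<And>x. x \<in> U \<Longrightarrow> distribution L\<^sub>0 x = UNIV"
    using U by (auto simp: transitive_shrinking_def connected_nbhd_def)
  have o0: "open U\<^sub>0" and L0v: "L\<^sub>0 \<subseteq> vector_fields U\<^sub>0" and L0c: "lie_closed (vf_bracket U\<^sub>0) L\<^sub>0"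
    using L0(1) by (auto simp: local_transitive_lie_algebra_def connected_nbhd_def)
  obtain T where T: "finite T" "L\<^sub>0 = span T" using L0(2) by (auto simp: finite_dimensional_def)
  interpret A: fd_lie_algebra "vf_bracket U\<^sub>0" L\<^sub>0
    by (rule fd_lie_algebra_vf[OF o0 L0v L0c]) (use T in auto)
  have R_br: "?R (vf_bracket U\<^sub>0 X Y) = vf_bracket U (?R X) (?R Y)" for X Y
    by (rule restrict_vf_bracket[OF oU(1,4)])
  have Rv: "?R ` L\<^sub>0 \<subseteq> vector_fields U" using restrict_vf_vector_fields[OF oU(1,4)] L0v by blast
  have "vf_bracket U X Y \<in> ?R ` L\<^sub>0" if XY: "X \<in> ?R ` L\<^sub>0" "Y \<in> ?R ` L\<^sub>0" for X Y
  proof -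
    obtain X' Y' where *: "X' \<in> L\<^sub>0" "Y' \<in> L\<^sub>0" "X = ?R X'" "Y = ?R Y'" using XY by blast
    show ?thesis unfolding *(3,4) R_br[symmetric] by (rule imageI[OF A.br_closed[OF *(1,2)]])
  qed
  then have Rc: "lie_closed (vf_bracket U) (?R ` L\<^sub>0)"
    by (simp add: lie_closed_def linear_subspace_image[OF linear_restrict_vf A.subspace_L])
  have fin: "\<exists>B. finite B \<and> ?R ` L\<^sub>0 \<subseteq> span B"
    by (rule exI[of _ "?R ` T"]) (simp add: T linear_span_image[OF linear_restrict_vf])
  interpret B: fd_lie_algebra "vf_bracket U" "?R ` L\<^sub>0" by (rule fd_lie_algebra_vf[OF oU(1) Rv Rc fin])
  interpret H: lie_hom "vf_bracket U\<^sub>0" L\<^sub>0 "vf_bracket U" "?R ` L\<^sub>0" ?R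
    by (intro lie_hom.intro A.fd_lie_algebra_axioms B.fd_lie_algebra_axioms lie_hom_axioms.intro
        linear_restrict_vf R_br refl)
  show ?thesis
  proof unfold_locales
    show "distribution (?R ` L\<^sub>0) x = UNIV" if x: "x \<in> U" for x
    proof -
      have "{X x |X. X \<in> ?R ` L\<^sub>0} = (\<lambda>X. ?R X x) ` L\<^sub>0" by blast
      also have "\<dots> = {X x |X. X \<in> L\<^sub>0}" using x by (auto simp: restrict_vf_def)
      finally have "{X x |X. X \<in> ?R ` L\<^sub>0} = {X x |X. X \<in> L\<^sub>0}" .
      then show ?thesis using tr[OF x] by (simp add: distribution_def)
    qed
    show "lie_solvable (vf_bracket U) (?R ` L\<^sub>0)" by (rule H.solvable_image[OF L0(3)])
  qed (rule oU Rv)+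
qed

theorem theorem4p1:
  fixes U\<^sub>0 U :: "(real^'n) set" and L\<^sub>0 L :: "(real^'n \<Rightarrow> real^'n) set"
    and k m :: nat and r a :: "nat \<Rightarrow> nat" and e :: "nat \<Rightarrow> 'n"
  assumes "local_transitive_lie_algebra U\<^sub>0 L\<^sub>0"
    and "finite_dimensional L\<^sub>0"
    and "lie_solvable (vf_bracket U\<^sub>0) L\<^sub>0"
    and "transitive_shrinking U\<^sub>0 L\<^sub>0 U" and "L = restrict_vf U ` L\<^sub>0"
    and "nilradical_data U L k m r a"
    and "bij_betw e {1..CARD('n)} UNIV"
  shows
    "(\<exists>V \<psi> w. V \<subseteq> U \<and> local_coordinates V \<psi> \<and> block_weights e m r a w \<and>
        pushforward V \<psi> ` L \<subseteq> homog_nonpos (\<psi> ` V) w \<and>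
        (\<forall>j\<in>{0..k}. pushforward V \<psi> ` nilradical_series (vf_bracket U) L j
                       \<subseteq> homog_sum (\<psi> ` V) w (- int k) (- int j)) \<and>
        (\<exists>G. G \<subseteq> homog (\<psi> ` V) w 0 \<and> lie_closed (vf_bracket (\<psi> ` V)) G \<and>
             finite_dimensional G \<and> (\<forall>X\<in>G. \<forall>Y\<in>G. vf_bracket (\<psi> ` V) X Y = 0) \<and>
             pushforward V \<psi> ` L \<subseteq> {X + Y | X Y. X \<in> homog_neg (\<psi> ` V) w \<and> Y \<in> G}))
     \<and>
     (\<forall>V \<phi> k' m' r' a'.
        V \<subseteq> U \<and> local_coordinates V \<phi> \<and>
        nilradical_data (\<phi> ` V) (pushforward V \<phi> ` L) k' m' r' a' \<longrightarrow>
        k' = k \<and> m' = m \<and> (\<forall>j\<in>{1..m}. r' j = r j \<and> a' j = a j) \<and>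
        (\<forall>V\<^sub>1 \<psi>\<^sub>1 w\<^sub>1 V\<^sub>2 \<psi>\<^sub>2 w\<^sub>2.
           V\<^sub>1 \<subseteq> U \<and> local_coordinates V\<^sub>1 \<psi>\<^sub>1 \<and> block_weights e m r a w\<^sub>1 \<and>
           V\<^sub>2 \<subseteq> \<phi> ` V \<and> local_coordinates V\<^sub>2 \<psi>\<^sub>2 \<and> block_weights e m' r' a' w\<^sub>2 \<longrightarrow>
           dilations_conjugate V\<^sub>1 \<psi>\<^sub>1 w\<^sub>1 V\<^sub>2 \<psi>\<^sub>2 w\<^sub>2))"
proof -
  interpret solvable_transitive U L
    unfolding assms(5) by (rule solvable_transitive_restrict[OF assms(1-4)])
  note data = assms(6) and e = assms(7)
  obtain V \<psi> \<rho> w E pos where V: "V \<subseteq> U" "local_coordinates V \<psi>" "\<psi> ` V = cube \<rho>"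
    "\<And>l. l \<in> {1..CARD('n)} \<Longrightarrow> w (e l) = wt k l"
    "graded_stage \<rho> (\<lambda>j. pushforward V \<psi> ` N j) E w pos UNIV"
    by (rule weighted_chart[OF N_Suc_k[OF data] e]) (rule that; assumption)
  interpret G: graded_stage \<rho> "\<lambda>j. pushforward V \<psi> ` N j" E w pos UNIV by (rule V(5))
  have wk: "w c \<le> k" for c
  proof -
    have "c \<in> e ` {1..CARD('n)}" using e by (simp add: bij_betw_def)
    then obtain l where "l \<in> {1..CARD('n)}" "c = e l" by blast
    then show ?thesis using V(4) wt_le[of k l] by simp
  qed
  have wM: "w c \<le> max_weight w" for c by (simp add: max_weight_def)
  \<comment> \<open>Makes \<open>- k\<close> an admissible lower bound for the degrees in
    \<open>A_homog\<close>.\<close>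
  have Mk: "max_weight w \<le> k" unfolding max_weight_def using wk by (subst Max_le_iff) auto
  have 1: "pushforward V \<psi> ` L \<subseteq> homog_nonpos (\<psi> ` V) w"
    unfolding homog_nonpos_def V(3) using G.A_homog[OF refl wM order_refl, of _ 0] by (auto simp: N_0)
  have 2: "pushforward V \<psi> ` nilradical_series (vf_bracket U) L j \<subseteq> homog_sum (\<psi> ` V) w (- int k)
      (- int j)" for j
  proof -
    have "- int k \<le> - int (max_weight w)" using Mk by simp
    from G.A_homog[OF refl wk this, of _ j] show ?thesis unfolding V(3) N_def by blast
  qed
  obtain T where T: "finite T" "T \<subseteq> L" "L \<subseteq> span T" using finite_basis[OF order_refl] by blast
  have "pushforward V \<psi> ` L \<subseteq> span (pushforward V \<psi> ` T)"
    using image_mono[OF T(3)] by (simp add: linear_span_image[OF linear_pushforward[OF V(2)]])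
  then have "\<exists>T. finite T \<and> T \<subseteq> pushforward V \<psi> ` N 0 \<and> pushforward V \<psi> ` N 0 \<subseteq> span T"
    unfolding N_0 using T(1,2) by (intro exI[of _ "pushforward V \<psi> ` T"]) (simp add: image_mono)
  then obtain G where G: "G \<subseteq> homog (cube \<rho>) w 0" "lie_closed (vf_bracket (cube \<rho>)) G"
      "finite_dimensional G"
    "\<And>X Y. X \<in> G \<Longrightarrow> Y \<in> G \<Longrightarrow> vf_bracket (cube \<rho>) X Y = 0"
    "pushforward V \<psi> ` N 0 \<subseteq> {X + Y |X Y. X \<in> homog_neg (cube \<rho>) w \<and> Y \<in> G}"
    by (rule G.degree_zero_part[OF refl]) (rule that; assumption)
  have 3: "\<exists>G. G \<subseteq> homog (\<psi> ` V) w 0 \<and> lie_closed (vf_bracket (\<psi> ` V)) G \<and>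
             finite_dimensional G \<and> (\<forall>X\<in>G. \<forall>Y\<in>G. vf_bracket (\<psi> ` V) X Y = 0) \<and>
             pushforward V \<psi> ` L \<subseteq> {X + Y | X Y. X \<in> homog_neg (\<psi> ` V) w \<and> Y \<in> G}"
    unfolding V(3) using G unfolding N_0 by (intro exI[of _ G] conjI ballI)
  have bw: "block_weights e m r a w" by (rule block_weights_wt[OF data, where w = w]) (rule V(4))
  have inv: "k' = k \<and> m' = m \<and> (\<forall>j\<in>{1..m}. r' j = r j \<and> a' j = a j)"
    if "V \<subseteq> U" and "local_coordinates V \<phi>" and "nilradical_data (\<phi> ` V) (pushforward V \<phi> ` L) k' m' r' a'"
    for V \<phi> k' m' r' a'
  proof -
    note p = solvable_transitive_pushforward[OF that(1,2)]
    interpret P: solvable_transitive "\<phi> ` V" "pushforward V \<phi> ` L" by (rule p(1))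
    have "nilradical_series (vf_bracket (\<phi> ` V)) (pushforward V \<phi> ` L) i = {0} \<longleftrightarrow> N i = {0}" for i
    proof -
      have N: "N i \<subseteq> L" "0 \<in> N i" using idealD(1,2)[OF ideal_N] subspace_0 by blast+
      have "{0} = pushforward V \<phi> ` {0}" using linear_0[OF linear_pushforward[OF that(2)]] by simp
      then show ?thesis unfolding p(2) using inj_on_image_eq_iff[OF p(4) N(1), of "{0}"] N by auto
    qed
    from data_unique[OF data that(3) this p(3)] show ?thesis by blast
  qed
  have conj: "dilations_conjugate V\<^sub>1 \<psi>\<^sub>1 w\<^sub>1 V\<^sub>2 \<psi>\<^sub>2 w\<^sub>2"
    if same: "m' = m" "\<forall>j\<in>{1..m}. r' j = r j \<and> a' j = a j"
      and lc: "local_coordinates V\<^sub>1 \<psi>\<^sub>1" "local_coordinates V\<^sub>2 \<psi>\<^sub>2"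
      and bw: "block_weights e m r a w\<^sub>1" "block_weights e m' r' a' w\<^sub>2"
    for m' r' a' V\<^sub>1 \<psi>\<^sub>1 w\<^sub>1 V\<^sub>2 \<psi>\<^sub>2 w\<^sub>2
  proof -
    \<comment> \<open>\<open>block_weights\<close> reads \<open>r\<close> and \<open>a\<close> only
      on \<open>{1..m}\<close>, where the two sets of data agree.\<close>
    have "(\<Sum>i=1..<j. a' i) = (\<Sum>i=1..<j. a i)" "(\<Sum>i=1..j. a' i) = (\<Sum>i=1..j. a i)" if "j \<in> {1..m}" for j
      using same(2) that by (auto intro!: sum.cong)
    then have "block_weights e m r a w\<^sub>2" using bw(2) same by (simp add: block_weights_def)
    then have "w\<^sub>1 = w\<^sub>2" using block_weights_unique[OF data e bw(1)] by blast
    then show ?thesis using dilations_conjugate_same_weights[OF lc] by blast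
  qed
  show ?thesis
  proof (intro conjI)
    show "\<exists>V \<psi> w. V \<subseteq> U \<and> local_coordinates V \<psi> \<and> block_weights e m r a w \<and>
        pushforward V \<psi> ` L \<subseteq> homog_nonpos (\<psi> ` V) w \<and>
        (\<forall>j\<in>{0..k}. pushforward V \<psi> ` nilradical_series (vf_bracket U) L j
                       \<subseteq> homog_sum (\<psi> ` V) w (- int k) (- int j)) \<and>
        (\<exists>G. G \<subseteq> homog (\<psi> ` V) w 0 \<and> lie_closed (vf_bracket (\<psi> ` V)) G \<and>
             finite_dimensional G \<and> (\<forall>X\<in>G. \<forall>Y\<in>G. vf_bracket (\<psi> ` V) X Y = 0) \<and>
             pushforward V \<psi> ` L \<subseteq> {X + Y | X Y. X \<in> homog_neg (\<psi> ` V) w \<and> Y \<in> G})"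
      by (intro exI[of _ V] exI[of _ \<psi>] exI[of _ w] conjI V(1,2) 1 3 bw ballI 2)
  next
    show "\<forall>V \<phi> k' m' r' a'.
        V \<subseteq> U \<and> local_coordinates V \<phi> \<and>
        nilradical_data (\<phi> ` V) (pushforward V \<phi> ` L) k' m' r' a' \<longrightarrow>
        k' = k \<and> m' = m \<and> (\<forall>j\<in>{1..m}. r' j = r j \<and> a' j = a j) \<and>
        (\<forall>V\<^sub>1 \<psi>\<^sub>1 w\<^sub>1 V\<^sub>2 \<psi>\<^sub>2 w\<^sub>2.
           V\<^sub>1 \<subseteq> U \<and> local_coordinates V\<^sub>1 \<psi>\<^sub>1 \<and> block_weights e m r a w\<^sub>1 \<and>
           V\<^sub>2 \<subseteq> \<phi> ` V \<and> local_coordinates V\<^sub>2 \<psi>\<^sub>2 \<and> block_weights e m' r' a' w\<^sub>2 \<longrightarrow>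
           dilations_conjugate V\<^sub>1 \<psi>\<^sub>1 w\<^sub>1 V\<^sub>2 \<psi>\<^sub>2 w\<^sub>2)"
      using inv conj by metis
  qed
qed

end
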